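(* There are multicategory structures on $\Gamma\text{-}\mathbf{Cat}_*$ and on $\mathbf{Mult}_*(\mathbb{N},\mathbf{Cat}_*^{\mathrm{op}})$, namely the ones described in the context, for which the construction $$A:\Gamma\text{-}\mathbf{Cat}_*\to\mathbf{Mult}_*(\mathbb{N},\mathbf{Cat}_*^{\mathrm{op}})$$ is (extends to) a multifunctor.
   Context: Multicategories are symmetric multicategories (coloured operads): they have objects, $r$-morphisms $(a_1,\dots,a_r)\to b$ for $r\ge 0$, units, composition and actions of the symmetric groups. Multifunctors preserve units, composition and the symmetric group actions. Any symmetric monoidal category has an underlying multicategory whose $r$-morphisms $(a_1,\dots,a_r)\to b$ are the morphisms $a_1\otimes\cdots\otimes a_r\to b$ (the source being the unit object if $r=0$). **Based multicategories.** Let $*$ be the terminal multicategory (one object and exactly one $r$-morphism for every $r\ge 0$). A based multicategory is a multicategory $M$ with a multifunctor $*\to M$; a based multifunctor is one commuting with these. **Based categories.** $\mathbf{Cat}_*$ is the category of small categories with a chosen base object, and base-object-preserving functors. The smash product $\mathcal{C}\wedge\mathcal{D}$ is the quotient of $\mathcal{C}\times\mathcal{D}$ such that based functors $\mathcal{C}\wedge\mathcal{D}\to\mathcal{E}$ are the functors $\mathcal{C}\times\mathcal{D}\to\mathcal{E}$ that are constant at the base object (and its identity) on $\mathcal{C}\times\{*\}$ and $\{*\}\times\mathcal{D}$. Its unit $S^0$ is the discrete category with two objects, one of which is the base object. **$\Gamma$-categories.** $\Gamma^{\mathrm{op}}$ has objects the based sets $\underline{n}=\{0,1,\dots,n\}$,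 $n\ge 0$, with basepoint $0$, and morphisms the based functions. A $\Gamma$-category is a functor $X:\Gamma^{\mathrm{op}}\to\mathbf{Cat}_*$ with $X(0)=*$ (one object, one morphism), where $X(n)$ denotes $X(\underline n)$. $\Gamma\text{-}\mathbf{Cat}_*$ is the category of $\Gamma$-categories and natural transformations. Its multicategory structure is the one underlying the Day convolution symmetric monoidal structure induced by the smash product on $\mathbf{Cat}_*$ and the smash product $\underline m\wedge\underline n\cong\underline{mn}$ (lexicographic order) on $\Gamma^{\mathrm{op}}$; $X\wedge Y$ is the left Kan extension of $(\underline m,\underline n)\mapsto X(m)\wedge Y(n)$ along $\wedge:\Gamma^{\mathrm{op}}\times\Gamma^{\mathrm{op}}\to\Gamma^{\mathrm{op}}$. Thus an $r$-morphism $(X_1,\dots,X_r)\to Y$ amounts to based functors $X_1(n_1)\wedge\cdots\wedge X_r(n_r)\to Y(n_1\cdots n_r)$ natural in $(\underline n_1,\dots,\underline n_r)\in(\Gamma^{\mathrm{op}})^r$ (for $r=0$, a based functor $S^0\to Y(1)$). **The multicategory $\mathbb{N}$.** Objects are the sets $[n]=\{1,\dots,n\}$, $n\ge 0$. An $r$-morphism $([n_1],\dots,[n_r])\to[m]$ is a function $[m]\to[n_1]\amalg\cdots\amalg[n_r]$. It is based at $[0]=\emptyset$. **The multicategory $\mathbf{Cat}_*^{\mathrm{op}}$.** Objects are small based categories. An $r$-morphism $(\mathcal{D}_1,\dots,\mathcal{D}_r)\to\mathcal{C}$ is a based functor $\mathcal{C}\to\mathcal{D}_1\times\cdots\times\mathcal{D}_r$.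 It is based at the terminal category $*$. **The multicategory $\mathbf{Mult}_*(\mathbb{N},\mathbf{Cat}_*^{\mathrm{op}})$.** Objects are based multifunctors $\mathbb{N}\to\mathbf{Cat}_*^{\mathrm{op}}$; write $Fm$ or $F(m)$ for $F[m]$. For a function $f:[m']\to\coprod_{l=1}^k[p_l]$, $Ff:Fm'\to\prod_l Fp_l$ denotes the induced functor, with components $(Ff)_l$. Identify $[m]\times[n]$ with $[mn]$ lexicographically. An $r$-morphism $\phi:(F_1,\dots,F_r)\to G$ is a based $r$-linear transformation, i.e. a family of based functors $$\phi_{m_1,\dots,m_r}:F_1m_1\wedge\cdots\wedge F_rm_r\to G(m_1\cdots m_r)$$ such that: (i) (multifunctoriality in each variable) for each $i$ and each $f:[m']\to\coprod_{l=1}^k[p_l]$, the composite of $\phi_{m_1,\dots,m',\dots,m_r}$ ($m'$ in position $i$) with $G(\mathrm{id}\times f\times\mathrm{id}):G(m_1\cdots m'\cdots m_r)\to\prod_lG(m_1\cdots p_l\cdots m_r)$ has $l$-th component $\phi_{m_1,\dots,p_l,\dots,m_r}\circ(\mathrm{id}\wedge(F_if)_l\wedge\mathrm{id})$; (ii) (bilinearity in each pair of variables $i\neq j$) given $f:[m']\to\coprod_l[p_l]$ in variable $i$ and $g:[n']\to\coprod_t[q_t]$ in variable $j$, the composite that applies $F_if$, then the maps $\phi$, then the functors $G(p_l\cdot g)$ (with identities in all other variables), and the composite that applies $F_jg$, then the maps $\phi$, then the functors $G(f\cdot q_t)$, agree after the canonical reordering isomorphism $\prod_l\prod_t\cong\prod_t\prod_l$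 of the target; (iii) basepoints are preserved: if some $m_i=0$ then $\phi_{m_1,\dots,m_r}$ is the map to $G(0)=*$. For $r=0$ this is a based functor $S^0\to G(1)$. Composition is $\gamma\circ(\phi^1,\dots,\phi^s)$ with components $\gamma\circ(\phi^1\wedge\cdots\wedge\phi^s)$. A permutation $\sigma$ acts by permuting the smash factors, applying $\phi$, and then applying $G$ to the corresponding bijection between the products of the sets $[m_i]$ taken in the two orders. **The construction $A$.** For a $\Gamma$-category $X$, $AX[n]=X(n)$. Given $f:[m]\to[n_1]\amalg\cdots\amalg[n_r]$, adjoin basepoints to get $f_+:\underline m\to\underline n_1\vee\cdots\vee\underline n_r$, and let $f_i:\underline m\to\underline n_i$ be the composite of $f_+$ with the map collapsing all wedge summands except $\underline n_i$ to the basepoint. Then $AX(f):X(m)\to X(n_1)\times\cdots\times X(n_r)$ is the functor with $i$-th coordinate $X(f_i)$. For a natural transformation $q:X\to Y$, $Aq$ has components $q(m):X(m)\to Y(m)$. *)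

theory Defs
  imports "HOL-Library.FuncSet" "HOL-Combinatorics.Permutations"
begin

(* All structure maps of categories, functors and families are made extensional (undefined off
   their domains), so that HOL equality is the mathematical equality of these objects. *)

record ('s, 't, 'd) arrow =
  src :: 's
  tgt :: 't
  dat :: 'd

record ('o, 'a) cat =
  Obj :: "'o set"
  Arr :: "'a set"
  Dom :: "'a \<Rightarrow> 'o"
  Cod :: "'a \<Rightarrow> 'o"
  Ident :: "'o \<Rightarrow> 'a"
  Comp :: "'a \<Rightarrow> 'a \<Rightarrow> 'a"

record ('o, 'a) bcat = "('o, 'a) cat" +
  Base :: 'o

locale category =
  fixes C :: "('o, 'a, 'z) cat_scheme"
  assumes Dom_closed: "Dom C \<in> Arr C \<rightarrow>\<^sub>E Obj C"
    and Cod_closed: "Cod C \<in> Arr C \<rightarrow>\<^sub>E Obj C"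
    and Ident_closed: "Ident C \<in> Obj C \<rightarrow>\<^sub>E Arr C"
    and Dom_Ident: "x \<in> Obj C \<Longrightarrow> Dom C (Ident C x) = x"
    and Cod_Ident: "x \<in> Obj C \<Longrightarrow> Cod C (Ident C x) = x"
    and Comp_closed: "\<lbrakk>g \<in> Arr C; f \<in> Arr C; Dom C g = Cod C f\<rbrakk> \<Longrightarrow> Comp C g f \<in> Arr C"
    and Dom_Comp: "\<lbrakk>g \<in> Arr C; f \<in> Arr C; Dom C g = Cod C f\<rbrakk> \<Longrightarrow> Dom C (Comp C g f) = Dom C f"
    and Cod_Comp: "\<lbrakk>g \<in> Arr C; f \<in> Arr C; Dom C g = Cod C f\<rbrakk> \<Longrightarrow> Cod C (Comp C g f) = Cod C g"
    and Comp_undefined: "\<not> (g \<in> Arr C \<and> f \<in> Arr C \<and> Dom C g = Cod C f) \<Longrightarrow> Comp C g f = undefined"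
    and Comp_Ident_left: "f \<in> Arr C \<Longrightarrow> Comp C (Ident C (Cod C f)) f = f"
    and Comp_Ident_right: "f \<in> Arr C \<Longrightarrow> Comp C f (Ident C (Dom C f)) = f"
    and Comp_assoc: "\<lbrakk>h \<in> Arr C; g \<in> Arr C; f \<in> Arr C; Dom C h = Cod C g; Dom C g = Cod C f\<rbrakk>
      \<Longrightarrow> Comp C (Comp C h g) f = Comp C h (Comp C g f)"

locale based_category = category C for C :: "('o, 'a) bcat" +
  assumes Base_closed: "Base C \<in> Obj C"

definition mk_cat ::
  "'o set \<Rightarrow> 'a set \<Rightarrow> ('a \<Rightarrow> 'o) \<Rightarrow> ('a \<Rightarrow> 'o) \<Rightarrow> ('o \<Rightarrow> 'a) \<Rightarrow> ('a \<Rightarrow> 'a \<Rightarrow> 'a) \<Rightarrow> ('o, 'a) cat" where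
  "mk_cat ob ar d c i m =
    \<lparr>Obj = ob, Arr = ar, Dom = restrict d ar, Cod = restrict c ar, Ident = restrict i ob,
     Comp = (\<lambda>g f. if g \<in> ar \<and> f \<in> ar \<and> d g = c f then m g f else undefined)\<rparr>"

definition with_base :: "('o, 'a) cat \<Rightarrow> 'o \<Rightarrow> ('o, 'a) bcat" where
  "with_base C b = cat.extend C (bcat.fields b)"

record ('o, 'a, 'p, 'b) ftor =
  FO :: "'o \<Rightarrow> 'p"
  FA :: "'a \<Rightarrow> 'b"

locale is_functor = C: category C + D: category D
  for C :: "('o, 'a, 'z) cat_scheme" and D :: "('p, 'b, 'y) cat_scheme" +
  fixes F :: "('o, 'a, 'p, 'b) ftor"
  assumes FO_closed: "FO F \<in> Obj C \<rightarrow>\<^sub>E Obj D"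
    and FA_closed: "FA F \<in> Arr C \<rightarrow>\<^sub>E Arr D"
    and FA_Dom: "f \<in> Arr C \<Longrightarrow> Dom D (FA F f) = FO F (Dom C f)"
    and FA_Cod: "f \<in> Arr C \<Longrightarrow> Cod D (FA F f) = FO F (Cod C f)"
    and FA_Ident: "x \<in> Obj C \<Longrightarrow> FA F (Ident C x) = Ident D (FO F x)"
    and FA_Comp: "\<lbrakk>g \<in> Arr C; f \<in> Arr C; Dom C g = Cod C f\<rbrakk>
      \<Longrightarrow> FA F (Comp C g f) = Comp D (FA F g) (FA F f)"

locale based_functor = is_functor C D F + C: based_category C + D: based_category D
  for C :: "('o, 'a) bcat" and D :: "('p, 'b) bcat" and F +
  assumes FO_Base: "FO F (Base C) = Base D"

locale nat_trans = F: is_functor C D F + G: is_functor C D G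
  for C :: "('o, 'a, 'z) cat_scheme" and D :: "('p, 'b, 'y) cat_scheme" and F G +
  fixes q :: "'o \<Rightarrow> 'b"
  assumes q_closed: "q \<in> Obj C \<rightarrow>\<^sub>E Arr D"
    and q_Dom: "x \<in> Obj C \<Longrightarrow> Dom D (q x) = FO F x"
    and q_Cod: "x \<in> Obj C \<Longrightarrow> Cod D (q x) = FO G x"
    and q_natural: "f \<in> Arr C \<Longrightarrow>
      Comp D (q (Cod C f)) (FA F f) = Comp D (FA G f) (q (Dom C f))"

definition mk_ftor ::
  "('o, 'a, 'z) cat_scheme \<Rightarrow> ('o \<Rightarrow> 'p) \<Rightarrow> ('a \<Rightarrow> 'b) \<Rightarrow> ('o, 'a, 'p, 'b) ftor" where
  "mk_ftor C u v = \<lparr>FO = restrict u (Obj C), FA = restrict v (Arr C)\<rparr>"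

definition fid :: "('o, 'a, 'z) cat_scheme \<Rightarrow> ('o, 'a, 'o, 'a) ftor" where
  "fid C = mk_ftor C (\<lambda>x. x) (\<lambda>f. f)"

text \<open>Composite of \<open>F\<close> followed by \<open>G\<close>, where \<open>C\<close> is the source of \<open>F\<close>.\<close>
definition fcomp :: "('o, 'a, 'z) cat_scheme \<Rightarrow> ('p, 'b, 'r, 'c) ftor \<Rightarrow> ('o, 'a, 'p, 'b) ftor
    \<Rightarrow> ('o, 'a, 'r, 'c) ftor" where
  "fcomp C G F = mk_ftor C (\<lambda>x. FO G (FO F x)) (\<lambda>f. FA G (FA F f))"

definition const_base :: "('o, 'a, 'z) cat_scheme \<Rightarrow> ('p, 'b) bcat \<Rightarrow> ('o, 'a, 'p, 'b) ftor" where
  "const_base C D = mk_ftor C (\<lambda>_. Base D) (\<lambda>_. Ident D (Base D))"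


text \<open>The chosen terminal category \<open>*\<close>; which element of each carrier type serves as its
  object and as its arrow is immaterial.\<close>
definition Term_Cat :: "('o, 'a) bcat" where
  "Term_Cat = with_base
    (mk_cat {undefined} {undefined} (\<lambda>_. undefined) (\<lambda>_. undefined) (\<lambda>_. undefined)
       (\<lambda>_ _. undefined)) undefined"

definition prod_cat :: "('o, 'a) bcat list \<Rightarrow> ('o list, 'a list) bcat" where
  "prod_cat Cs = with_base
    (mk_cat {xs. list_all2 (\<lambda>x C. x \<in> Obj C) xs Cs} {fs. list_all2 (\<lambda>f C. f \<in> Arr C) fs Cs}
       (map2 Dom Cs) (map2 Cod Cs) (map2 Ident Cs)
       (\<lambda>gs fs. map (\<lambda>i. Comp (Cs ! i) (gs ! i) (fs ! i)) [0..<length Cs]))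
    (map Base Cs)"

definition proj_ftor :: "('o, 'a) bcat list \<Rightarrow> nat \<Rightarrow> ('o list, 'a list, 'o, 'a) ftor" where
  "proj_ftor Cs i = mk_ftor (prod_cat Cs) (\<lambda>xs. xs ! i) (\<lambda>fs. fs ! i)"

text \<open>Based functors \<open>C\<^sub>1 \<and> \<dots> \<and> C\<^sub>r \<rightarrow> E\<close>, by the defining property of the quotient
  \<open>C\<^sub>1 \<and> \<dots> \<and> C\<^sub>r\<close> of \<open>C\<^sub>1 \<times> \<dots> \<times> C\<^sub>r\<close>: functors on the product which are constant at the base
  object (and its identity) wherever some coordinate is at the base object (and its identity).
  For \<open>r = 0\<close> the condition is void and a functor from the empty product is just an object of
  \<open>E\<close>, the image of the non-base object under a based functor \<open>S\<^sup>0 \<rightarrow> E\<close>.\<close>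
locale smash_functor = is_functor "prod_cat Cs" E F + E: based_category E
  for Cs :: "('o, 'a) bcat list" and E :: "('p, 'b) bcat" and F +
  assumes based_factors: "C \<in> set Cs \<Longrightarrow> based_category C"
    and collapse_Obj: "\<lbrakk>xs \<in> Obj (prod_cat Cs); i < length Cs; xs ! i = Base (Cs ! i)\<rbrakk>
      \<Longrightarrow> FO F xs = Base E"
    and collapse_Arr: "\<lbrakk>fs \<in> Arr (prod_cat Cs); i < length Cs;
        fs ! i = Ident (Cs ! i) (Base (Cs ! i))\<rbrakk> \<Longrightarrow> FA F fs = Ident E (Base E)"

type_synonym ('o, 'a) bfun = "(('o, 'a) bcat, ('o, 'a) bcat, ('o, 'a, 'o, 'a) ftor) arrow"

definition Cat_based :: "(('o, 'a) bcat, ('o, 'a) bfun) cat" where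
  "Cat_based = mk_cat {C. based_category C} {f. based_functor (src f) (tgt f) (dat f)} src tgt
    (\<lambda>C. \<lparr>src = C, tgt = C, dat = fid C\<rparr>)
    (\<lambda>g f. \<lparr>src = src f, tgt = tgt g, dat = fcomp (src f) (dat g) (dat f)\<rparr>)"


text \<open>\<open>MComp g [f\<^sub>1, \<dots>, f\<^sub>r]\<close> is \<open>g \<circ> (f\<^sub>1, \<dots>, f\<^sub>r)\<close>. \<open>Act \<sigma>\<close> is the right action of
  permutations of \<open>{..<r}\<close>, taking \<open>(a\<^sub>1, \<dots>, a\<^sub>r) \<rightarrow> b\<close> to \<open>(a\<^bsub>\<sigma> 1\<^esub>, \<dots>, a\<^bsub>\<sigma> r\<^esub>) \<rightarrow> b\<close>.\<close>
record ('o, 'm) multicat =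
  MObj :: "'o set"
  MMor :: "'m set"
  Src :: "'m \<Rightarrow> 'o list"
  Tgt :: "'m \<Rightarrow> 'o"
  MUnit :: "'o \<Rightarrow> 'm"
  MComp :: "'m \<Rightarrow> 'm list \<Rightarrow> 'm"
  Act :: "(nat \<Rightarrow> nat) \<Rightarrow> 'm \<Rightarrow> 'm"

fun chunks :: "nat list \<Rightarrow> 'x list \<Rightarrow> 'x list list" where
  "chunks [] xs = []"
| "chunks (n # ns) xs = take n xs # chunks ns (drop n xs)"

text \<open>\<open>block_perm \<sigma> ns\<close> permutes consecutive blocks of sizes \<open>ns\<close> by \<open>\<sigma>\<close>, that is,
  \<open>permute_list (block_perm \<sigma> ns) (concat xss) = concat (permute_list \<sigma> xss)\<close>, and
  \<open>sum_perm \<tau>s ns\<close> permutes within the blocks: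
  \<open>permute_list (sum_perm \<tau>s ns) (concat xss) = concat (map2 permute_list \<tau>s xss)\<close>.\<close>
definition block_perm :: "(nat \<Rightarrow> nat) \<Rightarrow> nat list \<Rightarrow> nat \<Rightarrow> nat" where
  "block_perm \<sigma> ns k = (if k < sum_list ns
     then concat (permute_list \<sigma> (chunks ns [0..<sum_list ns])) ! k else k)"

definition sum_perm :: "(nat \<Rightarrow> nat) list \<Rightarrow> nat list \<Rightarrow> nat \<Rightarrow> nat" where
  "sum_perm \<tau>s ns k = (if k < sum_list ns
     then concat (map2 permute_list \<tau>s (chunks ns [0..<sum_list ns])) ! k else k)"

locale multicategory =
  fixes M :: "('o, 'm) multicat"
  assumes Src_closed: "f \<in> MMor M \<Longrightarrow> Src M f \<in> lists (MObj M)"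
    and Tgt_closed: "f \<in> MMor M \<Longrightarrow> Tgt M f \<in> MObj M"
    and MUnit_closed: "a \<in> MObj M \<Longrightarrow> MUnit M a \<in> MMor M"
    and Src_MUnit: "a \<in> MObj M \<Longrightarrow> Src M (MUnit M a) = [a]"
    and Tgt_MUnit: "a \<in> MObj M \<Longrightarrow> Tgt M (MUnit M a) = a"
    and MComp_closed: "\<lbrakk>g \<in> MMor M; fs \<in> lists (MMor M); map (Tgt M) fs = Src M g\<rbrakk>
      \<Longrightarrow> MComp M g fs \<in> MMor M"
    and Src_MComp: "\<lbrakk>g \<in> MMor M; fs \<in> lists (MMor M); map (Tgt M) fs = Src M g\<rbrakk>
      \<Longrightarrow> Src M (MComp M g fs) = concat (map (Src M) fs)"
    and Tgt_MComp: "\<lbrakk>g \<in> MMor M; fs \<in> lists (MMor M); map (Tgt M) fs = Src M g\<rbrakk>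
      \<Longrightarrow> Tgt M (MComp M g fs) = Tgt M g"
    and MComp_MUnit_left: "f \<in> MMor M \<Longrightarrow> MComp M (MUnit M (Tgt M f)) [f] = f"
    and MComp_MUnit_right: "f \<in> MMor M \<Longrightarrow> MComp M f (map (MUnit M) (Src M f)) = f"
    and MComp_assoc: "\<lbrakk>g \<in> MMor M; fs \<in> lists (MMor M); map (Tgt M) fs = Src M g;
        hss \<in> lists (lists (MMor M)); map (map (Tgt M)) hss = map (Src M) fs\<rbrakk>
      \<Longrightarrow> MComp M (MComp M g fs) (concat hss) = MComp M g (map2 (MComp M) fs hss)"
    and Act_closed: "\<lbrakk>f \<in> MMor M; \<sigma> permutes {..<length (Src M f)}\<rbrakk> \<Longrightarrow> Act M \<sigma> f \<in> MMor M"
    and Src_Act: "\<lbrakk>f \<in> MMor M; \<sigma> permutes {..<length (Src M f)}\<rbrakk>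
      \<Longrightarrow> Src M (Act M \<sigma> f) = permute_list \<sigma> (Src M f)"
    and Tgt_Act: "\<lbrakk>f \<in> MMor M; \<sigma> permutes {..<length (Src M f)}\<rbrakk>
      \<Longrightarrow> Tgt M (Act M \<sigma> f) = Tgt M f"
    and Act_id: "f \<in> MMor M \<Longrightarrow> Act M id f = f"
    and Act_comp: "\<lbrakk>f \<in> MMor M; \<sigma> permutes {..<length (Src M f)};
        \<tau> permutes {..<length (Src M f)}\<rbrakk> \<Longrightarrow> Act M \<tau> (Act M \<sigma> f) = Act M (\<sigma> \<circ> \<tau>) f"
    and Act_outer: "\<lbrakk>g \<in> MMor M; fs \<in> lists (MMor M); map (Tgt M) fs = Src M g;
        \<sigma> permutes {..<length fs}\<rbrakk>
      \<Longrightarrow> MComp M (Act M \<sigma> g) (permute_list \<sigma> fs)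
          = Act M (block_perm \<sigma> (map (\<lambda>f. length (Src M f)) fs)) (MComp M g fs)"
    and Act_inner: "\<lbrakk>g \<in> MMor M; fs \<in> lists (MMor M); map (Tgt M) fs = Src M g;
        list_all2 (\<lambda>\<tau> f. \<tau> permutes {..<length (Src M f)}) \<tau>s fs\<rbrakk>
      \<Longrightarrow> MComp M g (map2 (Act M) \<tau>s fs)
          = Act M (sum_perm \<tau>s (map (\<lambda>f. length (Src M f)) fs)) (MComp M g fs)"

locale multifunctor = M: multicategory M + N: multicategory N
  for M :: "('o, 'm) multicat" and N :: "('p, 'n) multicat" +
  fixes F :: "('o, 'm, 'p, 'n) ftor"
  assumes FO_closed: "FO F \<in> MObj M \<rightarrow>\<^sub>E MObj N"
    and FA_closed: "FA F \<in> MMor M \<rightarrow>\<^sub>E MMor N"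
    and FA_Src: "f \<in> MMor M \<Longrightarrow> Src N (FA F f) = map (FO F) (Src M f)"
    and FA_Tgt: "f \<in> MMor M \<Longrightarrow> Tgt N (FA F f) = FO F (Tgt M f)"
    and FA_MUnit: "a \<in> MObj M \<Longrightarrow> FA F (MUnit M a) = MUnit N (FO F a)"
    and FA_MComp: "\<lbrakk>g \<in> MMor M; fs \<in> lists (MMor M); map (Tgt M) fs = Src M g\<rbrakk>
      \<Longrightarrow> FA F (MComp M g fs) = MComp N (FA F g) (map (FA F) fs)"
    and FA_Act: "\<lbrakk>f \<in> MMor M; \<sigma> permutes {..<length (Src M f)}\<rbrakk>
      \<Longrightarrow> FA F (Act M \<sigma> f) = Act N \<sigma> (FA F f)"

text \<open>The terminal multicategory; its unique \<open>r\<close>-morphism is represented by \<open>r\<close>.\<close>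
definition Term_Mult :: "(unit, nat) multicat" where
  "Term_Mult = \<lparr>MObj = UNIV, MMor = UNIV, Src = (\<lambda>r. replicate r ()), Tgt = (\<lambda>_. ()),
     MUnit = (\<lambda>_. 1), MComp = (\<lambda>_ rs. sum_list rs), Act = (\<lambda>_ r. r)\<rparr>"

locale based_multicategory = multifunctor Term_Mult M b
  for M :: "('o, 'm) multicat" and b :: "(unit, nat, 'o, 'm) ftor"

locale based_multifunctor =
  multifunctor M N F + M: based_multicategory M b + N: based_multicategory N c
  for M :: "('o, 'm) multicat" and b :: "(unit, nat, 'o, 'm) ftor"
    and N :: "('p, 'n) multicat" and c :: "(unit, nat, 'p, 'n) ftor"
    and F :: "('o, 'm, 'p, 'n) ftor" +
  assumes FO_base: "FO F (FO b x) = FO c x"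
    and FA_base: "FA F (FA b r) = FA c r"


text \<open>The object \<open>n\<close> stands for \<open>[n] = {1..n}\<close>. In the coproduct of the \<open>[n\<^sub>l]\<close> the element
  \<open>x \<in> [n\<^sub>l]\<close> is the pair \<open>(l, x)\<close>, with \<open>l\<close> counted from 0 as list positions are.\<close>
type_synonym nmor = "(nat list, nat, nat \<Rightarrow> nat \<times> nat) arrow"

definition coprod :: "nat list \<Rightarrow> (nat \<times> nat) set" where
  "coprod ns = (SIGMA l:{..<length ns}. {1..ns ! l})"

definition N_Mult :: "(nat, nmor) multicat" where
  "N_Mult = \<lparr>MObj = UNIV,
     MMor = {f. dat f \<in> {1..tgt f} \<rightarrow>\<^sub>E coprod (src f)},
     Src = src, Tgt = tgt,
     MUnit = (\<lambda>n. \<lparr>src = [n], tgt = n, dat = (\<lambda>x\<in>{1..n}. (0, x))\<rparr>),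
     MComp = (\<lambda>g fs. \<lparr>src = concat (map src fs), tgt = tgt g,
       dat = (\<lambda>x\<in>{1..tgt g}.
         let (i, y) = dat g x; (j, z) = dat (fs ! i) y
         in (sum_list (map (\<lambda>f. length (src f)) (take i fs)) + j, z))\<rparr>),
     Act = (\<lambda>\<sigma> f. \<lparr>src = permute_list \<sigma> (src f), tgt = tgt f,
       dat = (\<lambda>x\<in>{1..tgt f}. let (i, y) = dat f x in (inv \<sigma> i, y))\<rparr>)\<rparr>"

definition N_base :: "(unit, nat, nat, nmor) ftor" where
  "N_base = \<lparr>FO = (\<lambda>_. 0), FA = (\<lambda>r. \<lparr>src = replicate r 0, tgt = 0, dat = (\<lambda>_. undefined)\<rparr>)\<rparr>"

type_synonym ('o, 'a) opmor =
  "(('o, 'a) bcat list, ('o, 'a) bcat, ('o, 'a, 'o list, 'a list) ftor) arrow"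

definition Cat_op :: "(('o, 'a) bcat, ('o, 'a) opmor) multicat" where
  "Cat_op = \<lparr>MObj = {C. based_category C},
     MMor = {f. (\<forall>D \<in> set (src f). based_category D) \<and>
       based_functor (tgt f) (prod_cat (src f)) (dat f)},
     Src = src, Tgt = tgt,
     MUnit = (\<lambda>C. \<lparr>src = [C], tgt = C, dat = mk_ftor C (\<lambda>x. [x]) (\<lambda>u. [u])\<rparr>),
     MComp = (\<lambda>g fs. \<lparr>src = concat (map src fs), tgt = tgt g,
       dat = mk_ftor (tgt g)
         (\<lambda>x. concat (map2 (\<lambda>f y. FO (dat f) y) fs (FO (dat g) x)))
         (\<lambda>u. concat (map2 (\<lambda>f v. FA (dat f) v) fs (FA (dat g) u)))\<rparr>),
     Act = (\<lambda>\<sigma> f. \<lparr>src = permute_list \<sigma> (src f), tgt = tgt f,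
       dat = mk_ftor (tgt f)
         (\<lambda>x. permute_list \<sigma> (FO (dat f) x)) (\<lambda>u. permute_list \<sigma> (FA (dat f) u))\<rparr>)\<rparr>"

definition Cat_op_base :: "(unit, nat, ('o, 'a) bcat, ('o, 'a) opmor) ftor" where
  "Cat_op_base = \<lparr>FO = (\<lambda>_. Term_Cat), FA = (\<lambda>r. \<lparr>src = replicate r Term_Cat, tgt = Term_Cat,
     dat = const_base Term_Cat (prod_cat (replicate r Term_Cat))\<rparr>)\<rparr>"

text \<open>The component functor \<open>(Ff)\<^sub>l\<close> of a functor into a product.\<close>
definition coord :: "('o, 'a) opmor \<Rightarrow> nat \<Rightarrow> ('o, 'a, 'o, 'a) ftor" where
  "coord f l = fcomp (tgt f) (proj_ftor (src f) l) (dat f)"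


definition tuples :: "nat list \<Rightarrow> nat list set" where
  "tuples ns = {xs. list_all2 (\<lambda>x n. x \<in> {1..n}) xs ns}"

text \<open>The lexicographic bijection from \<open>[n\<^sub>1] \<times> \<dots> \<times> [n\<^sub>r]\<close> to \<open>[n\<^sub>1\<cdots>n\<^sub>r]\<close>, and its inverse.\<close>
fun enc :: "nat list \<Rightarrow> nat list \<Rightarrow> nat" where
  "enc (n # ns) (x # xs) = (x - 1) * prod_list ns + enc ns xs"
| "enc _ _ = 1"

definition dec :: "nat list \<Rightarrow> nat \<Rightarrow> nat list" where
  "dec ns = the_inv_into (tuples ns) (enc ns)"

text \<open>For \<open>\<sigma>\<close> permuting the \<open>r\<close> positions, the bijection from \<open>[n\<^sub>1\<cdots>n\<^sub>r]\<close> to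
  \<open>[n\<^bsub>\<sigma> 1\<^esub>\<cdots>n\<^bsub>\<sigma> r\<^esub>]\<close> which reorders tuples.\<close>
definition reorder :: "(nat \<Rightarrow> nat) \<Rightarrow> nat list \<Rightarrow> nat \<Rightarrow> nat" where
  "reorder \<sigma> ns k = enc (permute_list \<sigma> ns) (permute_list \<sigma> (dec ns k))"


text \<open>The \<open>r\<close>-morphisms \<open>(X\<^sub>1, \<dots>, X\<^sub>r) \<rightarrow> Y\<close> of both multicategories of interest are families of
  based functors \<open>X\<^sub>1 n\<^sub>1 \<and> \<dots> \<and> X\<^sub>r n\<^sub>r \<rightarrow> Y (n\<^sub>1\<cdots>n\<^sub>r)\<close>, where \<open>X\<^sub>i\<close>, \<open>Y\<close> are functors
  \<open>\<Gamma>\<^sup>o\<^sup>p \<rightarrow> Cat\<^sub>*\<close>, respectively multifunctors \<open>\<nat> \<rightarrow> Cat\<^sub>*\<^sup>o\<^sup>p\<close>. Hence units, composition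
  and symmetric group actions are defined once, for both.\<close>
type_synonym ('o, 'a) family = "nat list \<Rightarrow> ('o list, 'a list, 'o, 'a) ftor"
type_synonym ('x, 'o, 'a) fmor = "('x list, 'x, ('o, 'a) family) arrow"

definition prod_at :: "(nat, 'x, ('o, 'a) bcat, 'y) ftor list \<Rightarrow> nat list \<Rightarrow> ('o list, 'a list) bcat" where
  "prod_at Xs ns = prod_cat (map2 (\<lambda>X n. FO X n) Xs ns)"

definition smash_family :: "((nat, 'x, ('o, 'a) bcat, 'y) ftor, 'o, 'a) fmor \<Rightarrow> bool" where
  "smash_family \<phi> \<longleftrightarrow>
     dat \<phi> \<in> extensional {ns. length ns = length (src \<phi>)} \<and>
     (\<forall>ns. length ns = length (src \<phi>) \<longrightarrow>
        smash_functor (map2 (\<lambda>X n. FO X n) (src \<phi>) ns) (FO (tgt \<phi>) (prod_list ns)) (dat \<phi> ns))"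

definition fam_unit ::
  "(nat, 'x, ('o, 'a) bcat, 'y) ftor \<Rightarrow> ((nat, 'x, ('o, 'a) bcat, 'y) ftor, 'o, 'a) fmor" where
  "fam_unit X = \<lparr>src = [X], tgt = X,
     dat = (\<lambda>ns\<in>{ns. length ns = 1}. proj_ftor [FO X (ns ! 0)] 0)\<rparr>"

text \<open>The components of \<open>\<gamma> \<circ> (\<phi>\<^sub>1, \<dots>, \<phi>\<^sub>s)\<close> are the \<open>\<gamma> \<circ> (\<phi>\<^sub>1 \<and> \<dots> \<and> \<phi>\<^sub>s)\<close>.\<close>
definition fam_comp ::
  "((nat, 'x, ('o, 'a) bcat, 'y) ftor, 'o, 'a) fmor \<Rightarrow> ((nat, 'x, ('o, 'a) bcat, 'y) ftor, 'o, 'a) fmor list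
    \<Rightarrow> ((nat, 'x, ('o, 'a) bcat, 'y) ftor, 'o, 'a) fmor" where
  "fam_comp \<gamma> \<phi>s =
    (let Xs = concat (map src \<phi>s); rs = map (\<lambda>\<phi>. length (src \<phi>)) \<phi>s
     in \<lparr>src = Xs, tgt = tgt \<gamma>,
         dat = (\<lambda>ns\<in>{ns. length ns = length Xs}.
           let nss = chunks rs ns; Fs = map2 (\<lambda>\<phi> ms. dat \<phi> ms) \<phi>s nss
           in mk_ftor (prod_at Xs ns)
                (\<lambda>xs. FO (dat \<gamma> (map prod_list nss)) (map2 FO Fs (chunks rs xs)))
                (\<lambda>us. FA (dat \<gamma> (map prod_list nss)) (map2 FA Fs (chunks rs us))))\<rparr>)"

text \<open>Permute the smash factors, apply \<open>\<phi>\<close>, then apply the functor which the parameter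
  \<open>push Y \<sigma> ns\<close> associates with the bijection \<open>reorder \<sigma> ns\<close>.\<close>
definition fam_act ::
  "((nat, 'x, ('o, 'a) bcat, 'y) ftor \<Rightarrow> (nat \<Rightarrow> nat) \<Rightarrow> nat list \<Rightarrow> ('o, 'a, 'o, 'a) ftor) \<Rightarrow> (nat \<Rightarrow> nat)
    \<Rightarrow> ((nat, 'x, ('o, 'a) bcat, 'y) ftor, 'o, 'a) fmor \<Rightarrow> ((nat, 'x, ('o, 'a) bcat, 'y) ftor, 'o, 'a) fmor" where
  "fam_act push \<sigma> \<phi> =
    (let Xs = permute_list \<sigma> (src \<phi>)
     in \<lparr>src = Xs, tgt = tgt \<phi>,
         dat = (\<lambda>ns\<in>{ns. length ns = length Xs}.
           let ns' = permute_list (inv \<sigma>) ns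
           in fcomp (prod_at Xs ns) (push (tgt \<phi>) \<sigma> ns')
                (fcomp (prod_at Xs ns) (dat \<phi> ns')
                   (mk_ftor (prod_at Xs ns) (permute_list (inv \<sigma>)) (permute_list (inv \<sigma>)))))\<rparr>)"

text \<open>The one-variable family with components \<open>q m : X m \<rightarrow> Y m\<close>.\<close>
definition unary ::
  "(nat, 'x, ('o, 'a) bcat, 'y) ftor \<Rightarrow> (nat, 'x, ('o, 'a) bcat, 'y) ftor \<Rightarrow> (nat \<Rightarrow> ('o, 'a) bfun)
    \<Rightarrow> ((nat, 'x, ('o, 'a) bcat, 'y) ftor, 'o, 'a) fmor" where
  "unary X Y q = \<lparr>src = [X], tgt = Y, dat = (\<lambda>ns\<in>{ns. length ns = 1}.
     fcomp (prod_at [X] ns) (dat (q (ns ! 0))) (proj_ftor [FO X (ns ! 0)] 0))\<rparr>"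


text \<open>The object \<open>n\<close> stands for the based set \<open>{0..n}\<close>.\<close>
type_synonym gmor = "(nat, nat, nat \<Rightarrow> nat) arrow"

definition Gamma_op :: "(nat, gmor) cat" where
  "Gamma_op = mk_cat UNIV {f. dat f \<in> {0..src f} \<rightarrow>\<^sub>E {0..tgt f} \<and> dat f 0 = 0} src tgt
    (\<lambda>n. \<lparr>src = n, tgt = n, dat = (\<lambda>x\<in>{0..n}. x)\<rparr>)
    (\<lambda>g f. \<lparr>src = src f, tgt = tgt g, dat = compose {0..src f} (dat g) (dat f)\<rparr>)"

type_synonym ('o, 'a) gcat = "(nat, gmor, ('o, 'a) bcat, ('o, 'a) bfun) ftor"

locale gamma_category = is_functor Gamma_op Cat_based X for X :: "('o, 'a) gcat" +
  assumes at_zero: "FO X 0 = Term_Cat"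

text \<open>\<open>h\<^sub>1 \<and> \<dots> \<and> h\<^sub>r\<close> as a map of the based sets \<open>{0..n\<^sub>1\<cdots>n\<^sub>r} \<rightarrow> {0..m\<^sub>1\<cdots>m\<^sub>r}\<close>.\<close>
definition smash_gmor :: "gmor list \<Rightarrow> gmor" where
  "smash_gmor hs =
    (let ns = map src hs; ms = map tgt hs
     in \<lparr>src = prod_list ns, tgt = prod_list ms,
         dat = (\<lambda>k\<in>{0..prod_list ns}. if k = 0 then 0 else
           let ys = map2 (\<lambda>h x. dat h x) hs (dec ns k) in if 0 \<in> set ys then 0 else enc ms ys)\<rparr>)"

definition gamma_push :: "('o, 'a) gcat \<Rightarrow> (nat \<Rightarrow> nat) \<Rightarrow> nat list \<Rightarrow> ('o, 'a, 'o, 'a) ftor" where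
  "gamma_push Y \<sigma> ns = dat (FA Y \<lparr>src = prod_list ns, tgt = prod_list ns,
     dat = (\<lambda>k\<in>{0..prod_list ns}. if k = 0 then 0 else reorder \<sigma> ns k)\<rparr>)"

text \<open>The multicategory underlying Day convolution. By the universal property of the left Kan
  extension along \<open>\<and>\<close>, morphisms \<open>X\<^sub>1 \<and> \<dots> \<and> X\<^sub>r \<rightarrow> Y\<close> are the families natural in
  \<open>(n\<^sub>1, \<dots>, n\<^sub>r)\<close>; under this correspondence the symmetry of Day convolution acts by \<open>fam_act\<close>.\<close>
definition gamma_multimor :: "(('o, 'a) gcat, 'o, 'a) fmor \<Rightarrow> bool" where
  "gamma_multimor \<phi> \<longleftrightarrow>
     (\<forall>X \<in> set (src \<phi>). gamma_category X) \<and> gamma_category (tgt \<phi>) \<and> smash_family \<phi> \<and>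
     (\<forall>hs. length hs = length (src \<phi>) \<and> set hs \<subseteq> Arr Gamma_op \<longrightarrow>
        (let S = prod_at (src \<phi>) (map src hs); Hs = map2 (\<lambda>X h. dat (FA X h)) (src \<phi>) hs
         in fcomp S (dat \<phi> (map tgt hs)) (mk_ftor S (map2 FO Hs) (map2 FA Hs))
            = fcomp S (dat (FA (tgt \<phi>) (smash_gmor hs))) (dat \<phi> (map src hs))))"

definition Gamma_Cat :: "(('o, 'a) gcat, (('o, 'a) gcat, 'o, 'a) fmor) multicat" where
  "Gamma_Cat = \<lparr>MObj = {X. gamma_category X}, MMor = {\<phi>. gamma_multimor \<phi>}, Src = src, Tgt = tgt,
     MUnit = fam_unit, MComp = fam_comp, Act = fam_act gamma_push\<rparr>"


type_synonym ('o, 'a) ncat = "(nat, nmor, ('o, 'a) bcat, ('o, 'a) opmor) ftor"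

text \<open>\<open>id \<times> f \<times> id\<close> with \<open>f\<close> in position \<open>i\<close>, where \<open>ms ! i = tgt f\<close>.\<close>
definition times_nmor :: "nat list \<Rightarrow> nat \<Rightarrow> nmor \<Rightarrow> nmor" where
  "times_nmor ms i f = \<lparr>src = map (\<lambda>p. prod_list (ms[i := p])) (src f), tgt = prod_list ms,
     dat = (\<lambda>k\<in>{1..prod_list ms}.
       let xs = dec ms k; (l, y) = dat f (xs ! i) in (l, enc (ms[i := src f ! l]) (xs[i := y])))\<rparr>"

text \<open>\<open>id \<and> H \<and> id\<close> with \<open>H\<close> in position \<open>i\<close>.\<close>
definition at_position ::
  "('o list, 'a list) bcat \<Rightarrow> nat \<Rightarrow> ('o, 'a, 'o, 'a) ftor \<Rightarrow> ('o list, 'a list, 'o list, 'a list) ftor" where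
  "at_position S i H = mk_ftor S (\<lambda>xs. xs[i := FO H (xs ! i)]) (\<lambda>us. us[i := FA H (us ! i)])"

definition multifunctorial_in_each :: "(('o, 'a) ncat, 'o, 'a) fmor \<Rightarrow> bool" where
  "multifunctorial_in_each \<phi> \<longleftrightarrow>
     (\<forall>ms i f l. length ms = length (src \<phi>) \<and> i < length ms \<and>
        f \<in> MMor N_Mult \<and> tgt f = ms ! i \<and> l < length (src f) \<longrightarrow>
        (let S = prod_at (src \<phi>) ms
         in fcomp S (coord (FA (tgt \<phi>) (times_nmor ms i f)) l) (dat \<phi> ms)
            = fcomp S (dat \<phi> (ms[i := src f ! l])) (at_position S i (coord (FA (src \<phi> ! i) f) l))))"

text \<open>The two composites have targets \<open>\<Prod>\<^sub>l \<Prod>\<^sub>t G(\<cdots>p\<^sub>l\<cdots>q\<^sub>t\<cdots>)\<close> and \<open>\<Prod>\<^sub>t \<Prod>\<^sub>l G(\<cdots>p\<^sub>l\<cdots>q\<^sub>t\<cdots>)\<close>. That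
  they agree up to reordering means that the \<open>(l, t)\<close>-component of the first is the
  \<open>(t, l)\<close>-component of the second.\<close>
definition bilinear_in_pairs :: "(('o, 'a) ncat, 'o, 'a) fmor \<Rightarrow> bool" where
  "bilinear_in_pairs \<phi> \<longleftrightarrow>
     (\<forall>ms i j f g l t. length ms = length (src \<phi>) \<and> i < length ms \<and> j < length ms \<and> i \<noteq> j \<and>
        f \<in> MMor N_Mult \<and> tgt f = ms ! i \<and> g \<in> MMor N_Mult \<and> tgt g = ms ! j \<and>
        l < length (src f) \<and> t < length (src g) \<longrightarrow>
        (let S = prod_at (src \<phi>) ms; G = tgt \<phi>;
             ms1 = ms[i := src f ! l]; ms2 = ms[j := src g ! t]
         in fcomp S (coord (FA G (times_nmor ms1 j g)) t)
              (fcomp S (dat \<phi> ms1) (at_position S i (coord (FA (src \<phi> ! i) f) l)))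
            = fcomp S (coord (FA G (times_nmor ms2 i f)) l)
              (fcomp S (dat \<phi> ms2) (at_position S j (coord (FA (src \<phi> ! j) g) t)))))"

definition preserves_basepoints :: "(('o, 'a) ncat, 'o, 'a) fmor \<Rightarrow> bool" where
  "preserves_basepoints \<phi> \<longleftrightarrow>
     (\<forall>ms. length ms = length (src \<phi>) \<and> 0 \<in> set ms \<longrightarrow>
        dat \<phi> ms = const_base (prod_at (src \<phi>) ms) Term_Cat)"

definition linear_transformation :: "(('o, 'a) ncat, 'o, 'a) fmor \<Rightarrow> bool" where
  "linear_transformation \<phi> \<longleftrightarrow>
     (\<forall>F \<in> set (src \<phi>). based_multifunctor N_Mult N_base Cat_op Cat_op_base F) \<and>
     based_multifunctor N_Mult N_base Cat_op Cat_op_base (tgt \<phi>) \<and> smash_family \<phi> \<and>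
     multifunctorial_in_each \<phi> \<and> bilinear_in_pairs \<phi> \<and> preserves_basepoints \<phi>"

definition mult_push :: "('o, 'a) ncat \<Rightarrow> (nat \<Rightarrow> nat) \<Rightarrow> nat list \<Rightarrow> ('o, 'a, 'o, 'a) ftor" where
  "mult_push G \<sigma> ns = coord (FA G \<lparr>src = [prod_list ns], tgt = prod_list ns,
     dat = (\<lambda>k\<in>{1..prod_list ns}. (0, reorder \<sigma> ns k))\<rparr>) 0"

definition Mult_N_Cat_op :: "(('o, 'a) ncat, (('o, 'a) ncat, 'o, 'a) fmor) multicat" where
  "Mult_N_Cat_op = \<lparr>MObj = {F. based_multifunctor N_Mult N_base Cat_op Cat_op_base F},
     MMor = {\<phi>. linear_transformation \<phi>}, Src = src, Tgt = tgt,
     MUnit = fam_unit, MComp = fam_comp, Act = fam_act mult_push\<rparr>"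


text \<open>\<open>f\<^sub>l\<close>: adjoin basepoints to \<open>f\<close> and collapse all wedge summands but the \<open>l\<close>-th.\<close>
definition collapse_to :: "nat \<Rightarrow> nmor \<Rightarrow> gmor" where
  "collapse_to l f = \<lparr>src = tgt f, tgt = src f ! l,
     dat = (\<lambda>x\<in>{0..tgt f}. if x = 0 then 0 else let (i, y) = dat f x in if i = l then y else 0)\<rparr>"

definition A_obj :: "('o, 'a) gcat \<Rightarrow> ('o, 'a) ncat" where
  "A_obj X = \<lparr>FO = FO X,
     FA = (\<lambda>f\<in>MMor N_Mult. \<lparr>src = map (FO X) (src f), tgt = FO X (tgt f),
       dat = mk_ftor (FO X (tgt f))
         (\<lambda>x. map (\<lambda>l. FO (dat (FA X (collapse_to l f))) x) [0..<length (src f)])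
         (\<lambda>u. map (\<lambda>l. FA (dat (FA X (collapse_to l f))) u) [0..<length (src f)])\<rparr>)\<rparr>"

text \<open>\<open>A q : A X \<rightarrow> A Y\<close>, for \<open>q : X \<rightarrow> Y\<close>, has the components of \<open>q\<close>.\<close>
definition A_nat :: "('o, 'a) gcat \<Rightarrow> ('o, 'a) gcat \<Rightarrow> (nat \<Rightarrow> ('o, 'a) bfun)
    \<Rightarrow> (('o, 'a) ncat, 'o, 'a) fmor" where
  "A_nat X Y q = unary (A_obj X) (A_obj Y) q"

end

theory Submission
  imports Defs
begin

text \<open>
  A \<open>\<Gamma>\<close>-category and a based multifunctor \<open>\<nat> \<rightarrow> Cat\<^sub>*\<^sup>o\<^sup>p\<close> are essentially the same thing, and so are
  the morphisms of the two multicategories. A morphism \<open>f : [m] \<rightarrow> [n\<^sub>1] \<amalg> \<dots> \<amalg> [n\<^sub>r]\<close> of \<open>\<nat>\<close> is a list of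
  partial functions \<open>f\<^sub>l\<close> from \<open>[m]\<close> to \<open>[n\<^sub>l]\<close>, whose domains partition \<open>[m]\<close>; a partial function is a
  based map of the sets with a base point added. For a multifunctor \<open>F\<close>, the \<open>l\<close>-th coordinate of \<open>F f\<close>
  depends on \<open>f\<^sub>l\<close> only (\<open>coord_partial_act\<close>), because all other summands can be mapped to points. So \<open>F\<close>
  is given by an action of based maps on the categories \<open>F n\<close>. Conversely, the coordinates of
  \<open>(A X) f\<close> are the \<open>X f\<^sub>l\<close> by definition, and \<open>A X\<close> is a multifunctor because composition and
  permutation in \<open>\<nat>\<close> are those of partial functions (\<open>collapse_to_comp\<close>, \<open>collapse_to_act\<close>,
  \<open>A_obj_multifunctor\<close>).

  Hence both multicategories are instances of one construction. The locale \<open>gamma_action\<close> describes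
  objects consisting of based categories \<open>X n\<close> with an action of based maps; an \<open>r\<close>-morphism is a
  family of functors \<open>X\<^sub>1 n\<^sub>1 \<and> \<dots> \<and> X\<^sub>r n\<^sub>r \<rightarrow> Y (n\<^sub>1\<cdots>n\<^sub>r)\<close> natural with respect to all based maps. These form
  a multicategory (\<open>multicategory_of_families\<close>). Its axioms come down to properties of the smash product of
  based maps: associativity (\<open>smash_gmor_concat\<close>), functoriality (\<open>smash_gmor_Comp\<close>), and naturality and
  coherence of the bijections that reorder tuples (\<open>reorder_gmor_natural\<close>,
  \<open>reorder_gmor_block_perm\<close>, \<open>reorder_gmor_sum_perm\<close>).

  For \<open>\<Gamma>\<close>-categories the instance is read off from the definition. For based multifunctors one has to see
  that the linear transformations are the natural families (\<open>linear_transformation_iff\<close>).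
  Multifunctoriality in each variable is naturality for one based map at a time, which amounts to
  naturality for all of them together since the smash product is functorial
  (\<open>natural_if_natural_in_each\<close>). It implies bilinearity, as functors applied in different variables
  commute (\<open>bilinear_if_multifunctorial\<close>). The condition on base points holds because \<open>G 0\<close> is terminal
  (\<open>preserves_basepoints_family\<close>).

  Finally, \<open>X\<close> and \<open>A X\<close> have the same categories with the same action (\<open>partial_act_A_obj\<close>). So \<open>A\<close> can be
  defined on \<open>r\<close>-morphisms by keeping the components of a family (\<open>A_mor\<close>), and it is compatible with
  units, composition and permutations, which are given by the same formulas on both sides
  (\<open>multifunctor_A\<close>).
\<close>

section \<open>Cutting lists into blocks\<close>

lemma length_chunks [simp]: "length (chunks ns xs) = length ns"
  by (induction ns arbitrary: xs) auto

lemma chunks_concat: "map length xss = ns \<Longrightarrow> chunks ns (concat xss) = xss"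
  by (induction ns arbitrary: xss) auto

lemma map_chunks: "chunks ns (map f xs) = map (map f) (chunks ns xs)"
  by (induction ns arbitrary: xs) (auto simp: take_map drop_map)

lemma concat_chunks: "length xs = sum_list ns \<Longrightarrow> concat (chunks ns xs) = xs"
  by (induction ns arbitrary: xs) auto

lemma map_length_chunks: "length xs = sum_list ns \<Longrightarrow> map length (chunks ns xs) = ns"
  by (induction ns arbitrary: xs) auto

lemma obtain_blocks:
  assumes "length xs = sum_list ns"
  obtains xss where "xs = concat xss" "map length xss = ns"
  using that[of "chunks ns xs"] assms by (simp add: concat_chunks map_length_chunks)

text \<open>In a concatenation, the entry \<open>j\<close> of block \<open>i\<close> stands at the sum of the lengths of the earlier
  blocks plus \<open>j\<close>. Composition in \<open>N_Mult\<close> is written with these offsets, while composition in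
  \<open>Cat_op\<close> and of families concatenates lists; this fact and its companions translate between
  the two.\<close>
lemma nth_concat_offset:
  "\<lbrakk>i < length xss; j < length (xss ! i)\<rbrakk>
    \<Longrightarrow> concat xss ! (sum_list (map length (take i xss)) + j) = xss ! i ! j"
proof (induction xss arbitrary: i)
  case (Cons xs xss)
  then show ?case by (cases i) (auto simp: nth_append add.assoc)
qed simp

lemma take_concat_offset:
  "\<lbrakk>i < length xss; j \<le> length (xss ! i)\<rbrakk>
    \<Longrightarrow> take (sum_list (map length (take i xss)) + j) (concat xss) = concat (take i xss) @ take j (xss ! i)"
proof (induction xss arbitrary: i)
  case (Cons xs xss)
  then show ?case by (cases i) (auto simp: add.assoc)
qed simp

lemma offset_less:
  "\<lbrakk>i < length xss; j < length (xss ! i)\<rbrakk>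
    \<Longrightarrow> sum_list (map length (take i xss)) + j < length (concat xss)"
proof (induction xss arbitrary: i)
  case (Cons xs xss)
  then show ?case by (cases i) (auto simp: add.assoc)
qed simp

lemma obtain_offset:
  assumes "k < length (concat xss)"
  obtains i j where "i < length xss" "j < length (xss ! i)"
    "k = sum_list (map length (take i xss)) + j"
proof -
  have "\<exists>i j. i < length xss \<and> j < length (xss ! i) \<and> k = sum_list (map length (take i xss)) + j"
    using assms
  proof (induction xss arbitrary: k)
    case (Cons xs xss)
    show ?case
    proof (cases "k < length xs")
      case True
      then show ?thesis by (intro exI[of _ 0] exI[of _ k]) simp
    next
      case False
      with Cons.prems have "k - length xs < length (concat xss)" by auto
      from Cons.IH[OF this] obtain i j where "i < length xss" "j < length (xss ! i)"
        "k - length xs = sum_list (map length (take i xss)) + j" by blast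
      with False show ?thesis by (intro exI[of _ "Suc i"] exI[of _ j]) auto
    qed
  qed simp
  with that show ?thesis by blast
qed

section \<open>Block permutations\<close>

text \<open>A rearrangement of the list of all positions is a permutation. Both \<open>block_perm\<close> and
  \<open>sum_perm\<close> arise from such a rearrangement.\<close>
lemma nth_permutes:
  assumes "mset ys = mset [0..<N]"
  shows "(\<lambda>k. if k < N then ys ! k else k) permutes {..<N}"
proof (rule bij_imp_permutes)
  have d: "distinct ys" using assms mset_eq_imp_distinct_iff by fastforce
  have l: "length ys = N" using mset_eq_length[OF assms] by simp
  have s: "set ys = {..<N}" using mset_eq_setD[OF assms] by (simp add: atLeast0LessThan)
  have "bij_betw ((!) ys) {..<N} {..<N}"
    by (rule bij_betw_nth[OF d]) (simp_all add: l s)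
  then show "bij_betw (\<lambda>k. if k < N then ys ! k else k) {..<N} {..<N}"
    by (subst bij_betw_cong[of _ _ "(!) ys"]) simp_all
qed simp

lemma mset_concat_permute_list:
  assumes "\<sigma> permutes {..<length xss}"
  shows "mset (concat (permute_list \<sigma> xss)) = mset (concat xss)"
proof -
  have "mset (concat zss) = sum_mset (image_mset mset (mset zss))" for zss :: "'a list list"
    by (induction zss) auto
  then show ?thesis using assms by simp
qed

lemma block_perm_permutes:
  assumes "\<sigma> permutes {..<length ns}"
  shows "block_perm \<sigma> ns permutes {..<sum_list ns}"
proof -
  have "mset (concat (permute_list \<sigma> (chunks ns [0..<sum_list ns]))) = mset [0..<sum_list ns]"
    using mset_concat_permute_list[of \<sigma> "chunks ns [0..<sum_list ns]"] assms
    by (simp add: concat_chunks)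
  from nth_permutes[OF this] show ?thesis unfolding block_perm_def[abs_def] .
qed

lemma permute_list_nth_list:
  assumes "length ys = length xs" "\<And>k. k < length xs \<Longrightarrow> \<beta> k = ys ! k"
  shows "permute_list \<beta> xs = map ((!) xs) ys"
  by (rule nth_equalityI) (simp_all add: permute_list_def assms)

lemma map_nth_chunks:
  "map length xss = ns \<Longrightarrow> map (map ((!) (concat xss))) (chunks ns [0..<sum_list ns]) = xss"
proof -
  assume a: "map length xss = ns"
  have l: "sum_list ns = length (concat xss)" using a by (simp add: length_concat)
  show ?thesis
    unfolding map_chunks[symmetric] l map_nth using a by (rule chunks_concat)
qed

lemma map_permute_list:
  "\<sigma> permutes {..<length xs} \<Longrightarrow> map f (permute_list \<sigma> xs) = permute_list \<sigma> (map f xs)"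
  by (simp add: permute_list_map)

text \<open>Both sides are natural in the entries of the blocks, and every list is the image of its list of
  positions. For the list of positions, the claim is how \<open>block_perm\<close> is defined.\<close>
lemma permute_list_block_perm:
  assumes s: "\<sigma> permutes {..<length ns}" and l: "map length xss = ns"
  shows "permute_list (block_perm \<sigma> ns) (concat xss) = concat (permute_list \<sigma> xss)"
proof -
  let ?c = "chunks ns [0..<sum_list ns]"
  have L: "sum_list ns = length (concat xss)" using l by (simp add: length_concat)
  have "mset (concat (permute_list \<sigma> ?c)) = mset [0..<sum_list ns]"
    using mset_concat_permute_list[of \<sigma> ?c] s by (simp add: concat_chunks)
  then have "length (concat (permute_list \<sigma> ?c)) = length (concat xss)"
    using L mset_eq_length by fastforce
  then have "permute_list (block_perm \<sigma> ns) (concat xss)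
      = map ((!) (concat xss)) (concat (permute_list \<sigma> ?c))"
    by (rule permute_list_nth_list) (simp add: block_perm_def L)
  also have "\<dots> = concat (permute_list \<sigma> (map (map ((!) (concat xss))) ?c))"
    using s by (simp add: map_concat map_permute_list)
  also have "\<dots> = concat (permute_list \<sigma> xss)" by (simp only: map_nth_chunks[OF l])
  finally show ?thesis .
qed

lemma mset_concat_map2_permute_list:
  assumes "list_all2 (\<lambda>\<tau> xs. \<tau> permutes {..<length xs}) \<tau>s xss"
  shows "mset (concat (map2 permute_list \<tau>s xss)) = mset (concat xss)"
  using assms by (induction rule: list_all2_induct) auto

lemma list_all2_permutes_chunks:
  "list_all2 (\<lambda>\<tau> n. \<tau> permutes {..<n}) \<tau>s ns
    \<Longrightarrow> list_all2 (\<lambda>\<tau> xs. \<tau> permutes {..<length xs}) \<tau>s (chunks ns [0..<sum_list ns])"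
proof -
  assume "list_all2 (\<lambda>\<tau> n. \<tau> permutes {..<n}) \<tau>s ns"
  then have "list_all2 (\<lambda>\<tau> n. \<tau> permutes {..<n}) \<tau>s (map length (chunks ns [0..<sum_list ns]))"
    by (simp only: map_length_chunks length_upt diff_zero)
  then show ?thesis by (simp only: list_all2_map2)
qed

lemma sum_perm_permutes:
  assumes "list_all2 (\<lambda>\<tau> n. \<tau> permutes {..<n}) \<tau>s ns"
  shows "sum_perm \<tau>s ns permutes {..<sum_list ns}"
proof -
  have "mset (concat (map2 permute_list \<tau>s (chunks ns [0..<sum_list ns]))) = mset [0..<sum_list ns]"
    using mset_concat_map2_permute_list[OF list_all2_permutes_chunks[OF assms]]
    by (simp add: concat_chunks)
  from nth_permutes[OF this] show ?thesis unfolding sum_perm_def[abs_def] .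
qed

lemma map_map2_permute_list:
  "list_all2 (\<lambda>\<tau> xs. \<tau> permutes {..<length xs}) \<tau>s xss
    \<Longrightarrow> map (map f) (map2 permute_list \<tau>s xss) = map2 permute_list \<tau>s (map (map f) xss)"
  by (induction rule: list_all2_induct) (auto simp: map_permute_list)

text \<open>By naturality in the entries, as for \<open>permute_list_block_perm\<close>.\<close>
lemma permute_list_sum_perm:
  assumes s: "list_all2 (\<lambda>\<tau> n. \<tau> permutes {..<n}) \<tau>s ns" and l: "map length xss = ns"
  shows "permute_list (sum_perm \<tau>s ns) (concat xss) = concat (map2 permute_list \<tau>s xss)"
proof -
  let ?c = "chunks ns [0..<sum_list ns]"
  have L: "sum_list ns = length (concat xss)" using l by (simp add: length_concat)
  note a = list_all2_permutes_chunks[OF s]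
  have "mset (concat (map2 permute_list \<tau>s ?c)) = mset [0..<sum_list ns]"
    using mset_concat_map2_permute_list[OF a] by (simp add: concat_chunks)
  then have "length (concat (map2 permute_list \<tau>s ?c)) = length (concat xss)"
    using L mset_eq_length by fastforce
  then have "permute_list (sum_perm \<tau>s ns) (concat xss)
      = map ((!) (concat xss)) (concat (map2 permute_list \<tau>s ?c))"
    by (rule permute_list_nth_list) (simp add: sum_perm_def L)
  also have "\<dots> = concat (map2 permute_list \<tau>s (map (map ((!) (concat xss))) ?c))"
    using a by (simp add: map_concat map_map2_permute_list del: map_map)
  also have "\<dots> = concat (map2 permute_list \<tau>s xss)" by (simp only: map_nth_chunks[OF l])
  finally show ?thesis .
qed

lemma sum_list_take_length: "sum_list (take i (map length xss)) = sum_list (map length (take i xss))"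
  by (simp add: take_map)

lemma nth_chunks_upt:
  assumes "i < length ns" "j < ns ! i"
  shows "chunks ns [0..<sum_list ns] ! i ! j = sum_list (take i ns) + j"
proof -
  let ?c = "chunks ns [0..<sum_list ns]"
  have m: "map length ?c = ns" by (simp add: map_length_chunks)
  then have l: "length (?c ! i) = ns ! i" using assms by (metis length_chunks nth_map)
  have "?c ! i ! j = concat ?c ! (sum_list (map length (take i ?c)) + j)"
    using assms l by (intro nth_concat_offset[symmetric]) auto
  also have "\<dots> = [0..<sum_list ns] ! (sum_list (map length (take i ?c)) + j)"
    by (simp add: concat_chunks)
  also have "\<dots> = sum_list (map length (take i ?c)) + j"
    using offset_less[of i ?c j] assms l concat_chunks[of "[0..<sum_list ns]" ns] by simp
  also have "\<dots> = sum_list (take i ns) + j" by (metis m take_map)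
  finally show ?thesis .
qed

text \<open>The same two permutations in terms of offsets. Since \<open>Act N_Mult\<close> changes the index of a summand
  by an inverse permutation, equivariance in \<open>N_Mult\<close> needs the values of \<open>block_perm\<close> and \<open>sum_perm\<close>
  and not only their effect on lists.\<close>
lemma block_perm_offset:
  assumes s: "\<sigma> permutes {..<length ns}" and i: "i < length ns" and j: "j < ns ! \<sigma> i"
  shows "block_perm \<sigma> ns (sum_list (take i (permute_list \<sigma> ns)) + j) = sum_list (take (\<sigma> i) ns) + j"
proof -
  let ?c = "chunks ns [0..<sum_list ns]"
  let ?p = "permute_list \<sigma> ?c"
  have si: "\<sigma> i < length ns" using s i by (metis lessThan_iff permutes_in_image)
  have m: "map length ?p = permute_list \<sigma> ns"
    using s by (simp add: map_permute_list map_length_chunks)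
  have l: "length (?p ! i) = ns ! \<sigma> i"
    by (metis m i s length_chunks length_permute_list nth_map permute_list_nth)
  have "length (concat ?p) = sum_list (permute_list \<sigma> ns)" by (simp add: length_concat m)
  also have "\<dots> = sum_list ns" using s by (metis mset_permute_list sum_mset_sum_list)
  finally have L: "length (concat ?p) = sum_list ns" .
  have o: "sum_list (take i (permute_list \<sigma> ns)) = sum_list (map length (take i ?p))"
    by (metis m take_map)
  have "sum_list (map length (take i ?p)) + j < sum_list ns"
    using offset_less[of i ?p j] i j l L by simp
  then have "block_perm \<sigma> ns (sum_list (take i (permute_list \<sigma> ns)) + j) = ?p ! i ! j"
    unfolding block_perm_def o using nth_concat_offset[of i ?p j] i j l by simp
  also have "\<dots> = ?c ! \<sigma> i ! j" using s i by (simp add: permute_list_nth)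
  also have "\<dots> = sum_list (take (\<sigma> i) ns) + j" using si j by (rule nth_chunks_upt)
  finally show ?thesis .
qed

lemma sum_perm_offset:
  assumes s: "list_all2 (\<lambda>\<tau> n. \<tau> permutes {..<n}) \<tau>s ns" and i: "i < length ns" and j: "j < ns ! i"
  shows "sum_perm \<tau>s ns (sum_list (take i ns) + j) = sum_list (take i ns) + (\<tau>s ! i) j"
proof -
  let ?c = "chunks ns [0..<sum_list ns]"
  let ?p = "map2 permute_list \<tau>s ?c"
  have len: "length \<tau>s = length ns" using s by (rule list_all2_lengthD)
  have m: "map length ?p = ns"
    using map_length_chunks[of "[0..<sum_list ns]" ns] len
    by (intro nth_equalityI) (auto simp: list_eq_iff_nth_eq)
  have lc: "length (?c ! i) = ns ! i"
    using map_length_chunks[of "[0..<sum_list ns]" ns] i by (metis diff_zero length_chunks length_upt nth_map)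
  have l: "length (?p ! i) = ns ! i" using i len lc by simp
  have L: "length (concat ?p) = sum_list ns" by (simp only: length_concat m)
  have o: "sum_list (take i ns) = sum_list (map length (take i ?p))"
    by (metis m take_map)
  have t: "(\<tau>s ! i) permutes {..<ns ! i}" using s i len by (simp add: list_all2_conv_all_nth)
  then have tj: "(\<tau>s ! i) j < ns ! i" using j by (metis lessThan_iff permutes_in_image)
  have "sum_list (map length (take i ?p)) + j < sum_list ns"
    using offset_less[of i ?p j] i j l L len by simp
  then have "sum_perm \<tau>s ns (sum_list (take i ns) + j) = ?p ! i ! j"
    unfolding sum_perm_def o using nth_concat_offset[of i ?p j] i j l len by simp
  also have "\<dots> = ?c ! i ! (\<tau>s ! i) j" using i len j t lc by (simp add: permute_list_nth)
  also have "\<dots> = sum_list (take i ns) + (\<tau>s ! i) j" using i tj by (rule nth_chunks_upt)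
  finally show ?thesis .
qed

section \<open>The lexicographic numbering of tuples\<close>

lemma tuples_Nil [simp]: "tuples [] = {[]}"
  by (auto simp: tuples_def)

lemma tuples_Cons: "x # xs \<in> tuples (n # ns) \<longleftrightarrow> x \<in> {1..n} \<and> xs \<in> tuples ns"
  by (auto simp: tuples_def)

lemma tuples_length: "xs \<in> tuples ns \<Longrightarrow> length xs = length ns"
  by (auto simp: tuples_def dest: list_all2_lengthD)

lemma tuples_nth: "xs \<in> tuples ns \<longleftrightarrow> length xs = length ns \<and> (\<forall>i < length ns. xs ! i \<in> {1..ns ! i})"
  by (auto simp: tuples_def list_all2_conv_all_nth)

lemma enc_pos: "0 < enc ns xs"
  by (induction ns xs rule: enc.induct) auto

lemma enc_le: "xs \<in> tuples ns \<Longrightarrow> enc ns xs \<le> prod_list ns"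
proof (induction ns arbitrary: xs)
  case (Cons n ns)
  then obtain x ys where xs: "xs = x # ys" by (cases xs) (auto dest: tuples_length)
  with Cons.prems have x: "1 \<le> x" "x \<le> n" and ys: "ys \<in> tuples ns" by (auto simp: tuples_Cons)
  have "(x - 1) * prod_list ns + enc ns ys \<le> (x - 1) * prod_list ns + prod_list ns"
    using Cons.IH[OF ys] by simp
  also have "\<dots> = x * prod_list ns" using x by (cases x) auto
  also have "\<dots> \<le> n * prod_list ns" using x by simp
  finally show ?case by (simp add: xs)
qed simp

lemma enc_in: "xs \<in> tuples ns \<Longrightarrow> enc ns xs \<in> {1..prod_list ns}"
  using enc_le[of xs ns] enc_pos[of ns xs] by auto

text \<open>Up to shifts by one, the first entry and the number of the remaining tuple are quotient and
  remainder on division by the product of the remaining bounds.\<close>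
lemma enc_inj: "\<lbrakk>xs \<in> tuples ns; ys \<in> tuples ns; enc ns xs = enc ns ys\<rbrakk> \<Longrightarrow> xs = ys"
proof (induction ns arbitrary: xs ys)
  case (Cons n ns)
  obtain x xs' where xs: "xs = x # xs'" using Cons.prems(1) by (cases xs) (auto dest: tuples_length)
  obtain y ys' where ys: "ys = y # ys'" using Cons.prems(2) by (cases ys) (auto dest: tuples_length)
  let ?P = "prod_list ns"
  have x: "1 \<le> x" and y: "1 \<le> y" and x': "xs' \<in> tuples ns" and y': "ys' \<in> tuples ns"
    using Cons.prems by (auto simp: xs ys tuples_Cons)
  have e: "1 \<le> enc ns xs'" "enc ns xs' \<le> ?P" "1 \<le> enc ns ys'" "enc ns ys' \<le> ?P"
    using enc_in[OF x'] enc_in[OF y'] by auto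
  have eq: "(x - 1) * ?P + (enc ns xs' - 1) = (y - 1) * ?P + (enc ns ys' - 1)"
    using Cons.prems(3) e by (simp add: xs ys)
  have lt: "enc ns xs' - 1 < ?P" "enc ns ys' - 1 < ?P" using e by auto
  have "x - 1 = ((x - 1) * ?P + (enc ns xs' - 1)) div ?P" using lt by simp
  also have "\<dots> = y - 1" unfolding eq using lt by simp
  finally have "x = y" using x y by simp
  moreover have "enc ns xs' - 1 = ((x - 1) * ?P + (enc ns xs' - 1)) mod ?P" using lt by simp
  then have "enc ns xs' - 1 = enc ns ys' - 1" unfolding eq using lt by simp
  then have "xs' = ys'" using Cons.IH[OF x' y'] e by simp
  ultimately show ?case by (simp add: xs ys)
qed simp

lemma enc_surj: "k \<in> {1..prod_list ns} \<Longrightarrow> \<exists>xs \<in> tuples ns. enc ns xs = k"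
proof (induction ns arbitrary: k)
  case (Cons n ns)
  let ?P = "prod_list ns"
  have k: "1 \<le> k" "k \<le> n * ?P" using Cons.prems by auto
  then have P: "0 < ?P" by (cases "?P = 0") auto
  have "(k - 1) div ?P < n" using k P by (simp add: less_mult_imp_div_less)
  then have x: "(k - 1) div ?P + 1 \<in> {1..n}" by simp
  have "(k - 1) mod ?P + 1 \<in> {1..?P}" using P by (simp add: Suc_leI)
  from Cons.IH[OF this] obtain xs where xs: "xs \<in> tuples ns" "enc ns xs = (k - 1) mod ?P + 1" by blast
  have "enc (n # ns) (((k - 1) div ?P + 1) # xs) = k"
    using k by (simp add: xs(2))
  moreover have "((k - 1) div ?P + 1) # xs \<in> tuples (n # ns)"
    using x xs(1) by (simp add: tuples_Cons)
  ultimately show ?case by blast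
qed auto

lemma bij_betw_enc: "bij_betw (enc ns) (tuples ns) {1..prod_list ns}"
  unfolding bij_betw_def using enc_in enc_surj by (auto intro!: inj_onI dest: enc_inj) blast

lemma dec_enc: "xs \<in> tuples ns \<Longrightarrow> dec ns (enc ns xs) = xs"
  unfolding dec_def using bij_betw_enc[of ns]
  by (intro the_inv_into_f_f) (auto simp: bij_betw_def)

lemma dec_in: "k \<in> {1..prod_list ns} \<Longrightarrow> dec ns k \<in> tuples ns"
  using enc_surj[of k ns] dec_enc[of _ ns] by auto

text \<open>The shift by one comes from counting tuples from 1 and not from 0.\<close>
lemma enc_append:
  "length xs = length ns \<Longrightarrow> enc (ns @ ms) (xs @ ys) = (enc ns xs - 1) * prod_list ms + enc ms ys"
proof (induction ns arbitrary: xs)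
  case (Cons n ns)
  then obtain x xs' where xs: "xs = x # xs'" and l: "length xs' = length ns" by (cases xs) auto
  obtain e where e: "enc ns xs' = Suc e" using enc_pos[of ns xs'] gr0_implies_Suc by blast
  show ?case by (simp add: xs Cons.IH[OF l] e algebra_simps)
qed simp

lemma prod_list_concat: "prod_list (concat nss) = prod_list (map prod_list nss)"
  for nss :: "nat list list"
  by (induction nss) auto

text \<open>Strict associativity of the identification of \<open>[m] \<times> [n]\<close> with \<open>[mn]\<close>, from which the smash product of
  based maps inherits its associativity.\<close>
lemma enc_concat:
  "list_all2 (\<lambda>xs ns. length xs = length ns) xss nss
    \<Longrightarrow> enc (concat nss) (concat xss) = enc (map prod_list nss) (map2 enc nss xss)"
  by (induction rule: list_all2_induct) (auto simp: enc_append prod_list_concat)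

lemma prod_list_permute_list:
  "\<sigma> permutes {..<length ns} \<Longrightarrow> prod_list (permute_list \<sigma> ns) = prod_list ns" for ns :: "nat list"
  by (metis mset_permute_list prod_mset_prod_list)

lemma permute_list_in_tuples:
  assumes "\<sigma> permutes {..<length ns}" "xs \<in> tuples ns"
  shows "permute_list \<sigma> xs \<in> tuples (permute_list \<sigma> ns)"
  using assms permutes_in_image[OF assms(1)]
  by (auto simp: tuples_nth permute_list_nth simp flip: lessThan_iff)

section \<open>Categories and functors\<close>

lemma mk_ftor_simps [simp]:
  "x \<in> Obj C \<Longrightarrow> FO (mk_ftor C u v) x = u x"
  "f \<in> Arr C \<Longrightarrow> FA (mk_ftor C u v) f = v f"
  by (simp_all add: mk_ftor_def)

lemma mk_ftor_cong:
  "\<lbrakk>\<And>x. x \<in> Obj C \<Longrightarrow> u x = u' x; \<And>f. f \<in> Arr C \<Longrightarrow> v f = v' f\<rbrakk> \<Longrightarrow> mk_ftor C u v = mk_ftor C u' v'"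
  by (auto simp: mk_ftor_def restrict_def)

lemma with_base_simps [simp]:
  "Obj (with_base C b) = Obj C" "Arr (with_base C b) = Arr C" "Dom (with_base C b) = Dom C"
  "Cod (with_base C b) = Cod C" "Ident (with_base C b) = Ident C" "Comp (with_base C b) = Comp C"
  "Base (with_base C b) = b"
  by (simp_all add: with_base_def cat.extend_def bcat.fields_def)

lemma category_id:
  assumes "category C" "x \<in> Obj C" shows "Ident C x \<in> Arr C"
  using category.Ident_closed[OF assms(1)] assms(2) by auto

lemma category_dom_cod:
  assumes "category C" "f \<in> Arr C" shows "Dom C f \<in> Obj C" "Cod C f \<in> Obj C"
  using category.Dom_closed[OF assms(1)] category.Cod_closed[OF assms(1)] assms(2) by auto

lemma prod_cat_sets:
  "Obj (prod_cat Cs) = {xs. list_all2 (\<lambda>x C. x \<in> Obj C) xs Cs}"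
  "Arr (prod_cat Cs) = {fs. list_all2 (\<lambda>f C. f \<in> Arr C) fs Cs}"
  "Base (prod_cat Cs) = map Base Cs"
  by (simp_all add: prod_cat_def mk_cat_def)

lemma prod_cat_Obj: "xs \<in> Obj (prod_cat Cs) \<longleftrightarrow>
    length xs = length Cs \<and> (\<forall>i < length Cs. xs ! i \<in> Obj (Cs ! i))"
  by (auto simp: prod_cat_sets list_all2_conv_all_nth)

lemma prod_cat_Arr: "fs \<in> Arr (prod_cat Cs) \<longleftrightarrow>
    length fs = length Cs \<and> (\<forall>i < length Cs. fs ! i \<in> Arr (Cs ! i))"
  by (auto simp: prod_cat_sets list_all2_conv_all_nth)

lemma prod_cat_maps:
  "fs \<in> Arr (prod_cat Cs) \<Longrightarrow> Dom (prod_cat Cs) fs = map2 Dom Cs fs"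
  "fs \<in> Arr (prod_cat Cs) \<Longrightarrow> Cod (prod_cat Cs) fs = map2 Cod Cs fs"
  "xs \<in> Obj (prod_cat Cs) \<Longrightarrow> Ident (prod_cat Cs) xs = map2 Ident Cs xs"
  "\<lbrakk>gs \<in> Arr (prod_cat Cs); fs \<in> Arr (prod_cat Cs); Dom (prod_cat Cs) gs = Cod (prod_cat Cs) fs\<rbrakk>
    \<Longrightarrow> Comp (prod_cat Cs) gs fs = map (\<lambda>i. Comp (Cs ! i) (gs ! i) (fs ! i)) [0..<length Cs]"
  by (simp_all add: prod_cat_def mk_cat_def)

lemma prod_cat_nth:
  assumes "i < length Cs"
  shows "fs \<in> Arr (prod_cat Cs) \<Longrightarrow> Dom (prod_cat Cs) fs ! i = Dom (Cs ! i) (fs ! i)"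
  and "fs \<in> Arr (prod_cat Cs) \<Longrightarrow> Cod (prod_cat Cs) fs ! i = Cod (Cs ! i) (fs ! i)"
  and "xs \<in> Obj (prod_cat Cs) \<Longrightarrow> Ident (prod_cat Cs) xs ! i = Ident (Cs ! i) (xs ! i)"
  and "\<lbrakk>gs \<in> Arr (prod_cat Cs); fs \<in> Arr (prod_cat Cs); Dom (prod_cat Cs) gs = Cod (prod_cat Cs) fs\<rbrakk>
    \<Longrightarrow> Comp (prod_cat Cs) gs fs ! i = Comp (Cs ! i) (gs ! i) (fs ! i)"
  using assms by (simp_all add: prod_cat_maps prod_cat_Obj prod_cat_Arr)

lemma prod_cat_lengths:
  "fs \<in> Arr (prod_cat Cs) \<Longrightarrow> length (Dom (prod_cat Cs) fs) = length Cs"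
  "fs \<in> Arr (prod_cat Cs) \<Longrightarrow> length (Cod (prod_cat Cs) fs) = length Cs"
  "xs \<in> Obj (prod_cat Cs) \<Longrightarrow> length (Ident (prod_cat Cs) xs) = length Cs"
  "\<lbrakk>gs \<in> Arr (prod_cat Cs); fs \<in> Arr (prod_cat Cs); Dom (prod_cat Cs) gs = Cod (prod_cat Cs) fs\<rbrakk>
    \<Longrightarrow> length (Comp (prod_cat Cs) gs fs) = length Cs"
  by (simp_all add: prod_cat_maps prod_cat_Obj prod_cat_Arr)

lemma category_prod:
  assumes "\<And>C. C \<in> set Cs \<Longrightarrow> category C"
  shows "category (prod_cat Cs)"
proof -
  have c: "category (Cs ! i)" if "i < length Cs" for i using assms that by simp
  note dc = category_dom_cod[OF c] category_id[OF c]
  note D = prod_cat_nth[of _ Cs] and L = prod_cat_lengths[of _ Cs]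
  let ?P = "prod_cat Cs"
  have sq: "Dom (Cs ! i) (g ! i) = Cod (Cs ! i) (f ! i)"
    if "g \<in> Arr ?P" "f \<in> Arr ?P" "Dom ?P g = Cod ?P f" "i < length Cs" for g f i
    using that D(1)[of i g] D(2)[of i f] by simp
  have comp: "Comp ?P g f \<in> Arr ?P"
    if "g \<in> Arr ?P" "f \<in> Arr ?P" "Dom ?P g = Cod ?P f" for g f
    unfolding prod_cat_Arr using that sq[OF that] category.Comp_closed[OF c] L(4)[OF that]
    by (auto simp: D(4)[OF _ that] prod_cat_Arr)
  have dcc: "Dom ?P (Comp ?P g f) = Dom ?P f" "Cod ?P (Comp ?P g f) = Cod ?P g"
    if "g \<in> Arr ?P" "f \<in> Arr ?P" "Dom ?P g = Cod ?P f" for g f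
    using that sq[OF that] comp[OF that] category.Dom_Comp[OF c] category.Cod_Comp[OF c]
    by (auto intro!: nth_equalityI simp: L D prod_cat_Arr)
  have id: "Ident ?P x \<in> Arr ?P" if "x \<in> Obj ?P" for x
    using that dc(3) by (auto simp: prod_cat_Arr prod_cat_Obj[of x] D(3)[OF _ that] L(3)[OF that])
  have do: "Dom ?P f \<in> Obj ?P" "Cod ?P f \<in> Obj ?P" if "f \<in> Arr ?P" for f
    using that dc(1,2) by (auto simp: prod_cat_Obj prod_cat_Arr[of f] D(1,2)[OF _ that] L(1,2)[OF that])
  show ?thesis
  proof
    show "Dom ?P \<in> Arr ?P \<rightarrow>\<^sub>E Obj ?P" "Cod ?P \<in> Arr ?P \<rightarrow>\<^sub>E Obj ?P" "Ident ?P \<in> Obj ?P \<rightarrow>\<^sub>E Arr ?P"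
      using do id by (auto simp: PiE_def extensional_def prod_cat_def mk_cat_def)
    show "Dom ?P (Ident ?P x) = x" "Cod ?P (Ident ?P x) = x" if "x \<in> Obj ?P" for x
      using that id[OF that] category.Dom_Ident[OF c] category.Cod_Ident[OF c]
      by (auto intro!: nth_equalityI simp: L D prod_cat_Obj)
    show "Comp ?P g f = undefined" if "\<not> (g \<in> Arr ?P \<and> f \<in> Arr ?P \<and> Dom ?P g = Cod ?P f)" for g f
      using that by (auto simp: prod_cat_def mk_cat_def)
    show "Comp ?P (Ident ?P (Cod ?P f)) f = f" "Comp ?P f (Ident ?P (Dom ?P f)) = f" if f: "f \<in> Arr ?P" for f
    proof -
      have l: "Dom ?P (Ident ?P (Cod ?P f)) = Cod ?P f"
        and r: "Dom ?P f = Cod ?P (Ident ?P (Dom ?P f))"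
        using do[OF f] id category.Dom_Ident[OF c] category.Cod_Ident[OF c]
        by (auto intro!: nth_equalityI simp: L D prod_cat_Obj)
      show "Comp ?P (Ident ?P (Cod ?P f)) f = f"
        using f do(2)[OF f] id[OF do(2)[OF f]] l category.Comp_Ident_left[OF c]
        by (auto intro!: nth_equalityI simp: L D prod_cat_Arr)
      show "Comp ?P f (Ident ?P (Dom ?P f)) = f"
        using f do(1)[OF f] id[OF do(1)[OF f]] r category.Comp_Ident_right[OF c]
        by (auto intro!: nth_equalityI simp: L D prod_cat_Arr)
    qed
    show "Comp ?P (Comp ?P h g) f = Comp ?P h (Comp ?P g f)"
      if "h \<in> Arr ?P" "g \<in> Arr ?P" "f \<in> Arr ?P" "Dom ?P h = Cod ?P g" "Dom ?P g = Cod ?P f" for h g f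
      using that comp dcc sq category.Comp_assoc[OF c]
      by (auto intro!: nth_equalityI simp: L D prod_cat_Arr)
  qed (use comp dcc in auto)
qed

lemma based_category_iff: "based_category C \<longleftrightarrow> category C \<and> Base C \<in> Obj C"
  by (auto simp: based_category_def based_category_axioms_def)

lemma based_category_prod:
  assumes "\<And>C. C \<in> set Cs \<Longrightarrow> based_category C"
  shows "based_category (prod_cat Cs)"
  using assms category_prod[of Cs] by (auto simp: based_category_iff prod_cat_Obj prod_cat_sets(3))

lemma based_functor_iff: "based_functor C D F \<longleftrightarrow>
    is_functor C D F \<and> based_category C \<and> based_category D \<and> FO F (Base C) = Base D"
  by (auto simp: based_functor_def based_functor_axioms_def)

lemma functor_closed:
  assumes "is_functor C D F"
  shows "x \<in> Obj C \<Longrightarrow> FO F x \<in> Obj D" "f \<in> Arr C \<Longrightarrow> FA F f \<in> Arr D"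
  using is_functor.FO_closed[OF assms] is_functor.FA_closed[OF assms] by auto

lemma mk_functorI:
  assumes "category C" "category D"
    and "\<And>x. x \<in> Obj C \<Longrightarrow> u x \<in> Obj D" "\<And>f. f \<in> Arr C \<Longrightarrow> v f \<in> Arr D"
    and "\<And>f. f \<in> Arr C \<Longrightarrow> Dom D (v f) = u (Dom C f)" "\<And>f. f \<in> Arr C \<Longrightarrow> Cod D (v f) = u (Cod C f)"
    and "\<And>x. x \<in> Obj C \<Longrightarrow> v (Ident C x) = Ident D (u x)"
    and "\<And>g f. \<lbrakk>g \<in> Arr C; f \<in> Arr C; Dom C g = Cod C f\<rbrakk> \<Longrightarrow> v (Comp C g f) = Comp D (v g) (v f)"
  shows "is_functor C D (mk_ftor C u v)"
proof -
  note dc = category_dom_cod[OF assms(1)] category_id[OF assms(1)] category.Comp_closed[OF assms(1)]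
  show ?thesis unfolding is_functor_def is_functor_axioms_def
    using assms dc by (auto simp: mk_ftor_def)
qed

lemma ftor_eqI:
  assumes "is_functor C D F" "is_functor C D' G"
    and "\<And>x. x \<in> Obj C \<Longrightarrow> FO F x = FO G x" "\<And>f. f \<in> Arr C \<Longrightarrow> FA F f = FA G f"
  shows "F = G"
proof -
  note c = is_functor.FO_closed is_functor.FA_closed
  have "FO F = FO G" using c(1)[OF assms(1)] c(1)[OF assms(2)] assms(3)
    by (auto simp: PiE_def intro: extensionalityI)
  moreover have "FA F = FA G" using c(2)[OF assms(1)] c(2)[OF assms(2)] assms(4)
    by (auto simp: PiE_def intro: extensionalityI)
  ultimately show ?thesis by simp
qed

lemma functor_mk_ftor: "is_functor C D F \<Longrightarrow> mk_ftor C (FO F) (FA F) = F"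
  using is_functor.FO_closed[of C D F] is_functor.FA_closed[of C D F]
  by (auto simp: mk_ftor_def PiE_def extensional_restrict)

lemma functor_categories: "is_functor C D F \<Longrightarrow> category C" "is_functor C D F \<Longrightarrow> category D"
  by (auto simp: is_functor_def)

lemma functor_fcomp:
  assumes "is_functor C D F" "is_functor D E G"
  shows "is_functor C E (fcomp C G F)"
proof -
  interpret F: is_functor C D F by fact
  interpret G: is_functor D E G by fact
  note c = functor_closed[OF assms(1)] functor_closed[OF assms(2)]
  show ?thesis unfolding fcomp_def
    by (rule mk_functorI)
      (use c in \<open>auto simp: F.FA_Dom F.FA_Cod F.FA_Ident F.FA_Comp G.FA_Dom G.FA_Cod G.FA_Ident G.FA_Comp
        intro: F.C.category_axioms G.D.category_axioms\<close>)
qed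

lemma fcomp_simps [simp]:
  "x \<in> Obj C \<Longrightarrow> FO (fcomp C G F) x = FO G (FO F x)"
  "f \<in> Arr C \<Longrightarrow> FA (fcomp C G F) f = FA G (FA F f)"
  by (simp_all add: fcomp_def)

lemma functor_fid: "category C \<Longrightarrow> is_functor C C (fid C)"
  unfolding fid_def by (rule mk_functorI) auto

lemma fid_simps [simp]: "x \<in> Obj C \<Longrightarrow> FO (fid C) x = x" "f \<in> Arr C \<Longrightarrow> FA (fid C) f = f"
  by (simp_all add: fid_def)

lemma functor_proj:
  assumes "\<And>C. C \<in> set Cs \<Longrightarrow> category C" "i < length Cs"
  shows "is_functor (prod_cat Cs) (Cs ! i) (proj_ftor Cs i)"
  unfolding proj_ftor_def
  by (rule mk_functorI) (use assms in \<open>auto simp: category_prod prod_cat_nth prod_cat_Obj prod_cat_Arr\<close>)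

text \<open>The universal property of the product. Composites and permutations of functors between products are
  recognized as functors by means of their coordinates.\<close>
lemma functor_into_prod:
  assumes "category C" "\<And>D. D \<in> set Ds \<Longrightarrow> category D"
    and "\<And>x. x \<in> Obj C \<Longrightarrow> length (u x) = length Ds" "\<And>f. f \<in> Arr C \<Longrightarrow> length (v f) = length Ds"
    and f: "\<And>i. i < length Ds \<Longrightarrow> is_functor C (Ds ! i) (mk_ftor C (\<lambda>x. u x ! i) (\<lambda>f. v f ! i))"
  shows "is_functor C (prod_cat Ds) (mk_ftor C u v)"
proof -
  note dc = category_dom_cod[OF assms(1)] category_id[OF assms(1)] category.Comp_closed[OF assms(1)]
  have u: "u x \<in> Obj (prod_cat Ds)" if "x \<in> Obj C" for x
    using assms(3) functor_closed(1)[OF f] that by (auto simp: prod_cat_Obj)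
  have v: "v x \<in> Arr (prod_cat Ds)" if "x \<in> Arr C" for x
    using assms(4) functor_closed(2)[OF f] that by (auto simp: prod_cat_Arr)
  have D: "Dom (prod_cat Ds) (v x) = u (Dom C x)" "Cod (prod_cat Ds) (v x) = u (Cod C x)" if "x \<in> Arr C" for x
    using is_functor.FA_Dom[OF f] is_functor.FA_Cod[OF f] that u v dc assms(3)
    by (auto intro!: nth_equalityI simp: prod_cat_lengths prod_cat_nth)
  show ?thesis
  proof (rule mk_functorI)
    show "v (Ident C x) = Ident (prod_cat Ds) (u x)" if "x \<in> Obj C" for x
      using is_functor.FA_Ident[OF f] that u dc assms(4)
      by (auto intro!: nth_equalityI simp: prod_cat_lengths prod_cat_nth)
    show "v (Comp C g h) = Comp (prod_cat Ds) (v g) (v h)"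
      if "g \<in> Arr C" "h \<in> Arr C" "Dom C g = Cod C h" for g h
      using is_functor.FA_Comp[OF f] that v dc assms(4) D
      by (auto intro!: nth_equalityI simp: prod_cat_lengths prod_cat_nth)
  qed (use assms u v D category_prod[of Ds] in auto)
qed

lemma functor_const_base:
  assumes "category C" "based_category D"
  shows "is_functor C D (const_base C D)"
proof -
  have D: "category D" "Base D \<in> Obj D" using assms(2) by (auto simp: based_category_iff)
  note i = category_id[OF D] category.Dom_Ident[OF D] category.Cod_Ident[OF D]
  show ?thesis unfolding const_base_def
    using category.Comp_Ident_left[OF D(1) i(1)] i
    by (intro mk_functorI) (auto intro: assms D)
qed

lemma Term_Cat_simps [simp]: "Obj Term_Cat = {undefined}" "Arr Term_Cat = {undefined}" "Base Term_Cat = undefined"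
  by (simp_all add: Term_Cat_def mk_cat_def)

lemma based_Term_Cat: "based_category Term_Cat"
  by (auto simp: based_category_iff category_def Term_Cat_def mk_cat_def)

text \<open>Compatibility with base points rests on this, since the base object of \<open>Cat_op\<close> is terminal and so are
  products of copies of it.\<close>
lemma functor_into_points_unique:
  assumes "is_functor C D F" "is_functor C D' G" "Obj D = {x}" "Arr D = {f}" "Obj D' = {x}" "Arr D' = {f}"
  shows "F = G"
  using functor_closed[OF assms(1)] functor_closed[OF assms(2)] assms(3-)
  by (intro ftor_eqI[OF assms(1,2)]) auto

lemma prod_Term_Cat:
  "Obj (prod_cat (replicate r Term_Cat)) = {replicate r undefined}"
  "Arr (prod_cat (replicate r Term_Cat)) = {replicate r undefined}"
  by (auto simp: prod_cat_Obj prod_cat_Arr intro!: nth_equalityI)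

lemma smash_functor_iff: "smash_functor Cs E F \<longleftrightarrow>
    is_functor (prod_cat Cs) E F \<and> based_category E \<and> (\<forall>C \<in> set Cs. based_category C) \<and>
    (\<forall>xs i. xs \<in> Obj (prod_cat Cs) \<longrightarrow> i < length Cs \<longrightarrow> xs ! i = Base (Cs ! i) \<longrightarrow> FO F xs = Base E) \<and>
    (\<forall>fs i. fs \<in> Arr (prod_cat Cs) \<longrightarrow> i < length Cs \<longrightarrow> fs ! i = Ident (Cs ! i) (Base (Cs ! i))
      \<longrightarrow> FA F fs = Ident E (Base E))"
  by (auto simp: smash_functor_def smash_functor_axioms_def)

lemma smash_functor_functor: "smash_functor Cs E F \<Longrightarrow> is_functor (prod_cat Cs) E F"
  by (simp add: smash_functor_iff)

section \<open>The terminal multicategory\<close>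

lemma multicategory_Term_Mult: "multicategory Term_Mult"
proof -
  have len: "length fs = g" if "map (\<lambda>_. ()) fs = replicate g ()" for fs :: "nat list" and g
    using arg_cong[OF that, of length] by simp
  have perm: "permute_list \<sigma> (replicate n x) = replicate n x" if "\<sigma> permutes {..<n}" for \<sigma> n and x :: unit
    by (rule nth_equalityI) auto
  have conc: "concat (map (\<lambda>r. replicate r ()) fs) = replicate (sum_list fs) ()" for fs
    by (induction fs) (auto simp: replicate_add)
  have assoc: "sum_list (concat hss) = sum_list (map2 (\<lambda>_. sum_list) fs hss)"
    if "length hss = length fs" for fs :: "nat list" and hss :: "nat list list"
    using that by (induction hss fs rule: list_induct2) auto
  have perm_sum: "sum_list (permute_list \<sigma> fs) = sum_list fs"
    if "\<sigma> permutes {..<length fs}" for \<sigma> and fs :: "nat list"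
    using that by (metis mset_permute_list sum_mset_sum_list)
  have inner: "map2 (\<lambda>_ r. r) \<tau>s fs = fs" if "length \<tau>s = length fs"
    for \<tau>s :: "(nat \<Rightarrow> nat) list" and fs :: "nat list"
    using that by (intro nth_equalityI) auto
  show ?thesis
    by (unfold_locales)
      (auto simp: Term_Mult_def perm conc assoc[symmetric] sum_list_replicate perm_sum inner
        dest!: list_all2_lengthD map_eq_imp_length_eq)
qed

section \<open>The multicategory of finite sets\<close>

lemma N_Mult_simps [simp]:
  "MObj N_Mult = UNIV" "Src N_Mult = src" "Tgt N_Mult = tgt"
  by (simp_all add: N_Mult_def)

lemma N_Mult_mor: "f \<in> MMor N_Mult \<longleftrightarrow> dat f \<in> {1..tgt f} \<rightarrow>\<^sub>E coprod (src f)"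
  by (simp add: N_Mult_def)

lemma N_Mult_morE:
  assumes "f \<in> MMor N_Mult" "x \<in> {1..tgt f}"
  obtains i y where "dat f x = (i, y)" "i < length (src f)" "y \<in> {1..src f ! i}"
proof -
  have "dat f x \<in> coprod (src f)" using assms unfolding N_Mult_mor by blast
  then show ?thesis using that by (cases "dat f x") (auto simp: coprod_def)
qed

lemma N_Mult_eqI:
  assumes "f \<in> MMor N_Mult" "g \<in> MMor N_Mult" "src f = src g" "tgt f = tgt g"
    and "\<And>x. x \<in> {1..tgt f} \<Longrightarrow> dat f x = dat g x"
  shows "f = g"
proof -
  have "dat f = dat g" using assms unfolding N_Mult_mor
    by (auto simp: PiE_def intro: extensionalityI)
  then show ?thesis using assms by simp
qed

lemma N_Mult_unit:
  "src (MUnit N_Mult n) = [n]" "tgt (MUnit N_Mult n) = n"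
  "x \<in> {1..n} \<Longrightarrow> dat (MUnit N_Mult n) x = (0, x)" "MUnit N_Mult n \<in> MMor N_Mult"
  by (simp_all add: N_Mult_def coprod_def)

lemma N_Mult_comp_simps:
  "src (MComp N_Mult g fs) = concat (map src fs)" "tgt (MComp N_Mult g fs) = tgt g"
  "\<lbrakk>x \<in> {1..tgt g}; dat g x = (i, y); dat (fs ! i) y = (j, z)\<rbrakk>
    \<Longrightarrow> dat (MComp N_Mult g fs) x = (sum_list (map length (take i (map src fs))) + j, z)"
  by (auto simp: N_Mult_def take_map comp_def)

lemma N_Mult_comp_closed:
  assumes g: "g \<in> MMor N_Mult" and fs: "set fs \<subseteq> MMor N_Mult" and t: "map tgt fs = src g"
  shows "MComp N_Mult g fs \<in> MMor N_Mult"
proof -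
  have len: "length fs = length (src g)" using t by (metis length_map)
  have "dat (MComp N_Mult g fs) x \<in> coprod (concat (map src fs))" if x: "x \<in> {1..tgt g}" for x
  proof -
    obtain i y where iy: "dat g x = (i, y)" "i < length (src g)" "y \<in> {1..src g ! i}"
      using N_Mult_morE[OF g x] .
    have f: "fs ! i \<in> MMor N_Mult" using fs iy len by auto
    have il: "i < length fs" using iy len by simp
    then have "src g ! i = tgt (fs ! i)" by (simp flip: t)
    then have y: "y \<in> {1..tgt (fs ! i)}" using iy by simp
    obtain j z where jz: "dat (fs ! i) y = (j, z)" "j < length (src (fs ! i))" "z \<in> {1..src (fs ! i) ! j}"
      using N_Mult_morE[OF f y] .
    have i: "i < length (map src fs)" "j < length (map src fs ! i)" using iy jz len by simp_all
    have "(sum_list (map length (take i (map src fs))) + j, z) \<in> coprod (concat (map src fs))"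
      using offset_less[OF i] nth_concat_offset[OF i] i jz by (simp add: coprod_def del: length_concat)
    then show ?thesis by (simp only: N_Mult_comp_simps(3)[OF x iy(1) jz(1)])
  qed
  moreover have "dat (MComp N_Mult g fs) \<in> extensional {1..tgt g}"
    by (simp add: N_Mult_def)
  ultimately show ?thesis unfolding N_Mult_mor N_Mult_comp_simps by (auto simp: PiE_def)
qed

lemma N_Mult_act_simps:
  "src (Act N_Mult \<sigma> f) = permute_list \<sigma> (src f)" "tgt (Act N_Mult \<sigma> f) = tgt f"
  "\<lbrakk>x \<in> {1..tgt f}; dat f x = (i, y)\<rbrakk> \<Longrightarrow> dat (Act N_Mult \<sigma> f) x = (inv \<sigma> i, y)"
  by (auto simp: N_Mult_def)

lemma inv_less:
  assumes "\<sigma> permutes {..<n}" "i < n" shows "inv \<sigma> i < n"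
  using permutes_in_image[OF permutes_inv[OF assms(1)]] assms(2) by blast

lemma perm_less:
  assumes "\<sigma> permutes {..<n}" "i < n" shows "\<sigma> i < n"
  using permutes_in_image[OF assms(1)] assms(2) by blast

lemma N_Mult_act_closed:
  assumes f: "f \<in> MMor N_Mult" and s: "\<sigma> permutes {..<length (src f)}"
  shows "Act N_Mult \<sigma> f \<in> MMor N_Mult"
proof -
  have "dat (Act N_Mult \<sigma> f) x \<in> coprod (permute_list \<sigma> (src f))" if x: "x \<in> {1..tgt f}" for x
  proof -
    obtain i y where iy: "dat f x = (i, y)" "i < length (src f)" "y \<in> {1..src f ! i}"
      using N_Mult_morE[OF f x] .
    show ?thesis using iy inv_less[OF s iy(2)] s
      by (auto simp: N_Mult_act_simps(3)[OF x iy(1)] coprod_def permute_list_nth permutes_inverses)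
  qed
  moreover have "dat (Act N_Mult \<sigma> f) \<in> extensional {1..tgt f}"
    by (simp add: N_Mult_def)
  ultimately show ?thesis unfolding N_Mult_mor N_Mult_act_simps by (auto simp: PiE_def)
qed

lemma concat_map_concat: "concat (map f (concat xss)) = concat (map (\<lambda>xs. concat (map f xs)) xss)"
  by (induction xss) auto

lemma sum_list_length_concat:
  "sum_list (map length (concat xsss)) = sum_list (map length (map concat xsss))"
  by (induction xsss) (auto simp: length_concat)

text \<open>Following an element through the three functions, both sides find it in the same summand, since
  the offset of a block of blocks is the sum of the offsets at the two levels.\<close>
lemma N_Mult_assoc:
  assumes g: "g \<in> MMor N_Mult" and fs: "set fs \<subseteq> MMor N_Mult" and t: "map tgt fs = src g"
    and hss: "\<And>hs. hs \<in> set hss \<Longrightarrow> set hs \<subseteq> MMor N_Mult" and th: "map (map tgt) hss = map src fs"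
  shows "MComp N_Mult (MComp N_Mult g fs) (concat hss) = MComp N_Mult g (map2 (MComp N_Mult) fs hss)"
    (is "?L = ?R")
proof (rule N_Mult_eqI)
  have len: "length fs = length (src g)" using t by (metis length_map)
  have lh: "length hss = length fs" using th by (metis length_map)
  have thn: "map tgt (hss ! i) = src (fs ! i)" if "i < length fs" for i
    using that lh th by (metis nth_map)
  have set2: "set (map2 (MComp N_Mult) fs hss) \<subseteq> MMor N_Mult"
  proof -
    have "fs ! i \<in> MMor N_Mult" "set (hss ! i) \<subseteq> MMor N_Mult" if "i < length fs" for i
      using that fs hss[of "hss ! i"] lh by auto
    then show ?thesis using thn lh by (auto simp: set_zip intro!: N_Mult_comp_closed)
  qed
  have t2: "map tgt (map2 (MComp N_Mult) fs hss) = src g"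
    using t lh by (auto intro!: nth_equalityI simp: N_Mult_comp_simps list_eq_iff_nth_eq)
  have src2: "map src (map2 (MComp N_Mult) fs hss) = map (\<lambda>hs. concat (map src hs)) hss"
    using lh by (auto intro!: nth_equalityI simp: N_Mult_comp_simps)
  have tc: "map tgt (concat hss) = concat (map src fs)" by (simp add: map_concat th)
  show "?L \<in> MMor N_Mult"
    using hss tc by (intro N_Mult_comp_closed g fs t) (auto simp: N_Mult_comp_simps)
  show "?R \<in> MMor N_Mult" by (intro N_Mult_comp_closed g set2 t2)
  show "src ?L = src ?R" by (simp only: N_Mult_comp_simps src2 concat_map_concat)
  show "tgt ?L = tgt ?R" by (simp add: N_Mult_comp_simps)
  fix x assume "x \<in> {1..tgt ?L}"
  then have x: "x \<in> {1..tgt g}" by (simp add: N_Mult_comp_simps)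
  obtain i y where iy: "dat g x = (i, y)" "i < length (src g)" "y \<in> {1..src g ! i}"
    using N_Mult_morE[OF g x] .
  have i: "i < length fs" "i < length hss" using iy len lh by auto
  have f: "fs ! i \<in> MMor N_Mult" using fs i by auto
  have tf: "src g ! i = tgt (fs ! i)" using i by (simp flip: t)
  with iy have y: "y \<in> {1..tgt (fs ! i)}" by simp
  obtain j z where jz: "dat (fs ! i) y = (j, z)" "j < length (src (fs ! i))" "z \<in> {1..src (fs ! i) ! j}"
    using N_Mult_morE[OF f y] .
  have j: "j < length (hss ! i)" using jz thn[OF i(1)] by (metis length_map)
  have th': "src (fs ! i) ! j = tgt (hss ! i ! j)" using j by (simp flip: thn[OF i(1)])
  have h: "hss ! i ! j \<in> MMor N_Mult" using hss[of "hss ! i"] i j by auto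
  have z: "z \<in> {1..tgt (hss ! i ! j)}" using jz th' by simp
  obtain k w where kw: "dat (hss ! i ! j) z = (k, w)"
    using N_Mult_morE[OF h z] .
  have off: "sum_list (map length (take i (map src fs))) = sum_list (map length (take i hss))"
    unfolding th[symmetric] by (simp add: take_map comp_def)
  have L1: "dat (MComp N_Mult g fs) x = (sum_list (map length (take i hss)) + j, z)"
    using N_Mult_comp_simps(3)[OF x iy(1) jz(1)] off by simp
  have "dat ?L x = (sum_list (map length (take (sum_list (map length (take i hss)) + j) (map src (concat hss)))) + k, w)"
    using x kw nth_concat_offset[OF i(2) j] by (intro N_Mult_comp_simps(3)[OF _ L1]) (auto simp: N_Mult_comp_simps)
  also have "take (sum_list (map length (take i hss)) + j) (map src (concat hss))
      = concat (take i (map (map src) hss)) @ take j (map src (hss ! i))"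
    unfolding take_map unfolding take_concat_offset[OF i(2) less_imp_le[OF j]]
    by (simp only: map_append map_concat)
  also have "sum_list (map length \<dots>) = sum_list (map length (take i (map (\<lambda>hs. concat (map src hs)) hss)))
      + sum_list (map length (take j (map src (hss ! i))))"
    by (simp only: map_append sum_list_append take_map sum_list_length_concat
      map_map comp_def)
  finally have L: "dat ?L x = (sum_list (map length (take i (map (\<lambda>hs. concat (map src hs)) hss)))
      + sum_list (map length (take j (map src (hss ! i)))) + k, w)" .
  have "dat (map2 (MComp N_Mult) fs hss ! i) y = (sum_list (map length (take j (map src (hss ! i)))) + k, w)"
    using i N_Mult_comp_simps(3)[OF y jz(1) kw] by simp
  from N_Mult_comp_simps(3)[OF x iy(1) this] show "dat ?L x = dat ?R x"
    unfolding L src2 by simp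
qed

text \<open>The action is by inverse permutations on the indices of summands, so the claim is
  \<open>block_perm_offset\<close> read from right to left.\<close>
lemma N_Mult_outer:
  assumes g: "g \<in> MMor N_Mult" and fs: "set fs \<subseteq> MMor N_Mult" and t: "map tgt fs = src g"
    and s: "\<sigma> permutes {..<length fs}"
  shows "MComp N_Mult (Act N_Mult \<sigma> g) (permute_list \<sigma> fs)
    = Act N_Mult (block_perm \<sigma> (map (\<lambda>f. length (src f)) fs)) (MComp N_Mult g fs)"
    (is "?L = Act _ ?\<beta> ?C")
proof (rule N_Mult_eqI)
  let ?rs = "map (\<lambda>f. length (src f)) fs"
  have len: "length fs = length (src g)" using t by (metis length_map)
  have sr: "\<sigma> permutes {..<length ?rs}" "\<sigma> permutes {..<length (src g)}" using s len by simp_all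
  have C: "?C \<in> MMor N_Mult" by (intro N_Mult_comp_closed g fs t)
  have bp: "?\<beta> permutes {..<length (src ?C)}"
    using block_perm_permutes[OF sr(1)] by (simp add: N_Mult_comp_simps length_concat comp_def)
  have pm: "map f (permute_list \<sigma> fs) = permute_list \<sigma> (map f fs)" for f :: "nmor \<Rightarrow> 'c"
    using s by (rule map_permute_list)
  show "?L \<in> MMor N_Mult"
    using fs t s pm[of tgt] by (intro N_Mult_comp_closed N_Mult_act_closed g) (auto simp: N_Mult_act_simps sr)
  show "Act N_Mult ?\<beta> ?C \<in> MMor N_Mult" by (intro N_Mult_act_closed C bp)
  show "src ?L = src (Act N_Mult ?\<beta> ?C)"
    using permute_list_block_perm[OF sr(1), of "map src fs"]
    by (simp add: N_Mult_act_simps N_Mult_comp_simps pm comp_def)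
  show "tgt ?L = tgt (Act N_Mult ?\<beta> ?C)" by (simp add: N_Mult_act_simps N_Mult_comp_simps)
  fix x assume "x \<in> {1..tgt ?L}"
  then have x: "x \<in> {1..tgt g}" by (simp add: N_Mult_comp_simps N_Mult_act_simps)
  obtain i y where iy: "dat g x = (i, y)" "i < length (src g)" "y \<in> {1..src g ! i}"
    using N_Mult_morE[OF g x] .
  have i: "i < length fs" using iy len by auto
  have f: "fs ! i \<in> MMor N_Mult" using fs i by auto
  have tf: "src g ! i = tgt (fs ! i)" using i by (simp flip: t)
  with iy have y: "y \<in> {1..tgt (fs ! i)}" by simp
  obtain j z where jz: "dat (fs ! i) y = (j, z)" "j < length (src (fs ! i))"
    using N_Mult_morE[OF f y] .
  let ?i = "inv \<sigma> i"
  have si: "\<sigma> ?i = i" using permutes_inverses(1)[OF s] .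
  have il: "?i < length fs" using inv_less[OF s i] .
  have "dat (Act N_Mult \<sigma> g) x = (?i, y)" using N_Mult_act_simps(3)[OF x iy(1)] .
  moreover have "dat (permute_list \<sigma> fs ! ?i) y = (j, z)" using il s si jz by (simp add: permute_list_nth)
  moreover have "x \<in> {1..tgt (Act N_Mult \<sigma> g)}" using x by (simp add: N_Mult_act_simps)
  ultimately have "dat ?L x = (sum_list (map length (take ?i (map src (permute_list \<sigma> fs)))) + j, z)"
    by (intro N_Mult_comp_simps(3))
  also have "sum_list (map length (take ?i (map src (permute_list \<sigma> fs)))) = sum_list (take ?i (permute_list \<sigma> ?rs))"
    by (simp add: take_map[symmetric] pm[symmetric] comp_def)
  finally have L: "dat ?L x = (sum_list (take ?i (permute_list \<sigma> ?rs)) + j, z)" .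
  have "?\<beta> (sum_list (take ?i (permute_list \<sigma> ?rs)) + j) = sum_list (take i ?rs) + j"
    using block_perm_offset[OF sr(1), of ?i j] il i jz by (simp add: si)
  then have "inv ?\<beta> (sum_list (take i ?rs) + j) = sum_list (take ?i (permute_list \<sigma> ?rs)) + j"
    using permutes_inverses(2)[OF bp] by metis
  moreover have "dat ?C x = (sum_list (take i ?rs) + j, z)"
    using N_Mult_comp_simps(3)[OF x iy(1) jz(1)] by (simp add: take_map comp_def)
  moreover have "x \<in> {1..tgt ?C}" using x by (simp add: N_Mult_comp_simps)
  ultimately show "dat ?L x = dat (Act N_Mult ?\<beta> ?C) x"
    using N_Mult_act_simps(3)[of x ?C _ z ?\<beta>] L by simp
qed

lemma N_Mult_inner:
  assumes g: "g \<in> MMor N_Mult" and fs: "set fs \<subseteq> MMor N_Mult" and t: "map tgt fs = src g"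
    and s: "list_all2 (\<lambda>\<tau> f. \<tau> permutes {..<length (src f)}) \<tau>s fs"
  shows "MComp N_Mult g (map2 (Act N_Mult) \<tau>s fs)
    = Act N_Mult (sum_perm \<tau>s (map (\<lambda>f. length (src f)) fs)) (MComp N_Mult g fs)"
    (is "?L = Act _ ?\<beta> ?C")
proof (rule N_Mult_eqI)
  let ?rs = "map (\<lambda>f. length (src f)) fs"
  have len: "length fs = length (src g)" using t by (metis length_map)
  have lt: "length \<tau>s = length fs" using s by (rule list_all2_lengthD)
  have sr: "list_all2 (\<lambda>\<tau> n. \<tau> permutes {..<n}) \<tau>s ?rs" using s by (simp add: list_all2_map2)
  have sn: "\<tau>s ! i permutes {..<length (src (fs ! i))}" if "i < length fs" for i
    using s that lt by (simp add: list_all2_conv_all_nth)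
  have C: "?C \<in> MMor N_Mult" by (intro N_Mult_comp_closed g fs t)
  have bp: "?\<beta> permutes {..<length (src ?C)}"
    using sum_perm_permutes[OF sr] by (simp add: N_Mult_comp_simps length_concat comp_def)
  have srcA: "map src (map2 (Act N_Mult) \<tau>s fs) = map2 permute_list \<tau>s (map src fs)"
    using lt by (auto intro!: nth_equalityI simp: N_Mult_act_simps)
  have lens: "map length (map src (map2 (Act N_Mult) \<tau>s fs)) = ?rs"
    using lt by (auto intro!: nth_equalityI simp: N_Mult_act_simps)
  show "?L \<in> MMor N_Mult"
  proof (intro N_Mult_comp_closed g)
    show "set (map2 (Act N_Mult) \<tau>s fs) \<subseteq> MMor N_Mult"
      using fs sn lt by (auto simp: set_zip intro!: N_Mult_act_closed)
    show "map tgt (map2 (Act N_Mult) \<tau>s fs) = src g"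
      using t lt by (auto intro!: nth_equalityI simp: N_Mult_act_simps list_eq_iff_nth_eq)
  qed
  show "Act N_Mult ?\<beta> ?C \<in> MMor N_Mult" by (intro N_Mult_act_closed C bp)
  show "src ?L = src (Act N_Mult ?\<beta> ?C)"
    using permute_list_sum_perm[OF sr, of "map src fs"] srcA
    by (simp add: N_Mult_act_simps N_Mult_comp_simps comp_def)
  show "tgt ?L = tgt (Act N_Mult ?\<beta> ?C)" by (simp add: N_Mult_act_simps N_Mult_comp_simps)
  fix x assume "x \<in> {1..tgt ?L}"
  then have x: "x \<in> {1..tgt g}" by (simp add: N_Mult_comp_simps N_Mult_act_simps)
  obtain i y where iy: "dat g x = (i, y)" "i < length (src g)" "y \<in> {1..src g ! i}"
    using N_Mult_morE[OF g x] .
  have i: "i < length fs" using iy len by auto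
  have f: "fs ! i \<in> MMor N_Mult" using fs i by auto
  have tf: "src g ! i = tgt (fs ! i)" using i by (simp flip: t)
  with iy have y: "y \<in> {1..tgt (fs ! i)}" by simp
  obtain j z where jz: "dat (fs ! i) y = (j, z)" "j < length (src (fs ! i))"
    using N_Mult_morE[OF f y] .
  let ?j = "inv (\<tau>s ! i) j"
  have sj: "(\<tau>s ! i) ?j = j" using permutes_inverses(1)[OF sn[OF i]] .
  have jl: "?j < length (src (fs ! i))" using inv_less[OF sn[OF i] jz(2)] .
  have "dat (map2 (Act N_Mult) \<tau>s fs ! i) y = (?j, z)"
    using N_Mult_act_simps(3)[OF y jz(1)] i lt by simp
  from N_Mult_comp_simps(3)[OF x iy(1) this]
  have L: "dat ?L x = (sum_list (take i ?rs) + ?j, z)"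
    by (simp only: take_map[symmetric] lens)
  have "?\<beta> (sum_list (take i ?rs) + ?j) = sum_list (take i ?rs) + j"
    using sum_perm_offset[OF sr, of i ?j] i jl by (simp add: sj)
  then have "inv ?\<beta> (sum_list (take i ?rs) + j) = sum_list (take i ?rs) + ?j"
    using permutes_inverses(2)[OF bp] by metis
  moreover have "dat ?C x = (sum_list (take i ?rs) + j, z)"
    using N_Mult_comp_simps(3)[OF x iy(1) jz(1)] by (simp add: take_map comp_def)
  moreover have "x \<in> {1..tgt ?C}" using x by (simp add: N_Mult_comp_simps)
  ultimately show "dat ?L x = dat (Act N_Mult ?\<beta> ?C) x"
    using N_Mult_act_simps(3)[of x ?C _ z ?\<beta>] L by simp
qed

lemma multicategory_N_Mult: "multicategory N_Mult"
proof
  fix f assume f: "f \<in> MMor N_Mult"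
  show "MComp N_Mult (MUnit N_Mult (Tgt N_Mult f)) [f] = f"
  proof (rule N_Mult_eqI[OF _ f])
    show "MComp N_Mult (MUnit N_Mult (Tgt N_Mult f)) [f] \<in> MMor N_Mult"
      using f by (intro N_Mult_comp_closed) (simp_all add: N_Mult_unit)
    fix x assume "x \<in> {1..tgt (MComp N_Mult (MUnit N_Mult (Tgt N_Mult f)) [f])}"
    then have x: "x \<in> {1..tgt f}" by (simp add: N_Mult_comp_simps N_Mult_unit)
    obtain i y where "dat f x = (i, y)" using N_Mult_morE[OF f x] .
    with N_Mult_comp_simps(3)[of x "MUnit N_Mult (tgt f)" 0 x "[f]" i y] x
    show "dat (MComp N_Mult (MUnit N_Mult (Tgt N_Mult f)) [f]) x = dat f x"
      by (simp add: N_Mult_unit)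
  qed (simp_all add: N_Mult_comp_simps N_Mult_unit)
  let ?us = "map (MUnit N_Mult) (src f)"
  have src: "map src ?us = map (\<lambda>n. [n]) (src f)" by (simp add: N_Mult_unit)
  have src': "concat (map src ?us) = src f" unfolding src by (induction "src f") simp_all
  show "MComp N_Mult f (map (MUnit N_Mult) (Src N_Mult f)) = f" unfolding N_Mult_simps
  proof (rule N_Mult_eqI[OF _ f])
    show "MComp N_Mult f ?us \<in> MMor N_Mult"
      using f by (intro N_Mult_comp_closed) (auto simp: N_Mult_unit comp_def)
    show "src (MComp N_Mult f ?us) = src f" using src' by (simp add: N_Mult_comp_simps)
    fix x assume "x \<in> {1..tgt (MComp N_Mult f ?us)}"
    then have x: "x \<in> {1..tgt f}" by (simp add: N_Mult_comp_simps N_Mult_unit)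
    obtain i y where iy: "dat f x = (i, y)" "i < length (src f)" "y \<in> {1..src f ! i}"
      using N_Mult_morE[OF f x] .
    have "dat (?us ! i) y = (0, y)" using iy by (simp add: N_Mult_unit)
    from N_Mult_comp_simps(3)[OF x iy(1) this] show "dat (MComp N_Mult f ?us) x = dat f x"
      using iy unfolding src by (simp add: take_map comp_def sum_list_triv)
  qed (simp add: N_Mult_comp_simps)
  show "Act N_Mult id f = f"
  proof (rule N_Mult_eqI[OF N_Mult_act_closed f])
    fix x assume "x \<in> {1..tgt (Act N_Mult id f)}"
    then have x: "x \<in> {1..tgt f}" by (simp add: N_Mult_act_simps)
    obtain i y where iy: "dat f x = (i, y)" using N_Mult_morE[OF f x] .
    show "dat (Act N_Mult id f) x = dat f x" using N_Mult_act_simps(3)[OF x iy, of id] iy by simp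
  qed (simp_all add: f permutes_id N_Mult_act_simps)
  fix \<sigma> \<tau> assume s: "\<sigma> permutes {..<length (Src N_Mult f)}" and t: "\<tau> permutes {..<length (Src N_Mult f)}"
  show "Act N_Mult \<tau> (Act N_Mult \<sigma> f) = Act N_Mult (\<sigma> \<circ> \<tau>) f"
  proof (rule N_Mult_eqI)
    fix x assume "x \<in> {1..tgt (Act N_Mult \<tau> (Act N_Mult \<sigma> f))}"
    then have x: "x \<in> {1..tgt f}" by (simp add: N_Mult_act_simps)
    obtain i y where iy: "dat f x = (i, y)" using N_Mult_morE[OF f x] .
    note 1 = N_Mult_act_simps(3)[OF x iy]
    show "dat (Act N_Mult \<tau> (Act N_Mult \<sigma> f)) x = dat (Act N_Mult (\<sigma> \<circ> \<tau>) f) x"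
      using 1[of "\<sigma> \<circ> \<tau>"] N_Mult_act_simps(3)[of x "Act N_Mult \<sigma> f" _ y \<tau>, OF _ 1[of \<sigma>]] x s t
      by (simp add: N_Mult_act_simps o_inv_distrib permutes_bij)
  qed (use f s t in \<open>auto simp: N_Mult_act_simps permute_list_compose intro!: N_Mult_act_closed permutes_compose\<close>)
qed (auto simp: N_Mult_comp_simps N_Mult_act_simps N_Mult_unit N_Mult_comp_closed N_Mult_act_closed
      in_lists_conv_set subset_iff intro!: N_Mult_assoc N_Mult_outer N_Mult_inner)

section \<open>The opposite multicategory of based categories\<close>

lemma Cat_op_simps [simp]:
  "MObj Cat_op = {C. based_category C}" "Src Cat_op = src" "Tgt Cat_op = tgt"
  by (simp_all add: Cat_op_def)

lemma Cat_op_mor: "f \<in> MMor Cat_op \<longleftrightarrow>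
    (\<forall>D \<in> set (src f). based_category D) \<and> based_functor (tgt f) (prod_cat (src f)) (dat f)"
  by (simp add: Cat_op_def)

lemma Cat_op_mor_functor: "f \<in> MMor Cat_op \<Longrightarrow> is_functor (tgt f) (prod_cat (src f)) (dat f)"
  by (simp add: Cat_op_mor based_functor_iff)

lemma Cat_op_mor_based:
  "f \<in> MMor Cat_op \<Longrightarrow> based_category (tgt f)" "f \<in> MMor Cat_op \<Longrightarrow> i < length (src f) \<Longrightarrow> based_category (src f ! i)"
  by (simp_all add: Cat_op_mor based_functor_iff)

lemma Cat_op_mor_values:
  assumes "f \<in> MMor Cat_op"
  shows "x \<in> Obj (tgt f) \<Longrightarrow> length (FO (dat f) x) = length (src f)"
    and "u \<in> Arr (tgt f) \<Longrightarrow> length (FA (dat f) u) = length (src f)"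
    and "\<lbrakk>x \<in> Obj (tgt f); i < length (src f)\<rbrakk> \<Longrightarrow> FO (dat f) x ! i \<in> Obj (src f ! i)"
    and "\<lbrakk>u \<in> Arr (tgt f); i < length (src f)\<rbrakk> \<Longrightarrow> FA (dat f) u ! i \<in> Arr (src f ! i)"
  using functor_closed[OF Cat_op_mor_functor[OF assms]] by (auto simp: prod_cat_Obj prod_cat_Arr)

lemma functor_coord:
  assumes "f \<in> MMor Cat_op" "l < length (src f)"
  shows "is_functor (tgt f) (src f ! l) (coord f l)"
proof -
  have "is_functor (prod_cat (src f)) (src f ! l) (proj_ftor (src f) l)"
    using assms by (intro functor_proj) (auto simp: Cat_op_mor based_category_iff)
  then show ?thesis unfolding coord_def by (rule functor_fcomp[OF Cat_op_mor_functor[OF assms(1)]])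
qed

lemma coord_simps:
  assumes "f \<in> MMor Cat_op" "l < length (src f)"
  shows "x \<in> Obj (tgt f) \<Longrightarrow> FO (coord f l) x = FO (dat f) x ! l"
    and "u \<in> Arr (tgt f) \<Longrightarrow> FA (coord f l) u = FA (dat f) u ! l"
  using functor_closed[OF Cat_op_mor_functor[OF assms(1)]] by (simp_all add: coord_def proj_ftor_def)

lemma Cat_op_eqI:
  assumes "f \<in> MMor Cat_op" "g \<in> MMor Cat_op" "src f = src g" "tgt f = tgt g"
    and "\<And>x. x \<in> Obj (tgt f) \<Longrightarrow> FO (dat f) x = FO (dat g) x"
    and "\<And>u. u \<in> Arr (tgt f) \<Longrightarrow> FA (dat f) u = FA (dat g) u"
  shows "f = g"
proof -
  have "dat f = dat g"
    using Cat_op_mor_functor[OF assms(1)] Cat_op_mor_functor[OF assms(2)] assms(3-)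
    by (auto intro: ftor_eqI)
  then show ?thesis using assms(3,4) by simp
qed

text \<open>Since the functor takes values in a product, it can be described and checked on coordinates.\<close>
lemma Cat_op_morI:
  assumes "based_category (tgt f)" "\<And>D. D \<in> set (src f) \<Longrightarrow> based_category D"
    and "dat f = mk_ftor (tgt f) u v"
    and "\<And>x. x \<in> Obj (tgt f) \<Longrightarrow> length (u x) = length (src f)"
    and "\<And>x. x \<in> Arr (tgt f) \<Longrightarrow> length (v x) = length (src f)"
    and F: "\<And>l. l < length (src f) \<Longrightarrow> \<exists>F. is_functor (tgt f) (src f ! l) F \<and> FO F (Base (tgt f)) = Base (src f ! l) \<and>
      (\<forall>x \<in> Obj (tgt f). u x ! l = FO F x) \<and> (\<forall>x \<in> Arr (tgt f). v x ! l = FA F x)"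
  shows "f \<in> MMor Cat_op"
proof -
  have b: "Base (tgt f) \<in> Obj (tgt f)" using assms(1) by (simp add: based_category_iff)
  have c: "is_functor (tgt f) (src f ! l) (mk_ftor (tgt f) (\<lambda>x. u x ! l) (\<lambda>x. v x ! l)) \<and> u (Base (tgt f)) ! l = Base (src f ! l)"
    if l: "l < length (src f)" for l
  proof -
    obtain F where F: "is_functor (tgt f) (src f ! l) F" "FO F (Base (tgt f)) = Base (src f ! l)"
      "\<forall>x \<in> Obj (tgt f). u x ! l = FO F x" "\<forall>x \<in> Arr (tgt f). v x ! l = FA F x" using F[OF l] by blast
    have "mk_ftor (tgt f) (\<lambda>x. u x ! l) (\<lambda>x. v x ! l) = mk_ftor (tgt f) (FO F) (FA F)"
      by (rule mk_ftor_cong) (simp_all add: F(3,4))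
    also have "\<dots> = F" by (rule functor_mk_ftor[OF F(1)])
    finally show ?thesis using F b by simp
  qed
  have "is_functor (tgt f) (prod_cat (src f)) (mk_ftor (tgt f) u v)"
    by (rule functor_into_prod) (use assms(1,2,4,5) c in \<open>auto simp: based_category_iff\<close>)
  moreover have "u (Base (tgt f)) = map Base (src f)"
    using assms(4) c b by (intro nth_equalityI) simp_all
  ultimately show ?thesis using assms(1-3) b based_category_prod[of "src f"]
    by (simp add: Cat_op_mor based_functor_iff prod_cat_sets(3))
qed

lemma coord_base:
  assumes "f \<in> MMor Cat_op" "l < length (src f)"
  shows "FO (coord f l) (Base (tgt f)) = Base (src f ! l)"
proof -
  have "Base (tgt f) \<in> Obj (tgt f)" "FO (dat f) (Base (tgt f)) = map Base (src f)"
    using assms(1) by (auto simp: Cat_op_mor based_functor_iff based_category_iff prod_cat_sets(3))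
  then show ?thesis using assms by (simp add: coord_simps)
qed

lemma Cat_op_unit:
  "src (MUnit Cat_op C) = [C]" "tgt (MUnit Cat_op C) = C" "dat (MUnit Cat_op C) = mk_ftor C (\<lambda>x. [x]) (\<lambda>u. [u])"
  by (simp_all add: Cat_op_def)

lemma Cat_op_unit_closed: "based_category C \<Longrightarrow> MUnit Cat_op C \<in> MMor Cat_op"
  by (rule Cat_op_morI)
    (auto simp: Cat_op_unit based_category_iff intro!: exI[of _ "fid C"] functor_fid)

lemma Cat_op_comp:
  "src (MComp Cat_op g fs) = concat (map src fs)" "tgt (MComp Cat_op g fs) = tgt g"
  "dat (MComp Cat_op g fs) = mk_ftor (tgt g)
         (\<lambda>x. concat (map2 (\<lambda>f y. FO (dat f) y) fs (FO (dat g) x)))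
         (\<lambda>u. concat (map2 (\<lambda>f v. FA (dat f) v) fs (FA (dat g) u)))"
  by (simp_all add: Cat_op_def)

text \<open>The value of a composite is a concatenation whose blocks have the lengths of the sources of the
  inner morphisms, so the offsets of the value and of the source agree.\<close>
lemma Cat_op_blocks:
  assumes g: "g \<in> MMor Cat_op" and fs: "set fs \<subseteq> MMor Cat_op" and t: "map tgt fs = src g"
  shows "x \<in> Obj (tgt g) \<Longrightarrow> map length (map2 (\<lambda>f y. FO (dat f) y) fs (FO (dat g) x)) = map length (map src fs)"
    and "u \<in> Arr (tgt g) \<Longrightarrow> map length (map2 (\<lambda>f y. FA (dat f) y) fs (FA (dat g) u)) = map length (map src fs)"
proof -
  have len: "length fs = length (src g)" using t by (metis length_map)
  have f: "fs ! i \<in> MMor Cat_op" "tgt (fs ! i) = src g ! i" if "i < length fs" for i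
    using fs that t by (auto simp flip: t)
  show "map length (map2 (\<lambda>f y. FO (dat f) y) fs (FO (dat g) x)) = map length (map src fs)" if "x \<in> Obj (tgt g)"
    using Cat_op_mor_values[OF g] Cat_op_mor_values[OF f(1)] that len f(2)
    by (intro nth_equalityI) simp_all
  show "map length (map2 (\<lambda>f y. FA (dat f) y) fs (FA (dat g) u)) = map length (map src fs)" if "u \<in> Arr (tgt g)"
    using Cat_op_mor_values[OF g] Cat_op_mor_values[OF f(1)] that len f(2)
    by (intro nth_equalityI) simp_all
qed

text \<open>The coordinates of a composite are composites of coordinates. The second part is the form in which
  composition in \<open>Cat_op\<close> is used later.\<close>
lemma Cat_op_comp_closed:
  assumes g: "g \<in> MMor Cat_op" and fs: "set fs \<subseteq> MMor Cat_op" and t: "map tgt fs = src g"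
  shows "MComp Cat_op g fs \<in> MMor Cat_op"
    and "\<lbrakk>i < length fs; j < length (src (fs ! i))\<rbrakk> \<Longrightarrow>
      coord (MComp Cat_op g fs) (sum_list (map length (take i (map src fs))) + j)
        = fcomp (tgt g) (coord (fs ! i) j) (coord g i)"
proof -
  let ?C = "MComp Cat_op g fs"
  have len: "length fs = length (src g)" using t by (metis length_map)
  have f: "fs ! i \<in> MMor Cat_op" "tgt (fs ! i) = src g ! i" if "i < length fs" for i
    using fs that by (auto simp flip: t)
  note bO = Cat_op_blocks(1)[OF g fs t] and bA = Cat_op_blocks(2)[OF g fs t]
  define F where "F i j = fcomp (tgt g) (coord (fs ! i) j) (coord g i)" for i j
  have F: "is_functor (tgt g) (src (fs ! i) ! j) (F i j)" "FO (F i j) (Base (tgt g)) = Base (src (fs ! i) ! j)"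
    if "i < length fs" "j < length (src (fs ! i))" for i j
  proof -
    have "is_functor (tgt g) (src g ! i) (coord g i)" using functor_coord[OF g] that len by simp
    moreover have "is_functor (src g ! i) (src (fs ! i) ! j) (coord (fs ! i) j)"
      using functor_coord[OF f(1)] that f(2) by metis
    ultimately show "is_functor (tgt g) (src (fs ! i) ! j) (F i j)" unfolding F_def by (rule functor_fcomp)
    have "Base (tgt g) \<in> Obj (tgt g)" using Cat_op_mor_based(1)[OF g] by (simp add: based_category_iff)
    then show "FO (F i j) (Base (tgt g)) = Base (src (fs ! i) ! j)"
      using coord_base[OF g, of i] coord_base[OF f(1) that(2)] f(2) that len by (simp add: F_def)
  qed
  have valO: "concat (map2 (\<lambda>f y. FO (dat f) y) fs (FO (dat g) x)) ! (sum_list (map length (take i (map src fs))) + j)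
      = FO (F i j) x" if "i < length fs" "j < length (src (fs ! i))" "x \<in> Obj (tgt g)" for i j x
  proof -
    let ?b = "map2 (\<lambda>f y. FO (dat f) y) fs (FO (dat g) x)"
    have "sum_list (map length (take i (map src fs))) = sum_list (map length (take i ?b))"
      using bO[OF that(3)] by (metis take_map)
    moreover have "length (?b ! i) = length (src (fs ! i))"
      using arg_cong[OF bO[OF that(3)], of "\<lambda>l. l ! i"] that Cat_op_mor_values(1)[OF g that(3)] len by simp
    ultimately show ?thesis
      using nth_concat_offset[of i ?b j] that Cat_op_mor_values[OF g] len f
      by (simp add: F_def coord_simps[OF g] coord_simps[OF f(1)])
  qed
  have valA: "concat (map2 (\<lambda>f y. FA (dat f) y) fs (FA (dat g) x)) ! (sum_list (map length (take i (map src fs))) + j)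
      = FA (F i j) x" if "i < length fs" "j < length (src (fs ! i))" "x \<in> Arr (tgt g)" for i j x
  proof -
    let ?b = "map2 (\<lambda>f y. FA (dat f) y) fs (FA (dat g) x)"
    have "sum_list (map length (take i (map src fs))) = sum_list (map length (take i ?b))"
      using bA[OF that(3)] by (metis take_map)
    moreover have "length (?b ! i) = length (src (fs ! i))"
      using arg_cong[OF bA[OF that(3)], of "\<lambda>l. l ! i"] that Cat_op_mor_values(2)[OF g that(3)] len by simp
    ultimately show ?thesis
      using nth_concat_offset[of i ?b j] that Cat_op_mor_values[OF g] len f
      by (simp add: F_def coord_simps[OF g] coord_simps[OF f(1)])
  qed
  show C: "?C \<in> MMor Cat_op"
  proof (rule Cat_op_morI)
    show "dat ?C = mk_ftor (tgt ?C) (\<lambda>x. concat (map2 (\<lambda>f y. FO (dat f) y) fs (FO (dat g) x)))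
         (\<lambda>u. concat (map2 (\<lambda>f v. FA (dat f) v) fs (FA (dat g) u)))"
      by (simp only: Cat_op_comp)
    show "length (concat (map2 (\<lambda>f y. FO (dat f) y) fs (FO (dat g) x))) = length (src ?C)"
      if "x \<in> Obj (tgt ?C)" for x
      using bO that by (simp only: Cat_op_comp length_concat)
    show "length (concat (map2 (\<lambda>f y. FA (dat f) y) fs (FA (dat g) x))) = length (src ?C)"
      if "x \<in> Arr (tgt ?C)" for x
      using bA that by (simp only: Cat_op_comp length_concat)
    fix l assume "l < length (src ?C)"
    then have l: "l < length (concat (map src fs))" by (simp only: Cat_op_comp)
    obtain i j where ij: "i < length (map src fs)" "j < length (map src fs ! i)"
      "l = sum_list (map length (take i (map src fs))) + j" using obtain_offset[OF l] .
    have "concat (map src fs) ! l = src (fs ! i) ! j" using nth_concat_offset[OF ij(1,2)] ij by simp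
    then show "\<exists>F. is_functor (tgt ?C) (src ?C ! l) F \<and> FO F (Base (tgt ?C)) = Base (src ?C ! l) \<and>
        (\<forall>x \<in> Obj (tgt ?C). concat (map2 (\<lambda>f y. FO (dat f) y) fs (FO (dat g) x)) ! l = FO F x) \<and>
        (\<forall>x \<in> Arr (tgt ?C). concat (map2 (\<lambda>f y. FA (dat f) y) fs (FA (dat g) x)) ! l = FA F x)"
      using F[of i j] valO[of i j] valA[of i j] ij
      by (intro exI[of _ "F i j"] conjI ballI) (simp_all add: Cat_op_comp(1,2))
  next
    show "based_category (tgt ?C)" using Cat_op_mor_based(1)[OF g] by (simp add: Cat_op_comp)
    show "based_category D" if "D \<in> set (src ?C)" for D
      using that fs unfolding Cat_op_comp by (auto simp: Cat_op_mor)
  qed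
  show "coord ?C (sum_list (map length (take i (map src fs))) + j) = F i j"
    if ij: "i < length fs" "j < length (src (fs ! i))" for i j
  proof (rule ftor_eqI)
    have l: "sum_list (map length (take i (map src fs))) + j < length (src ?C)"
      using offset_less[of i "map src fs" j] ij by (simp add: Cat_op_comp)
    show "is_functor (tgt g) (src ?C ! (sum_list (map length (take i (map src fs))) + j))
        (coord ?C (sum_list (map length (take i (map src fs))) + j))"
      using functor_coord[OF C l] unfolding Cat_op_comp(2) .
    show "is_functor (tgt g) (src (fs ! i) ! j) (F i j)" by (rule F[OF ij])
    show "FO (coord ?C (sum_list (map length (take i (map src fs))) + j)) x = FO (F i j) x" if "x \<in> Obj (tgt g)" for x
      using valO[OF ij that] that coord_simps(1)[OF C l, of x] by (simp add: Cat_op_comp(2,3))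
    show "FA (coord ?C (sum_list (map length (take i (map src fs))) + j)) x = FA (F i j) x" if "x \<in> Arr (tgt g)" for x
      using valA[OF ij that] that coord_simps(2)[OF C l, of x] by (simp add: Cat_op_comp(2,3))
  qed
qed

lemma Cat_op_act:
  "src (Act Cat_op \<sigma> f) = permute_list \<sigma> (src f)" "tgt (Act Cat_op \<sigma> f) = tgt f"
  "dat (Act Cat_op \<sigma> f) = mk_ftor (tgt f)
         (\<lambda>x. permute_list \<sigma> (FO (dat f) x)) (\<lambda>u. permute_list \<sigma> (FA (dat f) u))"
  by (simp_all add: Cat_op_def)

lemma Cat_op_act_closed:
  assumes f: "f \<in> MMor Cat_op" and s: "\<sigma> permutes {..<length (src f)}"
  shows "Act Cat_op \<sigma> f \<in> MMor Cat_op"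
    and "l < length (src f) \<Longrightarrow> coord (Act Cat_op \<sigma> f) l = coord f (\<sigma> l)"
proof -
  let ?C = "Act Cat_op \<sigma> f"
  note v = Cat_op_mor_values[OF f] and sl = perm_less[OF s]
  show C: "?C \<in> MMor Cat_op"
  proof (rule Cat_op_morI)
    fix l assume "l < length (src ?C)"
    then show "\<exists>F. is_functor (tgt ?C) (src ?C ! l) F \<and> FO F (Base (tgt ?C)) = Base (src ?C ! l) \<and>
        (\<forall>x \<in> Obj (tgt ?C). permute_list \<sigma> (FO (dat f) x) ! l = FO F x) \<and>
        (\<forall>x \<in> Arr (tgt ?C). permute_list \<sigma> (FA (dat f) x) ! l = FA F x)"
      using functor_coord[OF f sl] coord_base[OF f sl] s sl
      by (intro exI[of _ "coord f (\<sigma> l)"]) (auto simp: Cat_op_act v permute_list_nth coord_simps[OF f])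
  qed (use Cat_op_mor_based[OF f] f s in \<open>auto simp: Cat_op_act v Cat_op_mor\<close>)
  show "coord ?C l = coord f (\<sigma> l)" if l: "l < length (src f)"
    by (rule ftor_eqI[of "tgt f" "src f ! \<sigma> l" _ "src f ! \<sigma> l"])
      (use functor_coord[OF f sl[OF l]] functor_coord[OF C, of l] l sl[OF l] s in
        \<open>auto simp: Cat_op_act coord_simps[OF C] coord_simps[OF f] v permute_list_nth\<close>)
qed

text \<open>Applying functions entry by entry commutes with cutting into blocks; this is associativity of the
  composition in \<open>Cat_op\<close> for a single object or arrow.\<close>
lemma concat_map2_concat:
  "list_all2 (\<lambda>as bs. length as = length bs) ass bss
    \<Longrightarrow> concat (map2 h (concat ass) (concat bss)) = concat (map2 (\<lambda>as bs. concat (map2 h as bs)) ass bss)"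
  by (induction rule: list_all2_induct) auto

lemma map2_permute_list:
  "\<lbrakk>\<sigma> permutes {..<length xs}; length ys = length xs\<rbrakk>
    \<Longrightarrow> map2 f (permute_list \<sigma> xs) (permute_list \<sigma> ys) = permute_list \<sigma> (map2 f xs ys)"
  by (rule nth_equalityI) (auto simp: permute_list_nth dest: perm_less)

lemma Cat_op_comp_values:
  "x \<in> Obj (tgt g) \<Longrightarrow> FO (dat (MComp Cat_op g fs)) x = concat (map2 (\<lambda>f y. FO (dat f) y) fs (FO (dat g) x))"
  "u \<in> Arr (tgt g) \<Longrightarrow> FA (dat (MComp Cat_op g fs)) u = concat (map2 (\<lambda>f y. FA (dat f) y) fs (FA (dat g) u))"
  by (simp_all add: Cat_op_comp(3))

lemma Cat_op_act_values:
  "x \<in> Obj (tgt f) \<Longrightarrow> FO (dat (Act Cat_op \<sigma> f)) x = permute_list \<sigma> (FO (dat f) x)"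
  "u \<in> Arr (tgt f) \<Longrightarrow> FA (dat (Act Cat_op \<sigma> f)) u = permute_list \<sigma> (FA (dat f) u)"
  by (simp_all add: Cat_op_act(3))

lemma Cat_op_composable_nth:
  assumes "set fs \<subseteq> MMor Cat_op" "map tgt fs = src g" "i < length fs"
  shows "fs ! i \<in> MMor Cat_op" "tgt (fs ! i) = src g ! i"
  using assms(1,3) by (auto simp flip: assms(2))

lemma Cat_op_unit_laws:
  assumes f: "f \<in> MMor Cat_op"
  shows "MComp Cat_op (MUnit Cat_op (tgt f)) [f] = f"
    and "MComp Cat_op f (map (MUnit Cat_op) (src f)) = f"
proof -
  show "MComp Cat_op (MUnit Cat_op (tgt f)) [f] = f"
    by (rule Cat_op_eqI)
      (use f Cat_op_mor_based(1)[OF f] in \<open>auto simp: Cat_op_comp_values Cat_op_unit Cat_op_comp(1,2)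
        intro!: Cat_op_comp_closed Cat_op_unit_closed\<close>)
  let ?us = "map (MUnit Cat_op) (src f)"
  have v: "map2 (\<lambda>f y. FO (dat f) y) ?us xs = map (\<lambda>x. [x]) xs" if "xs \<in> Obj (prod_cat (src f))" for xs
    using that by (auto intro!: nth_equalityI simp: Cat_op_unit prod_cat_Obj)
  have w: "map2 (\<lambda>f y. FA (dat f) y) ?us xs = map (\<lambda>x. [x]) xs" if "xs \<in> Arr (prod_cat (src f))" for xs
    using that by (auto intro!: nth_equalityI simp: Cat_op_unit prod_cat_Arr)
  have s: "map src ?us = map (\<lambda>x. [x]) (src f)" by (simp add: Cat_op_unit)
  note c = functor_closed[OF Cat_op_mor_functor[OF f]]
  show "MComp Cat_op f ?us = f"
  proof (rule Cat_op_eqI[OF _ f])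
    show "MComp Cat_op f ?us \<in> MMor Cat_op"
      using f by (intro Cat_op_comp_closed) (auto simp: Cat_op_unit comp_def Cat_op_mor intro!: Cat_op_unit_closed)
  qed (use v w c in \<open>simp_all add: Cat_op_comp_values Cat_op_comp(1,2) s concat_map_singleton del: map_map\<close>)
qed

lemma Cat_op_assoc:
  assumes g: "g \<in> MMor Cat_op" and fs: "set fs \<subseteq> MMor Cat_op" and t: "map tgt fs = src g"
    and hss: "\<And>hs. hs \<in> set hss \<Longrightarrow> set hs \<subseteq> MMor Cat_op" and th: "map (map tgt) hss = map src fs"
  shows "MComp Cat_op (MComp Cat_op g fs) (concat hss) = MComp Cat_op g (map2 (MComp Cat_op) fs hss)"
    (is "?L = ?R")
proof (rule Cat_op_eqI)
  have len: "length fs = length (src g)" using t by (metis length_map)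
  have lh: "length hss = length fs" using th by (metis length_map)
  note f = Cat_op_composable_nth[OF fs t]
  have h: "set (hss ! i) \<subseteq> MMor Cat_op" "map tgt (hss ! i) = src (fs ! i)" if "i < length fs" for i
  proof -
    show "set (hss ! i) \<subseteq> MMor Cat_op" using that lh by (intro hss) simp
    show "map tgt (hss ! i) = src (fs ! i)" using that lh th by (metis nth_map)
  qed
  have hl: "length (hss ! i) = length (src (fs ! i))" if "i < length fs" for i
    using h(2)[OF that] by (metis length_map)
  have set2: "set (map2 (MComp Cat_op) fs hss) \<subseteq> MMor Cat_op"
    using f h lh by (auto simp: set_zip intro!: Cat_op_comp_closed)
  have t2: "map tgt (map2 (MComp Cat_op) fs hss) = src g"
    using f lh len by (intro nth_equalityI) (simp_all add: Cat_op_comp)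
  have src2: "map src (map2 (MComp Cat_op) fs hss) = map (\<lambda>hs. concat (map src hs)) hss"
    using lh by (intro nth_equalityI) (simp_all add: Cat_op_comp)
  have tc: "map tgt (concat hss) = concat (map src fs)" by (simp add: map_concat th)
  show "?L \<in> MMor Cat_op"
    using hss tc by (intro Cat_op_comp_closed g fs t) (auto simp: Cat_op_comp)
  show "?R \<in> MMor Cat_op" by (intro Cat_op_comp_closed g set2 t2)
  show "src ?L = src ?R" by (simp only: Cat_op_comp src2 concat_map_concat)
  show "tgt ?L = tgt ?R" by (simp only: Cat_op_comp)
  note v = Cat_op_mor_values[OF g] Cat_op_mor_values[OF f(1)]
  show "FO (dat ?L) x = FO (dat ?R) x" if "x \<in> Obj (tgt ?L)" for x
  proof -
    have x: "x \<in> Obj (tgt g)" using that by (simp only: Cat_op_comp)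
    let ?ys = "FO (dat g) x"
    have "FO (dat ?L) x = concat (map2 (\<lambda>h y. FO (dat h) y) (concat hss) (concat (map2 (\<lambda>f y. FO (dat f) y) fs ?ys)))"
      using x by (simp add: Cat_op_comp_values Cat_op_comp(2))
    also have "\<dots> = concat (map2 (\<lambda>hs ys. concat (map2 (\<lambda>h y. FO (dat h) y) hs ys)) hss (map2 (\<lambda>f y. FO (dat f) y) fs ?ys))"
      using x lh hl len v f(2) by (intro concat_map2_concat) (simp add: list_all2_conv_all_nth)
    also have "map2 (\<lambda>hs ys. concat (map2 (\<lambda>h y. FO (dat h) y) hs ys)) hss (map2 (\<lambda>f y. FO (dat f) y) fs ?ys)
        = map2 (\<lambda>f y. FO (dat f) y) (map2 (MComp Cat_op) fs hss) ?ys"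
      using x lh len v f(2) by (intro nth_equalityI) (simp_all add: Cat_op_comp_values)
    finally show ?thesis using x by (simp add: Cat_op_comp_values)
  qed
  show "FA (dat ?L) x = FA (dat ?R) x" if "x \<in> Arr (tgt ?L)" for x
  proof -
    have x: "x \<in> Arr (tgt g)" using that by (simp only: Cat_op_comp)
    let ?ys = "FA (dat g) x"
    have "FA (dat ?L) x = concat (map2 (\<lambda>h y. FA (dat h) y) (concat hss) (concat (map2 (\<lambda>f y. FA (dat f) y) fs ?ys)))"
      using x by (simp add: Cat_op_comp_values Cat_op_comp(2))
    also have "\<dots> = concat (map2 (\<lambda>hs ys. concat (map2 (\<lambda>h y. FA (dat h) y) hs ys)) hss (map2 (\<lambda>f y. FA (dat f) y) fs ?ys))"
      using x lh hl len v f(2) by (intro concat_map2_concat) (simp add: list_all2_conv_all_nth)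
    also have "map2 (\<lambda>hs ys. concat (map2 (\<lambda>h y. FA (dat h) y) hs ys)) hss (map2 (\<lambda>f y. FA (dat f) y) fs ?ys)
        = map2 (\<lambda>f y. FA (dat f) y) (map2 (MComp Cat_op) fs hss) ?ys"
      using x lh len v f(2) by (intro nth_equalityI) (simp_all add: Cat_op_comp_values)
    finally show ?thesis using x by (simp add: Cat_op_comp_values)
  qed
qed

text \<open>Permuting the functions together with their arguments permutes the values block by block.\<close>
lemma Cat_op_outer:
  assumes g: "g \<in> MMor Cat_op" and fs: "set fs \<subseteq> MMor Cat_op" and t: "map tgt fs = src g"
    and s: "\<sigma> permutes {..<length fs}"
  shows "MComp Cat_op (Act Cat_op \<sigma> g) (permute_list \<sigma> fs)
    = Act Cat_op (block_perm \<sigma> (map (\<lambda>f. length (src f)) fs)) (MComp Cat_op g fs)"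
    (is "?L = Act _ ?\<beta> ?C")
proof (rule Cat_op_eqI)
  let ?rs = "map (\<lambda>f. length (src f)) fs"
  have len: "length fs = length (src g)" using t by (metis length_map)
  have sr: "\<sigma> permutes {..<length ?rs}" "\<sigma> permutes {..<length (src g)}" using s len by simp_all
  have C: "?C \<in> MMor Cat_op" by (intro Cat_op_comp_closed g fs t)
  have bp: "?\<beta> permutes {..<length (src ?C)}"
    using block_perm_permutes[OF sr(1)] by (simp add: Cat_op_comp length_concat comp_def)
  have pm: "map f (permute_list \<sigma> fs) = permute_list \<sigma> (map f fs)" for f :: "('a, 'b) opmor \<Rightarrow> 'c"
    using s by (rule map_permute_list)
  show "?L \<in> MMor Cat_op"
    using fs t s pm[of tgt] by (intro Cat_op_comp_closed Cat_op_act_closed g) (auto simp: Cat_op_act sr)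
  show "Act Cat_op ?\<beta> ?C \<in> MMor Cat_op" by (intro Cat_op_act_closed C bp)
  show "src ?L = src (Act Cat_op ?\<beta> ?C)"
    using permute_list_block_perm[OF sr(1), of "map src fs"]
    by (simp add: Cat_op_act Cat_op_comp pm comp_def)
  show "tgt ?L = tgt (Act Cat_op ?\<beta> ?C)" by (simp add: Cat_op_act Cat_op_comp)
  have rs: "?rs = map length (map src fs)" by simp
  show "FO (dat ?L) x = FO (dat (Act Cat_op ?\<beta> ?C)) x" if "x \<in> Obj (tgt ?L)" for x
  proof -
    have x: "x \<in> Obj (tgt g)" using that by (simp only: Cat_op_comp Cat_op_act)
    show ?thesis
      using x permute_list_block_perm[OF sr(1), of "map2 (\<lambda>f y. FO (dat f) y) fs (FO (dat g) x)"]
        map2_permute_list[OF s, of "FO (dat g) x" "\<lambda>f y. FO (dat f) y"] Cat_op_mor_values(1)[OF g x] len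
        Cat_op_blocks(1)[OF g fs t x, folded rs]
      by (simp add: Cat_op_comp_values Cat_op_act_values Cat_op_comp(2) Cat_op_act(2))
  qed
  show "FA (dat ?L) x = FA (dat (Act Cat_op ?\<beta> ?C)) x" if "x \<in> Arr (tgt ?L)" for x
  proof -
    have x: "x \<in> Arr (tgt g)" using that by (simp only: Cat_op_comp Cat_op_act)
    show ?thesis
      using x permute_list_block_perm[OF sr(1), of "map2 (\<lambda>f y. FA (dat f) y) fs (FA (dat g) x)"]
        map2_permute_list[OF s, of "FA (dat g) x" "\<lambda>f y. FA (dat f) y"] Cat_op_mor_values(2)[OF g x] len
        Cat_op_blocks(2)[OF g fs t x, folded rs]
      by (simp add: Cat_op_comp_values Cat_op_act_values Cat_op_comp(2) Cat_op_act(2))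
  qed
qed

lemma Cat_op_inner:
  assumes g: "g \<in> MMor Cat_op" and fs: "set fs \<subseteq> MMor Cat_op" and t: "map tgt fs = src g"
    and s: "list_all2 (\<lambda>\<tau> f. \<tau> permutes {..<length (src f)}) \<tau>s fs"
  shows "MComp Cat_op g (map2 (Act Cat_op) \<tau>s fs)
    = Act Cat_op (sum_perm \<tau>s (map (\<lambda>f. length (src f)) fs)) (MComp Cat_op g fs)"
    (is "?L = Act _ ?\<beta> ?C")
proof (rule Cat_op_eqI)
  let ?rs = "map (\<lambda>f. length (src f)) fs"
  have len: "length fs = length (src g)" using t by (metis length_map)
  have lt: "length \<tau>s = length fs" using s by (rule list_all2_lengthD)
  note f = Cat_op_composable_nth[OF fs t]
  have sr: "list_all2 (\<lambda>\<tau> n. \<tau> permutes {..<n}) \<tau>s ?rs" using s by (simp add: list_all2_map2)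
  have sn: "\<tau>s ! i permutes {..<length (src (fs ! i))}" if "i < length fs" for i
    using s that lt by (simp add: list_all2_conv_all_nth)
  have C: "?C \<in> MMor Cat_op" by (intro Cat_op_comp_closed g fs t)
  have bp: "?\<beta> permutes {..<length (src ?C)}"
    using sum_perm_permutes[OF sr] by (simp add: Cat_op_comp length_concat comp_def)
  have srcA: "map src (map2 (Act Cat_op) \<tau>s fs) = map2 permute_list \<tau>s (map src fs)"
    using lt by (auto intro!: nth_equalityI simp: Cat_op_act)
  show "?L \<in> MMor Cat_op"
  proof (intro Cat_op_comp_closed g)
    show "set (map2 (Act Cat_op) \<tau>s fs) \<subseteq> MMor Cat_op"
      using f sn lt by (auto simp: set_zip intro!: Cat_op_act_closed)
    show "map tgt (map2 (Act Cat_op) \<tau>s fs) = src g"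
      using f lt len by (intro nth_equalityI) (simp_all add: Cat_op_act)
  qed
  show "Act Cat_op ?\<beta> ?C \<in> MMor Cat_op" by (intro Cat_op_act_closed C bp)
  show "src ?L = src (Act Cat_op ?\<beta> ?C)"
    using permute_list_sum_perm[OF sr, of "map src fs"] srcA
    by (simp add: Cat_op_act Cat_op_comp comp_def)
  show "tgt ?L = tgt (Act Cat_op ?\<beta> ?C)" by (simp add: Cat_op_act Cat_op_comp)
  have rs: "?rs = map length (map src fs)" by simp
  show "FO (dat ?L) x = FO (dat (Act Cat_op ?\<beta> ?C)) x" if "x \<in> Obj (tgt ?L)" for x
  proof -
    have x: "x \<in> Obj (tgt g)" using that by (simp only: Cat_op_comp)
    have "map2 (\<lambda>f y. FO (dat f) y) (map2 (Act Cat_op) \<tau>s fs) (FO (dat g) x)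
        = map2 permute_list \<tau>s (map2 (\<lambda>f y. FO (dat f) y) fs (FO (dat g) x))"
      using lt len f(2) Cat_op_mor_values(1,3)[OF g x] by (intro nth_equalityI) (simp_all add: Cat_op_act_values)
    with x show ?thesis
      using permute_list_sum_perm[OF sr Cat_op_blocks(1)[OF g fs t x, folded rs]]
      by (simp add: Cat_op_comp_values Cat_op_act_values Cat_op_comp(2))
  qed
  show "FA (dat ?L) x = FA (dat (Act Cat_op ?\<beta> ?C)) x" if "x \<in> Arr (tgt ?L)" for x
  proof -
    have x: "x \<in> Arr (tgt g)" using that by (simp only: Cat_op_comp)
    have "map2 (\<lambda>f y. FA (dat f) y) (map2 (Act Cat_op) \<tau>s fs) (FA (dat g) x)
        = map2 permute_list \<tau>s (map2 (\<lambda>f y. FA (dat f) y) fs (FA (dat g) x))"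
      using lt len f(2) Cat_op_mor_values(2,4)[OF g x] by (intro nth_equalityI) (simp_all add: Cat_op_act_values)
    with x show ?thesis
      using permute_list_sum_perm[OF sr Cat_op_blocks(2)[OF g fs t x, folded rs]]
      by (simp add: Cat_op_comp_values Cat_op_act_values Cat_op_comp(2))
  qed
qed

lemma multicategory_Cat_op: "multicategory Cat_op"
proof
  fix f :: "('a, 'b) opmor" assume f: "f \<in> MMor Cat_op"
  note v = Cat_op_mor_values[OF f]
  show "Act Cat_op id f = f"
    by (rule Cat_op_eqI) (simp_all add: f permutes_id Cat_op_act_closed Cat_op_act Cat_op_act_values)
  fix \<sigma> \<tau> assume s: "\<sigma> permutes {..<length (Src Cat_op f)}" and t: "\<tau> permutes {..<length (Src Cat_op f)}"
  show "Act Cat_op \<tau> (Act Cat_op \<sigma> f) = Act Cat_op (\<sigma> \<circ> \<tau>) f"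
    using f s t
    by (intro Cat_op_eqI Cat_op_act_closed)
      (simp_all add: Cat_op_act Cat_op_act_values permute_list_compose v permutes_compose)
qed (auto simp: Cat_op_comp(1,2) Cat_op_act(1,2) Cat_op_unit Cat_op_unit_closed Cat_op_unit_laws Cat_op_comp_closed
      Cat_op_act_closed in_lists_conv_set subset_iff Cat_op_mor_based(1)
      dest: bspec[OF conjunct1[OF iffD1[OF Cat_op_mor]]]
      intro!: Cat_op_assoc Cat_op_outer Cat_op_inner)

section \<open>Base points of multicategories\<close>

lemma Term_Mult_simps:
  "MObj Term_Mult = UNIV" "MMor Term_Mult = UNIV" "Src Term_Mult r = replicate r ()" "Tgt Term_Mult r = ()"
  "MUnit Term_Mult x = 1" "MComp Term_Mult r rs = sum_list rs" "Act Term_Mult \<sigma> r = r"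
  by (simp_all add: Term_Mult_def)

text \<open>All equations required of a multifunctor out of the terminal multicategory are between morphisms
  all of whose sources and targets are the base object. They hold if such morphisms are determined by
  their arity, as is the case for \<open>0\<close> in \<open>N_Mult\<close> and for the terminal category.\<close>
lemma multifunctor_from_terminal:
  assumes M: "multicategory M" and a: "a \<in> MObj M"
    and mor: "\<And>r. FA b r \<in> MMor M" and src: "\<And>r. Src M (FA b r) = replicate r a"
    and tgt: "\<And>r. Tgt M (FA b r) = a" and ob: "\<And>x. FO b x = a"
    and unique: "\<And>f g. \<lbrakk>f \<in> MMor M; g \<in> MMor M; Src M f = Src M g; Tgt M f = a; Tgt M g = a; set (Src M f) \<subseteq> {a}\<rbrakk> \<Longrightarrow> f = g"
  shows "multifunctor Term_Mult M b"
proof -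
  interpret M: multicategory M by fact
  have len: "length fs = g" if "map (Tgt Term_Mult) fs = replicate g ()" for fs :: "nat list" and g
    using arg_cong[OF that, of length] by simp
  have conc: "concat (map (\<lambda>r. replicate r a) fs) = replicate (sum_list fs) a" for fs
    by (induction fs) (auto simp: replicate_add)
  have perm: "permute_list \<sigma> (replicate n a) = replicate n a" if "\<sigma> permutes {..<n}" for \<sigma> n
    by (rule nth_equalityI) (use that in \<open>auto simp: permute_list_nth dest: perm_less\<close>)
  have unit: "FA b 1 = MUnit M a"
    by (rule unique) (simp_all add: mor src tgt a M.MUnit_closed M.Src_MUnit M.Tgt_MUnit)
  have comp: "FA b (sum_list fs) = MComp M (FA b g) (map (FA b) fs)" if "length fs = g" for fs g
  proof -
    have c: "map (Tgt M) (map (FA b) fs) = Src M (FA b g)" "map (FA b) fs \<in> lists (MMor M)"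
      using that by (auto simp: src tgt mor intro: nth_equalityI)
    have "Src M (MComp M (FA b g) (map (FA b) fs)) = replicate (sum_list fs) a"
      using M.Src_MComp[OF mor c(2,1)] conc by (simp add: src comp_def)
    then show ?thesis using M.MComp_closed[OF mor c(2,1)] M.Tgt_MComp[OF mor c(2,1)]
      by (intro unique) (auto simp: mor src tgt)
  qed
  have act: "FA b r = Act M \<sigma> (FA b r)" if "\<sigma> permutes {..<r}" for \<sigma> r
  proof -
    have s: "\<sigma> permutes {..<length (Src M (FA b r))}" using that by (simp add: src)
    then show ?thesis using M.Act_closed[OF mor s] M.Src_Act[OF mor s] M.Tgt_Act[OF mor s] perm[OF that]
      by (intro unique) (auto simp: mor src tgt)
  qed
  show ?thesis
    by (intro multifunctor.intro multicategory_Term_Mult M multifunctor_axioms.intro)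
      (auto simp: Term_Mult_simps ob a mor src tgt unit[simplified] comp[OF len] intro!: act dest!: len)
qed

lemma based_N_Mult: "based_multicategory N_Mult N_base"
  unfolding based_multicategory_def
  by (rule multifunctor_from_terminal[where a = 0])
    (auto simp: multicategory_N_Mult N_base_def N_Mult_mor intro: N_Mult_eqI)

text \<open>The source is a product of terminal categories, which has one object and one arrow.\<close>
lemma Cat_op_into_points_unique:
  assumes "f \<in> MMor Cat_op" "g \<in> MMor Cat_op" "src f = src g" "tgt f = Term_Cat" "tgt g = Term_Cat"
    and "set (src f) \<subseteq> {Term_Cat}"
  shows "f = g"
proof -
  define r where "r = length (src f)"
  have "src f = replicate r Term_Cat" using assms(6) by (intro replicate_eqI) (auto simp: r_def)
  then have "Obj (prod_cat (src f)) = {replicate r undefined}" "Arr (prod_cat (src f)) = {replicate r undefined}"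
    using prod_Term_Cat[of r] by simp_all
  then have "dat f = dat g"
    using functor_into_points_unique[of Term_Cat "prod_cat (src f)" "dat f" "prod_cat (src f)" "dat g"]
      Cat_op_mor_functor[of f] Cat_op_mor_functor[of g] assms by simp
  then show ?thesis using assms(3-5) by simp
qed

lemma based_Cat_op: "based_multicategory Cat_op Cat_op_base"
proof -
  have c: "category Term_Cat" using based_Term_Cat by (simp add: based_category_iff)
  have b: "based_category (prod_cat (replicate r Term_Cat))" for r
    by (rule based_category_prod) (auto simp: based_Term_Cat)
  have m: "FA Cat_op_base r \<in> MMor Cat_op" for r
    using functor_const_base[OF c b, of r]
    by (auto simp: Cat_op_base_def Cat_op_mor based_Term_Cat based_functor_iff b const_base_def)
  show ?thesis unfolding based_multicategory_def
    by (rule multifunctor_from_terminal[where a = Term_Cat, OF multicategory_Cat_op _ m])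
      (auto simp: Cat_op_base_def based_Term_Cat intro!: Cat_op_into_points_unique)
qed

lemma Cat_op_coord_eqI:
  assumes "f \<in> MMor Cat_op" "g \<in> MMor Cat_op" "src f = src g" "tgt f = tgt g"
    and c: "\<And>l. l < length (src f) \<Longrightarrow> coord f l = coord g l"
  shows "f = g"
proof (rule Cat_op_eqI[OF assms(1-4)])
  note v = Cat_op_mor_values(1,2)[OF assms(1)] Cat_op_mor_values(1,2)[OF assms(2), folded assms(3,4)]
  note n = coord_simps[OF assms(1), symmetric] coord_simps[OF assms(2), folded assms(3,4), symmetric]
  show "FO (dat f) x = FO (dat g) x" if "x \<in> Obj (tgt f)" for x
    by (rule nth_equalityI) (simp_all add: v that n c)
  show "FA (dat f) x = FA (dat g) x" if "x \<in> Arr (tgt f)" for x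
    by (rule nth_equalityI) (simp_all add: v that n c)
qed

lemma coord_unit: "based_category C \<Longrightarrow> coord (MUnit Cat_op C) 0 = fid C"
  by (rule ftor_eqI[of C C _ C])
    (use functor_coord[OF Cat_op_unit_closed, of C 0] in
      \<open>auto simp: coord_simps[OF Cat_op_unit_closed] Cat_op_unit based_category_iff functor_fid\<close>)

section \<open>Smash products of based maps\<close>

lemma Gamma_op_Obj [simp]: "Obj Gamma_op = UNIV"
  by (simp add: Gamma_op_def mk_cat_def)

lemma Gamma_op_Arr: "h \<in> Arr Gamma_op \<longleftrightarrow> dat h \<in> {0..src h} \<rightarrow>\<^sub>E {0..tgt h} \<and> dat h 0 = 0"
  by (simp add: Gamma_op_def mk_cat_def)

lemma Gamma_op_Dom_Cod: "h \<in> Arr Gamma_op \<Longrightarrow> Dom Gamma_op h = src h" "h \<in> Arr Gamma_op \<Longrightarrow> Cod Gamma_op h = tgt h"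
  by (simp_all add: Gamma_op_def mk_cat_def)

lemma Gamma_op_zero: "h \<in> Arr Gamma_op \<Longrightarrow> dat h 0 = 0"
  by (simp add: Gamma_op_Arr)

lemma Gamma_op_le: "\<lbrakk>h \<in> Arr Gamma_op; x \<le> src h\<rbrakk> \<Longrightarrow> dat h x \<le> tgt h"
  by (auto simp: Gamma_op_Arr)

lemma Gamma_op_Ident:
  "src (Ident Gamma_op n) = n" "tgt (Ident Gamma_op n) = n" "x \<le> n \<Longrightarrow> dat (Ident Gamma_op n) x = x"
  "Ident Gamma_op n \<in> Arr Gamma_op"
  by (simp_all add: Gamma_op_def mk_cat_def)

lemma Gamma_op_Comp:
  assumes "g \<in> Arr Gamma_op" "h \<in> Arr Gamma_op" "src g = tgt h"
  shows "src (Comp Gamma_op g h) = src h" "tgt (Comp Gamma_op g h) = tgt g"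
    "x \<le> src h \<Longrightarrow> dat (Comp Gamma_op g h) x = dat g (dat h x)"
    "Comp Gamma_op g h \<in> Arr Gamma_op"
  using assms by (auto simp: Gamma_op_def mk_cat_def compose_def)

lemma Gamma_op_eqI:
  assumes "g \<in> Arr Gamma_op" "h \<in> Arr Gamma_op" "src g = src h" "tgt g = tgt h"
    and "\<And>x. x \<in> {1..src g} \<Longrightarrow> dat g x = dat h x"
  shows "g = h"
proof -
  have "dat g x = dat h x" for x
  proof (cases "x \<in> {0..src g}")
    case True
    then show ?thesis using assms(5)[of x] Gamma_op_zero[OF assms(1)] Gamma_op_zero[OF assms(2)]
      by (cases "x = 0") auto
  next
    case False
    then show ?thesis using assms(1-3) unfolding Gamma_op_Arr
      by (metis PiE_arb)
  qed
  then have "dat g = dat h" by blast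
  then show ?thesis using assms(3,4) by simp
qed

definition based_tuples :: "nat list \<Rightarrow> nat list set" where
  "based_tuples ns = {xs. list_all2 (\<le>) xs ns}"

text \<open>The projection from the product of based sets to their smash product, which identifies all tuples
  with an entry at the base point.\<close>
definition based_enc :: "nat list \<Rightarrow> nat list \<Rightarrow> nat" where
  "based_enc ns xs = (if 0 \<in> set xs then 0 else enc ns xs)"

lemma based_tuples_nth: "xs \<in> based_tuples ns \<longleftrightarrow> length xs = length ns \<and> (\<forall>i < length ns. xs ! i \<le> ns ! i)"
  by (auto simp: based_tuples_def list_all2_conv_all_nth)

lemma based_enc_tuples: "xs \<in> tuples ns \<Longrightarrow> xs \<in> based_tuples ns \<and> based_enc ns xs = enc ns xs"
  by (auto simp: tuples_nth based_tuples_nth based_enc_def in_set_conv_nth)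

lemma based_tuples_cases: "xs \<in> based_tuples ns \<Longrightarrow> 0 \<in> set xs \<or> xs \<in> tuples ns"
  by (fastforce simp: tuples_nth based_tuples_nth in_set_conv_nth Suc_le_eq)

lemma based_enc_le: "xs \<in> based_tuples ns \<Longrightarrow> based_enc ns xs \<le> prod_list ns"
  using based_tuples_cases[of xs ns] enc_le[of xs ns] by (auto simp: based_enc_def)

lemma based_enc_concat:
  assumes "list_all2 (\<lambda>xs ns. length xs = length ns) xss nss"
  shows "based_enc (concat nss) (concat xss) = based_enc (map prod_list nss) (map2 based_enc nss xss)"
proof (cases "0 \<in> set (concat xss)")
  case True
  then obtain ys where "ys \<in> set xss" "0 \<in> set ys" by auto
  then obtain i where i: "i < length xss" "0 \<in> set (xss ! i)" by (metis in_set_conv_nth)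
  then have "map2 based_enc nss xss ! i = 0" "i < length (map2 based_enc nss xss)"
    using list_all2_lengthD[OF assms] by (auto simp: based_enc_def)
  then have "0 \<in> set (map2 based_enc nss xss)" by (metis nth_mem)
  with True show ?thesis by (simp add: based_enc_def)
next
  case False
  have eq: "map2 based_enc nss xss = map2 enc nss xss"
    using False list_all2_lengthD[OF assms] by (intro nth_equalityI) (auto simp: based_enc_def)
  moreover have "0 \<notin> set (map2 enc nss xss)"
    by (auto simp: set_zip gr_implies_not_zero[OF enc_pos])
  ultimately show ?thesis unfolding eq using False enc_concat[OF assms] by (simp add: based_enc_def)
qed

lemma permute_list_in_based_tuples:
  assumes "\<sigma> permutes {..<length ns}" "xs \<in> based_tuples ns"
  shows "permute_list \<sigma> xs \<in> based_tuples (permute_list \<sigma> ns)"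
  using assms perm_less[OF assms(1)] by (auto simp: based_tuples_nth permute_list_nth)

lemma map2_dat_in_based_tuples:
  assumes "set hs \<subseteq> Arr Gamma_op" "xs \<in> based_tuples (map src hs)"
  shows "map2 (\<lambda>h x. dat h x) hs xs \<in> based_tuples (map tgt hs)"
  using assms by (auto simp: based_tuples_nth intro!: Gamma_op_le)

lemma smash_gmor_simps: "src (smash_gmor hs) = prod_list (map src hs)" "tgt (smash_gmor hs) = prod_list (map tgt hs)"
  by (simp_all add: smash_gmor_def Let_def)

text \<open>The smash product of based maps is induced by their product. Every equation between smash products
  and reorderings below is checked on tuples by means of this fact and \<open>reorder_gmor_enc\<close>.\<close>
lemma smash_gmor_enc:
  assumes "set hs \<subseteq> Arr Gamma_op" "xs \<in> based_tuples (map src hs)"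
  shows "dat (smash_gmor hs) (based_enc (map src hs) xs) = based_enc (map tgt hs) (map2 (\<lambda>h x. dat h x) hs xs)"
proof (cases "0 \<in> set xs")
  case True
  then obtain i where i: "i < length xs" "xs ! i = 0" by (auto simp: in_set_conv_nth)
  then have l: "i < length hs" using assms(2) by (simp add: based_tuples_nth)
  with assms(1) have "hs ! i \<in> Arr Gamma_op" by auto
  then have "map2 (\<lambda>h x. dat h x) hs xs ! i = 0" using i l Gamma_op_zero by simp
  moreover have "i < length (map2 (\<lambda>h x. dat h x) hs xs)" using i l by simp
  ultimately have "0 \<in> set (map2 (\<lambda>h x. dat h x) hs xs)" by (metis nth_mem)
  with True show ?thesis by (simp add: based_enc_def smash_gmor_def Let_def)
next
  case False
  with based_tuples_cases[OF assms(2)] have xs: "xs \<in> tuples (map src hs)" by blast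
  show ?thesis using enc_in[OF xs] False
    by (simp add: smash_gmor_def Let_def dec_enc[OF xs] based_enc_def)
qed

lemma smash_gmor_Arr:
  assumes "set hs \<subseteq> Arr Gamma_op" shows "smash_gmor hs \<in> Arr Gamma_op"
proof -
  let ?s = "smash_gmor hs"
  have "dat ?s k \<le> tgt ?s" if k: "k \<in> {1..src ?s}" for k
  proof -
    obtain xs where xs: "xs \<in> tuples (map src hs)" "enc (map src hs) xs = k"
      using enc_surj[of k "map src hs"] k by (auto simp: smash_gmor_simps)
    then have b: "xs \<in> based_tuples (map src hs)" "k = based_enc (map src hs) xs"
      using based_enc_tuples[of xs "map src hs"] by auto
    show ?thesis unfolding b(2) smash_gmor_enc[OF assms b(1)] smash_gmor_simps
      by (rule based_enc_le[OF map2_dat_in_based_tuples[OF assms b(1)]])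
  qed
  moreover have "dat ?s 0 = 0" by (simp add: smash_gmor_def Let_def)
  ultimately have "dat ?s k \<le> tgt ?s" if "k \<in> {0..src ?s}" for k
    using that by (cases "k = 0") auto
  moreover have "dat ?s \<in> extensional {0..src ?s}" by (simp add: smash_gmor_def Let_def)
  ultimately show ?thesis using \<open>dat ?s 0 = 0\<close> by (auto simp: Gamma_op_Arr PiE_def)
qed

text \<open>The elements other than the base point are numbers of tuples without an entry at a base point.\<close>
lemma Gamma_op_tuple_eqI:
  assumes "g \<in> Arr Gamma_op" "h \<in> Arr Gamma_op" "src g = prod_list ns" "src h = prod_list ns" "tgt g = tgt h"
    and "\<And>xs. \<lbrakk>xs \<in> tuples ns; xs \<in> based_tuples ns\<rbrakk> \<Longrightarrow> dat g (based_enc ns xs) = dat h (based_enc ns xs)"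
  shows "g = h"
proof (rule Gamma_op_eqI)
  fix k assume "k \<in> {1..src g}"
  then obtain xs where xs: "xs \<in> tuples ns" "enc ns xs = k"
    using enc_surj[of k ns] assms(3) by auto
  then show "dat g k = dat h k" using assms(6)[of xs] based_enc_tuples[of xs ns] by auto
qed (use assms in auto)

text \<open>The symmetry of the smash product in \<open>Gamma_op\<close>, for any number of factors.\<close>
definition reorder_gmor :: "(nat \<Rightarrow> nat) \<Rightarrow> nat list \<Rightarrow> gmor" where
  "reorder_gmor \<sigma> ns = \<lparr>src = prod_list ns, tgt = prod_list ns,
     dat = (\<lambda>k\<in>{0..prod_list ns}. if k = 0 then 0 else reorder \<sigma> ns k)\<rparr>"

lemma reorder_gmor_simps: "src (reorder_gmor \<sigma> ns) = prod_list ns" "tgt (reorder_gmor \<sigma> ns) = prod_list ns"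
  by (simp_all add: reorder_gmor_def)

lemma zero_in_permute_list:
  "\<lbrakk>\<sigma> permutes {..<length xs}\<rbrakk> \<Longrightarrow> 0 \<in> set (permute_list \<sigma> xs) \<longleftrightarrow> 0 \<in> set xs"
  by simp

lemma reorder_in:
  assumes "\<sigma> permutes {..<length ns}" "k \<in> {1..prod_list ns}"
  shows "reorder \<sigma> ns k \<in> {1..prod_list ns}"
  using enc_in[OF permute_list_in_tuples[OF assms(1) dec_in[OF assms(2)]]] prod_list_permute_list[OF assms(1)]
  by (simp add: reorder_def)

lemma reorder_gmor_Arr:
  assumes "\<sigma> permutes {..<length ns}" shows "reorder_gmor \<sigma> ns \<in> Arr Gamma_op"
  using reorder_in[OF assms] by (auto simp: Gamma_op_Arr reorder_gmor_def Suc_le_eq)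

lemma reorder_gmor_enc:
  assumes "\<sigma> permutes {..<length ns}" "xs \<in> based_tuples ns"
  shows "dat (reorder_gmor \<sigma> ns) (based_enc ns xs) = based_enc (permute_list \<sigma> ns) (permute_list \<sigma> xs)"
proof (cases "0 \<in> set xs")
  case True
  moreover have "\<sigma> permutes {..<length xs}" using assms by (simp add: based_tuples_nth)
  ultimately show ?thesis using zero_in_permute_list by (simp add: based_enc_def reorder_gmor_def)
next
  case False
  with based_tuples_cases[OF assms(2)] have xs: "xs \<in> tuples ns" by blast
  moreover have "\<sigma> permutes {..<length xs}" using assms by (simp add: based_tuples_nth)
  ultimately show ?thesis using enc_in[OF xs] False zero_in_permute_list
    by (simp add: reorder_gmor_def dec_enc[OF xs] based_enc_def reorder_def)
qed

lemma smash_gmor_single: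
  assumes "h \<in> Arr Gamma_op" shows "smash_gmor [h] = h"
proof (rule Gamma_op_tuple_eqI[where ns = "[src h]"])
  fix xs assume xs: "xs \<in> tuples [src h]" "xs \<in> based_tuples [src h]"
  then obtain x where x: "xs = [x]" "x \<le> src h" "1 \<le> x" by (cases xs) (auto simp: tuples_def)
  have "based_enc [n] [y] = y" for n y by (simp add: based_enc_def)
  then show "dat (smash_gmor [h]) (based_enc [src h] xs) = dat h (based_enc [src h] xs)"
    using smash_gmor_enc[of "[h]" xs] xs assms x by simp
qed (use assms smash_gmor_Arr[of "[h]"] in \<open>auto simp: smash_gmor_simps\<close>)

lemma obtain_tuple_blocks:
  assumes "xs \<in> tuples (concat nss)"
  obtains xss where "xs = concat xss" "length xss = length nss" "\<forall>i < length nss. xss ! i \<in> tuples (nss ! i)"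
proof -
  have "length xs = sum_list (map length nss)" using assms by (simp add: tuples_nth length_concat)
  then obtain xss where xss: "xs = concat xss" "map length xss = map length nss" by (rule obtain_blocks)
  have l: "length xss = length nss" using xss(2) by (metis length_map)
  have li: "length (xss ! i) = length (nss ! i)" if "i < length nss" for i
    using xss(2) that l by (metis nth_map)
  have "xss ! i \<in> tuples (nss ! i)" if i: "i < length nss" for i
    unfolding tuples_nth
  proof (intro conjI allI impI li[OF i])
    fix j assume j: "j < length (nss ! i)"
    have "take i (map length xss) = take i (map length nss)" using xss(2) by simp
    then have o: "map length (take i xss) = map length (take i nss)" by (simp add: take_map)
    have "concat xss ! (sum_list (map length (take i nss)) + j) = xss ! i ! j"
      using nth_concat_offset[of i xss j] i j l li o by simp
    moreover have "concat nss ! (sum_list (map length (take i nss)) + j) = nss ! i ! j"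
      by (rule nth_concat_offset[OF i j])
    ultimately show "xss ! i ! j \<in> {1..nss ! i ! j}"
      using assms offset_less[OF i j] xss(1) unfolding tuples_nth by metis
  qed
  with that xss l show ?thesis by blast
qed

lemma map2_concat:
  "list_all2 (\<lambda>as bs. length as = length bs) ass bss
    \<Longrightarrow> map2 h (concat ass) (concat bss) = concat (map2 (map2 h) ass bss)"
  by (induction rule: list_all2_induct) auto

text \<open>Associativity of the smash product, from associativity of the lexicographic numbering.\<close>
lemma smash_gmor_concat:
  assumes "set (concat hss) \<subseteq> Arr Gamma_op"
  shows "smash_gmor (concat hss) = smash_gmor (map smash_gmor hss)"
proof (rule Gamma_op_tuple_eqI[where ns = "concat (map (map src) hss)"])
  have h: "set (hss ! i) \<subseteq> Arr Gamma_op" if "i < length hss" for i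
    using assms nth_mem[OF that] by auto
  have m: "set (map smash_gmor hss) \<subseteq> Arr Gamma_op"
    using smash_gmor_Arr[OF h] by (auto simp: in_set_conv_nth)
  show "smash_gmor (concat hss) \<in> Arr Gamma_op" "smash_gmor (map smash_gmor hss) \<in> Arr Gamma_op"
    by (rule smash_gmor_Arr[OF assms], rule smash_gmor_Arr[OF m])
  have sm: "map src (map smash_gmor hss) = map prod_list (map (map src) hss)"
    "map tgt (map smash_gmor hss) = map prod_list (map (map tgt) hss)"
    by (simp_all add: smash_gmor_simps)
  fix xs assume xs: "xs \<in> tuples (concat (map (map src) hss))" "xs \<in> based_tuples (concat (map (map src) hss))"
  obtain xss where xss: "xs = concat xss" "length xss = length hss"
    "\<forall>i < length hss. xss ! i \<in> tuples (map src (hss ! i))"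
    using obtain_tuple_blocks[OF xs(1)] by auto
  have b: "xss ! i \<in> based_tuples (map src (hss ! i))" if "i < length hss" for i
    using based_enc_tuples[OF xss(3)[rule_format, OF that]] by blast
  have l: "list_all2 (\<lambda>xs ns. length xs = length ns) xss (map (map src) hss)"
    using xss(2) b by (auto simp: list_all2_conv_all_nth based_tuples_nth)
  have l2: "list_all2 (\<lambda>as bs. length as = length bs) hss xss"
    using xss(2) b by (auto simp: list_all2_conv_all_nth based_tuples_nth)
  have bt: "map2 based_enc (map (map src) hss) xss \<in> based_tuples (map src (map smash_gmor hss))"
    using b xss(2) based_enc_le by (auto simp: based_tuples_nth smash_gmor_simps)
  have "dat (smash_gmor (concat hss)) (based_enc (concat (map (map src) hss)) xs)
      = based_enc (concat (map (map tgt) hss)) (concat (map2 (map2 (\<lambda>h x. dat h x)) hss xss))"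
    using smash_gmor_enc[OF assms, of xs] xs by (simp add: map_concat xss(1) map2_concat[OF l2])
  also have "\<dots> = based_enc (map prod_list (map (map tgt) hss))
      (map2 based_enc (map (map tgt) hss) (map2 (map2 (\<lambda>h x. dat h x)) hss xss))"
    using xss(2) b by (intro based_enc_concat) (auto simp: list_all2_conv_all_nth based_tuples_nth)
  also have "map2 based_enc (map (map tgt) hss) (map2 (map2 (\<lambda>h x. dat h x)) hss xss)
      = map2 (\<lambda>h x. dat h x) (map smash_gmor hss) (map2 based_enc (map (map src) hss) xss)"
    using xss(2) smash_gmor_enc[OF h b] by (intro nth_equalityI) simp_all
  also have "based_enc (map prod_list (map (map tgt) hss)) \<dots>
     = dat (smash_gmor (map smash_gmor hss)) (based_enc (concat (map (map src) hss)) xs)"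
    unfolding xss(1) based_enc_concat[OF l] sm[symmetric] using smash_gmor_enc[OF m bt] by simp
  finally show "dat (smash_gmor (concat hss)) (based_enc (concat (map (map src) hss)) xs)
     = dat (smash_gmor (map smash_gmor hss)) (based_enc (concat (map (map src) hss)) xs)" .
qed (simp_all add: smash_gmor_simps map_concat prod_list_concat comp_def)

lemma smash_gmor_Comp:
  assumes g: "set gs \<subseteq> Arr Gamma_op" and h: "set hs \<subseteq> Arr Gamma_op" and st: "map src gs = map tgt hs"
  shows "smash_gmor (map2 (Comp Gamma_op) gs hs) = Comp Gamma_op (smash_gmor gs) (smash_gmor hs)"
proof -
  have len: "length gs = length hs" using st by (metis length_map)
  have n: "gs ! i \<in> Arr Gamma_op" "hs ! i \<in> Arr Gamma_op" "src (gs ! i) = tgt (hs ! i)" if "i < length hs" for i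
    using g h st that len by (auto simp: list_eq_iff_nth_eq)
  note C = Gamma_op_Comp[OF n]
  have c: "set (map2 (Comp Gamma_op) gs hs) \<subseteq> Arr Gamma_op"
    using C(4) len by (auto simp: set_zip)
  have s: "map src (map2 (Comp Gamma_op) gs hs) = map src hs" "map tgt (map2 (Comp Gamma_op) gs hs) = map tgt gs"
    using C(1,2) len by (auto intro!: nth_equalityI)
  have S: "smash_gmor gs \<in> Arr Gamma_op" "smash_gmor hs \<in> Arr Gamma_op" "src (smash_gmor gs) = tgt (smash_gmor hs)"
    using g h st by (simp_all add: smash_gmor_Arr smash_gmor_simps)
  show ?thesis
  proof (rule Gamma_op_tuple_eqI[where ns = "map src hs"])
    fix xs assume xs: "xs \<in> tuples (map src hs)" "xs \<in> based_tuples (map src hs)"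
    note b = map2_dat_in_based_tuples[OF h xs(2)]
    have "map2 (\<lambda>h x. dat h x) (map2 (Comp Gamma_op) gs hs) xs
      = map2 (\<lambda>h x. dat h x) gs (map2 (\<lambda>h x. dat h x) hs xs)"
      using xs(2) C(3) len by (intro nth_equalityI) (simp_all add: based_tuples_nth)
    then have "dat (smash_gmor (map2 (Comp Gamma_op) gs hs)) (based_enc (map src hs) xs)
      = based_enc (map tgt gs) (map2 (\<lambda>h x. dat h x) gs (map2 (\<lambda>h x. dat h x) hs xs))"
      using smash_gmor_enc[OF c, of xs] xs unfolding s by simp
    also have "\<dots> = dat (smash_gmor gs) (dat (smash_gmor hs) (based_enc (map src hs) xs))"
      using smash_gmor_enc[OF g, of "map2 (\<lambda>h x. dat h x) hs xs"] b smash_gmor_enc[OF h xs(2)] unfolding st by simp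
    finally show "dat (smash_gmor (map2 (Comp Gamma_op) gs hs)) (based_enc (map src hs) xs)
      = dat (Comp Gamma_op (smash_gmor gs) (smash_gmor hs)) (based_enc (map src hs) xs)"
      using Gamma_op_Comp(3)[OF S] based_enc_le[OF xs(2)] by (simp add: smash_gmor_simps)
  qed (use Gamma_op_Comp[OF S] c in \<open>simp_all add: smash_gmor_Arr smash_gmor_simps s del: map_map\<close>)
qed

lemma smash_gmor_Ident: "smash_gmor (map (Ident Gamma_op) ns) = Ident Gamma_op (prod_list ns)"
proof (rule Gamma_op_tuple_eqI[where ns = ns])
  have i: "set (map (Ident Gamma_op) ns) \<subseteq> Arr Gamma_op" by (auto simp: Gamma_op_Ident)
  show "smash_gmor (map (Ident Gamma_op) ns) \<in> Arr Gamma_op" by (rule smash_gmor_Arr[OF i])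
  fix xs assume xs: "xs \<in> tuples ns" "xs \<in> based_tuples ns"
  have "map2 (\<lambda>h x. dat h x) (map (Ident Gamma_op) ns) xs = xs"
    using xs(2) by (intro nth_equalityI) (auto simp: based_tuples_nth Gamma_op_Ident)
  then show "dat (smash_gmor (map (Ident Gamma_op) ns)) (based_enc ns xs) = dat (Ident Gamma_op (prod_list ns)) (based_enc ns xs)"
    using smash_gmor_enc[OF i, of xs] xs based_enc_le[OF xs(2)] by (simp add: Gamma_op_Ident comp_def)
qed (simp_all add: smash_gmor_simps Gamma_op_Ident comp_def)

lemma reorder_gmor_id: "reorder_gmor id ns = Ident Gamma_op (prod_list ns)"
proof (rule Gamma_op_tuple_eqI[where ns = ns])
  fix xs assume xs: "xs \<in> tuples ns" "xs \<in> based_tuples ns"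
  then show "dat (reorder_gmor id ns) (based_enc ns xs) = dat (Ident Gamma_op (prod_list ns)) (based_enc ns xs)"
    using reorder_gmor_enc[of id ns xs] based_enc_le[OF xs(2)] by (simp add: Gamma_op_Ident permutes_id)
qed (simp_all add: reorder_gmor_simps Gamma_op_Ident reorder_gmor_Arr permutes_id)

lemma reorder_gmor_Comp:
  assumes s: "\<sigma> permutes {..<length ns}" and t: "\<tau> permutes {..<length ns}"
  shows "Comp Gamma_op (reorder_gmor \<tau> (permute_list \<sigma> ns)) (reorder_gmor \<sigma> ns) = reorder_gmor (\<sigma> \<circ> \<tau>) ns"
proof -
  have t': "\<tau> permutes {..<length (permute_list \<sigma> ns)}" using t by simp
  note c = permutes_compose[OF t s]
  have S: "reorder_gmor \<tau> (permute_list \<sigma> ns) \<in> Arr Gamma_op" "reorder_gmor \<sigma> ns \<in> Arr Gamma_op"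
    "src (reorder_gmor \<tau> (permute_list \<sigma> ns)) = tgt (reorder_gmor \<sigma> ns)"
    using s t' by (simp_all add: reorder_gmor_Arr reorder_gmor_simps prod_list_permute_list)
  show ?thesis
  proof (rule Gamma_op_tuple_eqI[where ns = ns])
    fix xs assume xs: "xs \<in> tuples ns" "xs \<in> based_tuples ns"
    then have l: "length xs = length ns" by (simp add: based_tuples_nth)
    show "dat (Comp Gamma_op (reorder_gmor \<tau> (permute_list \<sigma> ns)) (reorder_gmor \<sigma> ns)) (based_enc ns xs)
      = dat (reorder_gmor (\<sigma> \<circ> \<tau>) ns) (based_enc ns xs)"
      using Gamma_op_Comp(3)[OF S] based_enc_le[OF xs(2)] reorder_gmor_enc[OF s xs(2)] reorder_gmor_enc[OF c xs(2)]
        reorder_gmor_enc[OF t' permute_list_in_based_tuples[OF s xs(2)]] t l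
      by (simp add: reorder_gmor_simps permute_list_compose)
  qed (use Gamma_op_Comp[OF S] c s in \<open>simp_all add: reorder_gmor_Arr reorder_gmor_simps prod_list_permute_list\<close>)
qed

text \<open>Naturality of the symmetry: mapping the entries of a tuple commutes with permuting them.\<close>
lemma reorder_gmor_natural:
  assumes h: "set hs \<subseteq> Arr Gamma_op" and s: "\<sigma> permutes {..<length hs}"
  shows "Comp Gamma_op (reorder_gmor \<sigma> (map tgt hs)) (smash_gmor hs)
    = Comp Gamma_op (smash_gmor (permute_list \<sigma> hs)) (reorder_gmor \<sigma> (map src hs))"
proof -
  have s': "\<sigma> permutes {..<length (map tgt hs)}" "\<sigma> permutes {..<length (map src hs)}" using s by simp_all
  have p: "set (permute_list \<sigma> hs) \<subseteq> Arr Gamma_op" using h s by simp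
  have m: "map src (permute_list \<sigma> hs) = permute_list \<sigma> (map src hs)"
    "map tgt (permute_list \<sigma> hs) = permute_list \<sigma> (map tgt hs)" using s by (simp_all add: map_permute_list)
  have L: "reorder_gmor \<sigma> (map tgt hs) \<in> Arr Gamma_op" "smash_gmor hs \<in> Arr Gamma_op"
    "src (reorder_gmor \<sigma> (map tgt hs)) = tgt (smash_gmor hs)"
    using s h by (simp_all add: reorder_gmor_Arr smash_gmor_Arr reorder_gmor_simps smash_gmor_simps)
  have R: "smash_gmor (permute_list \<sigma> hs) \<in> Arr Gamma_op" "reorder_gmor \<sigma> (map src hs) \<in> Arr Gamma_op"
    "src (smash_gmor (permute_list \<sigma> hs)) = tgt (reorder_gmor \<sigma> (map src hs))"
    using s p s' by (simp_all add: reorder_gmor_Arr smash_gmor_Arr reorder_gmor_simps smash_gmor_simps m prod_list_permute_list)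
  show ?thesis
  proof (rule Gamma_op_tuple_eqI[where ns = "map src hs"])
    fix xs assume xs: "xs \<in> tuples (map src hs)" "xs \<in> based_tuples (map src hs)"
    have l: "length xs = length hs" using xs by (simp add: based_tuples_nth)
    have "dat (Comp Gamma_op (reorder_gmor \<sigma> (map tgt hs)) (smash_gmor hs)) (based_enc (map src hs) xs)
      = based_enc (permute_list \<sigma> (map tgt hs)) (permute_list \<sigma> (map2 (\<lambda>h x. dat h x) hs xs))"
      using Gamma_op_Comp(3)[OF L] based_enc_le[OF xs(2)] smash_gmor_enc[OF h xs(2)]
        reorder_gmor_enc[OF s'(1) map2_dat_in_based_tuples[OF h xs(2)]] by (simp add: smash_gmor_simps)
    also have "\<dots> = based_enc (map tgt (permute_list \<sigma> hs)) (map2 (\<lambda>h x. dat h x) (permute_list \<sigma> hs) (permute_list \<sigma> xs))"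
      using map2_permute_list[OF s, of xs "\<lambda>h x. dat h x"] l m by simp
    also have "\<dots> = dat (Comp Gamma_op (smash_gmor (permute_list \<sigma> hs)) (reorder_gmor \<sigma> (map src hs))) (based_enc (map src hs) xs)"
      using Gamma_op_Comp(3)[OF R] based_enc_le[OF xs(2)] reorder_gmor_enc[OF s'(2) xs(2)]
        smash_gmor_enc[OF p, of "permute_list \<sigma> xs"] permute_list_in_based_tuples[OF s'(2) xs(2)] m
      by (simp add: reorder_gmor_simps)
    finally show "dat (Comp Gamma_op (reorder_gmor \<sigma> (map tgt hs)) (smash_gmor hs)) (based_enc (map src hs) xs)
      = dat (Comp Gamma_op (smash_gmor (permute_list \<sigma> hs)) (reorder_gmor \<sigma> (map src hs))) (based_enc (map src hs) xs)" .
  qed (use Gamma_op_Comp[OF L] Gamma_op_Comp[OF R] m s in \<open>simp_all add: smash_gmor_simps reorder_gmor_simps prod_list_permute_list\<close>)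
qed

text \<open>Coherence of the symmetry, used for equivariance of composition in the outer morphism: permuting
  the blocks of a tuple is the same as permuting the numbers of the blocks.\<close>
lemma reorder_gmor_block_perm:
  assumes s: "\<sigma> permutes {..<length nss}"
  shows "reorder_gmor (block_perm \<sigma> (map length nss)) (concat nss) = reorder_gmor \<sigma> (map prod_list nss)"
proof (rule Gamma_op_tuple_eqI[where ns = "concat nss"])
  have s': "\<sigma> permutes {..<length (map length nss)}" "\<sigma> permutes {..<length (map prod_list nss)}" using s by simp_all
  have b: "block_perm \<sigma> (map length nss) permutes {..<length (concat nss)}"
    using block_perm_permutes[OF s'(1)] by (simp add: length_concat)
  show "reorder_gmor (block_perm \<sigma> (map length nss)) (concat nss) \<in> Arr Gamma_op"
    "reorder_gmor \<sigma> (map prod_list nss) \<in> Arr Gamma_op"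
    using b s'(2) by (simp_all only: reorder_gmor_Arr)
  fix xs assume xs: "xs \<in> tuples (concat nss)" "xs \<in> based_tuples (concat nss)"
  obtain xss where xss: "xs = concat xss" "length xss = length nss"
    "\<forall>i < length nss. xss ! i \<in> tuples (nss ! i)"
    by (rule obtain_tuple_blocks[OF xs(1)])
  have bt: "xss ! i \<in> based_tuples (nss ! i)" if "i < length nss" for i
    using based_enc_tuples[OF xss(3)[rule_format, OF that]] by blast
  have l: "list_all2 (\<lambda>xs ns. length xs = length ns) xss nss"
    using xss(2) bt by (auto simp: list_all2_conv_all_nth based_tuples_nth)
  then have ml: "map length xss = map length nss" by (auto simp: list_all2_conv_all_nth intro!: nth_equalityI)
  have lp: "list_all2 (\<lambda>xs ns. length xs = length ns) (permute_list \<sigma> xss) (permute_list \<sigma> nss)"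
    using l s xss(2) perm_less[OF s] by (auto simp: list_all2_conv_all_nth permute_list_nth)
  have e: "map2 based_enc nss xss \<in> based_tuples (map prod_list nss)"
    using bt xss(2) based_enc_le by (auto simp: based_tuples_nth)
  show "dat (reorder_gmor (block_perm \<sigma> (map length nss)) (concat nss)) (based_enc (concat nss) xs)
    = dat (reorder_gmor \<sigma> (map prod_list nss)) (based_enc (concat nss) xs)"
    unfolding reorder_gmor_enc[OF b xs(2)]
    unfolding xss(1) permute_list_block_perm[OF s'(1) refl] permute_list_block_perm[OF s'(1) ml]
      based_enc_concat[OF l] based_enc_concat[OF lp] reorder_gmor_enc[OF s'(2) e]
    using map2_permute_list[OF s xss(2), of based_enc] s by (simp add: map_permute_list)
qed (simp_all add: reorder_gmor_simps prod_list_concat)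

text \<open>Coherence of the symmetry, used for equivariance of composition in the inner morphisms: permuting
  within the blocks of a tuple is the smash product of the permutations of the single blocks.\<close>
lemma reorder_gmor_sum_perm:
  assumes t: "list_all2 (\<lambda>\<tau> ns. \<tau> permutes {..<length ns}) \<tau>s nss"
  shows "reorder_gmor (sum_perm \<tau>s (map length nss)) (concat nss) = smash_gmor (map2 reorder_gmor \<tau>s nss)"
proof (rule Gamma_op_tuple_eqI[where ns = "concat nss"])
  have t': "list_all2 (\<lambda>\<tau> n. \<tau> permutes {..<n}) \<tau>s (map length nss)" using t by (simp add: list_all2_map2)
  have lt: "length \<tau>s = length nss" using t by (rule list_all2_lengthD)
  have tn: "(\<tau>s ! i) permutes {..<length (nss ! i)}" if "i < length nss" for i
    using t that lt by (simp add: list_all2_conv_all_nth)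
  have b: "sum_perm \<tau>s (map length nss) permutes {..<length (concat nss)}"
    using sum_perm_permutes[OF t'] by (simp add: length_concat)
  have r: "set (map2 reorder_gmor \<tau>s nss) \<subseteq> Arr Gamma_op"
    using tn lt by (auto simp: set_zip intro!: reorder_gmor_Arr)
  have m: "map src (map2 reorder_gmor \<tau>s nss) = map prod_list nss" "map tgt (map2 reorder_gmor \<tau>s nss) = map prod_list nss"
    using lt by (auto intro!: nth_equalityI simp: reorder_gmor_simps)
  show "reorder_gmor (sum_perm \<tau>s (map length nss)) (concat nss) \<in> Arr Gamma_op" "smash_gmor (map2 reorder_gmor \<tau>s nss) \<in> Arr Gamma_op"
    by (simp_all only: reorder_gmor_Arr[OF b] smash_gmor_Arr[OF r])
  show "src (smash_gmor (map2 reorder_gmor \<tau>s nss)) = prod_list (concat nss)"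
    "tgt (reorder_gmor (sum_perm \<tau>s (map length nss)) (concat nss)) = tgt (smash_gmor (map2 reorder_gmor \<tau>s nss))"
    by (simp_all only: smash_gmor_simps reorder_gmor_simps m prod_list_concat)
  fix xs assume xs: "xs \<in> tuples (concat nss)" "xs \<in> based_tuples (concat nss)"
  obtain xss where xss: "xs = concat xss" "length xss = length nss"
    "\<forall>i < length nss. xss ! i \<in> tuples (nss ! i)"
    by (rule obtain_tuple_blocks[OF xs(1)])
  have bt: "xss ! i \<in> based_tuples (nss ! i)" if "i < length nss" for i
    using based_enc_tuples[OF xss(3)[rule_format, OF that]] by blast
  then have ll: "length (xss ! i) = length (nss ! i)" if "i < length nss" for i
    using that by (simp add: based_tuples_nth)
  have l: "list_all2 (\<lambda>xs ns. length xs = length ns) xss nss"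
    using xss(2) ll by (simp add: list_all2_conv_all_nth)
  then have ml: "map length xss = map length nss" by (auto simp: list_all2_conv_all_nth intro!: nth_equalityI)
  have lp: "list_all2 (\<lambda>xs ns. length xs = length ns) (map2 permute_list \<tau>s xss) (map2 permute_list \<tau>s nss)"
    using l lt xss(2) by (simp add: list_all2_conv_all_nth)
  have e: "map2 based_enc nss xss \<in> based_tuples (map src (map2 reorder_gmor \<tau>s nss))"
    unfolding m using bt xss(2) based_enc_le by (auto simp: based_tuples_nth)
  have "map prod_list (map2 permute_list \<tau>s nss) = map prod_list nss"
    using lt tn by (intro nth_equalityI) (simp_all add: prod_list_permute_list)
  moreover have "map2 based_enc (map2 permute_list \<tau>s nss) (map2 permute_list \<tau>s xss)
      = map2 (\<lambda>h x. dat h x) (map2 reorder_gmor \<tau>s nss) (map2 based_enc nss xss)"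
    using lt xss(2) tn bt by (intro nth_equalityI) (simp_all add: reorder_gmor_enc)
  moreover have "dat (smash_gmor (map2 reorder_gmor \<tau>s nss)) (based_enc (map prod_list nss) (map2 based_enc nss xss))
     = based_enc (map prod_list nss) (map2 (\<lambda>h x. dat h x) (map2 reorder_gmor \<tau>s nss) (map2 based_enc nss xss))"
    using smash_gmor_enc[OF r e] unfolding m .
  ultimately show "dat (reorder_gmor (sum_perm \<tau>s (map length nss)) (concat nss)) (based_enc (concat nss) xs)
    = dat (smash_gmor (map2 reorder_gmor \<tau>s nss)) (based_enc (concat nss) xs)"
    unfolding reorder_gmor_enc[OF b xs(2)]
    unfolding xss(1) permute_list_sum_perm[OF t' refl] permute_list_sum_perm[OF t' ml]
      based_enc_concat[OF l] based_enc_concat[OF lp] by simp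
qed (simp add: reorder_gmor_simps)

section \<open>Families natural under an action of based maps\<close>

text \<open>With \<open>car\<close> being \<open>Obj\<close> or \<open>Arr\<close>, these are the objects and the arrows of \<open>prod_at\<close>; see
  \<open>prod_at_sets\<close>. The parameter makes it possible to argue about both at once.\<close>
definition tuples_at ::
  "('c \<Rightarrow> 'e set) \<Rightarrow> (nat, 'x, 'c, 'y) ftor list \<Rightarrow> nat list \<Rightarrow> 'e list set" where
  "tuples_at car Xs ns = {xs. length xs = length Xs \<and> (\<forall>i < length Xs. xs ! i \<in> car (FO (Xs ! i) (ns ! i)))}"

lemma prod_at_sets:
  assumes "length ns = length Xs"
  shows "Obj (prod_at Xs ns) = tuples_at Obj Xs ns" "Arr (prod_at Xs ns) = tuples_at Arr Xs ns"
  using assms by (auto simp: prod_at_def tuples_at_def prod_cat_Obj prod_cat_Arr)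

lemma permute_list_inv:
  assumes "\<sigma> permutes {..<length xs}"
  shows "permute_list (inv \<sigma>) (permute_list \<sigma> xs) = xs" "permute_list \<sigma> (permute_list (inv \<sigma>) xs) = xs"
  using permute_list_compose[OF permutes_inv[OF assms], of \<sigma>] permute_list_compose[OF assms, of "inv \<sigma>"]
    permutes_inv_o[OF assms] by simp_all

lemma tuples_at_permute:
  assumes "\<sigma> permutes {..<length Xs}" "length ns = length Xs" "xs \<in> tuples_at car Xs ns"
  shows "permute_list \<sigma> xs \<in> tuples_at car (permute_list \<sigma> Xs) (permute_list \<sigma> ns)"
  using assms perm_less[OF assms(1)] by (auto simp: tuples_at_def permute_list_nth)

lemma obtain_permuted:
  assumes "\<sigma> permutes {..<length Xs}" "length ns = length Xs" "xs \<in> tuples_at car (permute_list \<sigma> Xs) ns"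
  obtains ns' xs' where "ns = permute_list \<sigma> ns'" "xs = permute_list \<sigma> xs'" "length ns' = length Xs"
    "xs' \<in> tuples_at car Xs ns'"
proof
  have l: "length xs = length Xs" using assms(3) by (simp add: tuples_at_def)
  have s: "\<sigma> permutes {..<length ns}" "\<sigma> permutes {..<length xs}" using assms l by simp_all
  show "ns = permute_list \<sigma> (permute_list (inv \<sigma>) ns)" "xs = permute_list \<sigma> (permute_list (inv \<sigma>) xs)"
    using permute_list_inv(2)[OF s(1)] permute_list_inv(2)[OF s(2)] by simp_all
  show "length (permute_list (inv \<sigma>) ns) = length Xs" using assms by simp
  have "inv \<sigma> permutes {..<length (permute_list \<sigma> Xs)}" using permutes_inv[OF assms(1)] by simp
  from tuples_at_permute[OF this _ assms(3)] show "permute_list (inv \<sigma>) xs \<in> tuples_at car Xs (permute_list (inv \<sigma>) ns)"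
    using assms(2) permute_list_inv(1)[OF assms(1)] by simp
qed

text \<open>The arguments of a composite \<open>\<gamma> \<circ> (\<phi>\<^sub>1, \<dots>, \<phi>\<^sub>s)\<close>, cut into those of the single \<open>\<phi>\<^sub>i\<close>: \<open>nss\<close> lists
  the numbers at which the factors are evaluated, and \<open>xss\<close> the objects or arrows.\<close>
definition blocks where
  "blocks car \<phi>s nss xss \<longleftrightarrow> length nss = length \<phi>s \<and> length xss = length \<phi>s \<and>
    (\<forall>i < length \<phi>s. length (nss ! i) = length (src (\<phi>s ! i)) \<and> xss ! i \<in> tuples_at car (src (\<phi>s ! i)) (nss ! i))"

lemma blocks_lengths:
  assumes "blocks car \<phi>s nss xss"
  shows "map length nss = map (\<lambda>\<phi>. length (src \<phi>)) \<phi>s" "map length xss = map (\<lambda>\<phi>. length (src \<phi>)) \<phi>s"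
  using assms by (auto simp: blocks_def tuples_at_def intro!: nth_equalityI)

lemma same_shape_offset:
  assumes "map length xss = map length yss"
  shows "sum_list (map length (take i xss)) = sum_list (map length (take i yss))"
  using assms by (metis take_map)

text \<open>This makes it possible to compute composites without \<open>chunks\<close>: all arguments are concatenations of
  blocks, for which \<open>chunks_concat\<close> applies.\<close>
lemma blocks_concat_iff:
  assumes m: "map length nss = map (\<lambda>\<phi>. length (src \<phi>)) \<phi>s" "map length xss = map (\<lambda>\<phi>. length (src \<phi>)) \<phi>s"
  shows "concat xss \<in> tuples_at car (concat (map src \<phi>s)) (concat nss) \<longleftrightarrow> blocks car \<phi>s nss xss"
proof -
  have l: "length nss = length \<phi>s" "length xss = length \<phi>s" using m by (metis length_map)+
  have li: "length (nss ! i) = length (src (\<phi>s ! i))" "length (xss ! i) = length (src (\<phi>s ! i))" if "i < length \<phi>s" for i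
    using m that l by (auto simp: list_eq_iff_nth_eq)
  have L: "length (concat xss) = length (concat (map src \<phi>s))" by (simp add: length_concat m comp_def)
  let ?o = "\<lambda>i. sum_list (map length (take i (map src \<phi>s)))"
  have o: "sum_list (map length (take i nss)) = ?o i" "sum_list (map length (take i xss)) = ?o i" for i
    by (rule same_shape_offset, simp add: m comp_def)+
  have n: "concat nss ! (?o i + j) = nss ! i ! j" "concat xss ! (?o i + j) = xss ! i ! j"
      "concat (map src \<phi>s) ! (?o i + j) = src (\<phi>s ! i) ! j" "?o i + j < length (concat (map src \<phi>s))"
    if "i < length \<phi>s" "j < length (src (\<phi>s ! i))" for i j
    using nth_concat_offset[of i nss j] nth_concat_offset[of i xss j] nth_concat_offset[of i "map src \<phi>s" j]
      offset_less[of i "map src \<phi>s" j] that l li o by simp_all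
  have "(\<forall>k < length (concat (map src \<phi>s)). P k) \<longleftrightarrow> (\<forall>i < length \<phi>s. \<forall>j < length (src (\<phi>s ! i)). P (?o i + j))" for P
  proof
    assume a: "\<forall>i < length \<phi>s. \<forall>j < length (src (\<phi>s ! i)). P (?o i + j)"
    show "\<forall>k < length (concat (map src \<phi>s)). P k"
    proof (intro allI impI)
      fix k assume "k < length (concat (map src \<phi>s))"
      then obtain i j where "i < length (map src \<phi>s)" "j < length (map src \<phi>s ! i)" "k = ?o i + j"
        by (rule obtain_offset)
      then show "P k" using a by simp
    qed
  qed (use n(4) in blast)
  note this[of "\<lambda>k. concat xss ! k \<in> car (FO (concat (map src \<phi>s) ! k) (concat nss ! k))"]
  moreover have "(\<forall>i < length \<phi>s. \<forall>j < length (src (\<phi>s ! i)).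
      concat xss ! (?o i + j) \<in> car (FO (concat (map src \<phi>s) ! (?o i + j)) (concat nss ! (?o i + j))))
    \<longleftrightarrow> (\<forall>i < length \<phi>s. \<forall>j < length (src (\<phi>s ! i)). xss ! i ! j \<in> car (FO (src (\<phi>s ! i) ! j) (nss ! i ! j)))"
    by (simp only: n cong: imp_cong)
  ultimately show ?thesis using L l li by (simp add: tuples_at_def blocks_def)
qed

lemma obtain_argument_blocks:
  assumes n: "map length nss = map (\<lambda>\<phi>. length (src \<phi>)) \<phi>s"
    and xs: "xs \<in> tuples_at car (concat (map src \<phi>s)) (concat nss)"
  obtains xss where "xs = concat xss" "blocks car \<phi>s nss xss"
proof -
  have "length xs = sum_list (map (\<lambda>\<phi>. length (src \<phi>)) \<phi>s)"
    using xs by (simp add: tuples_at_def length_concat comp_def)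
  then obtain xss where x: "xs = concat xss" "map length xss = map (\<lambda>\<phi>. length (src \<phi>)) \<phi>s"
    by (rule obtain_blocks)
  with xs blocks_concat_iff[OF n x(2)] that show ?thesis by blast
qed

lemma obtain_all_blocks:
  assumes n: "length ns = length (concat (map src \<phi>s))"
    and xs: "xs \<in> tuples_at car (concat (map src \<phi>s)) ns"
  obtains nss xss where "ns = concat nss" "xs = concat xss" "blocks car \<phi>s nss xss"
proof -
  have "length ns = sum_list (map (\<lambda>\<phi>. length (src \<phi>)) \<phi>s)"
    using n by (simp add: length_concat comp_def)
  then obtain nss where x: "ns = concat nss" "map length nss = map (\<lambda>\<phi>. length (src \<phi>)) \<phi>s"
    by (rule obtain_blocks)
  from obtain_argument_blocks[OF x(2)] xs x(1) that show ?thesis by metis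
qed

lemma chunks_nth:
  assumes "length xs = sum_list rs" "i < length rs"
  shows "length (chunks rs xs ! i) = rs ! i"
    and "j < rs ! i \<Longrightarrow> chunks rs xs ! i ! j = xs ! (sum_list (take i rs) + j)"
proof -
  obtain xss where x: "xs = concat xss" "map length xss = rs" using obtain_blocks[OF assms(1)] .
  have c: "chunks rs xs = xss" unfolding x(1) by (rule chunks_concat[OF x(2)])
  have l: "length xss = length rs" using x(2) by (metis length_map)
  show "length (chunks rs xs ! i) = rs ! i" unfolding c using x(2) assms(2) l by (metis nth_map)
  then show "chunks rs xs ! i ! j = xs ! (sum_list (take i rs) + j)" if "j < rs ! i"
    using nth_concat_offset[of i xss j] that assms(2) l c x by (metis take_map)
qed

text \<open>What a \<open>\<Gamma>\<close>-category and a based multifunctor out of \<open>\<nat>\<close> have in common: a sequence of based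
  categories on which based maps act functorially. The set \<open>ob\<close> is the set of objects of the
  multicategory to be constructed, and \<open>push\<close> is the parameter of \<open>fam_act\<close>, which has to be the
  action of the reordering bijections.\<close>
locale gamma_action =
  fixes ob :: "(nat, 'x, ('o, 'a) bcat, 'y) ftor set"
    and act :: "(nat, 'x, ('o, 'a) bcat, 'y) ftor \<Rightarrow> gmor \<Rightarrow> ('o, 'a, 'o, 'a) ftor"
    and push :: "(nat, 'x, ('o, 'a) bcat, 'y) ftor \<Rightarrow> (nat \<Rightarrow> nat) \<Rightarrow> nat list \<Rightarrow> ('o, 'a, 'o, 'a) ftor"
  assumes act_functor: "\<lbrakk>X \<in> ob; h \<in> Arr Gamma_op\<rbrakk> \<Longrightarrow> based_functor (FO X (src h)) (FO X (tgt h)) (act X h)"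
    and act_Ident: "X \<in> ob \<Longrightarrow> act X (Ident Gamma_op n) = fid (FO X n)"
    and act_Comp: "\<lbrakk>X \<in> ob; g \<in> Arr Gamma_op; h \<in> Arr Gamma_op; src g = tgt h\<rbrakk>
      \<Longrightarrow> act X (Comp Gamma_op g h) = fcomp (FO X (src h)) (act X g) (act X h)"
    and push_act: "\<lbrakk>X \<in> ob; \<sigma> permutes {..<length ns}\<rbrakk> \<Longrightarrow> push X \<sigma> ns = act X (reorder_gmor \<sigma> ns)"
begin

definition family :: "((nat, 'x, ('o, 'a) bcat, 'y) ftor, 'o, 'a) fmor \<Rightarrow> bool" where
  "family \<phi> \<longleftrightarrow> set (src \<phi>) \<subseteq> ob \<and> tgt \<phi> \<in> ob \<and> smash_family \<phi>"

definition natural_at :: "((nat, 'x, ('o, 'a) bcat, 'y) ftor, 'o, 'a) fmor \<Rightarrow> gmor list \<Rightarrow> bool" where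
  "natural_at \<phi> hs \<longleftrightarrow>
     (let S = prod_at (src \<phi>) (map src hs); Hs = map2 act (src \<phi>) hs
      in fcomp S (dat \<phi> (map tgt hs)) (mk_ftor S (map2 FO Hs) (map2 FA Hs))
         = fcomp S (act (tgt \<phi>) (smash_gmor hs)) (dat \<phi> (map src hs)))"

definition natural :: "((nat, 'x, ('o, 'a) bcat, 'y) ftor, 'o, 'a) fmor \<Rightarrow> bool" where
  "natural \<phi> \<longleftrightarrow> (\<forall>hs. length hs = length (src \<phi>) \<and> set hs \<subseteq> Arr Gamma_op \<longrightarrow> natural_at \<phi> hs)"

lemma based_value: "X \<in> ob \<Longrightarrow> based_category (FO X n)"
  using act_functor[of X "Ident Gamma_op n"] by (auto simp: Gamma_op_Ident based_functor_iff)

lemma category_value: "X \<in> ob \<Longrightarrow> category (FO X n)"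
  using based_value by (simp add: based_category_iff)

lemma based_values:
  "\<lbrakk>set Xs \<subseteq> ob; C \<in> set (map2 (\<lambda>X n. FO X n) Xs ns)\<rbrakk> \<Longrightarrow> based_category C"
  by (auto dest!: set_zip_leftD intro!: based_value)

lemma category_prod_at: "set Xs \<subseteq> ob \<Longrightarrow> category (prod_at Xs ns)"
  unfolding prod_at_def by (rule category_prod) (use based_values[of Xs] in \<open>auto simp: based_category_iff\<close>)

lemma family_component:
  assumes "family \<phi>" "length ns = length (src \<phi>)"
  shows "smash_functor (map2 (\<lambda>X n. FO X n) (src \<phi>) ns) (FO (tgt \<phi>) (prod_list ns)) (dat \<phi> ns)"
    "is_functor (prod_at (src \<phi>) ns) (FO (tgt \<phi>) (prod_list ns)) (dat \<phi> ns)"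
  using assms by (auto simp: family_def smash_family_def prod_at_def dest: smash_functor_functor)

lemma family_eqI:
  assumes "family \<phi>" "family \<psi>" "src \<phi> = src \<psi>" "tgt \<phi> = tgt \<psi>"
    and O: "\<And>ns xs. \<lbrakk>length ns = length (src \<phi>); xs \<in> tuples_at Obj (src \<phi>) ns\<rbrakk> \<Longrightarrow> FO (dat \<phi> ns) xs = FO (dat \<psi> ns) xs"
    and A: "\<And>ns xs. \<lbrakk>length ns = length (src \<phi>); xs \<in> tuples_at Arr (src \<phi>) ns\<rbrakk> \<Longrightarrow> FA (dat \<phi> ns) xs = FA (dat \<psi> ns) xs"
  shows "\<phi> = \<psi>"
proof -
  have "dat \<phi> ns = dat \<psi> ns" if l: "length ns = length (src \<phi>)" for ns
    using ftor_eqI[OF family_component(2)[OF assms(1) l] family_component(2)[OF assms(2), of ns, folded assms(3)]]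
      O[OF l] A[OF l] l assms(3) by (simp add: prod_at_sets)
  moreover have "dat \<phi> \<in> extensional {ns. length ns = length (src \<phi>)}" "dat \<psi> \<in> extensional {ns. length ns = length (src \<phi>)}"
    using assms(1-3) by (auto simp: family_def smash_family_def)
  ultimately have "dat \<phi> = dat \<psi>" by (intro extensionalityI) auto
  then show ?thesis using assms(3,4) by simp
qed

lemma functor_proj_at:
  assumes "set Xs \<subseteq> ob" "length ns = length Xs" "i < length Xs"
  shows "is_functor (prod_at Xs ns) (FO (Xs ! i) (ns ! i)) (mk_ftor (prod_at Xs ns) (\<lambda>xs. xs ! i) (\<lambda>us. us ! i))"
  using functor_proj[of "map2 (\<lambda>X n. FO X n) Xs ns" i] assms(2,3) based_values[OF assms(1), of _ ns]
  by (simp add: prod_at_def proj_ftor_def based_category_iff)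

lemma functor_into_prod_at:
  assumes "category C" "set Xs \<subseteq> ob" "length ns = length Xs"
    and "\<And>x. x \<in> Obj C \<Longrightarrow> length (u x) = length Xs" "\<And>f. f \<in> Arr C \<Longrightarrow> length (v f) = length Xs"
    and "\<And>i. i < length Xs \<Longrightarrow> is_functor C (FO (Xs ! i) (ns ! i)) (F i)"
    and "\<And>i x. \<lbrakk>i < length Xs; x \<in> Obj C\<rbrakk> \<Longrightarrow> u x ! i = FO (F i) x"
    and "\<And>i x. \<lbrakk>i < length Xs; x \<in> Arr C\<rbrakk> \<Longrightarrow> v x ! i = FA (F i) x"
  shows "is_functor C (prod_at Xs ns) (mk_ftor C u v)"
  unfolding prod_at_def
proof (rule functor_into_prod)
  fix i assume "i < length (map2 (\<lambda>X n. FO X n) Xs ns)"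
  then have i: "i < length Xs" by simp
  have "mk_ftor C (\<lambda>x. u x ! i) (\<lambda>x. v x ! i) = mk_ftor C (FO (F i)) (FA (F i))"
    by (rule mk_ftor_cong) (simp_all add: assms(7,8) i)
  also have "\<dots> = F i" by (rule functor_mk_ftor[OF assms(6)[OF i]])
  finally show "is_functor C (map2 (\<lambda>X n. FO X n) Xs ns ! i) (mk_ftor C (\<lambda>x. u x ! i) (\<lambda>x. v x ! i))"
    using assms(3) assms(6)[OF i] i by simp
qed (use assms(1,3-5) based_values[OF assms(2), of _ ns] in \<open>auto simp: based_category_iff\<close>)

lemma fam_comp_simps:
  "src (fam_comp \<gamma> \<phi>s) = concat (map src \<phi>s)" "tgt (fam_comp \<gamma> \<phi>s) = tgt \<gamma>"
  by (simp_all add: fam_comp_def Let_def)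

lemma fam_act_simps:
  "src (fam_act p \<sigma> \<phi>) = permute_list \<sigma> (src \<phi>)" "tgt (fam_act p \<sigma> \<phi>) = tgt \<phi>"
  by (simp_all add: fam_act_def Let_def)

lemma fam_unit_simps: "src (fam_unit X) = [X]" "tgt (fam_unit X) = X"
  by (simp_all add: fam_unit_def)

lemma family_unit:
  assumes "X \<in> ob" shows "family (fam_unit X)"
proof -
  have "smash_functor [FO X n] (FO X n) (proj_ftor [FO X n] 0)" for n
  proof -
    have "is_functor (prod_cat [FO X n]) (FO X n) (proj_ftor [FO X n] 0)"
      using functor_proj[of "[FO X n]" 0] category_value[OF assms] by simp
    then show ?thesis using based_value[OF assms]
      by (auto simp: smash_functor_iff proj_ftor_def less_Suc_eq)
  qed
  then show ?thesis using assms
    by (auto simp: family_def smash_family_def fam_unit_def length_Suc_conv)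
qed

lemma fam_comp_dat:
  assumes "length ns = length (concat (map src \<phi>s))"
  defines "rs \<equiv> map (\<lambda>\<phi>. length (src \<phi>)) \<phi>s" and "S \<equiv> prod_at (concat (map src \<phi>s)) ns"
  shows "dat (fam_comp \<gamma> \<phi>s) ns = mk_ftor S
    (\<lambda>xs. FO (dat \<gamma> (map prod_list (chunks rs ns))) (map2 FO (map2 (\<lambda>\<phi> ms. dat \<phi> ms) \<phi>s (chunks rs ns)) (chunks rs xs)))
    (\<lambda>us. FA (dat \<gamma> (map prod_list (chunks rs ns))) (map2 FA (map2 (\<lambda>\<phi> ms. dat \<phi> ms) \<phi>s (chunks rs ns)) (chunks rs us)))"
  using assms by (simp add: fam_comp_def Let_def)

lemma fam_act_dat:
  fixes \<sigma> :: "nat \<Rightarrow> nat"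
  assumes "length ns = length (src \<phi>)"
  defines "S \<equiv> prod_at (permute_list \<sigma> (src \<phi>)) ns" and "ns' \<equiv> permute_list (inv \<sigma>) ns"
  shows "dat (fam_act p \<sigma> \<phi>) ns = fcomp S (p (tgt \<phi>) \<sigma> ns')
    (fcomp S (dat \<phi> ns') (mk_ftor S (permute_list (inv \<sigma>)) (permute_list (inv \<sigma>))))"
  using assms by (simp add: fam_act_def Let_def)

text \<open>A composite is the composite of \<open>\<gamma>\<close> with the functor into a product whose \<open>i\<close>-th coordinate is \<open>\<phi>\<^sub>i\<close>
  after projecting to the \<open>i\<close>-th block. If one argument of \<open>\<phi>\<^sub>i\<close> is at the base point, then so is the
  \<open>i\<close>-th argument of \<open>\<gamma>\<close>.\<close>
lemma family_comp:
  assumes g: "family \<gamma>" and f: "\<And>\<phi>. \<phi> \<in> set \<phi>s \<Longrightarrow> family \<phi>" and t: "map tgt \<phi>s = src \<gamma>"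
  shows "family (fam_comp \<gamma> \<phi>s)"
proof -
  let ?Xs = "concat (map src \<phi>s)" and ?rs = "map (\<lambda>\<phi>. length (src \<phi>)) \<phi>s"
  have len: "length \<phi>s = length (src \<gamma>)" using t by (metis length_map)
  have fi: "family (\<phi>s ! i)" "tgt (\<phi>s ! i) = src \<gamma> ! i" if "i < length \<phi>s" for i
    using that f by (auto simp flip: t)
  have obX: "set ?Xs \<subseteq> ob" using f by (auto simp: family_def)
  have obg: "set (src \<gamma>) \<subseteq> ob" "tgt \<gamma> \<in> ob" using g by (auto simp: family_def)
  have "smash_functor (map2 (\<lambda>X n. FO X n) ?Xs ns) (FO (tgt \<gamma>) (prod_list ns)) (dat (fam_comp \<gamma> \<phi>s) ns)"
    if ns: "length ns = length ?Xs" for ns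
  proof -
    define nss where "nss = chunks ?rs ns"
    define S where "S = prod_at ?Xs ns"
    define Ns where "Ns = map prod_list nss"
    \<comment> \<open>The functor into the product of the values \<open>\<gamma>\<close> is applied to.\<close>
    define U where "U = mk_ftor S (\<lambda>xs. map2 FO (map2 (\<lambda>\<phi> ms. dat \<phi> ms) \<phi>s nss) (chunks ?rs xs))
      (\<lambda>us. map2 FA (map2 (\<lambda>\<phi> ms. dat \<phi> ms) \<phi>s nss) (chunks ?rs us))"
    have nl: "length ns = sum_list ?rs" using ns by (simp add: length_concat comp_def)
    have lns: "length nss = length \<phi>s" "length Ns = length (src \<gamma>)" by (simp_all add: nss_def Ns_def len)
    have ml: "map length nss = ?rs" "concat nss = ns"
      using map_length_chunks[OF nl] concat_chunks[OF nl] by (simp_all add: nss_def)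
    have cS: "category S" unfolding S_def by (rule category_prod_at[OF obX])
    have S: "Obj S = tuples_at Obj ?Xs ns" "Arr S = tuples_at Arr ?Xs ns"
      unfolding S_def by (rule prod_at_sets[OF ns])+
    have bl: "blocks Obj \<phi>s nss (chunks ?rs xs)" if "xs \<in> Obj S" for xs
    proof -
      have "length xs = sum_list ?rs" using that ns nl S by (simp add: tuples_at_def)
      then show ?thesis using blocks_concat_iff[OF ml(1), of "chunks ?rs xs" Obj] that S
        by (simp add: ml concat_chunks map_length_chunks)
    qed
    have bl': "blocks Arr \<phi>s nss (chunks ?rs xs)" if "xs \<in> Arr S" for xs
    proof -
      have "length xs = sum_list ?rs" using that ns nl S by (simp add: tuples_at_def)
      then show ?thesis using blocks_concat_iff[OF ml(1), of "chunks ?rs xs" Arr] that S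
        by (simp add: ml concat_chunks map_length_chunks)
    qed
    have li: "length (nss ! i) = length (src (\<phi>s ! i))" if "i < length \<phi>s" for i
      using ml(1) that lns by (auto simp: list_eq_iff_nth_eq)
    let ?o = "\<lambda>i. sum_list (take i ?rs)"
    have off: "?o i + j < length ?Xs" "?Xs ! (?o i + j) = src (\<phi>s ! i) ! j" "ns ! (?o i + j) = nss ! i ! j"
      if "i < length \<phi>s" "j < length (src (\<phi>s ! i))" for i j
      using offset_less[of i "map src \<phi>s" j] nth_concat_offset[of i "map src \<phi>s" j] nth_concat_offset[of i nss j] that lns li
      unfolding sum_list_take_length[symmetric] ml by (simp_all add: comp_def)
    have chunk: "is_functor S (prod_at (src (\<phi>s ! i)) (nss ! i)) (mk_ftor S (\<lambda>xs. chunks ?rs xs ! i) (\<lambda>xs. chunks ?rs xs ! i))"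
      if i: "i < length \<phi>s" for i
    proof (rule functor_into_prod_at[where F = "\<lambda>j. mk_ftor S (\<lambda>xs. xs ! (?o i + j)) (\<lambda>us. us ! (?o i + j))"])
      show "set (src (\<phi>s ! i)) \<subseteq> ob" using fi(1)[OF i] by (simp add: family_def)
      show "length (nss ! i) = length (src (\<phi>s ! i))" by (rule li[OF i])
      show "length (chunks ?rs xs ! i) = length (src (\<phi>s ! i))" if "xs \<in> Obj S" for xs
        using bl[OF that] i by (simp add: blocks_def tuples_at_def)
      show "length (chunks ?rs xs ! i) = length (src (\<phi>s ! i))" if "xs \<in> Arr S" for xs
        using bl'[OF that] i by (simp add: blocks_def tuples_at_def)
      fix j assume j: "j < length (src (\<phi>s ! i))"
      show "is_functor S (FO (src (\<phi>s ! i) ! j) (nss ! i ! j)) (mk_ftor S (\<lambda>xs. xs ! (?o i + j)) (\<lambda>us. us ! (?o i + j)))"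
        using functor_proj_at[OF obX ns off(1)[OF i j]] unfolding S_def off[OF i j] .
      show "chunks ?rs xs ! i ! j = FO (mk_ftor S (\<lambda>xs. xs ! (?o i + j)) (\<lambda>us. us ! (?o i + j))) xs" if "xs \<in> Obj S" for xs
        using chunks_nth(2)[of xs ?rs i j] i j that nl ns S by (simp add: tuples_at_def)
      show "chunks ?rs xs ! i ! j = FA (mk_ftor S (\<lambda>xs. xs ! (?o i + j)) (\<lambda>us. us ! (?o i + j))) xs" if "xs \<in> Arr S" for xs
        using chunks_nth(2)[of xs ?rs i j] i j that nl ns S by (simp add: tuples_at_def)
    qed (rule cS)
    have U: "is_functor S (prod_at (src \<gamma>) Ns) U" unfolding U_def
    proof (rule functor_into_prod_at[where F = "\<lambda>i. fcomp S (dat (\<phi>s ! i) (nss ! i)) (mk_ftor S (\<lambda>xs. chunks ?rs xs ! i) (\<lambda>xs. chunks ?rs xs ! i))"])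
      fix i assume "i < length (src \<gamma>)"
      then have i: "i < length \<phi>s" using len by simp
      have "is_functor (prod_at (src (\<phi>s ! i)) (nss ! i)) (FO (src \<gamma> ! i) (Ns ! i)) (dat (\<phi>s ! i) (nss ! i))"
        using family_component(2)[OF fi(1)[OF i] li[OF i]] fi(2)[OF i] i lns by (simp add: Ns_def)
      then show "is_functor S (FO (src \<gamma> ! i) (Ns ! i)) (fcomp S (dat (\<phi>s ! i) (nss ! i)) (mk_ftor S (\<lambda>xs. chunks ?rs xs ! i) (\<lambda>xs. chunks ?rs xs ! i)))"
        by (rule functor_fcomp[OF chunk[OF i]])
    qed (use cS obg lns len in simp_all)
    have dat: "dat (fam_comp \<gamma> \<phi>s) ns = fcomp S (dat \<gamma> Ns) U"
      unfolding fcomp_def fam_comp_dat[OF ns] U_def S_def[symmetric] nss_def[symmetric] Ns_def[symmetric]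
      by (rule mk_ftor_cong) simp_all
    have P: "prod_list Ns = prod_list ns" by (simp add: Ns_def prod_list_concat ml(2)[symmetric])
    have F: "is_functor S (FO (tgt \<gamma>) (prod_list ns)) (fcomp S (dat \<gamma> Ns) U)"
      using functor_fcomp[OF U family_component(2)[OF g lns(2)]] P by simp
    have split: "\<exists>i j. i < length \<phi>s \<and> j < length (src (\<phi>s ! i)) \<and> k = ?o i + j" if k: "k < length ?Xs" for k
    proof -
      obtain i j where "i < length (map src \<phi>s)" "j < length (map src \<phi>s ! i)" "k = sum_list (map length (take i (map src \<phi>s))) + j"
        by (rule obtain_offset[OF k])
      then show ?thesis unfolding sum_list_take_length[symmetric] by (auto simp: comp_def)
    qed
    show ?thesis unfolding smash_functor_iff dat prod_at_def[symmetric] S_def[symmetric]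
    proof (intro conjI allI impI)
      show "\<forall>C \<in> set (map2 (\<lambda>X n. FO X n) ?Xs ns). based_category C"
        using based_values[OF obX] by blast
      show "FO (fcomp S (dat \<gamma> Ns) U) xs = Base (FO (tgt \<gamma>) (prod_list ns))"
        if xs: "xs \<in> Obj S" and k: "k < length (map2 (\<lambda>X n. FO X n) ?Xs ns)" "xs ! k = Base (map2 (\<lambda>X n. FO X n) ?Xs ns ! k)" for xs k
      proof -
        have k': "k < length ?Xs" using k by simp
        obtain i j where ij: "i < length \<phi>s" "j < length (src (\<phi>s ! i))" "k = ?o i + j" using split[OF k'] by blast
        have xl: "length xs = sum_list ?rs" using xs ns nl S by (simp add: tuples_at_def)
        have "chunks ?rs xs ! i ! j = Base (FO (src (\<phi>s ! i) ! j) (nss ! i ! j))"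
          using k ns chunks_nth(2)[OF xl, of i j] ij off[OF ij(1,2)] by simp
        moreover have "chunks ?rs xs ! i \<in> Obj (prod_at (src (\<phi>s ! i)) (nss ! i))"
          using bl[OF xs] ij li by (simp add: blocks_def prod_at_sets)
        ultimately have "FO (dat (\<phi>s ! i) (nss ! i)) (chunks ?rs xs ! i) = Base (FO (src \<gamma> ! i) (Ns ! i))"
          using family_component(1)[OF fi(1) li, OF ij(1,1)] ij li fi(2) lns
          by (auto simp: smash_functor_iff prod_at_def Ns_def)
        then have "FO U xs ! i = Base (FO (src \<gamma> ! i) (Ns ! i))" using xs ij lns by (simp add: U_def)
        moreover have "FO U xs \<in> Obj (prod_at (src \<gamma>) Ns)" using functor_closed(1)[OF U xs] .
        ultimately show ?thesis
          using family_component(1)[OF g lns(2)] xs ij lns len P by (auto simp: smash_functor_iff prod_at_def)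
      qed
      show "FA (fcomp S (dat \<gamma> Ns) U) xs = Ident (FO (tgt \<gamma>) (prod_list ns)) (Base (FO (tgt \<gamma>) (prod_list ns)))"
        if xs: "xs \<in> Arr S" and k: "k < length (map2 (\<lambda>X n. FO X n) ?Xs ns)"
          "xs ! k = Ident (map2 (\<lambda>X n. FO X n) ?Xs ns ! k) (Base (map2 (\<lambda>X n. FO X n) ?Xs ns ! k))" for xs k
      proof -
        have k': "k < length ?Xs" using k by simp
        obtain i j where ij: "i < length \<phi>s" "j < length (src (\<phi>s ! i))" "k = ?o i + j" using split[OF k'] by blast
        have xl: "length xs = sum_list ?rs" using xs ns nl S by (simp add: tuples_at_def)
        have "chunks ?rs xs ! i ! j = Ident (FO (src (\<phi>s ! i) ! j) (nss ! i ! j)) (Base (FO (src (\<phi>s ! i) ! j) (nss ! i ! j)))"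
          using k ns chunks_nth(2)[OF xl, of i j] ij off[OF ij(1,2)] by simp
        moreover have "chunks ?rs xs ! i \<in> Arr (prod_at (src (\<phi>s ! i)) (nss ! i))"
          using bl'[OF xs] ij li by (simp add: blocks_def prod_at_sets)
        ultimately have "FA (dat (\<phi>s ! i) (nss ! i)) (chunks ?rs xs ! i) = Ident (FO (src \<gamma> ! i) (Ns ! i)) (Base (FO (src \<gamma> ! i) (Ns ! i)))"
          using family_component(1)[OF fi(1) li, OF ij(1,1)] ij li fi(2) lns
          by (auto simp: smash_functor_iff prod_at_def Ns_def)
        then have "FA U xs ! i = Ident (FO (src \<gamma> ! i) (Ns ! i)) (Base (FO (src \<gamma> ! i) (Ns ! i)))"
          using xs ij lns by (simp add: U_def)
        moreover have "FA U xs \<in> Arr (prod_at (src \<gamma>) Ns)" using functor_closed(2)[OF U xs] .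
        ultimately show ?thesis
          using family_component(1)[OF g lns(2)] xs ij lns len P by (auto simp: smash_functor_iff prod_at_def)
      qed
    qed (use F obg based_value in auto)
  qed
  moreover have "dat (fam_comp \<gamma> \<phi>s) \<in> extensional {ns. length ns = length (concat (map src \<phi>s))}"
    by (simp add: fam_comp_def Let_def)
  ultimately show ?thesis using obX obg by (simp add: family_def smash_family_def fam_comp_simps)
qed

text \<open>The three functors composed here are a permutation of factors, the given family and the action of a
  based map, and the last one preserves base points.\<close>
lemma family_act:
  assumes f: "family \<phi>" and s: "\<sigma> permutes {..<length (src \<phi>)}"
  shows "family (fam_act push \<sigma> \<phi>)"
proof -
  let ?Xs = "permute_list \<sigma> (src \<phi>)"
  have obX: "set ?Xs \<subseteq> ob" "set (src \<phi>) \<subseteq> ob" "tgt \<phi> \<in> ob" using f s by (auto simp: family_def)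
  have "smash_functor (map2 (\<lambda>X n. FO X n) ?Xs ns) (FO (tgt \<phi>) (prod_list ns)) (dat (fam_act push \<sigma> \<phi>) ns)"
    if l: "length ns = length (src \<phi>)" for ns
  proof -
    have ns: "length ns = length ?Xs" using l by simp
    define ns' where "ns' = permute_list (inv \<sigma>) ns"
    define S where "S = prod_at ?Xs ns"
    define U where "U = mk_ftor S (permute_list (inv \<sigma>)) (permute_list (inv \<sigma>))"
    note i = inv_less[OF s]
    have si: "inv \<sigma> permutes {..<length ns}" using permutes_inv[OF s] l by simp
    have l': "length ns' = length (src \<phi>)" by (simp add: ns'_def l)
    have P: "prod_list ns' = prod_list ns" unfolding ns'_def by (rule prod_list_permute_list[OF si])
    have S: "Obj S = tuples_at Obj ?Xs ns" "Arr S = tuples_at Arr ?Xs ns"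
      unfolding S_def by (rule prod_at_sets[OF ns])+
    have Xi: "?Xs ! inv \<sigma> k = src \<phi> ! k" "ns' ! k = ns ! inv \<sigma> k" if "k < length (src \<phi>)" for k
      using i[OF that] s si that l permutes_inverses(1)[OF s] by (simp_all add: permute_list_nth ns'_def)
    have nth: "permute_list (inv \<sigma>) xs ! k = xs ! inv \<sigma> k" if "length xs = length (src \<phi>)" "k < length (src \<phi>)" for k and xs :: "'c list"
      using that permutes_inv[OF s] by (simp add: permute_list_nth)
    have U: "is_functor S (prod_at (src \<phi>) ns') U" unfolding U_def
    proof (rule functor_into_prod_at[where F = "\<lambda>k. mk_ftor S (\<lambda>xs. xs ! inv \<sigma> k) (\<lambda>xs. xs ! inv \<sigma> k)"])
      fix k assume k: "k < length (src \<phi>)"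
      show "is_functor S (FO (src \<phi> ! k) (ns' ! k)) (mk_ftor S (\<lambda>xs. xs ! inv \<sigma> k) (\<lambda>xs. xs ! inv \<sigma> k))"
        using functor_proj_at[OF obX(1) ns, of "inv \<sigma> k"] i[OF k] Xi[OF k] by (simp add: S_def)
    qed (use S obX l' category_prod_at[OF obX(1), of ns] in \<open>simp_all add: nth S_def tuples_at_def\<close>)
    note pf = push_act[OF obX(3), of \<sigma> ns']
    have pb: "based_functor (FO (tgt \<phi>) (prod_list ns')) (FO (tgt \<phi>) (prod_list ns)) (push (tgt \<phi>) \<sigma> ns')"
      using act_functor[OF obX(3) reorder_gmor_Arr, of \<sigma> ns'] pf s l' P by (simp add: reorder_gmor_simps)
    then have pF: "is_functor (FO (tgt \<phi>) (prod_list ns')) (FO (tgt \<phi>) (prod_list ns)) (push (tgt \<phi>) \<sigma> ns')"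
      and pB: "FO (push (tgt \<phi>) \<sigma> ns') (Base (FO (tgt \<phi>) (prod_list ns'))) = Base (FO (tgt \<phi>) (prod_list ns))"
      by (simp_all add: based_functor_iff)
    have bO: "Base (FO (tgt \<phi>) (prod_list ns')) \<in> Obj (FO (tgt \<phi>) (prod_list ns'))"
      using based_value[OF obX(3)] by (simp add: based_category_iff)
    have pI: "FA (push (tgt \<phi>) \<sigma> ns') (Ident (FO (tgt \<phi>) (prod_list ns')) (Base (FO (tgt \<phi>) (prod_list ns'))))
      = Ident (FO (tgt \<phi>) (prod_list ns)) (Base (FO (tgt \<phi>) (prod_list ns)))"
      using is_functor.FA_Ident[OF pF bO] pB by simp
    have dat: "dat (fam_act push \<sigma> \<phi>) ns = fcomp S (push (tgt \<phi>) \<sigma> ns') (fcomp S (dat \<phi> ns') U)"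
      using fam_act_dat[OF l, of push \<sigma>] by (simp add: S_def ns'_def U_def)
    have F: "is_functor S (FO (tgt \<phi>) (prod_list ns)) (fcomp S (push (tgt \<phi>) \<sigma> ns') (fcomp S (dat \<phi> ns') U))"
      by (rule functor_fcomp[OF functor_fcomp[OF U family_component(2)[OF f l']] pF])
    note c = family_component(1)[OF f l']
    show ?thesis unfolding smash_functor_iff dat prod_at_def[symmetric] S_def[symmetric]
    proof (intro conjI allI impI)
      show "\<forall>C \<in> set (map2 (\<lambda>X n. FO X n) ?Xs ns). based_category C"
        using based_values[OF obX(1)] by blast
      fix xs k assume "k < length (map2 (\<lambda>X n. FO X n) ?Xs ns)"
      then have k: "k < length (src \<phi>)" by simp
      have sk: "\<sigma> k < length (src \<phi>)" using perm_less[OF s k] .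
      have v: "map2 (\<lambda>X n. FO X n) ?Xs ns ! k = FO (src \<phi> ! \<sigma> k) (ns' ! \<sigma> k)"
        using k sk Xi[OF sk] permutes_inverses(2)[OF s] l by simp
      {
        assume xs: "xs \<in> Obj S" and b: "xs ! k = Base (map2 (\<lambda>X n. FO X n) ?Xs ns ! k)"
        have "FO U xs ! \<sigma> k = Base (FO (src \<phi> ! \<sigma> k) (ns' ! \<sigma> k))"
          using nth[of xs "\<sigma> k"] sk b xs S permutes_inverses(2)[OF s] unfolding v by (simp add: U_def tuples_at_def)
        then have "FO (dat \<phi> ns') (FO U xs) = Base (FO (tgt \<phi>) (prod_list ns'))"
          using c functor_closed(1)[OF U xs] sk l' by (auto simp: smash_functor_iff prod_at_def)
        then show "FO (fcomp S (push (tgt \<phi>) \<sigma> ns') (fcomp S (dat \<phi> ns') U)) xs = Base (FO (tgt \<phi>) (prod_list ns))"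
          using xs pB by simp
      next
        assume xs: "xs \<in> Arr S" and b: "xs ! k = Ident (map2 (\<lambda>X n. FO X n) ?Xs ns ! k) (Base (map2 (\<lambda>X n. FO X n) ?Xs ns ! k))"
        have "FA U xs ! \<sigma> k = Ident (FO (src \<phi> ! \<sigma> k) (ns' ! \<sigma> k)) (Base (FO (src \<phi> ! \<sigma> k) (ns' ! \<sigma> k)))"
          using nth[of xs "\<sigma> k"] sk b xs S permutes_inverses(2)[OF s] unfolding v by (simp add: U_def tuples_at_def)
        then have "FA (dat \<phi> ns') (FA U xs) = Ident (FO (tgt \<phi>) (prod_list ns')) (Base (FO (tgt \<phi>) (prod_list ns')))"
          using c functor_closed(2)[OF U xs] sk l' by (auto simp: smash_functor_iff prod_at_def)
        then show "FA (fcomp S (push (tgt \<phi>) \<sigma> ns') (fcomp S (dat \<phi> ns') U)) xs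
            = Ident (FO (tgt \<phi>) (prod_list ns)) (Base (FO (tgt \<phi>) (prod_list ns)))"
          using xs pI by simp
      }
    qed (use F obX based_value in auto)
  qed
  moreover have "dat (fam_act push \<sigma> \<phi>) \<in> extensional {ns. length ns = length (src \<phi>)}"
    by (simp add: fam_act_def Let_def)
  ultimately show ?thesis using obX s by (simp add: family_def smash_family_def fam_act_simps)
qed

end

section \<open>Values of units, composites and permuted families\<close>

lemma concat_concat: "concat (concat xsss) = concat (map concat xsss)"
  by (induction xsss) auto

text \<open>The tuple that \<open>fam_comp\<close> passes to the outer family; \<open>l\<close> stands for \<open>FO\<close> or \<open>FA\<close>.\<close>
abbreviation apply_each where
  "apply_each l \<phi>s nss xss \<equiv> map2 l (map2 (\<lambda>\<phi> ms. dat \<phi> ms) \<phi>s nss) xss"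

text \<open>A functor consists of a map of objects and a map of arrows, and units, composition and permutation of
  families treat both in the same way. This locale isolates one of them, so that each equation is
  computed once: \<open>(l, u, car)\<close> is \<open>(FO, FO, Obj)\<close> or \<open>(FA, FA, Arr)\<close>. The selector occurs twice, as
  \<open>l\<close> for functors out of a product and as \<open>u\<close> for functors between the values of objects, because
  these have different types.\<close>
locale gamma_action_part = gamma_action ob act push
  for ob :: "(nat, 'x, ('o, 'a) bcat, 'y) ftor set" and act and push +
  fixes l :: "('o list, 'a list, 'o, 'a) ftor \<Rightarrow> 'e list \<Rightarrow> 'e"
    and u :: "('o, 'a, 'o, 'a) ftor \<Rightarrow> 'e \<Rightarrow> 'e"
    and car :: "('o, 'a) bcat \<Rightarrow> 'e set"
  assumes l_closed: "\<lbrakk>family \<phi>; length ns = length (src \<phi>); xs \<in> tuples_at car (src \<phi>) ns\<rbrakk>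
      \<Longrightarrow> l (dat \<phi> ns) xs \<in> car (FO (tgt \<phi>) (prod_list ns))"
    and u_Ident: "\<lbrakk>X \<in> ob; x \<in> car (FO X n)\<rbrakk> \<Longrightarrow> u (act X (Ident Gamma_op n)) x = x"
    and u_Comp: "\<lbrakk>X \<in> ob; g \<in> Arr Gamma_op; h \<in> Arr Gamma_op; src g = tgt h; x \<in> car (FO X (src h))\<rbrakk>
      \<Longrightarrow> u (act X (Comp Gamma_op g h)) x = u (act X g) (u (act X h) x)"
    and u_closed: "\<lbrakk>X \<in> ob; h \<in> Arr Gamma_op; x \<in> car (FO X (src h))\<rbrakk> \<Longrightarrow> u (act X h) x \<in> car (FO X (tgt h))"
    and l_natural: "\<lbrakk>natural \<phi>; length hs = length (src \<phi>); set hs \<subseteq> Arr Gamma_op; xs \<in> tuples_at car (src \<phi>) (map src hs)\<rbrakk>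
      \<Longrightarrow> l (dat \<phi> (map tgt hs)) (map2 u (map2 act (src \<phi>) hs) xs)
        = u (act (tgt \<phi>) (smash_gmor hs)) (l (dat \<phi> (map src hs)) xs)"
    and l_unit: "\<lbrakk>X \<in> ob; x \<in> car (FO X n)\<rbrakk> \<Longrightarrow> l (dat (fam_unit X) [n]) [x] = x"
    and l_comp: "\<lbrakk>length ns = length (concat (map src (\<phi>s :: ((nat, 'x, ('o, 'a) bcat, 'y) ftor, 'o, 'a) fmor list))); xs \<in> tuples_at car (concat (map src \<phi>s)) ns\<rbrakk>
      \<Longrightarrow> l (dat (fam_comp \<gamma> \<phi>s) ns) xs
        = l (dat \<gamma> (map prod_list (chunks (map (\<lambda>\<phi>. length (src \<phi>)) \<phi>s) ns)))
            (apply_each l \<phi>s (chunks (map (\<lambda>\<phi>. length (src \<phi>)) \<phi>s) ns) (chunks (map (\<lambda>\<phi>. length (src \<phi>)) \<phi>s) xs))"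
    and l_act: "\<lbrakk>length ns = length (src \<phi>); xs \<in> tuples_at car (permute_list \<sigma> (src \<phi>)) ns\<rbrakk>
      \<Longrightarrow> l (dat (fam_act push \<sigma> \<phi>) ns) xs
        = u (push (tgt \<phi>) \<sigma> (permute_list (inv \<sigma>) ns)) (l (dat \<phi> (permute_list (inv \<sigma>) ns)) (permute_list (inv \<sigma>) xs))"
begin

lemma comp_value:
  fixes \<gamma> :: "((nat, 'x, ('o, 'a) bcat, 'y) ftor, 'o, 'a) fmor"
  assumes "blocks car \<phi>s nss xss"
  shows "l (dat (fam_comp \<gamma> \<phi>s) (concat nss)) (concat xss) = l (dat \<gamma> (map prod_list nss)) (apply_each l \<phi>s nss xss)"
proof -
  note b = blocks_lengths[OF assms]
  have "concat xss \<in> tuples_at car (concat (map src \<phi>s)) (concat nss)" using blocks_concat_iff[OF b] assms by blast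
  moreover have "length (concat nss) = length (concat (map src \<phi>s))" by (simp add: length_concat b comp_def)
  ultimately show ?thesis using l_comp[of "concat nss" \<phi>s "concat xss" \<gamma>]
    by (simp only: chunks_concat[OF b(1)] chunks_concat[OF b(2)])
qed

lemma act_value:
  assumes "family \<phi>" "\<sigma> permutes {..<length (src \<phi>)}" "length ns = length (src \<phi>)" "xs \<in> tuples_at car (src \<phi>) ns"
  shows "l (dat (fam_act push \<sigma> \<phi>) (permute_list \<sigma> ns)) (permute_list \<sigma> xs)
    = u (act (tgt \<phi>) (reorder_gmor \<sigma> ns)) (l (dat \<phi> ns) xs)"
proof -
  have "length xs = length (src \<phi>)" "tgt \<phi> \<in> ob" using assms by (auto simp: tuples_at_def family_def)
  then show ?thesis
    using l_act[of "permute_list \<sigma> ns" \<phi> "permute_list \<sigma> xs" \<sigma>] assms tuples_at_permute[OF assms(2-4)]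
      permute_list_inv(1)[of \<sigma> ns] permute_list_inv(1)[of \<sigma> xs] push_act[of "tgt \<phi>" \<sigma> ns] by simp
qed

lemma apply_each_closed:
  assumes "\<And>\<phi>. \<phi> \<in> set \<phi>s \<Longrightarrow> family \<phi>" "map tgt \<phi>s = Ys" "blocks car \<phi>s nss xss"
  shows "apply_each l \<phi>s nss xss \<in> tuples_at car Ys (map prod_list nss)"
proof -
  have "l (dat (\<phi>s ! i) (nss ! i)) (xss ! i) \<in> car (FO (tgt (\<phi>s ! i)) (prod_list (nss ! i)))" if "i < length \<phi>s" for i
    using assms(1)[OF nth_mem[OF that]] assms(3) that by (intro l_closed) (simp_all add: blocks_def)
  then show ?thesis using assms(3) unfolding assms(2)[symmetric] by (simp add: tuples_at_def blocks_def)
qed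

text \<open>By naturality of the \<open>\<phi>\<^sub>i\<close> and then of \<open>\<gamma>\<close> for the smash products of the blocks of \<open>hs\<close>, whose smash
  product is that of \<open>hs\<close>.\<close>
lemma comp_natural:
  assumes g: "family \<gamma>" "natural \<gamma>" and f: "\<And>\<phi>. \<phi> \<in> set \<phi>s \<Longrightarrow> family \<phi> \<and> natural \<phi>" and t: "map tgt \<phi>s = src \<gamma>"
    and hs: "length hs = length (concat (map src \<phi>s))" "set hs \<subseteq> Arr Gamma_op"
    and xs: "xs \<in> tuples_at car (concat (map src \<phi>s)) (map src hs)"
  shows "l (dat (fam_comp \<gamma> \<phi>s) (map tgt hs)) (map2 u (map2 act (concat (map src \<phi>s)) hs) xs)
    = u (act (tgt \<gamma>) (smash_gmor hs)) (l (dat (fam_comp \<gamma> \<phi>s) (map src hs)) xs)"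
proof -
  let ?rs = "map (\<lambda>\<phi>. length (src \<phi>)) \<phi>s"
  have len: "length (src \<gamma>) = length \<phi>s" using t by (metis length_map)
  have "length hs = sum_list ?rs" using hs by (simp add: length_concat comp_def)
  then obtain hss where h: "hs = concat hss" "map length hss = ?rs" by (rule obtain_blocks)
  have lh: "length hss = length \<phi>s" using h(2) by (metis length_map)
  have lhi: "length (hss ! i) = length (src (\<phi>s ! i))" if "i < length \<phi>s" for i
    using h(2) lh that by (auto simp: list_eq_iff_nth_eq)
  have hi: "set (hss ! i) \<subseteq> Arr Gamma_op" if "i < length \<phi>s" for i
  proof -
    have "hss ! i \<in> set hss" using that lh by simp
    then have "set (hss ! i) \<subseteq> set (concat hss)" by auto
    then show ?thesis using hs(2) h(1) by blast
  qed
  have fi: "family (\<phi>s ! i)" "natural (\<phi>s ! i)" "tgt (\<phi>s ! i) = src \<gamma> ! i" if "i < length \<phi>s" for i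
    using f that by (auto simp flip: t)
  have obi: "set (src (\<phi>s ! i)) \<subseteq> ob" if "i < length \<phi>s" for i using fi(1)[OF that] by (simp add: family_def)
  let ?sss = "map (map src) hss" and ?tss = "map (map tgt) hss"
  have st: "map src hs = concat ?sss" "map tgt hs = concat ?tss" by (simp_all add: h(1) map_concat)
  have "map length ?sss = ?rs" by (simp add: h(2)[symmetric] comp_def)
  then obtain xss where x: "xs = concat xss" "blocks car \<phi>s ?sss xss"
    using xs unfolding st by (rule obtain_argument_blocks)
  have lx: "length xss = length \<phi>s" and lxi: "i < length \<phi>s \<Longrightarrow> length (xss ! i) = length (src (\<phi>s ! i))"
    and xi: "i < length \<phi>s \<Longrightarrow> xss ! i \<in> tuples_at car (src (\<phi>s ! i)) (map src (hss ! i))" for i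
    using x(2) lh by (auto simp: blocks_def tuples_at_def)
  \<comment> \<open>The arguments after applying \<open>hs\<close>, block by block.\<close>
  define zss where "zss = map2 (\<lambda>(\<phi>, hs) xs. map2 u (map2 act (src \<phi>) hs) xs) (zip \<phi>s hss) xss"
  have zi: "zss ! i = map2 u (map2 act (src (\<phi>s ! i)) (hss ! i)) (xss ! i)" if "i < length \<phi>s" for i
    using that lh lx by (simp add: zss_def)
  have lz: "length zss = length \<phi>s" by (simp add: zss_def lh lx)
  have "map2 act (concat (map src \<phi>s)) (concat hss) = concat (map2 (map2 act) (map src \<phi>s) hss)"
    using lh lhi by (intro map2_concat) (simp add: list_all2_conv_all_nth)
  moreover have "map2 u (concat (map2 (map2 act) (map src \<phi>s) hss)) (concat xss)
      = concat (map2 (map2 u) (map2 (map2 act) (map src \<phi>s) hss) xss)"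
    using lh lhi lx lxi by (intro map2_concat) (simp add: list_all2_conv_all_nth)
  moreover have "map2 (map2 u) (map2 (map2 act) (map src \<phi>s) hss) xss = zss"
    using lh lx lz zi by (intro nth_equalityI) simp_all
  ultimately have Z: "map2 u (map2 act (concat (map src \<phi>s)) hs) xs = concat zss" by (simp add: h(1) x(1))
  have bz: "blocks car \<phi>s ?tss zss" unfolding blocks_def
  proof (intro conjI allI impI)
    fix i assume i: "i < length \<phi>s"
    have "u (act (src (\<phi>s ! i) ! j) (hss ! i ! j)) (xss ! i ! j) \<in> car (FO (src (\<phi>s ! i) ! j) (tgt (hss ! i ! j)))"
      if j: "j < length (src (\<phi>s ! i))" for j
    proof (rule u_closed)
      show "src (\<phi>s ! i) ! j \<in> ob" using obi[OF i] j by auto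
      show "hss ! i ! j \<in> Arr Gamma_op" using hi[OF i] lhi[OF i] j by auto
      show "xss ! i ! j \<in> car (FO (src (\<phi>s ! i) ! j) (src (hss ! i ! j)))"
        using xi[OF i] lhi[OF i] j by (simp add: tuples_at_def)
    qed
    then show "zss ! i \<in> tuples_at car (src (\<phi>s ! i)) (?tss ! i)"
      using lhi[OF i] lxi[OF i] lh i by (simp add: zi[OF i] tuples_at_def)
    show "length (?tss ! i) = length (src (\<phi>s ! i))" using lhi[OF i] lh i by simp
  qed (simp_all add: lh lz)
  let ?Hs = "map smash_gmor hss"
  have E: "apply_each l \<phi>s ?tss zss = map2 u (map2 act (src \<gamma>) ?Hs) (apply_each l \<phi>s ?sss xss)"
  proof (rule nth_equalityI)
    fix i assume "i < length (apply_each l \<phi>s ?tss zss)"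
    then have i: "i < length \<phi>s" by simp
    show "apply_each l \<phi>s ?tss zss ! i = map2 u (map2 act (src \<gamma>) ?Hs) (apply_each l \<phi>s ?sss xss) ! i"
      using l_natural[OF fi(2)[OF i] lhi[OF i] hi[OF i] xi[OF i]] zi[OF i] i lh lz lx len fi(3)[OF i] by simp
  qed (simp_all add: lh lz lx len)
  have "set hs' \<subseteq> Arr Gamma_op" if "hs' \<in> set hss" for hs' using hi lh that by (metis in_set_conv_nth)
  then have HA: "set ?Hs \<subseteq> Arr Gamma_op" by (auto intro!: smash_gmor_Arr)
  have Hst: "map src ?Hs = map prod_list ?sss" "map tgt ?Hs = map prod_list ?tss" by (simp_all add: smash_gmor_simps)
  have c: "apply_each l \<phi>s ?sss xss \<in> tuples_at car (src \<gamma>) (map src ?Hs)"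
    unfolding Hst(1) using f t x(2) by (intro apply_each_closed) auto
  have "l (dat \<gamma> (map prod_list ?tss)) (apply_each l \<phi>s ?tss zss)
      = u (act (tgt \<gamma>) (smash_gmor ?Hs)) (l (dat \<gamma> (map prod_list ?sss)) (apply_each l \<phi>s ?sss xss))"
    using l_natural[OF g(2) _ HA c] unfolding E Hst by (simp add: lh len)
  moreover have "smash_gmor ?Hs = smash_gmor hs"
    using smash_gmor_concat[of hss] hs(2) h(1) by simp
  ultimately show ?thesis unfolding Z unfolding st x(1) comp_value[OF bz] comp_value[OF x(2)] by simp
qed

lemma unit_natural:
  assumes "X \<in> ob" "h \<in> Arr Gamma_op" "xs \<in> tuples_at car [X] [src h]"
  shows "l (dat (fam_unit X) [tgt h]) (map2 u (map2 act [X] [h]) xs)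
    = u (act X (smash_gmor [h])) (l (dat (fam_unit X) [src h]) xs)"
proof -
  obtain x where "xs = [x]" "x \<in> car (FO X (src h))" using assms(3) by (cases xs) (auto simp: tuples_at_def)
  then show ?thesis using assms by (simp add: l_unit u_closed smash_gmor_single)
qed

text \<open>By naturality of the given family and of the symmetry.\<close>
lemma act_natural:
  assumes f: "family \<phi>" "natural \<phi>" and s: "\<sigma> permutes {..<length (src \<phi>)}"
    and hs: "length hs = length (src \<phi>)" "set hs \<subseteq> Arr Gamma_op"
    and xs: "xs \<in> tuples_at car (permute_list \<sigma> (src \<phi>)) (map src hs)"
  shows "l (dat (fam_act push \<sigma> \<phi>) (map tgt hs)) (map2 u (map2 act (permute_list \<sigma> (src \<phi>)) hs) xs)
    = u (act (tgt \<phi>) (smash_gmor hs)) (l (dat (fam_act push \<sigma> \<phi>) (map src hs)) xs)"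
proof -
  define hs' where "hs' = permute_list (inv \<sigma>) hs"
  define xs' where "xs' = permute_list (inv \<sigma>) xs"
  have lx: "length xs = length (src \<phi>)" using xs by (simp add: tuples_at_def)
  have l': "length hs' = length (src \<phi>)" "length xs' = length (src \<phi>)" by (simp_all add: hs'_def xs'_def hs lx)
  have h: "hs = permute_list \<sigma> hs'" "xs = permute_list \<sigma> xs'"
    unfolding hs'_def xs'_def using permute_list_inv(2)[of \<sigma>] s hs(1) lx by metis+
  have sh: "\<sigma> permutes {..<length hs'}" using s l' by simp
  have A: "set hs' \<subseteq> Arr Gamma_op" using hs(2) h(1) set_permute_list[OF sh] by metis
  have st: "map src hs = permute_list \<sigma> (map src hs')" "map tgt hs = permute_list \<sigma> (map tgt hs')"
    unfolding h(1) by (simp_all only: map_permute_list[OF sh])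
  have "inv \<sigma> permutes {..<length (permute_list \<sigma> (src \<phi>))}" using permutes_inv[OF s] by simp
  from tuples_at_permute[OF this _ xs] have xs': "xs' \<in> tuples_at car (src \<phi>) (map src hs')"
    using hs l' permute_list_inv(1)[OF s] permute_list_inv(1)[of \<sigma> "map src hs'"] sh unfolding st xs'_def by simp
  have obs: "set (src \<phi>) \<subseteq> ob" "tgt \<phi> \<in> ob" using f by (auto simp: family_def)
  have M: "map2 u (map2 act (permute_list \<sigma> (src \<phi>)) hs) xs = permute_list \<sigma> (map2 u (map2 act (src \<phi>) hs') xs')"
    unfolding h using map2_permute_list[of \<sigma> "src \<phi>" hs' act] map2_permute_list[of \<sigma> "map2 act (src \<phi>) hs'" xs' u] s l' by simp
  have c: "map2 u (map2 act (src \<phi>) hs') xs' \<in> tuples_at car (src \<phi>) (map tgt hs')"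
  proof -
    have "u (act (src \<phi> ! i) (hs' ! i)) (xs' ! i) \<in> car (FO (src \<phi> ! i) (tgt (hs' ! i)))" if "i < length (src \<phi>)" for i
    proof (rule u_closed)
      show "src \<phi> ! i \<in> ob" using obs that by auto
      show "hs' ! i \<in> Arr Gamma_op" using A l' that by auto
      show "xs' ! i \<in> car (FO (src \<phi> ! i) (src (hs' ! i)))" using xs' l' that by (simp add: tuples_at_def)
    qed
    then show ?thesis using l' by (simp add: tuples_at_def)
  qed
  have lc: "l (dat \<phi> (map src hs')) xs' \<in> car (FO (tgt \<phi>) (prod_list (map src hs')))"
    using l_closed[OF f(1) _ xs'] l' by simp
  have sm: "\<sigma> permutes {..<length (map src hs')}" "\<sigma> permutes {..<length (map tgt hs')}" using sh by simp_all
  have "l (dat (fam_act push \<sigma> \<phi>) (map tgt hs)) (map2 u (map2 act (permute_list \<sigma> (src \<phi>)) hs) xs)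
      = u (act (tgt \<phi>) (reorder_gmor \<sigma> (map tgt hs'))) (l (dat \<phi> (map tgt hs')) (map2 u (map2 act (src \<phi>) hs') xs'))"
    unfolding M st using act_value[OF f(1) s _ c] l' by simp
  also have "\<dots> = u (act (tgt \<phi>) (reorder_gmor \<sigma> (map tgt hs'))) (u (act (tgt \<phi>) (smash_gmor hs')) (l (dat \<phi> (map src hs')) xs'))"
    using l_natural[OF f(2) l'(1) A xs'] by simp
  also have "\<dots> = u (act (tgt \<phi>) (Comp Gamma_op (reorder_gmor \<sigma> (map tgt hs')) (smash_gmor hs'))) (l (dat \<phi> (map src hs')) xs')"
    using lc by (intro u_Comp[symmetric]) (simp_all add: obs reorder_gmor_Arr[OF sm(2)] smash_gmor_Arr[OF A] reorder_gmor_simps smash_gmor_simps)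
  also have "\<dots> = u (act (tgt \<phi>) (Comp Gamma_op (smash_gmor hs) (reorder_gmor \<sigma> (map src hs')))) (l (dat \<phi> (map src hs')) xs')"
    unfolding h(1) reorder_gmor_natural[OF A sh] ..
  also have "\<dots> = u (act (tgt \<phi>) (smash_gmor hs)) (u (act (tgt \<phi>) (reorder_gmor \<sigma> (map src hs'))) (l (dat \<phi> (map src hs')) xs'))"
    using lc prod_list_permute_list[OF sm(1)]
    by (intro u_Comp) (simp_all add: obs reorder_gmor_Arr[OF sm(1)] smash_gmor_Arr[OF hs(2)] reorder_gmor_simps smash_gmor_simps st)
  also have "u (act (tgt \<phi>) (reorder_gmor \<sigma> (map src hs'))) (l (dat \<phi> (map src hs')) xs') = l (dat (fam_act push \<sigma> \<phi>) (map src hs)) xs"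
    unfolding st h(2) using act_value[OF f(1) s _ xs'] l' by simp
  finally show ?thesis .
qed

lemma unit_left_value:
  assumes "family \<phi>" "length ns = length (src \<phi>)" "xs \<in> tuples_at car (src \<phi>) ns"
  shows "l (dat (fam_comp (fam_unit (tgt \<phi>)) [\<phi>]) ns) xs = l (dat \<phi> ns) xs"
proof -
  have "blocks car [\<phi>] [ns] [xs]" using assms by (simp add: blocks_def)
  from comp_value[OF this, of "fam_unit (tgt \<phi>)"] show ?thesis
    using l_unit[OF _ l_closed[OF assms]] assms(1) by (simp add: family_def)
qed

lemma unit_right_value:
  assumes "family \<phi>" "length ns = length (src \<phi>)" "xs \<in> tuples_at car (src \<phi>) ns"
  shows "l (dat (fam_comp \<phi> (map fam_unit (src \<phi>))) ns) xs = l (dat \<phi> ns) xs"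
proof -
  have lx: "length xs = length (src \<phi>)" and xi: "i < length (src \<phi>) \<Longrightarrow> xs ! i \<in> car (FO (src \<phi> ! i) (ns ! i))" for i
    using assms(3) by (auto simp: tuples_at_def)
  have b: "blocks car (map fam_unit (src \<phi>)) (map (\<lambda>n. [n]) ns) (map (\<lambda>x. [x]) xs)"
    using assms lx xi by (auto simp: blocks_def fam_unit_simps tuples_at_def)
  have "apply_each l (map fam_unit (src \<phi>)) (map (\<lambda>n. [n]) ns) (map (\<lambda>x. [x]) xs) = xs"
    using assms(1,2) lx xi by (intro nth_equalityI) (auto simp: family_def intro!: l_unit)
  with comp_value[OF b, of \<phi>] show ?thesis by (simp add: concat_map_singleton comp_def)
qed

text \<open>Both sides evaluate to the same expression once the arguments are cut into blocks of blocks.\<close>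
lemma assoc_value:
  assumes f: "\<And>\<phi>. \<phi> \<in> set \<phi>s \<Longrightarrow> family \<phi>" and p: "\<And>\<psi>s. \<psi>s \<in> set \<psi>ss \<Longrightarrow> \<forall>\<psi> \<in> set \<psi>s. family \<psi>"
    and t: "map (map tgt) \<psi>ss = map src \<phi>s"
    and ns: "length ns = length (concat (map src (concat \<psi>ss)))"
    and xs: "xs \<in> tuples_at car (concat (map src (concat \<psi>ss))) ns"
  shows "l (dat (fam_comp (fam_comp \<gamma> \<phi>s) (concat \<psi>ss)) ns) xs = l (dat (fam_comp \<gamma> (map2 fam_comp \<phi>s \<psi>ss)) ns) xs"
proof -
  obtain ns0 xs0 where b0: "ns = concat ns0" "xs = concat xs0" "blocks car (concat \<psi>ss) ns0 xs0"
    using obtain_all_blocks[OF ns xs] .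
  have l0: "length ns0 = sum_list (map length \<psi>ss)" "length xs0 = sum_list (map length \<psi>ss)"
    using b0(3) by (simp_all add: blocks_def length_concat)
  obtain nsss where n: "ns0 = concat nsss" "map length nsss = map length \<psi>ss" using obtain_blocks[OF l0(1)] .
  obtain xsss where x: "xs0 = concat xsss" "map length xsss = map length \<psi>ss" using obtain_blocks[OF l0(2)] .
  have L: "length \<psi>ss = length \<phi>s" using t by (metis length_map)
  have Ln: "length nsss = length \<phi>s" "length xsss = length \<phi>s" using n(2) x(2) L by (metis length_map)+
  have Li: "length (nsss ! i) = length (\<psi>ss ! i)" "length (xsss ! i) = length (\<psi>ss ! i)" if "i < length \<phi>s" for i
    using n(2) x(2) that Ln L by (auto simp: list_eq_iff_nth_eq)
  have ti: "map tgt (\<psi>ss ! i) = src (\<phi>s ! i)" if "i < length \<phi>s" for i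
    using arg_cong[OF t, of "\<lambda>z. z ! i"] that L by simp
  have pl: "length (\<psi>ss ! i) = length (src (\<phi>s ! i))" if "i < length \<phi>s" for i
    using arg_cong[OF ti[OF that], of length] by simp
  have bi: "blocks car (\<psi>ss ! i) (nsss ! i) (xsss ! i)" if i: "i < length \<phi>s" for i
    unfolding blocks_def
  proof (intro conjI allI impI)
    fix j assume j: "j < length (\<psi>ss ! i)"
    let ?k = "sum_list (map length (take i \<psi>ss)) + j"
    have ij: "i < length \<psi>ss" "j < length (\<psi>ss ! i)" "i < length nsss" "j < length (nsss ! i)"
      "i < length xsss" "j < length (xsss ! i)" using i j L Ln Li[OF i] by simp_all
    have k: "?k < length (concat \<psi>ss)" "concat \<psi>ss ! ?k = \<psi>ss ! i ! j"
      by (rule offset_less[OF ij(1,2)], rule nth_concat_offset[OF ij(1,2)])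
    have e: "ns0 ! ?k = nsss ! i ! j" "xs0 ! ?k = xsss ! i ! j"
      using nth_concat_offset[OF ij(3,4)] nth_concat_offset[OF ij(5,6)]
      unfolding same_shape_offset[OF n(2)] same_shape_offset[OF x(2)] n(1) x(1) .
    from b0(3) k(1) have "length (ns0 ! ?k) = length (src (concat \<psi>ss ! ?k))"
      "xs0 ! ?k \<in> tuples_at car (src (concat \<psi>ss ! ?k)) (ns0 ! ?k)"
      by (simp_all add: blocks_def del: length_concat)
    then show "length (nsss ! i ! j) = length (src (\<psi>ss ! i ! j))" "xsss ! i ! j \<in> tuples_at car (src (\<psi>ss ! i ! j)) (nsss ! i ! j)"
      unfolding e k(2) .
  qed (use Li[OF i] in simp_all)
  \<comment> \<open>The results of the innermost families, grouped by the \<open>\<phi>s\<close> that they are passed to.\<close>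
  let ?Y = "map2 (\<lambda>(\<psi>s, nss) xss. apply_each l \<psi>s nss xss) (zip \<psi>ss nsss) xsss"
  have Yi: "?Y ! i = apply_each l (\<psi>ss ! i) (nsss ! i) (xsss ! i)" if "i < length \<phi>s" for i
    using that L Ln by simp
  have c1: "map2 (\<lambda>\<phi> ms. dat \<phi> ms) (concat \<psi>ss) ns0 = concat (map2 (map2 (\<lambda>\<phi> ms. dat \<phi> ms)) \<psi>ss nsss)"
    unfolding n(1) using Li L Ln by (intro map2_concat) (simp add: list_all2_conv_all_nth)
  have c2: "map2 l (concat (map2 (map2 (\<lambda>\<phi> ms. dat \<phi> ms)) \<psi>ss nsss)) xs0
      = concat (map2 (map2 l) (map2 (map2 (\<lambda>\<phi> ms. dat \<phi> ms)) \<psi>ss nsss) xsss)"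
    unfolding x(1) using Li L Ln by (intro map2_concat) (simp add: list_all2_conv_all_nth)
  have c3: "map2 (map2 l) (map2 (map2 (\<lambda>\<phi> ms. dat \<phi> ms)) \<psi>ss nsss) xsss = ?Y"
    using L Ln by (intro nth_equalityI) simp_all
  have Y: "apply_each l (concat \<psi>ss) ns0 xs0 = concat ?Y" unfolding c1 c2 c3 ..
  have fi: "family (\<phi>s ! i)" if "i < length \<phi>s" for i using f that by simp
  have pi: "family \<psi>" if "i < length \<phi>s" "\<psi> \<in> set (\<psi>ss ! i)" for i \<psi> using p[of "\<psi>ss ! i"] that L by auto
  have bY: "blocks car \<phi>s (map (map prod_list) nsss) ?Y" unfolding blocks_def
  proof (intro conjI allI impI)
    fix i assume i: "i < length \<phi>s"
    show "length (map (map prod_list) nsss ! i) = length (src (\<phi>s ! i))" using i Li pl Ln by simp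
    have "apply_each l (\<psi>ss ! i) (nsss ! i) (xsss ! i) \<in> tuples_at car (src (\<phi>s ! i)) (map prod_list (nsss ! i))"
      using pi[OF i] ti[OF i] bi[OF i] by (rule apply_each_closed)
    then show "?Y ! i \<in> tuples_at car (src (\<phi>s ! i)) (map (map prod_list) nsss ! i)"
      unfolding Yi[OF i] using i Ln by simp
  qed (simp_all add: L Ln)
  have bR: "blocks car (map2 fam_comp \<phi>s \<psi>ss) (map concat nsss) (map concat xsss)" unfolding blocks_def
  proof (intro conjI allI impI)
    fix i assume "i < length (map2 fam_comp \<phi>s \<psi>ss)"
    then have i: "i < length \<phi>s" by simp
    note b = blocks_lengths[OF bi[OF i]]
    show "length (map concat nsss ! i) = length (src (map2 fam_comp \<phi>s \<psi>ss ! i))"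
      using i L Ln b(1) by (simp add: fam_comp_simps length_concat comp_def)
    show "map concat xsss ! i \<in> tuples_at car (src (map2 fam_comp \<phi>s \<psi>ss ! i)) (map concat nsss ! i)"
      using i L Ln bi[OF i] blocks_concat_iff[OF b] by (simp add: fam_comp_simps)
  qed (simp_all add: L Ln)
  have "l (dat (fam_comp (fam_comp \<gamma> \<phi>s) (concat \<psi>ss)) ns) xs
      = l (dat (fam_comp \<gamma> \<phi>s) (concat (map (map prod_list) nsss))) (concat ?Y)"
    unfolding b0(1,2) comp_value[OF b0(3)] unfolding Y by (simp add: n(1) map_concat)
  also have "\<dots> = l (dat \<gamma> (map prod_list (map (map prod_list) nsss))) (apply_each l \<phi>s (map (map prod_list) nsss) ?Y)"
    by (rule comp_value[OF bY])
  also have "map prod_list (map (map prod_list) nsss) = map prod_list (map concat nsss)"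
    by (simp add: prod_list_concat)
  also have "apply_each l \<phi>s (map (map prod_list) nsss) ?Y
      = apply_each l (map2 fam_comp \<phi>s \<psi>ss) (map concat nsss) (map concat xsss)"
  proof (rule nth_equalityI)
    fix i assume "i < length (apply_each l \<phi>s (map (map prod_list) nsss) ?Y)"
    then have i: "i < length \<phi>s" by simp
    show "apply_each l \<phi>s (map (map prod_list) nsss) ?Y ! i
        = apply_each l (map2 fam_comp \<phi>s \<psi>ss) (map concat nsss) (map concat xsss) ! i"
      using i L Ln comp_value[OF bi[OF i], of "\<phi>s ! i"] by simp
  qed (simp add: L Ln)
  also have "l (dat \<gamma> (map prod_list (map concat nsss))) \<dots> = l (dat (fam_comp \<gamma> (map2 fam_comp \<phi>s \<psi>ss)) ns) xs"
    unfolding comp_value[OF bR, symmetric] by (simp add: b0(1,2) n(1) x(1) concat_concat)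
  finally show ?thesis .
qed

lemma act_id_value:
  assumes "family \<phi>" "length ns = length (src \<phi>)" "xs \<in> tuples_at car (src \<phi>) ns"
  shows "l (dat (fam_act push id \<phi>) ns) xs = l (dat \<phi> ns) xs"
  using act_value[OF assms(1) permutes_id assms(2,3)] l_closed[OF assms] assms(1)
  by (simp add: reorder_gmor_id u_Ident family_def)

lemma act_comp_value:
  assumes f: "family \<phi>" and s: "\<sigma> permutes {..<length (src \<phi>)}" and t: "\<tau> permutes {..<length (src \<phi>)}"
    and "length ns = length (src \<phi>)" "xs \<in> tuples_at car (permute_list (\<sigma> \<circ> \<tau>) (src \<phi>)) ns"
  shows "l (dat (fam_act push \<tau> (fam_act push \<sigma> \<phi>)) ns) xs = l (dat (fam_act push (\<sigma> \<circ> \<tau>) \<phi>) ns) xs"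
proof -
  note st = permutes_compose[OF t s]
  obtain ns' xs' where n: "ns = permute_list (\<sigma> \<circ> \<tau>) ns'" "xs = permute_list (\<sigma> \<circ> \<tau>) xs'" "length ns' = length (src \<phi>)"
    "xs' \<in> tuples_at car (src \<phi>) ns'"
    using obtain_permuted[OF st assms(4,5)] .
  have lx: "length xs' = length (src \<phi>)" using n(4) by (simp add: tuples_at_def)
  let ?\<phi> = "fam_act push \<sigma> \<phi>"
  have p: "ns = permute_list \<tau> (permute_list \<sigma> ns')" "xs = permute_list \<tau> (permute_list \<sigma> xs')"
    using n(1-3) lx t by (simp_all add: permute_list_compose)
  have t': "\<tau> permutes {..<length (src ?\<phi>)}" using t by (simp add: fam_act_simps)
  have sn: "\<sigma> permutes {..<length ns'}" "\<tau> permutes {..<length ns'}" using s t n by simp_all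
  have tn: "\<tau> permutes {..<length (permute_list \<sigma> ns')}" using t n by simp
  have o: "tgt \<phi> \<in> ob" using f by (simp add: family_def)
  have "l (dat (fam_act push \<tau> ?\<phi>) ns) xs
      = u (act (tgt \<phi>) (reorder_gmor \<tau> (permute_list \<sigma> ns'))) (l (dat ?\<phi> (permute_list \<sigma> ns')) (permute_list \<sigma> xs'))"
    unfolding p using act_value[OF family_act[OF f s] t', of "permute_list \<sigma> ns'" "permute_list \<sigma> xs'"]
      tuples_at_permute[OF s n(3,4)] n(3) by (simp add: fam_act_simps)
  also have "\<dots> = u (act (tgt \<phi>) (reorder_gmor \<tau> (permute_list \<sigma> ns'))) (u (act (tgt \<phi>) (reorder_gmor \<sigma> ns')) (l (dat \<phi> ns') xs'))"
    unfolding act_value[OF f s n(3,4)] ..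
  also have "\<dots> = u (act (tgt \<phi>) (reorder_gmor (\<sigma> \<circ> \<tau>) ns')) (l (dat \<phi> ns') xs')"
    unfolding reorder_gmor_Comp[OF sn, symmetric] using l_closed[OF f n(3,4)]
    by (intro u_Comp[symmetric]) (simp_all add: o reorder_gmor_Arr[OF tn] reorder_gmor_Arr[OF sn(1)] reorder_gmor_simps prod_list_permute_list[OF sn(1)])
  also have "\<dots> = l (dat (fam_act push (\<sigma> \<circ> \<tau>) \<phi>) ns) xs"
    unfolding n(1,2) using act_value[OF f st n(3,4)] by simp
  finally show ?thesis .
qed

text \<open>Both sides apply \<open>\<gamma> \<circ> (\<phi>\<^sub>1, \<dots>, \<phi>\<^sub>s)\<close> to the same arguments and then reorder the result, the left one
  according to the numbers of the blocks and the right one according to the blocks;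
  \<open>reorder_gmor_block_perm\<close> identifies the two.\<close>
lemma outer_value:
  assumes g: "family \<gamma>" and f: "\<And>\<phi>. \<phi> \<in> set \<phi>s \<Longrightarrow> family \<phi>" and t: "map tgt \<phi>s = src \<gamma>"
    and s: "\<sigma> permutes {..<length \<phi>s}"
    and ns: "length ns = length (concat (map src (permute_list \<sigma> \<phi>s)))"
    and xs: "xs \<in> tuples_at car (concat (map src (permute_list \<sigma> \<phi>s))) ns"
  shows "l (dat (fam_comp (fam_act push \<sigma> \<gamma>) (permute_list \<sigma> \<phi>s)) ns) xs
    = l (dat (fam_act push (block_perm \<sigma> (map (\<lambda>\<phi>. length (src \<phi>)) \<phi>s)) (fam_comp \<gamma> \<phi>s)) ns) xs"
proof -
  let ?rs = "map (\<lambda>\<phi>. length (src \<phi>)) \<phi>s"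
  let ?\<beta> = "block_perm \<sigma> ?rs"
  obtain nss' xss' where b': "ns = concat nss'" "xs = concat xss'" "blocks car (permute_list \<sigma> \<phi>s) nss' xss'"
    using obtain_all_blocks[OF ns xs] .
  define nss where "nss = permute_list (inv \<sigma>) nss'"
  define xss where "xss = permute_list (inv \<sigma>) xss'"
  have l': "length nss' = length \<phi>s" "length xss' = length \<phi>s" using b'(3) by (simp_all add: blocks_def)
  have ll: "length nss = length \<phi>s" "length xss = length \<phi>s" by (simp_all add: nss_def xss_def l')
  have P: "nss' = permute_list \<sigma> nss" "xss' = permute_list \<sigma> xss"
    unfolding nss_def xss_def using permute_list_inv(2)[of \<sigma>] s l' by metis+
  have b: "blocks car \<phi>s nss xss" unfolding blocks_def
  proof (intro conjI allI impI)
    fix i assume i: "i < length \<phi>s"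
    have k: "inv \<sigma> i < length \<phi>s" using inv_less[OF s i] .
    have "permute_list \<sigma> \<phi>s ! inv \<sigma> i = \<phi>s ! i" "nss' ! inv \<sigma> i = nss ! i" "xss' ! inv \<sigma> i = xss ! i"
      using k s ll permutes_inverses(1)[OF s] by (simp_all add: P permute_list_nth)
    then show "length (nss ! i) = length (src (\<phi>s ! i))" "xss ! i \<in> tuples_at car (src (\<phi>s ! i)) (nss ! i)"
      using b'(3) k unfolding blocks_def by (metis length_permute_list)+
  qed (simp_all add: ll)
  note bl = blocks_lengths[OF b]
  have len: "length (src \<gamma>) = length \<phi>s" using t by (metis length_map)
  have sg: "\<sigma> permutes {..<length (src \<gamma>)}" and sr: "\<sigma> permutes {..<length ?rs}" and sn: "\<sigma> permutes {..<length nss}"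
    using s len ll by simp_all
  have c: "apply_each l \<phi>s nss xss \<in> tuples_at car (src \<gamma>) (map prod_list nss)"
    using f t b by (rule apply_each_closed)
  let ?C = "fam_comp \<gamma> \<phi>s"
  have C: "family ?C" using g f t by (rule family_comp)
  have bp: "?\<beta> permutes {..<length (src ?C)}"
    using block_perm_permutes[OF sr] by (simp add: fam_comp_simps length_concat comp_def)
  have cb: "concat xss \<in> tuples_at car (src ?C) (concat nss)" "length (concat nss) = length (src ?C)"
    using blocks_concat_iff[OF bl] b by (simp_all add: fam_comp_simps length_concat bl comp_def)
  have "apply_each l (permute_list \<sigma> \<phi>s) (permute_list \<sigma> nss) (permute_list \<sigma> xss) = permute_list \<sigma> (apply_each l \<phi>s nss xss)"
    using map2_permute_list[OF s ll(1), of "\<lambda>\<phi> ms. dat \<phi> ms"] map2_permute_list[of \<sigma> "map2 (\<lambda>\<phi> ms. dat \<phi> ms) \<phi>s nss" xss l] s ll by simp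
  moreover have "map prod_list (permute_list \<sigma> nss) = permute_list \<sigma> (map prod_list nss)" by (rule map_permute_list[OF sn])
  ultimately have "l (dat (fam_comp (fam_act push \<sigma> \<gamma>) (permute_list \<sigma> \<phi>s)) ns) xs
      = l (dat (fam_act push \<sigma> \<gamma>) (permute_list \<sigma> (map prod_list nss))) (permute_list \<sigma> (apply_each l \<phi>s nss xss))"
    unfolding b'(1,2) comp_value[OF b'(3)] unfolding P by simp
  also have "\<dots> = u (act (tgt \<gamma>) (reorder_gmor \<sigma> (map prod_list nss))) (l (dat \<gamma> (map prod_list nss)) (apply_each l \<phi>s nss xss))"
    using c ll len by (intro act_value[OF g sg]) simp_all
  also have "\<dots> = u (act (tgt ?C) (reorder_gmor ?\<beta> (concat nss))) (l (dat ?C (concat nss)) (concat xss))"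
    unfolding comp_value[OF b] reorder_gmor_block_perm[OF sn, symmetric] bl(1) fam_comp_simps ..
  also have "\<dots> = l (dat (fam_act push ?\<beta> ?C) (permute_list ?\<beta> (concat nss))) (permute_list ?\<beta> (concat xss))"
    using act_value[OF C bp cb(2,1)] by simp
  also have "\<dots> = l (dat (fam_act push ?\<beta> ?C) ns) xs"
    unfolding permute_list_block_perm[OF sr bl(1)] permute_list_block_perm[OF sr bl(2)] by (simp only: b' P)
  finally show ?thesis .
qed

text \<open>On the left the results of the \<open>\<phi>\<^sub>i\<close> are reordered before \<open>\<gamma>\<close> is applied, on the right the result of
  \<open>\<gamma>\<close> is reordered. By naturality of \<open>\<gamma>\<close> for the reordering bijections, the former reorders the result
  by their smash product, and \<open>reorder_gmor_sum_perm\<close> applies.\<close>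
lemma inner_value:
  assumes g: "family \<gamma>" "natural \<gamma>" and f: "\<And>\<phi>. \<phi> \<in> set \<phi>s \<Longrightarrow> family \<phi>" and t: "map tgt \<phi>s = src \<gamma>"
    and s: "list_all2 (\<lambda>\<tau> \<phi>. \<tau> permutes {..<length (src \<phi>)}) \<tau>s \<phi>s"
    and ns: "length ns = length (concat (map src (map2 (fam_act push) \<tau>s \<phi>s)))"
    and xs: "xs \<in> tuples_at car (concat (map src (map2 (fam_act push) \<tau>s \<phi>s))) ns"
  shows "l (dat (fam_comp \<gamma> (map2 (fam_act push) \<tau>s \<phi>s)) ns) xs
    = l (dat (fam_act push (sum_perm \<tau>s (map (\<lambda>\<phi>. length (src \<phi>)) \<phi>s)) (fam_comp \<gamma> \<phi>s)) ns) xs"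
proof -
  let ?rs = "map (\<lambda>\<phi>. length (src \<phi>)) \<phi>s"
  let ?\<beta> = "sum_perm \<tau>s ?rs"
  have len: "length (src \<gamma>) = length \<phi>s" using t by (metis length_map)
  have lt: "length \<tau>s = length \<phi>s" using s by (rule list_all2_lengthD)
  have sn: "\<tau>s ! i permutes {..<length (src (\<phi>s ! i))}" if "i < length \<phi>s" for i
    using s that lt by (simp add: list_all2_conv_all_nth)
  have sr: "list_all2 (\<lambda>\<tau> n. \<tau> permutes {..<n}) \<tau>s ?rs" using s by (simp add: list_all2_map2)
  obtain nss' xss' where b': "ns = concat nss'" "xs = concat xss'" "blocks car (map2 (fam_act push) \<tau>s \<phi>s) nss' xss'"
    using obtain_all_blocks[OF ns xs] .
  have "\<exists>ns xs. nss' ! i = permute_list (\<tau>s ! i) ns \<and> xss' ! i = permute_list (\<tau>s ! i) xs \<and>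
      length ns = length (src (\<phi>s ! i)) \<and> xs \<in> tuples_at car (src (\<phi>s ! i)) ns" if i: "i < length \<phi>s" for i
  proof -
    have "length (nss' ! i) = length (src (\<phi>s ! i))" "xss' ! i \<in> tuples_at car (permute_list (\<tau>s ! i) (src (\<phi>s ! i))) (nss' ! i)"
      using b'(3) i lt by (auto simp: blocks_def fam_act_simps)
    from obtain_permuted[OF sn[OF i] this] show ?thesis by metis
  qed
  then obtain N Z where NZ: "\<And>i. i < length \<phi>s \<Longrightarrow> nss' ! i = permute_list (\<tau>s ! i) (N i) \<and> xss' ! i = permute_list (\<tau>s ! i) (Z i) \<and>
      length (N i) = length (src (\<phi>s ! i)) \<and> Z i \<in> tuples_at car (src (\<phi>s ! i)) (N i)" by metis
  define nss where "nss = map N [0..<length \<phi>s]"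
  define xss where "xss = map Z [0..<length \<phi>s]"
  have l': "length nss' = length \<phi>s" "length xss' = length \<phi>s" using b'(3) lt by (simp_all add: blocks_def)
  have ll: "length nss = length \<phi>s" "length xss = length \<phi>s" by (simp_all add: nss_def xss_def)
  have b: "blocks car \<phi>s nss xss" using NZ by (simp add: blocks_def nss_def xss_def)
  note bl = blocks_lengths[OF b]
  have P: "nss' = map2 permute_list \<tau>s nss" "xss' = map2 permute_list \<tau>s xss"
    using NZ lt l' by (auto simp: nss_def xss_def intro!: nth_equalityI)
  have sl: "\<tau>s ! i permutes {..<length (nss ! i)}" if "i < length \<phi>s" for i
    using sn[OF that] NZ that by (simp add: nss_def)
  have t': "list_all2 (\<lambda>\<tau> ns. \<tau> permutes {..<length ns}) \<tau>s nss"
    using sl lt ll by (simp add: list_all2_conv_all_nth)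
  let ?hs = "map2 reorder_gmor \<tau>s nss"
  have hA: "set ?hs \<subseteq> Arr Gamma_op" using sl lt ll by (auto simp: set_zip intro!: reorder_gmor_Arr)
  have hst: "map src ?hs = map prod_list nss" "map tgt ?hs = map prod_list nss"
    using lt ll by (auto intro!: nth_equalityI simp: reorder_gmor_simps)
  have Pp: "map prod_list nss' = map prod_list nss"
    using lt ll sl unfolding P by (intro nth_equalityI) (simp_all add: prod_list_permute_list)
  have c: "apply_each l \<phi>s nss xss \<in> tuples_at car (src \<gamma>) (map prod_list nss)"
    using f t b by (rule apply_each_closed)
  have E: "apply_each l (map2 (fam_act push) \<tau>s \<phi>s) nss' xss' = map2 u (map2 act (src \<gamma>) ?hs) (apply_each l \<phi>s nss xss)"
  proof (rule nth_equalityI)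
    fix i assume "i < length (apply_each l (map2 (fam_act push) \<tau>s \<phi>s) nss' xss')"
    then have i: "i < length \<phi>s" by simp
    have "tgt (\<phi>s ! i) = src \<gamma> ! i" using i by (simp flip: t)
    moreover have "family (\<phi>s ! i)" using f i by simp
    ultimately show "apply_each l (map2 (fam_act push) \<tau>s \<phi>s) nss' xss' ! i = map2 u (map2 act (src \<gamma>) ?hs) (apply_each l \<phi>s nss xss) ! i"
      using act_value[of "\<phi>s ! i" "\<tau>s ! i" "nss ! i" "xss ! i"] sn[OF i] b i lt ll l' len by (simp add: P blocks_def)
  qed (simp add: l' ll lt len)
  let ?C = "fam_comp \<gamma> \<phi>s"
  have C: "family ?C" using g(1) f t by (rule family_comp)
  have bp: "?\<beta> permutes {..<length (src ?C)}"
    using sum_perm_permutes[OF sr] by (simp add: fam_comp_simps length_concat comp_def)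
  have cb: "concat xss \<in> tuples_at car (src ?C) (concat nss)" "length (concat nss) = length (src ?C)"
    using blocks_concat_iff[OF bl] b by (simp_all add: fam_comp_simps length_concat bl comp_def)
  have "l (dat (fam_comp \<gamma> (map2 (fam_act push) \<tau>s \<phi>s)) ns) xs
      = l (dat \<gamma> (map tgt ?hs)) (map2 u (map2 act (src \<gamma>) ?hs) (apply_each l \<phi>s nss xss))"
    unfolding b'(1,2) comp_value[OF b'(3)] E Pp hst ..
  also have "\<dots> = u (act (tgt \<gamma>) (smash_gmor ?hs)) (l (dat \<gamma> (map prod_list nss)) (apply_each l \<phi>s nss xss))"
    using l_natural[OF g(2) _ hA, unfolded hst, OF _ c] lt ll len unfolding hst by simp
  also have "\<dots> = u (act (tgt ?C) (reorder_gmor ?\<beta> (concat nss))) (l (dat ?C (concat nss)) (concat xss))"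
    unfolding comp_value[OF b] reorder_gmor_sum_perm[OF t', symmetric] bl(1) fam_comp_simps ..
  also have "\<dots> = l (dat (fam_act push ?\<beta> ?C) (permute_list ?\<beta> (concat nss))) (permute_list ?\<beta> (concat xss))"
    using act_value[OF C bp cb(2,1)] by simp
  also have "\<dots> = l (dat (fam_act push ?\<beta> ?C) ns) xs"
    unfolding permute_list_sum_perm[OF sr bl(1)] permute_list_sum_perm[OF sr bl(2)] by (simp only: b' P)
  finally show ?thesis .
qed

end


section \<open>The multicategory of natural families\<close>

context gamma_action begin

lemma natural_at_iff:
  assumes "length hs = length (src \<phi>)"
  shows "natural_at \<phi> hs \<longleftrightarrow>
        (\<forall>xs \<in> tuples_at Obj (src \<phi>) (map src hs). FO (dat \<phi> (map tgt hs)) (map2 FO (map2 act (src \<phi>) hs) xs)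
          = FO (act (tgt \<phi>) (smash_gmor hs)) (FO (dat \<phi> (map src hs)) xs)) \<and>
        (\<forall>us \<in> tuples_at Arr (src \<phi>) (map src hs). FA (dat \<phi> (map tgt hs)) (map2 FA (map2 act (src \<phi>) hs) us)
          = FA (act (tgt \<phi>) (smash_gmor hs)) (FA (dat \<phi> (map src hs)) us))"
    (is "_ \<longleftrightarrow> ?O \<and> ?A")
proof
  let ?S = "prod_at (src \<phi>) (map src hs)"
  note S = prod_at_sets[of "map src hs" "src \<phi>", unfolded length_map, OF assms]
  assume "natural_at \<phi> hs"
  then have e: "fcomp ?S (dat \<phi> (map tgt hs)) (mk_ftor ?S (map2 FO (map2 act (src \<phi>) hs)) (map2 FA (map2 act (src \<phi>) hs)))
      = fcomp ?S (act (tgt \<phi>) (smash_gmor hs)) (dat \<phi> (map src hs))"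
    unfolding natural_at_def Let_def .
  have ?O
  proof
    fix xs assume "xs \<in> tuples_at Obj (src \<phi>) (map src hs)"
    then show "FO (dat \<phi> (map tgt hs)) (map2 FO (map2 act (src \<phi>) hs) xs)
          = FO (act (tgt \<phi>) (smash_gmor hs)) (FO (dat \<phi> (map src hs)) xs)"
      using arg_cong[OF e, of "\<lambda>F. FO F xs"] by (simp add: S)
  qed
  moreover have ?A
  proof
    fix us assume "us \<in> tuples_at Arr (src \<phi>) (map src hs)"
    then show "FA (dat \<phi> (map tgt hs)) (map2 FA (map2 act (src \<phi>) hs) us)
          = FA (act (tgt \<phi>) (smash_gmor hs)) (FA (dat \<phi> (map src hs)) us)"
      using arg_cong[OF e, of "\<lambda>F. FA F us"] by (simp add: S)
  qed
  ultimately show "?O \<and> ?A" ..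
next
  note S = prod_at_sets[of "map src hs" "src \<phi>", unfolded length_map, OF assms]
  assume "?O \<and> ?A"
  then show "natural_at \<phi> hs" unfolding natural_at_def Let_def fcomp_def by (intro mk_ftor_cong) (simp_all add: S)
qed

lemma family_closed:
  assumes "family \<phi>" "length ns = length (src \<phi>)"
  shows "xs \<in> tuples_at Obj (src \<phi>) ns \<Longrightarrow> FO (dat \<phi> ns) xs \<in> Obj (FO (tgt \<phi>) (prod_list ns))"
    and "us \<in> tuples_at Arr (src \<phi>) ns \<Longrightarrow> FA (dat \<phi> ns) us \<in> Arr (FO (tgt \<phi>) (prod_list ns))"
  using functor_closed[OF family_component(2)[OF assms]] assms(2) by (simp_all add: prod_at_sets)

lemma act_closed:
  assumes "X \<in> ob" "h \<in> Arr Gamma_op"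
  shows "x \<in> Obj (FO X (src h)) \<Longrightarrow> FO (act X h) x \<in> Obj (FO X (tgt h))"
    and "u \<in> Arr (FO X (src h)) \<Longrightarrow> FA (act X h) u \<in> Arr (FO X (tgt h))"
  using functor_closed[of "FO X (src h)" "FO X (tgt h)" "act X h"] act_functor[OF assms] by (auto simp: based_functor_iff)

lemma fam_unit_values:
  "x \<in> Obj (FO X n) \<Longrightarrow> FO (dat (fam_unit X) [n]) [x] = x" "u \<in> Arr (FO X n) \<Longrightarrow> FA (dat (fam_unit X) [n]) [u] = u"
  by (simp_all add: fam_unit_def proj_ftor_def prod_cat_Obj prod_cat_Arr)

sublocale on_objects: gamma_action_part ob act push FO FO Obj
proof
  fix \<phi> :: "((nat, 'x, ('o, 'a) bcat, 'y) ftor, 'o, 'a) fmor" and hs xs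
  assume "natural \<phi>" "length hs = length (src \<phi>)" "set hs \<subseteq> Arr Gamma_op" "xs \<in> tuples_at Obj (src \<phi>) (map src hs)"
  then show "FO (dat \<phi> (map tgt hs)) (map2 FO (map2 act (src \<phi>) hs) xs) = FO (act (tgt \<phi>) (smash_gmor hs)) (FO (dat \<phi> (map src hs)) xs)"
    using natural_at_iff[of hs \<phi>] by (auto simp: natural_def)
qed (simp_all add: family_closed act_Ident act_Comp act_closed fam_unit_values fam_comp_dat fam_act_dat prod_at_sets)

sublocale on_arrows: gamma_action_part ob act push FA FA Arr
proof
  fix \<phi> :: "((nat, 'x, ('o, 'a) bcat, 'y) ftor, 'o, 'a) fmor" and hs xs
  assume "natural \<phi>" "length hs = length (src \<phi>)" "set hs \<subseteq> Arr Gamma_op" "xs \<in> tuples_at Arr (src \<phi>) (map src hs)"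
  then show "FA (dat \<phi> (map tgt hs)) (map2 FA (map2 act (src \<phi>) hs) xs) = FA (act (tgt \<phi>) (smash_gmor hs)) (FA (dat \<phi> (map src hs)) xs)"
    using natural_at_iff[of hs \<phi>] by (auto simp: natural_def)
qed (simp_all add: family_closed act_Ident act_Comp act_closed fam_unit_values fam_comp_dat fam_act_dat prod_at_sets)

lemma naturalI:
  assumes "\<And>hs xs. \<lbrakk>length hs = length (src \<phi>); set hs \<subseteq> Arr Gamma_op; xs \<in> tuples_at Obj (src \<phi>) (map src hs)\<rbrakk>
      \<Longrightarrow> FO (dat \<phi> (map tgt hs)) (map2 FO (map2 act (src \<phi>) hs) xs)
          = FO (act (tgt \<phi>) (smash_gmor hs)) (FO (dat \<phi> (map src hs)) xs)"
    and "\<And>hs us. \<lbrakk>length hs = length (src \<phi>); set hs \<subseteq> Arr Gamma_op; us \<in> tuples_at Arr (src \<phi>) (map src hs)\<rbrakk>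
      \<Longrightarrow> FA (dat \<phi> (map tgt hs)) (map2 FA (map2 act (src \<phi>) hs) us)
          = FA (act (tgt \<phi>) (smash_gmor hs)) (FA (dat \<phi> (map src hs)) us)"
  shows "natural \<phi>"
  using assms unfolding natural_def by (simp add: natural_at_iff)

lemma natural_unit: "X \<in> ob \<Longrightarrow> natural (fam_unit X)"
  by (rule naturalI; clarsimp simp: fam_unit_simps length_Suc_conv)
    (use on_objects.unit_natural on_arrows.unit_natural in \<open>force simp: tuples_at_def\<close>)+

lemma natural_comp:
  assumes "family \<gamma>" "natural \<gamma>" "\<And>\<phi>. \<phi> \<in> set \<phi>s \<Longrightarrow> family \<phi> \<and> natural \<phi>" "map tgt \<phi>s = src \<gamma>"
  shows "natural (fam_comp \<gamma> \<phi>s)"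
  by (rule naturalI; unfold fam_comp_simps)
    (rule on_objects.comp_natural[OF assms] on_arrows.comp_natural[OF assms]; assumption)+

lemma natural_act:
  assumes "family \<phi>" "natural \<phi>" "\<sigma> permutes {..<length (src \<phi>)}"
  shows "natural (fam_act push \<sigma> \<phi>)"
  by (rule naturalI; unfold fam_act_simps length_permute_list)
    (rule on_objects.act_natural[OF assms] on_arrows.act_natural[OF assms]; assumption)+

text \<open>The two copies of \<open>gamma_action_part\<close> give all equations on objects and on arrows; what remains is
  to compare sources and to see that both sides are families, and hence determined by these values.\<close>
theorem multicategory_of_families:
  "multicategory \<lparr>MObj = ob, MMor = {\<phi>. family \<phi> \<and> natural \<phi>}, Src = src, Tgt = tgt,
     MUnit = fam_unit, MComp = fam_comp, Act = fam_act push\<rparr>"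
proof (unfold_locales, simp_all only: multicat.simps in_lists_conv_set mem_Collect_eq)
  fix \<phi> assume f: "family \<phi> \<and> natural \<phi>"
  then show "\<forall>X \<in> set (src \<phi>). X \<in> ob" "tgt \<phi> \<in> ob" by (auto simp: family_def)
  have o: "set (src \<phi>) \<subseteq> ob" "tgt \<phi> \<in> ob" using f by (auto simp: family_def)
  have L: "family (fam_comp (fam_unit (tgt \<phi>)) [\<phi>])"
    using f o by (intro family_comp family_unit) (auto simp: fam_unit_simps)
  show "fam_comp (fam_unit (tgt \<phi>)) [\<phi>] = \<phi>"
    by (rule family_eqI[OF L]) (use f in \<open>auto simp: fam_comp_simps fam_unit_simps on_objects.unit_left_value on_arrows.unit_left_value\<close>)
  have R: "family (fam_comp \<phi> (map fam_unit (src \<phi>)))"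
    using f o by (intro family_comp) (auto simp: fam_unit_simps comp_def intro!: family_unit)
  have s: "src (fam_comp \<phi> (map fam_unit (src \<phi>))) = src \<phi>"
    by (simp add: fam_comp_simps fam_unit_simps comp_def concat_map_singleton)
  show "fam_comp \<phi> (map fam_unit (src \<phi>)) = \<phi>"
    by (rule family_eqI[OF R]) (use f s in \<open>auto simp: fam_comp_simps(2) on_objects.unit_right_value on_arrows.unit_right_value\<close>)
  show "fam_act push id \<phi> = \<phi>"
    by (rule family_eqI[OF family_act])
      (use f in \<open>auto simp: fam_act_simps permutes_id on_objects.act_id_value on_arrows.act_id_value\<close>)
next
  fix \<phi> \<sigma> \<tau> assume f: "family \<phi> \<and> natural \<phi>"
    and s: "\<sigma> permutes {..<length (src \<phi>)}" and t: "\<tau> permutes {..<length (src \<phi>)}"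
  have F: "family (fam_act push \<sigma> \<phi>)" using f s by (intro family_act) auto
  show "fam_act push \<tau> (fam_act push \<sigma> \<phi>) = fam_act push (\<sigma> \<circ> \<tau>) \<phi>"
  proof (rule family_eqI)
    have e: "src (fam_act push \<tau> (fam_act push \<sigma> \<phi>)) = permute_list (\<sigma> \<circ> \<tau>) (src \<phi>)"
      using t by (simp add: fam_act_simps permute_list_compose)
    then show "src (fam_act push \<tau> (fam_act push \<sigma> \<phi>)) = src (fam_act push (\<sigma> \<circ> \<tau>) \<phi>)" by (simp add: fam_act_simps)
    fix ns :: "nat list" and xs assume ns: "length ns = length (src (fam_act push \<tau> (fam_act push \<sigma> \<phi>)))"
    show "FO (dat (fam_act push \<tau> (fam_act push \<sigma> \<phi>)) ns) xs = FO (dat (fam_act push (\<sigma> \<circ> \<tau>) \<phi>) ns) xs"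
      if "xs \<in> tuples_at Obj (src (fam_act push \<tau> (fam_act push \<sigma> \<phi>))) ns"
      using f s t ns that unfolding e by (intro on_objects.act_comp_value) auto
    show "FA (dat (fam_act push \<tau> (fam_act push \<sigma> \<phi>)) ns) xs = FA (dat (fam_act push (\<sigma> \<circ> \<tau>) \<phi>) ns) xs"
      if "xs \<in> tuples_at Arr (src (fam_act push \<tau> (fam_act push \<sigma> \<phi>))) ns" for xs
      using f s t ns that unfolding e by (intro on_arrows.act_comp_value) auto
  qed (use f s t F in \<open>auto simp: fam_act_simps intro!: family_act permutes_compose\<close>)
next
  fix \<gamma> \<phi>s \<psi>ss
  assume g: "family \<gamma> \<and> natural \<gamma>" and f: "\<forall>\<phi> \<in> set \<phi>s. family \<phi> \<and> natural \<phi>" and t: "map tgt \<phi>s = src \<gamma>"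
    and p: "\<forall>\<psi>s \<in> set \<psi>ss. \<forall>\<psi> \<in> set \<psi>s. family \<psi> \<and> natural \<psi>" and tp: "map (map tgt) \<psi>ss = map src \<phi>s"
  let ?L = "fam_comp (fam_comp \<gamma> \<phi>s) (concat \<psi>ss)" and ?R = "fam_comp \<gamma> (map2 fam_comp \<phi>s \<psi>ss)"
  have lp: "length \<psi>ss = length \<phi>s" using arg_cong[OF tp, of length] by simp
  have ti: "map tgt (\<psi>ss ! i) = src (\<phi>s ! i)" if "i < length \<phi>s" for i
    using arg_cong[OF tp, of "\<lambda>z. z ! i"] that lp by simp
  have C: "family (fam_comp \<gamma> \<phi>s)" using g f t by (intro family_comp) auto
  have LF: "family ?L" using p tp by (intro family_comp[OF C]) (auto simp: fam_comp_simps map_concat)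
  have ic: "family (fam_comp (\<phi>s ! i) (\<psi>ss ! i))" if "i < length \<phi>s" for i
  proof (rule family_comp[OF _ _ ti[OF that]])
    show "family (\<phi>s ! i)" using f that by simp
    show "family \<psi>" if "\<psi> \<in> set (\<psi>ss ! i)" for \<psi> using bspec[OF p nth_mem[of i \<psi>ss]] that \<open>i < length \<phi>s\<close> lp by simp
  qed
  have RF: "family ?R"
  proof (rule family_comp)
    show "family \<gamma>" using g ..
    show "family \<phi>" if "\<phi> \<in> set (map2 fam_comp \<phi>s \<psi>ss)" for \<phi> using that ic lp by (auto simp: set_zip)
    show "map tgt (map2 fam_comp \<phi>s \<psi>ss) = src \<gamma>"
      unfolding t[symmetric] using lp by (intro nth_equalityI) (simp_all add: fam_comp_simps)
  qed
  have "map src (map2 fam_comp \<phi>s \<psi>ss) = map (\<lambda>\<psi>s. concat (map src \<psi>s)) \<psi>ss"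
    using lp by (intro nth_equalityI) (simp_all add: fam_comp_simps)
  then have s: "src ?L = src ?R" by (simp only: fam_comp_simps concat_map_concat)
  show "?L = ?R"
  proof (rule family_eqI[OF LF RF s])
    fix ns :: "nat list" and xs assume ns: "length ns = length (src ?L)"
    show "FO (dat ?L ns) xs = FO (dat ?R ns) xs" if "xs \<in> tuples_at Obj (src ?L) ns"
      using f p tp ns that unfolding fam_comp_simps by (intro on_objects.assoc_value) auto
    show "FA (dat ?L ns) xs = FA (dat ?R ns) xs" if "xs \<in> tuples_at Arr (src ?L) ns" for xs
      using f p tp ns that unfolding fam_comp_simps by (intro on_arrows.assoc_value) auto
  qed (simp add: fam_comp_simps)
next
  fix \<gamma> \<phi>s \<sigma>
  assume g: "family \<gamma> \<and> natural \<gamma>" and f: "\<forall>\<phi> \<in> set \<phi>s. family \<phi> \<and> natural \<phi>" and t: "map tgt \<phi>s = src \<gamma>"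
    and s: "\<sigma> permutes {..<length \<phi>s}"
  let ?rs = "map (\<lambda>\<phi>. length (src \<phi>)) \<phi>s"
  let ?L = "fam_comp (fam_act push \<sigma> \<gamma>) (permute_list \<sigma> \<phi>s)" and ?R = "fam_act push (block_perm \<sigma> ?rs) (fam_comp \<gamma> \<phi>s)"
  have len: "length (src \<gamma>) = length \<phi>s" using arg_cong[OF t, of length] by simp
  have sg: "\<sigma> permutes {..<length (src \<gamma>)}" "\<sigma> permutes {..<length ?rs}" using s len by simp_all
  have C: "family (fam_comp \<gamma> \<phi>s)" using g f t by (intro family_comp) auto
  have bp: "block_perm \<sigma> ?rs permutes {..<length (src (fam_comp \<gamma> \<phi>s))}"
    using block_perm_permutes[OF sg(2)] by (simp add: fam_comp_simps length_concat comp_def)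
  have A: "family (fam_act push \<sigma> \<gamma>)" using g sg(1) by (intro family_act) auto
  have LF: "family ?L" using A f t s map_permute_list[OF s, of tgt] by (intro family_comp) (auto simp: fam_act_simps)
  have RF: "family ?R" by (rule family_act[OF C bp])
  have e: "src ?L = src ?R"
    using permute_list_block_perm[OF sg(2), of "map src \<phi>s"] map_permute_list[OF s, of src]
    by (simp add: fam_comp_simps fam_act_simps comp_def)
  show "?L = ?R"
  proof (rule family_eqI[OF LF RF e])
    fix ns :: "nat list" and xs assume ns: "length ns = length (src ?L)"
    show "FO (dat ?L ns) xs = FO (dat ?R ns) xs" if "xs \<in> tuples_at Obj (src ?L) ns"
      using g f t s ns that unfolding fam_comp_simps by (intro on_objects.outer_value) auto
    show "FA (dat ?L ns) xs = FA (dat ?R ns) xs" if "xs \<in> tuples_at Arr (src ?L) ns" for xs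
      using g f t s ns that unfolding fam_comp_simps by (intro on_arrows.outer_value) auto
  qed (simp add: fam_comp_simps fam_act_simps)
next
  fix \<gamma> \<phi>s \<tau>s
  assume g: "family \<gamma> \<and> natural \<gamma>" and f: "\<forall>\<phi> \<in> set \<phi>s. family \<phi> \<and> natural \<phi>" and t: "map tgt \<phi>s = src \<gamma>"
    and s: "list_all2 (\<lambda>\<tau> \<phi>. \<tau> permutes {..<length (src \<phi>)}) \<tau>s \<phi>s"
  let ?rs = "map (\<lambda>\<phi>. length (src \<phi>)) \<phi>s"
  let ?L = "fam_comp \<gamma> (map2 (fam_act push) \<tau>s \<phi>s)" and ?R = "fam_act push (sum_perm \<tau>s ?rs) (fam_comp \<gamma> \<phi>s)"
  have len: "length (src \<gamma>) = length \<phi>s" using arg_cong[OF t, of length] by simp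
  have lt: "length \<tau>s = length \<phi>s" using s by (rule list_all2_lengthD)
  have sr: "list_all2 (\<lambda>\<tau> n. \<tau> permutes {..<n}) \<tau>s ?rs" using s by (simp add: list_all2_map2)
  have C: "family (fam_comp \<gamma> \<phi>s)" using g f t by (intro family_comp) auto
  have bp: "sum_perm \<tau>s ?rs permutes {..<length (src (fam_comp \<gamma> \<phi>s))}"
    using sum_perm_permutes[OF sr] by (simp add: fam_comp_simps length_concat comp_def)
  have LF: "family ?L"
  proof (rule family_comp)
    show "family \<phi>" if "\<phi> \<in> set (map2 (fam_act push) \<tau>s \<phi>s)" for \<phi>
      using that f s lt by (auto simp: set_zip list_all2_conv_all_nth intro!: family_act)
    show "map tgt (map2 (fam_act push) \<tau>s \<phi>s) = src \<gamma>"
      using t lt by (auto intro!: nth_equalityI simp: fam_act_simps list_eq_iff_nth_eq)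
  qed (use g in simp)
  have RF: "family ?R" by (rule family_act[OF C bp])
  have "map src (map2 (fam_act push) \<tau>s \<phi>s) = map2 permute_list \<tau>s (map src \<phi>s)"
    using lt by (auto intro!: nth_equalityI simp: fam_act_simps)
  then have e: "src ?L = src ?R"
    using permute_list_sum_perm[OF sr, of "map src \<phi>s"] by (simp add: fam_comp_simps fam_act_simps comp_def)
  show "?L = ?R"
  proof (rule family_eqI[OF LF RF e])
    fix ns :: "nat list" and xs assume ns: "length ns = length (src ?L)"
    show "FO (dat ?L ns) xs = FO (dat ?R ns) xs" if "xs \<in> tuples_at Obj (src ?L) ns"
      using g f t s ns that unfolding fam_comp_simps by (intro on_objects.inner_value) auto
    show "FA (dat ?L ns) xs = FA (dat ?R ns) xs" if "xs \<in> tuples_at Arr (src ?L) ns" for xs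
      using g f t s ns that unfolding fam_comp_simps by (intro on_arrows.inner_value) auto
  qed (simp add: fam_comp_simps fam_act_simps)
qed (auto simp: fam_comp_simps fam_act_simps fam_unit_simps intro: family_unit family_comp family_act
      natural_unit natural_comp natural_act)

end

section \<open>Naturality in each variable\<close>

context gamma_action begin

lemma act_tuple:
  assumes "set Xs \<subseteq> ob" "length hs = length Xs" "set hs \<subseteq> Arr Gamma_op"
  shows "xs \<in> tuples_at Obj Xs (map src hs) \<Longrightarrow> map2 FO (map2 act Xs hs) xs \<in> tuples_at Obj Xs (map tgt hs)"
    and "us \<in> tuples_at Arr Xs (map src hs) \<Longrightarrow> map2 FA (map2 act Xs hs) us \<in> tuples_at Arr Xs (map tgt hs)"
proof -
  have n: "Xs ! i \<in> ob" "hs ! i \<in> Arr Gamma_op" if "i < length Xs" for i using assms that by auto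
  show "map2 FO (map2 act Xs hs) xs \<in> tuples_at Obj Xs (map tgt hs)" if "xs \<in> tuples_at Obj Xs (map src hs)"
    using that assms(2) act_closed(1)[OF n] by (simp add: tuples_at_def)
  show "map2 FA (map2 act Xs hs) us \<in> tuples_at Arr Xs (map tgt hs)" if "us \<in> tuples_at Arr Xs (map src hs)"
    using that assms(2) act_closed(2)[OF n] by (simp add: tuples_at_def)
qed

text \<open>By functoriality of the smash product.\<close>
lemma natural_at_Comp:
  assumes f: "family \<phi>" and l: "length gs = length (src \<phi>)" "length hs = length (src \<phi>)"
    and A: "set gs \<subseteq> Arr Gamma_op" "set hs \<subseteq> Arr Gamma_op" and st: "map src gs = map tgt hs"
    and g: "natural_at \<phi> gs" and h: "natural_at \<phi> hs"
  shows "natural_at \<phi> (map2 (Comp Gamma_op) gs hs)"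
proof -
  let ?c = "map2 (Comp Gamma_op) gs hs"
  have o: "set (src \<phi>) \<subseteq> ob" "tgt \<phi> \<in> ob" using f by (auto simp: family_def)
  have st': "src (gs ! i) = tgt (hs ! i)" if "i < length (src \<phi>)" for i
    using arg_cong[OF st, of "\<lambda>z. z ! i"] that l by simp
  have n: "gs ! i \<in> Arr Gamma_op" "hs ! i \<in> Arr Gamma_op" "src (gs ! i) = tgt (hs ! i)" "src \<phi> ! i \<in> ob"
    if "i < length (src \<phi>)" for i
    using A o st'[OF that] that l by auto
  note C = Gamma_op_Comp[OF n(1-3)]
  have c: "map src ?c = map src hs" "map tgt ?c = map tgt gs" "length ?c = length (src \<phi>)"
    using C(1,2) l by (auto intro!: nth_equalityI)
  have S: "smash_gmor gs \<in> Arr Gamma_op" "smash_gmor hs \<in> Arr Gamma_op" "src (smash_gmor gs) = tgt (smash_gmor hs)"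
    using A st by (simp_all add: smash_gmor_Arr smash_gmor_simps)
  have lm: "length (map src hs) = length (src \<phi>)" using l by simp
  show ?thesis unfolding natural_at_iff[OF c(3)] c
  proof (intro conjI ballI)
    fix xs assume xs: "xs \<in> tuples_at Obj (src \<phi>) (map src hs)"
    have "map2 FO (map2 act (src \<phi>) ?c) xs = map2 FO (map2 act (src \<phi>) gs) (map2 FO (map2 act (src \<phi>) hs) xs)"
      using xs l n by (intro nth_equalityI) (simp_all add: tuples_at_def act_Comp)
    then show "FO (dat \<phi> (map tgt gs)) (map2 FO (map2 act (src \<phi>) ?c) xs)
        = FO (act (tgt \<phi>) (smash_gmor ?c)) (FO (dat \<phi> (map src hs)) xs)"
      using g h xs act_tuple(1)[OF o(1) l(2) A(2) xs] family_closed(1)[OF f lm xs]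
      unfolding natural_at_iff[OF l(1)] natural_at_iff[OF l(2)] smash_gmor_Comp[OF A st] st
      by (simp add: act_Comp[OF o(2) S] smash_gmor_simps)
  next
    fix xs assume xs: "xs \<in> tuples_at Arr (src \<phi>) (map src hs)"
    have "map2 FA (map2 act (src \<phi>) ?c) xs = map2 FA (map2 act (src \<phi>) gs) (map2 FA (map2 act (src \<phi>) hs) xs)"
      using xs l n by (intro nth_equalityI) (simp_all add: tuples_at_def act_Comp)
    then show "FA (dat \<phi> (map tgt gs)) (map2 FA (map2 act (src \<phi>) ?c) xs)
        = FA (act (tgt \<phi>) (smash_gmor ?c)) (FA (dat \<phi> (map src hs)) xs)"
      using g h xs act_tuple(2)[OF o(1) l(2) A(2) xs] family_closed(2)[OF f lm xs]
      unfolding natural_at_iff[OF l(1)] natural_at_iff[OF l(2)] smash_gmor_Comp[OF A st] st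
      by (simp add: act_Comp[OF o(2) S] smash_gmor_simps)
  qed
qed

lemma act_Ident_update:
  assumes "set (src \<phi>) \<subseteq> ob" "length ms = length (src \<phi>)" "i < length ms" "src h = ms ! i"
  shows "mk_ftor (prod_at (src \<phi>) ms) (map2 FO (map2 act (src \<phi>) ((map (Ident Gamma_op) ms)[i := h])))
      (map2 FA (map2 act (src \<phi>) ((map (Ident Gamma_op) ms)[i := h])))
    = at_position (prod_at (src \<phi>) ms) i (act (src \<phi> ! i) h)"
  unfolding at_position_def
proof (rule mk_ftor_cong)
  have o: "src \<phi> ! j \<in> ob" if "j < length ms" for j using assms(1,2) that by auto
  show "map2 FO (map2 act (src \<phi>) ((map (Ident Gamma_op) ms)[i := h])) xs = xs[i := FO (act (src \<phi> ! i) h) (xs ! i)]"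
    if "xs \<in> Obj (prod_at (src \<phi>) ms)" for xs
    using that assms o by (intro nth_equalityI) (auto simp: prod_at_sets tuples_at_def nth_list_update act_Ident)
  show "map2 FA (map2 act (src \<phi>) ((map (Ident Gamma_op) ms)[i := h])) xs = xs[i := FA (act (src \<phi> ! i) h) (xs ! i)]"
    if "xs \<in> Arr (prod_at (src \<phi>) ms)" for xs
    using that assms o by (intro nth_equalityI) (auto simp: prod_at_sets tuples_at_def nth_list_update act_Ident)
qed

lemma natural_at_Ident:
  assumes f: "family \<phi>" and l: "length ms = length (src \<phi>)"
  shows "natural_at \<phi> (map (Ident Gamma_op) ms)"
proof -
  have o: "set (src \<phi>) \<subseteq> ob" "tgt \<phi> \<in> ob" using f by (auto simp: family_def)
  have n: "src \<phi> ! i \<in> ob" if "i < length (src \<phi>)" for i using o that by auto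
  have m: "map src (map (Ident Gamma_op) ms) = ms" "map tgt (map (Ident Gamma_op) ms) = ms"
    by (simp_all add: Gamma_op_Ident comp_def)
  have "map2 FO (map2 act (src \<phi>) (map (Ident Gamma_op) ms)) xs = xs" if "xs \<in> tuples_at Obj (src \<phi>) ms" for xs
    using that l n by (intro nth_equalityI) (simp_all add: tuples_at_def act_Ident)
  moreover have "map2 FA (map2 act (src \<phi>) (map (Ident Gamma_op) ms)) xs = xs" if "xs \<in> tuples_at Arr (src \<phi>) ms" for xs
    using that l n by (intro nth_equalityI) (simp_all add: tuples_at_def act_Ident)
  ultimately show ?thesis using l family_closed[OF f l] o(2)
    by (subst natural_at_iff) (simp_all add: m smash_gmor_Ident act_Ident del: map_map)
qed

text \<open>A tuple of based maps is a composite of tuples with one entry that may differ from an identity. The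
  maps are applied from the first variable to the last: \<open>part k\<close> consists of the first \<open>k\<close> of them and
  of identities on the sources of the others.\<close>
lemma natural_if_natural_in_each:
  assumes f: "family \<phi>"
    and each: "\<And>ms i h. \<lbrakk>length ms = length (src \<phi>); i < length ms; h \<in> Arr Gamma_op; src h = ms ! i\<rbrakk>
      \<Longrightarrow> natural_at \<phi> ((map (Ident Gamma_op) ms)[i := h])"
  shows "natural \<phi>"
  unfolding natural_def
proof (intro allI impI, elim conjE)
  fix hs assume l: "length hs = length (src \<phi>)" and A: "set hs \<subseteq> Arr Gamma_op"
  have hA: "hs ! i \<in> Arr Gamma_op" if "i < length hs" for i using A that by auto
  define part where "part k = take k hs @ map (Ident Gamma_op) (drop k (map src hs))" for k
  have len: "length (part k) = length (src \<phi>)" if "k \<le> length hs" for k using that l by (simp add: part_def)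
  have nth: "part k ! i = (if i < k then hs ! i else Ident Gamma_op (src (hs ! i)))" if "k \<le> length hs" "i < length hs" for k i
    using that by (simp add: part_def nth_append)
  have pA: "set (part k) \<subseteq> Arr Gamma_op" for k
    using A by (auto simp: part_def Gamma_op_Ident dest: in_set_takeD)
  have "natural_at \<phi> (part k)" if "k \<le> length hs" for k
    using that
  proof (induction k)
    case 0
    show ?case using natural_at_Ident[OF f, of "map src hs"] l by (simp add: part_def)
  next
    case (Suc k)
    then have k: "k < length hs" by simp
    \<comment> \<open>\<open>gs\<close> applies the next based map, \<open>hs ! k\<close>, after those in \<open>part k\<close>.\<close>
    define ms where "ms = map tgt (part k)"
    define gs where "gs = (map (Ident Gamma_op) ms)[k := hs ! k]"
    have lms: "length ms = length hs" using len[of k] k l by (simp add: ms_def)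
    have msn: "ms ! i = (if i < k then tgt (hs ! i) else src (hs ! i))" if "i < length hs" for i
      using nth[of k i] that k len[of k] l by (simp add: ms_def Gamma_op_Ident)
    have gsn: "gs ! i = (if i = k then hs ! k else Ident Gamma_op (ms ! i))" if "i < length hs" for i
      using that lms by (simp add: gs_def nth_list_update)
    have lg: "length gs = length hs" by (simp add: gs_def lms)
    have g: "natural_at \<phi> gs" unfolding gs_def using k l lms msn[OF k] hA[OF k] by (intro each) simp_all
    have gA: "set gs \<subseteq> Arr Gamma_op"
      using hA[OF k] by (auto simp: gs_def Gamma_op_Ident dest!: set_update_subset_insert[THEN subsetD])
    have st: "map src gs = map tgt (part k)"
      unfolding ms_def[symmetric] using lg lms gsn msn k by (intro nth_equalityI) (auto simp: Gamma_op_Ident)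
    have "map2 (Comp Gamma_op) gs (part k) = part (Suc k)"
    proof (rule nth_equalityI)
      fix i assume "i < length (map2 (Comp Gamma_op) gs (part k))"
      then have i: "i < length hs" using lg by simp
      note I = Gamma_op_Ident(4)
      have idl: "Comp Gamma_op (Ident Gamma_op (tgt h)) h = h" "Comp Gamma_op h (Ident Gamma_op (src h)) = h"
        if "h \<in> Arr Gamma_op" for h
        using Gamma_op_Comp[OF I that, of "tgt h"] Gamma_op_Comp[OF that I, of "src h"] Gamma_op_le[OF that] that
        by (auto intro!: Gamma_op_eqI simp: Gamma_op_Ident)
      have idI: "Comp Gamma_op (Ident Gamma_op m) (Ident Gamma_op m) = Ident Gamma_op m" for m
        using idl(1)[OF I, of m] by (simp add: Gamma_op_Ident)
      have pn: "part k ! i = (if i < k then hs ! i else Ident Gamma_op (src (hs ! i)))"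
        using nth i k by simp
      have "map2 (Comp Gamma_op) gs (part k) ! i = Comp Gamma_op (gs ! i) (part k ! i)"
        using i lg len[of k] l k by simp
      also have "\<dots> = part (Suc k) ! i"
        unfolding nth[OF Suc.prems i] gsn[OF i] pn msn[OF i] using hA[OF i] idl[of "hs ! i"] idI
        by (cases i k rule: linorder_cases) auto
      finally show "map2 (Comp Gamma_op) gs (part k) ! i = part (Suc k) ! i" .
    qed (use k l lg len in simp)
    then show ?case
      using natural_at_Comp[OF f, of gs "part k"] lg l len[of k] k gA pA st g Suc.IH by simp
  qed
  from this[of "length hs"] show "natural_at \<phi> hs" by (simp add: part_def)
qed

end

section \<open>Functions to coproducts as lists of partial functions\<close>

lemma offset_inj:
  fixes i i' :: nat and xss :: "'b list list"
  assumes "i < length xss" "i' < length xss" "j < length (xss ! i)" "j' < length (xss ! i')"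
    and eq: "sum_list (map length (take i xss)) + j = sum_list (map length (take i' xss)) + j'"
  shows "i = i' \<and> j = j'"
proof -
  let ?o = "\<lambda>i. sum_list (map length (take i xss))"
  have step: "?o a + length (xss ! a) \<le> ?o b" if "a < b" "b < length xss" for a b
  proof -
    have "take b xss = take a xss @ xss ! a # drop (Suc a) (take b xss)"
      using that id_take_nth_drop[of a "take b xss"] by (simp add: min_def)
    from arg_cong[OF this, of "\<lambda>z. sum_list (map length z)"] show ?thesis by simp
  qed
  have "\<not> i < i'" using step[OF _ assms(2), of i] assms(3) eq by linarith
  moreover have "\<not> i' < i" using step[OF _ assms(1), of i'] assms(4) eq by linarith
  ultimately have "i = i'" by simp
  with eq show ?thesis by simp
qed

lemma collapse_to_simps:
  "src (collapse_to l f) = tgt f" "tgt (collapse_to l f) = src f ! l"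
  "\<lbrakk>x \<in> {1..tgt f}; dat f x = (i, y)\<rbrakk> \<Longrightarrow> dat (collapse_to l f) x = (if i = l then y else 0)"
  by (simp_all add: collapse_to_def)

lemma collapse_to_Arr:
  assumes "f \<in> MMor N_Mult" "l < length (src f)" shows "collapse_to l f \<in> Arr Gamma_op"
proof -
  have "dat (collapse_to l f) x \<le> src f ! l" if "x \<in> {0..tgt f}" for x
  proof (cases "x = 0")
    case False
    then have x: "x \<in> {1..tgt f}" using that by simp
    obtain i y where "dat f x = (i, y)" "i < length (src f)" "y \<in> {1..src f ! i}" using N_Mult_morE[OF assms(1) x] .
    then show ?thesis using collapse_to_simps(3)[OF x] by auto
  qed (simp add: collapse_to_def)
  then show ?thesis by (auto simp: Gamma_op_Arr collapse_to_simps collapse_to_def)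
qed

lemma collapse_to_unit: "collapse_to 0 (MUnit N_Mult n) = Ident Gamma_op n"
proof (rule Gamma_op_eqI)
  fix x assume "x \<in> {1..src (collapse_to 0 (MUnit N_Mult n))}"
  then have x: "x \<in> {1..n}" by (simp add: collapse_to_simps N_Mult_unit)
  then show "dat (collapse_to 0 (MUnit N_Mult n)) x = dat (Ident Gamma_op n) x"
    using collapse_to_simps(3)[of x "MUnit N_Mult n" 0 x 0] by (simp add: N_Mult_unit Gamma_op_Ident)
qed (simp_all add: collapse_to_simps N_Mult_unit Gamma_op_Ident collapse_to_Arr)

text \<open>An element is in the summand \<open>(i, j)\<close> of a composite if \<open>g\<close> sends it to the \<open>i\<close>-th summand and \<open>f\<^sub>i\<close> from
  there to the \<open>j\<close>-th one. Together with \<open>collapse_to_unit\<close> and \<open>collapse_to_act\<close> this describes the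
  multicategory \<open>\<nat>\<close> in terms of partial functions.\<close>
lemma collapse_to_comp:
  assumes g: "g \<in> MMor N_Mult" and fs: "set fs \<subseteq> MMor N_Mult" and t: "map tgt fs = src g"
    and ij: "i < length fs" "j < length (src (fs ! i))"
  shows "collapse_to (sum_list (map length (take i (map src fs))) + j) (MComp N_Mult g fs)
    = Comp Gamma_op (collapse_to j (fs ! i)) (collapse_to i g)"
proof -
  let ?o = "\<lambda>i. sum_list (map length (take i (map src fs)))"
  have len: "length (src g) = length fs" using arg_cong[OF t, of length] by simp
  have f: "fs ! k \<in> MMor N_Mult" "tgt (fs ! k) = src g ! k" if "k < length fs" for k
    using fs that by (auto simp flip: t)
  note C = N_Mult_comp_closed[OF g fs t]
  have o: "?o i + j < length (src (MComp N_Mult g fs))"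
    using offset_less[of i "map src fs" j] ij by (simp add: N_Mult_comp_simps)
  have so: "concat (map src fs) ! (?o i + j) = src (fs ! i) ! j"
    using nth_concat_offset[of i "map src fs" j] ij by simp
  have A: "collapse_to j (fs ! i) \<in> Arr Gamma_op" "collapse_to i g \<in> Arr Gamma_op"
    "src (collapse_to j (fs ! i)) = tgt (collapse_to i g)"
    using ij f g len by (simp_all add: collapse_to_Arr collapse_to_simps)
  show ?thesis
  proof (rule Gamma_op_eqI)
    show "collapse_to (?o i + j) (MComp N_Mult g fs) \<in> Arr Gamma_op" by (rule collapse_to_Arr[OF C o])
    fix x assume "x \<in> {1..src (collapse_to (?o i + j) (MComp N_Mult g fs))}"
    then have x: "x \<in> {1..tgt g}" by (simp add: collapse_to_simps N_Mult_comp_simps)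
    obtain i' y where iy: "dat g x = (i', y)" "i' < length (src g)" "y \<in> {1..src g ! i'}"
      using N_Mult_morE[OF g x] .
    have i': "i' < length fs" using iy len by simp
    have y: "y \<in> {1..tgt (fs ! i')}" using iy f[OF i'] by simp
    obtain j' z where jz: "dat (fs ! i') y = (j', z)" "j' < length (src (fs ! i'))" using N_Mult_morE[OF f(1)[OF i'] y] .
    have "dat (MComp N_Mult g fs) x = (?o i' + j', z)" by (rule N_Mult_comp_simps(3)[OF x iy(1) jz(1)])
    moreover have "x \<in> {1..tgt (MComp N_Mult g fs)}" using x by (simp add: N_Mult_comp_simps)
    ultimately have "dat (collapse_to (?o i + j) (MComp N_Mult g fs)) x = (if ?o i' + j' = ?o i + j then z else 0)"
      by (intro collapse_to_simps(3))
    also have "?o i' + j' = ?o i + j \<longleftrightarrow> i' = i \<and> j' = j"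
      using offset_inj[of i' "map src fs" i j' j] ij i' jz by auto
    also have "(if i' = i \<and> j' = j then z else 0) = dat (collapse_to j (fs ! i)) (dat (collapse_to i g) x)"
      using collapse_to_simps(3)[OF x iy(1), of i] collapse_to_simps(3)[OF y jz(1), of j] Gamma_op_zero[OF A(1)] by auto
    finally show "dat (collapse_to (?o i + j) (MComp N_Mult g fs)) x
        = dat (Comp Gamma_op (collapse_to j (fs ! i)) (collapse_to i g)) x"
      using Gamma_op_Comp(3)[OF A] x by (simp add: collapse_to_simps)
  qed (use Gamma_op_Comp[OF A] so in \<open>simp_all add: collapse_to_simps N_Mult_comp_simps\<close>)
qed

lemma collapse_to_act:
  assumes f: "f \<in> MMor N_Mult" and s: "\<sigma> permutes {..<length (src f)}" and l: "l < length (src f)"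
  shows "collapse_to l (Act N_Mult \<sigma> f) = collapse_to (\<sigma> l) f"
proof (rule Gamma_op_eqI)
  show "collapse_to l (Act N_Mult \<sigma> f) \<in> Arr Gamma_op" "collapse_to (\<sigma> l) f \<in> Arr Gamma_op"
    by (rule collapse_to_Arr[OF N_Mult_act_closed[OF f s]], simp add: N_Mult_act_simps l)
      (rule collapse_to_Arr[OF f perm_less[OF s l]])
  fix x assume "x \<in> {1..src (collapse_to l (Act N_Mult \<sigma> f))}"
  then have x: "x \<in> {1..tgt f}" "x \<in> {1..tgt (Act N_Mult \<sigma> f)}" by (simp_all add: collapse_to_simps N_Mult_act_simps)
  obtain i y where iy: "dat f x = (i, y)" using N_Mult_morE[OF f x(1)] .
  have "inv \<sigma> i = l \<longleftrightarrow> i = \<sigma> l" using permutes_inverses[OF s] by metis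
  then show "dat (collapse_to l (Act N_Mult \<sigma> f)) x = dat (collapse_to (\<sigma> l) f) x"
    using collapse_to_simps(3)[OF x(2) N_Mult_act_simps(3)[OF x(1) iy]] collapse_to_simps(3)[OF x(1) iy] by simp
qed (use s l in \<open>simp_all add: collapse_to_simps N_Mult_act_simps permute_list_nth\<close>)

text \<open>A based map \<open>h\<close> is a partial function; sending the elements at which it is undefined to
  themselves in a second summand makes it a morphism of \<open>\<nat>\<close>.\<close>
definition total_extension :: "gmor \<Rightarrow> nmor" where
  "total_extension h = \<lparr>src = [tgt h, src h], tgt = src h,
     dat = (\<lambda>x\<in>{1..src h}. if dat h x = 0 then (1, x) else (0, dat h x))\<rparr>"

lemma total_extension_simps: "src (total_extension h) = [tgt h, src h]" "tgt (total_extension h) = src h"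
  "x \<in> {1..src h} \<Longrightarrow> dat (total_extension h) x = (if dat h x = 0 then (1, x) else (0, dat h x))"
  by (simp_all add: total_extension_def)

lemma total_extension_mor:
  assumes "h \<in> Arr Gamma_op" shows "total_extension h \<in> MMor N_Mult"
  using Gamma_op_le[OF assms] by (auto simp: N_Mult_mor total_extension_def coprod_def less_2_cases_iff Suc_le_eq)

lemma collapse_to_total_extension:
  assumes "h \<in> Arr Gamma_op" shows "collapse_to 0 (total_extension h) = h"
proof (rule Gamma_op_eqI)
  fix x assume "x \<in> {1..src (collapse_to 0 (total_extension h))}"
  then have x: "x \<in> {1..src h}" by (simp add: collapse_to_simps total_extension_simps)
  then show "dat (collapse_to 0 (total_extension h)) x = dat h x"
    by (simp add: collapse_to_def total_extension_def)
qed (use assms total_extension_mor[OF assms] in \<open>simp_all add: collapse_to_simps total_extension_simps collapse_to_Arr\<close>)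

text \<open>The partial functions that make up \<open>id \<times> f \<times> id\<close> are the smash products of those of \<open>f\<close> with
  identities: a tuple is in the domain of the \<open>l\<close>-th one if its \<open>i\<close>-th entry is in the domain of \<open>f\<^sub>l\<close>.
  This relates multifunctoriality in the variable \<open>i\<close> to naturality.\<close>
lemma collapse_to_times_nmor:
  assumes f: "f \<in> MMor N_Mult" and i: "i < length ms" "tgt f = ms ! i" and l: "l < length (src f)"
  shows "times_nmor ms i f \<in> MMor N_Mult"
    and "collapse_to l (times_nmor ms i f) = smash_gmor ((map (Ident Gamma_op) ms)[i := collapse_to l f])"
proof -
  let ?T = "times_nmor ms i f" and ?hs = "(map (Ident Gamma_op) ms)[i := collapse_to l f]"
  have T: "src ?T = map (\<lambda>p. prod_list (ms[i := p])) (src f)" "tgt ?T = prod_list ms"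
    by (simp_all add: times_nmor_def)
  have val: "dat ?T (enc ms xs) = (a, enc (ms[i := src f ! a]) (xs[i := y]))"
    if "xs \<in> tuples ms" "dat f (xs ! i) = (a, y)" for xs a y
    using enc_in[OF that(1)] that(2) by (simp add: times_nmor_def dec_enc[OF that(1)])
  have upd: "xs[i := y] \<in> tuples (ms[i := p])" if "xs \<in> tuples ms" "y \<in> {1..p}" for xs y p
    using that i by (auto simp: tuples_nth nth_list_update)
  show M: "?T \<in> MMor N_Mult"
  proof -
    have "dat ?T k \<in> coprod (src ?T)" if k: "k \<in> {1..prod_list ms}" for k
    proof -
      obtain xs where xs: "xs \<in> tuples ms" "enc ms xs = k" using enc_surj[OF k] by blast
      have "xs ! i \<in> {1..tgt f}" using xs(1) i by (simp add: tuples_nth)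
      then obtain a y where a: "dat f (xs ! i) = (a, y)" "a < length (src f)" "y \<in> {1..src f ! a}"
        by (rule N_Mult_morE[OF f])
      show ?thesis using enc_in[OF upd[OF xs(1) a(3)]] val[OF xs(1) a(1)] a(2)
        by (simp add: xs(2) coprod_def T)
    qed
    moreover have "dat ?T \<in> extensional {1..prod_list ms}" by (simp add: times_nmor_def)
    ultimately show ?thesis by (auto simp: N_Mult_mor T PiE_def)
  qed
  have hA: "set ?hs \<subseteq> Arr Gamma_op"
    using collapse_to_Arr[OF f l] by (auto simp: Gamma_op_Ident dest!: set_update_subset_insert[THEN subsetD])
  have hst: "map src ?hs = ms" "map tgt ?hs = ms[i := src f ! l]"
    using i by (simp_all add: map_update collapse_to_simps Gamma_op_Ident comp_def)
  show "collapse_to l ?T = smash_gmor ?hs"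
  proof (rule Gamma_op_tuple_eqI[where ns = ms])
    show "collapse_to l ?T \<in> Arr Gamma_op" using l by (intro collapse_to_Arr[OF M]) (simp add: T)
    show "smash_gmor ?hs \<in> Arr Gamma_op" by (rule smash_gmor_Arr[OF hA])
    fix xs assume xs: "xs \<in> tuples ms" "xs \<in> based_tuples ms"
    have e: "based_enc ms xs = enc ms xs" using based_enc_tuples[OF xs(1)] by simp
    have xi: "xs ! i \<in> {1..tgt f}" using xs(1) i by (simp add: tuples_nth)
    then obtain a y where a: "dat f (xs ! i) = (a, y)" "a < length (src f)" "y \<in> {1..src f ! a}"
      by (rule N_Mult_morE[OF f])
    have lx: "length xs = length ms" using xs by (simp add: based_tuples_nth)
    have m: "map2 (\<lambda>h x. dat h x) ?hs xs = xs[i := (if a = l then y else 0)]"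
      using i(1) lx xs(2) collapse_to_simps(3)[OF xi a(1), of l]
      by (intro nth_equalityI) (simp_all add: nth_list_update Gamma_op_Ident based_tuples_nth, auto)
    have "dat (collapse_to l ?T) (enc ms xs) = (if a = l then enc (ms[i := src f ! a]) (xs[i := y]) else 0)"
      using enc_in[OF xs(1)] by (intro collapse_to_simps(3) val xs a) (simp add: T)
    also have "\<dots> = based_enc (ms[i := src f ! l]) (xs[i := (if a = l then y else 0)])"
    proof (cases "a = l")
      case True
      then show ?thesis using based_enc_tuples[OF upd[OF xs(1) a(3)]] by simp
    next
      case False
      then show ?thesis using i lx set_update_memI[of i xs 0] by (simp add: based_enc_def)
    qed
    also have "\<dots> = dat (smash_gmor ?hs) (based_enc ms xs)"
      using smash_gmor_enc[OF hA, of xs] xs(2) unfolding hst m by simp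
    finally show "dat (collapse_to l ?T) (based_enc ms xs) = dat (smash_gmor ?hs) (based_enc ms xs)" unfolding e .
  qed (use l in \<open>simp_all only: collapse_to_simps smash_gmor_simps hst T nth_map\<close>)
qed

section \<open>Based multifunctors and their action of based maps\<close>

lemma fcomp_fid_left: "is_functor C D F \<Longrightarrow> fcomp C (fid D) F = F"
  by (rule ftor_eqI[OF functor_fcomp[OF _ functor_fid], of C D F])
    (auto simp: functor_closed functor_categories)

definition partial_act :: "('o, 'a) ncat \<Rightarrow> gmor \<Rightarrow> ('o, 'a, 'o, 'a) ftor" where
  "partial_act F h = coord (FA F (total_extension h)) 0"

definition summand :: "nat \<Rightarrow> nat \<Rightarrow> nmor" where
  "summand n k = \<lparr>src = [n, k], tgt = n, dat = (\<lambda>x\<in>{1..n}. (0, x))\<rparr>"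

lemma summand_mor: "summand n k \<in> MMor N_Mult"
  by (auto simp: summand_def N_Mult_mor coprod_def)

text \<open>The aim is to see that \<open>F\<close> is determined by its values on objects and an action of based maps.\<close>
locale N_multifunctor = multifunctor N_Mult Cat_op F
  for F :: "('o, 'a) ncat"
begin

lemma mor: "f \<in> MMor N_Mult \<Longrightarrow> FA F f \<in> MMor Cat_op"
  using FA_closed by blast

lemma src_tgt:
  assumes "f \<in> MMor N_Mult" shows "src (FA F f) = map (FO F) (src f)" "tgt (FA F f) = FO F (tgt f)"
  using FA_Src[OF assms] FA_Tgt[OF assms] by simp_all

lemma based_value: "based_category (FO F n)"
  using FO_closed by auto

lemma coord_functor:
  assumes "f \<in> MMor N_Mult" "l < length (src f)"
  shows "is_functor (FO F (tgt f)) (FO F (src f ! l)) (coord (FA F f) l)"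
  using functor_coord[OF mor[OF assms(1)], of l] src_tgt[OF assms(1)] assms(2) by simp

lemma coord_FA_unit: "coord (FA F (MUnit N_Mult n)) 0 = fid (FO F n)"
  using FA_MUnit[of n] coord_unit[OF based_value] by simp

lemma coord_FA_comp:
  assumes g: "g \<in> MMor N_Mult" and fs: "set fs \<subseteq> MMor N_Mult" and t: "map tgt fs = src g"
    and ij: "i < length fs" "j < length (src (fs ! i))"
  shows "coord (FA F (MComp N_Mult g fs)) (sum_list (map length (take i (map src fs))) + j)
    = fcomp (FO F (tgt g)) (coord (FA F (fs ! i)) j) (coord (FA F g) i)"
proof -
  have f: "fs ! i \<in> MMor N_Mult" using fs ij by auto
  have "FA F (MComp N_Mult g fs) = MComp Cat_op (FA F g) (map (FA F) fs)"
    using FA_MComp[OF g, of fs] fs t by auto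
  moreover have "sum_list (map length (take i (map src (map (FA F) fs)))) = sum_list (map length (take i (map src fs)))"
    using fs by (intro same_shape_offset) (auto simp: src_tgt subset_iff)
  moreover have "set (map (FA F) fs) \<subseteq> MMor Cat_op" using fs mor by auto
  moreover have "map tgt (map (FA F) fs) = src (FA F g)"
    using fs by (auto simp: src_tgt[OF g] t[symmetric] src_tgt subset_iff)
  ultimately show ?thesis
    using Cat_op_comp_closed(2)[OF mor[OF g], of "map (FA F) fs" i j] ij src_tgt[OF g] src_tgt[OF f] by simp
qed

lemma coord_FA_act:
  assumes "f \<in> MMor N_Mult" "\<sigma> permutes {..<length (src f)}" "l < length (src f)"
  shows "coord (FA F (Act N_Mult \<sigma> f)) l = coord (FA F f) (\<sigma> l)"
  using FA_Act[OF assms(1)] Cat_op_act_closed(2)[OF mor[OF assms(1)]] src_tgt(1)[OF assms(1)] assms by simp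

text \<open>Composing the inclusion \<open>[n] \<rightarrow> [n] \<amalg> [0]\<close> with the \<open>0\<close>-morphism out of \<open>[0]\<close> gives the unit;
  every other inclusion of a summand factors through this one.\<close>
lemma coord_summand: "coord (FA F (summand n k)) 0 = fid (FO F n)"
proof -
  let ?z = "\<lparr>src = [], tgt = 0, dat = (\<lambda>_. undefined)\<rparr> :: nmor"
  let ?c = "\<lparr>src = [k], tgt = 0, dat = (\<lambda>_. undefined)\<rparr> :: nmor"
  let ?u = "MUnit N_Mult n"
  have zc: "?z \<in> MMor N_Mult" "?c \<in> MMor N_Mult" by (simp_all add: N_Mult_mor)
  have d: "dat (summand n m) x = (0, x)" if "x \<in> {1..n}" for m x using that by (simp add: summand_def)
  have z: "MComp N_Mult (summand n 0) [?u, ?z] = ?u"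
  proof (rule N_Mult_eqI[OF N_Mult_comp_closed[OF summand_mor] N_Mult_unit(4)])
    fix x assume "x \<in> {1..tgt (MComp N_Mult (summand n 0) [?u, ?z])}"
    then have x: "x \<in> {1..n}" by (simp add: N_Mult_comp_simps summand_def)
    show "dat (MComp N_Mult (summand n 0) [?u, ?z]) x = dat ?u x"
      using N_Mult_comp_simps(3)[of x "summand n 0" 0 x "[?u, ?z]" 0 x] d[OF x, of 0] x
      by (simp add: N_Mult_unit summand_def)
  qed (use zc in \<open>simp_all add: N_Mult_unit summand_def N_Mult_comp_simps\<close>)
  have c: "MComp N_Mult (summand n 0) [?u, ?c] = summand n k"
  proof (rule N_Mult_eqI[OF N_Mult_comp_closed[OF summand_mor] summand_mor])
    fix x assume "x \<in> {1..tgt (MComp N_Mult (summand n 0) [?u, ?c])}"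
    then have x: "x \<in> {1..n}" by (simp add: N_Mult_comp_simps summand_def)
    show "dat (MComp N_Mult (summand n 0) [?u, ?c]) x = dat (summand n k) x"
      using N_Mult_comp_simps(3)[of x "summand n 0" 0 x "[?u, ?c]" 0 x] d[OF x, of 0] d[OF x, of k] x
      by (simp add: N_Mult_unit summand_def)
  qed (use zc in \<open>simp_all add: N_Mult_unit summand_def N_Mult_comp_simps\<close>)
  have F: "is_functor (FO F n) (FO F n) (coord (FA F (summand n 0)) 0)"
    using coord_functor[OF summand_mor, of 0 n 0] by (simp add: summand_def)
  have "coord (FA F (MComp N_Mult (summand n 0) [?u, w])) 0 = coord (FA F (summand n 0)) 0"
    if "w \<in> MMor N_Mult" "tgt w = 0" for w
    using coord_FA_comp[OF summand_mor, of "[?u, w]" n 0 0 0] that fcomp_fid_left[OF F]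
    by (simp add: N_Mult_unit coord_FA_unit) (simp add: summand_def)
  from this[OF zc(1)] this[OF zc(2)] show ?thesis unfolding z c by (simp add: coord_FA_unit)
qed

text \<open>Whatever the other coordinates of \<open>f\<close> are, sending their values to one-element sets leads to
  the same morphism as sending the second summand of the total extension there.\<close>
lemma coord_first:
  assumes f: "f \<in> MMor N_Mult" and r: "src f = n # ns"
  shows "coord (FA F f) 0 = partial_act F (collapse_to 0 f)"
proof -
  let ?h = "collapse_to 0 f" and ?u = "MUnit N_Mult n" and ?m = "tgt f" and ?r = "length (src f)"
  let ?E = "total_extension ?h"
  \<comment> \<open>\<open>pt k\<close> is the map from \<open>[k]\<close> to a point. The morphism \<open>s\<close> sends an element of the domain of \<open>f\<close> to the
    point that belongs to its summand under \<open>f\<close>; it is applied to the elements outside of the first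
    summand only.\<close>
  define pt where "pt k = (\<lparr>src = [1], tgt = k, dat = (\<lambda>x\<in>{1..k}. (0, 1))\<rparr> :: nmor)" for k
  define s where "s = (\<lparr>src = replicate ?r 1, tgt = ?m, dat = (\<lambda>x\<in>{1..?m}. (fst (dat f x), 1))\<rparr> :: nmor)"
  have h: "?h \<in> Arr Gamma_op" by (rule collapse_to_Arr[OF f]) (simp add: r)
  have ht: "src ?h = ?m" "tgt ?h = n" by (simp_all add: collapse_to_simps r)
  note E = total_extension_mor[OF h] and Es = total_extension_simps[where h = ?h, unfolded ht]
  have pt: "pt k \<in> MMor N_Mult" for k by (auto simp: pt_def N_Mult_mor coprod_def)
  have fx: "fst (dat f x) < ?r" if "x \<in> {1..?m}" for x by (rule N_Mult_morE[OF f that]) simp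
  then have s: "s \<in> MMor N_Mult" by (auto simp: s_def N_Mult_mor coprod_def)
  let ?fs = "summand n 1 # map pt ns" and ?gs = "[?u, s]"
  have fs: "set ?fs \<subseteq> MMor N_Mult" "map tgt ?fs = src f"
    using pt summand_mor by (auto simp: r summand_def pt_def comp_def)
  have gs: "set ?gs \<subseteq> MMor N_Mult" "map tgt ?gs = src ?E"
    using s by (auto simp: N_Mult_unit s_def Es)
  have srcs: "map src ?fs = [n, 1] # map (\<lambda>_. [1]) ns" by (simp add: summand_def pt_def)
  have eq: "MComp N_Mult f ?fs = MComp N_Mult ?E ?gs"
  proof (rule N_Mult_eqI[OF N_Mult_comp_closed[OF f fs] N_Mult_comp_closed[OF E gs]])
    have "concat (map (\<lambda>_. [1]) ns) = replicate (length ns) (1::nat)" by (induction ns) auto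
    then show "src (MComp N_Mult f ?fs) = src (MComp N_Mult ?E ?gs)"
      by (simp only: N_Mult_comp_simps srcs) (simp add: N_Mult_unit s_def r)
    show "tgt (MComp N_Mult f ?fs) = tgt (MComp N_Mult ?E ?gs)" by (simp add: N_Mult_comp_simps Es)
    fix x assume "x \<in> {1..tgt (MComp N_Mult f ?fs)}"
    then have x: "x \<in> {1..?m}" "x \<in> {1..tgt ?E}" by (simp_all add: N_Mult_comp_simps Es)
    obtain i y where iy: "dat f x = (i, y)" "i < ?r" "y \<in> {1..src f ! i}" using N_Mult_morE[OF f x(1)] .
    have hx: "dat ?h x = (if i = 0 then y else 0)" by (rule collapse_to_simps(3)[OF x(1) iy(1)])
    show "dat (MComp N_Mult f ?fs) x = dat (MComp N_Mult ?E ?gs) x"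
    proof (cases "i = 0")
      case True
      have y: "y \<in> {1..n}" using iy True r by simp
      have "dat (?fs ! i) y = (0, y)" using y True by (simp add: summand_def)
      from N_Mult_comp_simps(3)[OF x(1) iy(1) this] have "dat (MComp N_Mult f ?fs) x = (0, y)" using True by simp
      moreover have "dat ?E x = (0, y)" using Es(3)[OF x(1)] hx True y by simp
      then have "dat (MComp N_Mult ?E ?gs) x = (0, y)"
        using N_Mult_comp_simps(3)[OF x(2), of 0 y ?gs 0 y] y by (simp add: N_Mult_unit)
      ultimately show ?thesis by simp
    next
      case False
      then obtain i' where i': "i = Suc i'" "i' < length ns" using iy r by (cases i) auto
      \<comment> \<open>The summand of index \<open>0\<close> is replaced by two summands, hence the shift of \<open>i\<close> by one.\<close>
      have "dat (?fs ! i) y = (0, 1)" using iy i' r by (simp add: pt_def)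
      from N_Mult_comp_simps(3)[OF x(1) iy(1) this]
      have "dat (MComp N_Mult f ?fs) x = (sum_list (map length (take i (map src ?fs))), 1)" by simp
      also have "sum_list (map length (take i (map src ?fs))) = Suc i"
        unfolding srcs i' using i'(2) by (simp add: take_map comp_def sum_list_triv)
      finally have 1: "dat (MComp N_Mult f ?fs) x = (Suc i, 1)" .
      have "dat ?E x = (1, x)" using Es(3)[OF x(1)] hx False by simp
      then have "dat (MComp N_Mult ?E ?gs) x = (Suc i, 1)"
        using N_Mult_comp_simps(3)[OF x(2), of 1 x ?gs i 1] x(1) iy(1) by (simp add: N_Mult_unit s_def)
      with 1 show ?thesis by simp
    qed
  qed
  have "coord (FA F (MComp N_Mult f ?fs)) 0 = fcomp (FO F ?m) (coord (FA F (summand n 1)) 0) (coord (FA F f) 0)"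
    using coord_FA_comp[OF f fs, of 0 0] by (simp add: summand_def)
  also have "\<dots> = coord (FA F f) 0"
    using coord_functor[OF f, of 0] by (simp add: coord_summand r fcomp_fid_left)
  finally have L: "coord (FA F (MComp N_Mult f ?fs)) 0 = coord (FA F f) 0" .
  have "coord (FA F (MComp N_Mult ?E ?gs)) 0 = fcomp (FO F ?m) (coord (FA F ?u) 0) (coord (FA F ?E) 0)"
    using coord_FA_comp[OF E gs, of 0 0] by (simp add: N_Mult_unit Es)
  also have "\<dots> = coord (FA F ?E) 0"
    using coord_functor[OF E, of 0] by (simp add: coord_FA_unit Es fcomp_fid_left)
  finally show ?thesis using L eq by (simp add: partial_act_def)
qed

text \<open>A multifunctor sees each of the partial functions that make up \<open>f\<close> separately. The action of
  permutations moves the \<open>l\<close>-th summand to the front, where \<open>coord_first\<close> applies.\<close>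
theorem coord_partial_act:
  assumes f: "f \<in> MMor N_Mult" and l: "l < length (src f)"
  shows "coord (FA F f) l = partial_act F (collapse_to l f)"
proof -
  let ?\<sigma> = "Transposition.transpose 0 l"
  have s: "?\<sigma> permutes {..<length (src f)}" using l by (intro permutes_swap_id) auto
  have z: "0 < length (src f)" using l by linarith
  let ?f = "Act N_Mult ?\<sigma> f"
  have "length (src ?f) = length (src f)" by (simp add: N_Mult_act_simps)
  with l obtain n ns where "src ?f = n # ns" by (cases "src ?f") auto
  from coord_first[OF N_Mult_act_closed[OF f s] this]
  show ?thesis using coord_FA_act[OF f s z] collapse_to_act[OF f s z] by simp
qed

lemma partial_act_functor:
  assumes h: "h \<in> Arr Gamma_op"
  shows "based_functor (FO F (src h)) (FO F (tgt h)) (partial_act F h)"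
  using coord_functor[OF total_extension_mor[OF h], of 0] coord_base[OF mor[OF total_extension_mor[OF h]], of 0]
    src_tgt[OF total_extension_mor[OF h]] based_value
  by (simp add: based_functor_iff partial_act_def total_extension_simps)

lemma partial_act_Ident: "partial_act F (Ident Gamma_op n) = fid (FO F n)"
  using coord_partial_act[of "MUnit N_Mult n" 0] coord_FA_unit[of n]
  by (simp add: N_Mult_unit collapse_to_unit)

text \<open>Composing total extensions on the first summand yields a morphism whose first partial function is
  the composite, and \<open>coord_partial_act\<close> computes the first coordinate from this partial function.\<close>
lemma partial_act_Comp:
  assumes g: "g \<in> Arr Gamma_op" and h: "h \<in> Arr Gamma_op" and st: "src g = tgt h"
  shows "partial_act F (Comp Gamma_op g h) = fcomp (FO F (src h)) (partial_act F g) (partial_act F h)"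
proof -
  let ?g = "total_extension g" and ?h = "total_extension h"
  let ?fs = "[?g, MUnit N_Mult (src h)]"
  note G = total_extension_mor[OF g] and H = total_extension_mor[OF h]
  have fs: "set ?fs \<subseteq> MMor N_Mult" "map tgt ?fs = src ?h"
    using G st by (simp_all add: N_Mult_unit total_extension_simps)
  have "coord (FA F (MComp N_Mult ?h ?fs)) 0 = partial_act F (collapse_to 0 (MComp N_Mult ?h ?fs))"
    by (rule coord_partial_act[OF N_Mult_comp_closed[OF H fs]])
      (simp add: N_Mult_comp_simps total_extension_simps)
  also have "collapse_to 0 (MComp N_Mult ?h ?fs) = Comp Gamma_op g h"
    using collapse_to_comp[OF H fs, of 0 0]
    by (simp add: total_extension_simps collapse_to_total_extension[OF g] collapse_to_total_extension[OF h])
  finally show ?thesis using coord_FA_comp[OF H fs, of 0 0]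
    by (simp add: total_extension_simps partial_act_def)
qed

end

section \<open>The multicategory of Gamma-categories\<close>

lemma Cat_based_mor: "f \<in> Arr Cat_based \<longleftrightarrow> based_functor (src f) (tgt f) (dat f)"
  by (simp add: Cat_based_def mk_cat_def)

lemma Cat_based_simps:
  "f \<in> Arr Cat_based \<Longrightarrow> Dom Cat_based f = src f" "f \<in> Arr Cat_based \<Longrightarrow> Cod Cat_based f = tgt f"
  "based_category C \<Longrightarrow> dat (Ident Cat_based C) = fid C" "C \<in> Obj Cat_based \<longleftrightarrow> based_category C"
  "\<lbrakk>g \<in> Arr Cat_based; f \<in> Arr Cat_based; src g = tgt f\<rbrakk> \<Longrightarrow> dat (Comp Cat_based g f) = fcomp (src f) (dat g) (dat f)"
  by (simp_all add: Cat_based_def mk_cat_def)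

lemma gamma_category_values:
  assumes X: "gamma_category X"
  shows "based_category (FO X n)"
    and "h \<in> Arr Gamma_op \<Longrightarrow> FA X h \<in> Arr Cat_based \<and> src (FA X h) = FO X (src h) \<and> tgt (FA X h) = FO X (tgt h)"
proof -
  interpret gamma_category X by fact
  show "based_category (FO X n)" using functor_closed(1)[OF is_functor_axioms, of n] by (simp add: Cat_based_simps)
  assume h: "h \<in> Arr Gamma_op"
  have "FA X h \<in> Arr Cat_based" using functor_closed(2)[OF is_functor_axioms h] .
  then show "FA X h \<in> Arr Cat_based \<and> src (FA X h) = FO X (src h) \<and> tgt (FA X h) = FO X (tgt h)"
    using FA_Dom[OF h] FA_Cod[OF h] by (simp add: Cat_based_simps Gamma_op_Dom_Cod[OF h])
qed

lemma gamma_action_Gamma: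
  "gamma_action {X :: ('o, 'a) gcat. gamma_category X} (\<lambda>X h. dat (FA X h)) gamma_push"
proof (rule gamma_action.intro)
  fix X :: "('o, 'a) gcat" assume "X \<in> {X. gamma_category X}"
  then have X: "gamma_category X" by simp
  interpret gamma_category X by fact
  note v = gamma_category_values[OF X]
  show "based_functor (FO X (src h)) (FO X (tgt h)) (dat (FA X h))" if "h \<in> Arr Gamma_op" for h
    using v(2)[OF that] by (auto simp: Cat_based_mor)
  show "dat (FA X (Ident Gamma_op n)) = fid (FO X n)" for n
    using FA_Ident[of n] v(1) by (simp add: Cat_based_simps)
  show "dat (FA X (Comp Gamma_op g h)) = fcomp (FO X (src h)) (dat (FA X g)) (dat (FA X h))"
    if "g \<in> Arr Gamma_op" "h \<in> Arr Gamma_op" "src g = tgt h" for g h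
    using FA_Comp[OF that(1,2)] v(2)[OF that(1)] v(2)[OF that(2)] that by (simp add: Cat_based_simps Gamma_op_Dom_Cod)
  show "gamma_push X \<sigma> ns = dat (FA X (reorder_gmor \<sigma> ns))" for \<sigma> ns
    by (simp add: gamma_push_def reorder_gmor_def)
qed

interpretation gamma: gamma_action "{X. gamma_category X}" "\<lambda>X h. dat (FA X h)" gamma_push
  by (rule gamma_action_Gamma)

lemma gamma_multimor_iff: "gamma_multimor \<phi> \<longleftrightarrow> gamma.family \<phi> \<and> gamma.natural \<phi>"
  by (auto simp: gamma_multimor_def gamma.family_def gamma.natural_def gamma.natural_at_def)

text \<open>Naturality for the action \<open>X h\<close> is the naturality in the definition of \<open>Gamma_Cat\<close>.\<close>
lemma multicategory_Gamma_Cat: "multicategory Gamma_Cat"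
  using gamma.multicategory_of_families by (simp add: Gamma_Cat_def gamma_multimor_iff)

section \<open>The multicategory of based multifunctors\<close>

abbreviation N_functors :: "('o, 'a) ncat set" where
  "N_functors \<equiv> {F. based_multifunctor N_Mult N_base Cat_op Cat_op_base F}"

lemma N_functors_multifunctor: "F \<in> N_functors \<Longrightarrow> N_multifunctor F"
  by (simp add: based_multifunctor_def N_multifunctor_def)

lemma N_functors_zero: "F \<in> N_functors \<Longrightarrow> FO F 0 = Term_Cat"
  using based_multifunctor.FO_base[of N_Mult N_base Cat_op Cat_op_base F] by (simp add: N_base_def Cat_op_base_def)

lemma reorder_mor:
  assumes "\<sigma> permutes {..<length ns}"
  defines "f \<equiv> \<lparr>src = [prod_list ns], tgt = prod_list ns, dat = (\<lambda>k\<in>{1..prod_list ns}. (0, reorder \<sigma> ns k))\<rparr> :: nmor"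
  shows "f \<in> MMor N_Mult" "collapse_to 0 f = reorder_gmor \<sigma> ns"
proof -
  show f: "f \<in> MMor N_Mult" using reorder_in[OF assms(1)] by (auto simp: f_def N_Mult_mor coprod_def)
  show "collapse_to 0 f = reorder_gmor \<sigma> ns"
    by (rule Gamma_op_eqI[OF collapse_to_Arr[OF f] reorder_gmor_Arr[OF assms(1)]])
      (simp_all add: f_def collapse_to_def reorder_gmor_def)
qed

lemma gamma_action_N_functors: "gamma_action (N_functors :: ('o, 'a) ncat set) partial_act mult_push"
proof (rule gamma_action.intro)
  fix F :: "('o, 'a) ncat" assume "F \<in> N_functors"
  then interpret N_multifunctor F by (rule N_functors_multifunctor)
  show "based_functor (FO F (src h)) (FO F (tgt h)) (partial_act F h)" if "h \<in> Arr Gamma_op" for h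
    using partial_act_functor[OF that] .
  show "partial_act F (Ident Gamma_op n) = fid (FO F n)" for n by (rule partial_act_Ident)
  show "partial_act F (Comp Gamma_op g h) = fcomp (FO F (src h)) (partial_act F g) (partial_act F h)"
    if "g \<in> Arr Gamma_op" "h \<in> Arr Gamma_op" "src g = tgt h" for g h
    by (rule partial_act_Comp[OF that])
  show "mult_push F \<sigma> ns = partial_act F (reorder_gmor \<sigma> ns)" if "\<sigma> permutes {..<length ns}" for \<sigma> ns
    using coord_partial_act[OF reorder_mor(1)[OF that], of 0] reorder_mor(2)[OF that] by (simp add: mult_push_def)
qed

interpretation mult: gamma_action N_functors partial_act mult_push
  by (rule gamma_action_N_functors)

text \<open>An instance of multifunctoriality in the variable \<open>i\<close> is naturality for a tuple of based maps with
  identities at all other positions.\<close>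
lemma multifunctorial_equation_iff:
  assumes f: "mult.family \<phi>" and ms: "length ms = length (src \<phi>)" "i < length ms"
    and g: "f \<in> MMor N_Mult" "tgt f = ms ! i" "l < length (src f)"
  defines "S \<equiv> prod_at (src \<phi>) ms"
  shows "fcomp S (coord (FA (tgt \<phi>) (times_nmor ms i f)) l) (dat \<phi> ms)
            = fcomp S (dat \<phi> (ms[i := src f ! l])) (at_position S i (coord (FA (src \<phi> ! i) f) l))
    \<longleftrightarrow> mult.natural_at \<phi> ((map (Ident Gamma_op) ms)[i := collapse_to l f])"
proof -
  have o: "set (src \<phi>) \<subseteq> N_functors" "tgt \<phi> \<in> N_functors" using f by (auto simp: mult.family_def)
  have oi: "src \<phi> ! i \<in> N_functors" using subsetD[OF o(1) nth_mem] ms by simp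
  let ?hs = "(map (Ident Gamma_op) ms)[i := collapse_to l f]"
  have hst: "map src ?hs = ms" "map tgt ?hs = ms[i := src f ! l]"
    using ms g by (simp_all add: map_update collapse_to_simps Gamma_op_Ident comp_def)
  have 1: "coord (FA (tgt \<phi>) (times_nmor ms i f)) l = partial_act (tgt \<phi>) (smash_gmor ?hs)"
    using N_multifunctor.coord_partial_act[OF N_functors_multifunctor[OF o(2)] collapse_to_times_nmor(1)[OF g(1) ms(2) g(2,3)], of l]
      collapse_to_times_nmor(2)[OF g(1) ms(2) g(2,3)] g(3) by (simp add: times_nmor_def)
  have 2: "coord (FA (src \<phi> ! i) f) l = partial_act (src \<phi> ! i) (collapse_to l f)"
    by (rule N_multifunctor.coord_partial_act[OF N_functors_multifunctor[OF oi] g(1,3)])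
  have "src (collapse_to l f) = ms ! i" using g by (simp add: collapse_to_simps)
  note 3 = mult.act_Ident_update[OF o(1) ms this]
  show ?thesis unfolding mult.natural_at_def Let_def hst 1 2 S_def 3 by (rule eq_commute)
qed

lemma multifunctorial_iff_natural:
  assumes f: "mult.family \<phi>"
  shows "multifunctorial_in_each \<phi> \<longleftrightarrow> mult.natural \<phi>"
proof
  assume n: "mult.natural \<phi>"
  show "multifunctorial_in_each \<phi>" unfolding multifunctorial_in_each_def Let_def
  proof (intro allI impI, elim conjE)
    fix ms i f' l assume *: "length ms = length (src \<phi>)" "i < length ms" "f' \<in> MMor N_Mult" "tgt f' = ms ! i" "l < length (src f')"
    have "set ((map (Ident Gamma_op) ms)[i := collapse_to l f']) \<subseteq> Arr Gamma_op"
      using collapse_to_Arr[OF *(3,5)] by (auto simp: Gamma_op_Ident dest!: set_update_subset_insert[THEN subsetD])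
    then have "mult.natural_at \<phi> ((map (Ident Gamma_op) ms)[i := collapse_to l f'])"
      using n *(1) by (simp add: mult.natural_def)
    then show "fcomp (prod_at (src \<phi>) ms) (coord (FA (tgt \<phi>) (times_nmor ms i f')) l) (dat \<phi> ms)
            = fcomp (prod_at (src \<phi>) ms) (dat \<phi> (ms[i := src f' ! l])) (at_position (prod_at (src \<phi>) ms) i (coord (FA (src \<phi> ! i) f') l))"
      using multifunctorial_equation_iff[OF f *] by blast
  qed
next
  assume m: "multifunctorial_in_each \<phi>"
  show "mult.natural \<phi>"
  proof (rule mult.natural_if_natural_in_each[OF f])
    fix ms i h assume *: "length ms = length (src \<phi>)" "i < length ms" "h \<in> Arr Gamma_op" "src h = ms ! i"
    note t = total_extension_mor[OF *(3)]
    have l: "0 < length (src (total_extension h))" "tgt (total_extension h) = ms ! i" using *(4) by (simp_all add: total_extension_simps)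
    show "mult.natural_at \<phi> ((map (Ident Gamma_op) ms)[i := h])"
      using multifunctorial_equation_iff[OF f *(1,2) t l(2,1)] m *(1,2) t l
      unfolding multifunctorial_in_each_def Let_def collapse_to_total_extension[OF *(3)] by blast
  qed
qed

text \<open>By multifunctoriality in \<open>j\<close>, respectively in \<open>i\<close>, both composites become \<open>\<phi>\<close> after the functors
  \<open>(F\<^sub>i f)\<^sub>l\<close> and \<open>(F\<^sub>j g)\<^sub>t\<close>, which act on different factors and therefore commute.\<close>
lemma bilinear_if_multifunctorial:
  assumes f: "mult.family \<phi>" and m: "multifunctorial_in_each \<phi>"
  shows "bilinear_in_pairs \<phi>"
  unfolding bilinear_in_pairs_def Let_def
proof (intro allI impI, elim conjE)
  fix ms i j g h l t
  assume l: "length ms = length (src \<phi>)" and ij: "i < length ms" "j < length ms" "i \<noteq> j"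
    and g: "g \<in> MMor N_Mult" "tgt g = ms ! i" "l < length (src g)"
    and h: "h \<in> MMor N_Mult" "tgt h = ms ! j" "t < length (src h)"
  let ?Xs = "src \<phi>" and ?G = "tgt \<phi>"
  let ?S = "\<lambda>ms. prod_at ?Xs ms"
  let ?f1 = "coord (FA (?Xs ! i) g) l" and ?f2 = "coord (FA (?Xs ! j) h) t"
  let ?ms1 = "ms[i := src g ! l]" and ?ms2 = "ms[j := src h ! t]"
  have e: "fcomp (?S ms) (coord (FA ?G (times_nmor ms i f)) l) (dat \<phi> ms)
      = fcomp (?S ms) (dat \<phi> (ms[i := src f ! l])) (at_position (?S ms) i (coord (FA (?Xs ! i) f) l))"
    if "length ms = length ?Xs" "i < length ms" "f \<in> MMor N_Mult" "tgt f = ms ! i" "l < length (src f)" for ms i f l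
    using m that unfolding multifunctorial_in_each_def Let_def by blast
  have e1: "fcomp (?S ?ms1) (coord (FA ?G (times_nmor ?ms1 j h)) t) (dat \<phi> ?ms1)
      = fcomp (?S ?ms1) (dat \<phi> (?ms1[j := src h ! t])) (at_position (?S ?ms1) j ?f2)"
    using l ij h by (intro e) simp_all
  have e2: "fcomp (?S ?ms2) (coord (FA ?G (times_nmor ?ms2 i g)) l) (dat \<phi> ?ms2)
      = fcomp (?S ?ms2) (dat \<phi> (?ms2[i := src g ! l])) (at_position (?S ?ms2) i ?f1)"
    using l ij g by (intro e) simp_all
  have sw: "?ms2[i := src g ! l] = ?ms1[j := src h ! t]" using ij by (simp add: list_update_swap)
  have o: "set ?Xs \<subseteq> N_functors" using f by (simp add: mult.family_def)
  have "?Xs ! i \<in> N_functors" "?Xs ! j \<in> N_functors"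
    by (rule subsetD[OF o nth_mem], use l ij in simp)+
  then have F: "is_functor (FO (?Xs ! i) (ms ! i)) (FO (?Xs ! i) (src g ! l)) ?f1" "is_functor (FO (?Xs ! j) (ms ! j)) (FO (?Xs ! j) (src h ! t)) ?f2"
    using N_multifunctor.coord_functor[OF N_functors_multifunctor g(1,3)] N_multifunctor.coord_functor[OF N_functors_multifunctor h(1,3)] g(2) h(2)
    by simp_all
  note c1 = functor_closed[OF F(1)] and c2 = functor_closed[OF F(2)]
  have S: "Obj (?S ms) = tuples_at Obj ?Xs ms" "Arr (?S ms) = tuples_at Arr ?Xs ms"
    "Obj (?S ?ms1) = tuples_at Obj ?Xs ?ms1" "Arr (?S ?ms1) = tuples_at Arr ?Xs ?ms1"
    "Obj (?S ?ms2) = tuples_at Obj ?Xs ?ms2" "Arr (?S ?ms2) = tuples_at Arr ?Xs ?ms2"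
    using l by (simp_all add: prod_at_sets)
  show "fcomp (?S ms) (coord (FA ?G (times_nmor ?ms1 j h)) t) (fcomp (?S ms) (dat \<phi> ?ms1) (at_position (?S ms) i ?f1))
      = fcomp (?S ms) (coord (FA ?G (times_nmor ?ms2 i g)) l) (fcomp (?S ms) (dat \<phi> ?ms2) (at_position (?S ms) j ?f2))"
    unfolding fcomp_def[of "?S ms" "coord (FA ?G (times_nmor ?ms1 j h)) t"] fcomp_def[of "?S ms" "coord (FA ?G (times_nmor ?ms2 i g)) l"]
  proof (rule mk_ftor_cong)
    fix xs assume xs: "xs \<in> Obj (?S ms)"
    have lx: "length xs = length ms" using xs l by (simp add: S tuples_at_def)
    have x1: "xs[i := FO ?f1 (xs ! i)] \<in> Obj (?S ?ms1)" and x2: "xs[j := FO ?f2 (xs ! j)] \<in> Obj (?S ?ms2)"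
      using xs c1(1) c2(1) l ij by (auto simp: S tuples_at_def nth_list_update)
    show "FO (coord (FA ?G (times_nmor ?ms1 j h)) t) (FO (fcomp (?S ms) (dat \<phi> ?ms1) (at_position (?S ms) i ?f1)) xs)
      = FO (coord (FA ?G (times_nmor ?ms2 i g)) l) (FO (fcomp (?S ms) (dat \<phi> ?ms2) (at_position (?S ms) j ?f2)) xs)"
      using arg_cong[OF e1, of "\<lambda>F. FO F (xs[i := FO ?f1 (xs ! i)])"] arg_cong[OF e2, of "\<lambda>F. FO F (xs[j := FO ?f2 (xs ! j)])"]
        x1 x2 xs ij lx unfolding sw by (simp add: at_position_def list_update_swap)
  next
    fix xs assume xs: "xs \<in> Arr (?S ms)"
    have lx: "length xs = length ms" using xs l by (simp add: S tuples_at_def)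
    have x1: "xs[i := FA ?f1 (xs ! i)] \<in> Arr (?S ?ms1)" and x2: "xs[j := FA ?f2 (xs ! j)] \<in> Arr (?S ?ms2)"
      using xs c1(2) c2(2) l ij by (auto simp: S tuples_at_def nth_list_update)
    show "FA (coord (FA ?G (times_nmor ?ms1 j h)) t) (FA (fcomp (?S ms) (dat \<phi> ?ms1) (at_position (?S ms) i ?f1)) xs)
      = FA (coord (FA ?G (times_nmor ?ms2 i g)) l) (FA (fcomp (?S ms) (dat \<phi> ?ms2) (at_position (?S ms) j ?f2)) xs)"
      using arg_cong[OF e1, of "\<lambda>F. FA F (xs[i := FA ?f1 (xs ! i)])"] arg_cong[OF e2, of "\<lambda>F. FA F (xs[j := FA ?f2 (xs ! j)])"]
        x1 x2 xs ij lx unfolding sw by (simp add: at_position_def list_update_swap)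
  qed
qed

text \<open>If some \<open>m\<^sub>i\<close> is 0 then so is the product, and the target is the terminal category.\<close>
lemma preserves_basepoints_family:
  assumes f: "mult.family \<phi>" shows "preserves_basepoints \<phi>"
  unfolding preserves_basepoints_def
proof (intro allI impI, elim conjE)
  fix ms :: "nat list" assume l: "length ms = length (src \<phi>)" and z: "0 \<in> set ms"
  have "prod_list ms = 0" using z by (induction ms) auto
  moreover have "FO (tgt \<phi>) 0 = Term_Cat" using f by (intro N_functors_zero) (auto simp: mult.family_def)
  ultimately have "is_functor (prod_at (src \<phi>) ms) Term_Cat (dat \<phi> ms)" using mult.family_component(2)[OF f l] by simp
  then show "dat \<phi> ms = const_base (prod_at (src \<phi>) ms) Term_Cat"
    using functor_const_base[OF functor_categories(1) based_Term_Cat] by (intro functor_into_points_unique) auto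
qed

lemma linear_transformation_iff: "linear_transformation \<phi> \<longleftrightarrow> mult.family \<phi> \<and> mult.natural \<phi>"
proof -
  have "linear_transformation \<phi> \<longleftrightarrow> mult.family \<phi> \<and> multifunctorial_in_each \<phi> \<and> bilinear_in_pairs \<phi> \<and> preserves_basepoints \<phi>"
    by (auto simp: linear_transformation_def mult.family_def)
  then show ?thesis
    using multifunctorial_iff_natural[of \<phi>] bilinear_if_multifunctorial[of \<phi>] preserves_basepoints_family[of \<phi>] by blast
qed

lemma multicategory_Mult_N_Cat_op: "multicategory Mult_N_Cat_op"
  using mult.multicategory_of_families by (simp add: Mult_N_Cat_op_def linear_transformation_iff)

section \<open>The multifunctor A\<close>

lemma A_obj_FO [simp]: "FO (A_obj X) = FO X"
  by (simp add: A_obj_def)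

lemma A_obj_FA:
  assumes X: "gamma_category X" and f: "f \<in> MMor N_Mult"
  shows "FA (A_obj X) f \<in> MMor Cat_op" "src (FA (A_obj X) f) = map (FO X) (src f)" "tgt (FA (A_obj X) f) = FO X (tgt f)"
    and "l < length (src f) \<Longrightarrow> coord (FA (A_obj X) f) l = dat (FA X (collapse_to l f))"
proof -
  let ?F = "FA (A_obj X) f"
  note v = gamma_category_values[OF X]
  show st: "src ?F = map (FO X) (src f)" "tgt ?F = FO X (tgt f)" using f by (simp_all add: A_obj_def)
  have d: "dat ?F = mk_ftor (FO X (tgt f))
         (\<lambda>x. map (\<lambda>l. FO (dat (FA X (collapse_to l f))) x) [0..<length (src f)])
         (\<lambda>u. map (\<lambda>l. FA (dat (FA X (collapse_to l f))) u) [0..<length (src f)])"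
    using f by (simp add: A_obj_def)
  have b: "based_functor (FO X (tgt f)) (FO X (src f ! l)) (dat (FA X (collapse_to l f)))" if "l < length (src f)" for l
    using v(2)[OF collapse_to_Arr[OF f that]] by (auto simp: Cat_based_mor collapse_to_simps)
  show M: "?F \<in> MMor Cat_op"
  proof (rule Cat_op_morI[OF _ _ d[folded st(2)]])
    fix l assume "l < length (src ?F)"
    then have "l < length (src f)" by (simp add: st)
    then show "\<exists>F. is_functor (tgt ?F) (src ?F ! l) F \<and> FO F (Base (tgt ?F)) = Base (src ?F ! l) \<and>
        (\<forall>x \<in> Obj (tgt ?F). map (\<lambda>l. FO (dat (FA X (collapse_to l f))) x) [0..<length (src f)] ! l = FO F x) \<and>
        (\<forall>x \<in> Arr (tgt ?F). map (\<lambda>l. FA (dat (FA X (collapse_to l f))) x) [0..<length (src f)] ! l = FA F x)"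
      using b by (intro exI[of _ "dat (FA X (collapse_to l f))"]) (simp add: st based_functor_iff)
  qed (use v(1) in \<open>auto simp: st\<close>)
  show "coord ?F l = dat (FA X (collapse_to l f))" if l: "l < length (src f)"
  proof (rule ftor_eqI)
    show "is_functor (FO X (tgt f)) (FO X (src f ! l)) (coord ?F l)" using functor_coord[OF M, of l] l st by simp
    show "is_functor (FO X (tgt f)) (FO X (src f ! l)) (dat (FA X (collapse_to l f)))" using b[OF l] by (simp add: based_functor_iff)
  qed (use l st coord_simps[OF M, of l] in \<open>simp_all add: d\<close>)
qed

text \<open>Composition and permutation of morphisms of \<open>\<nat>\<close> are composition and permutation of partial functions,
  and \<open>X\<close> is a functor on these; the equations are compared coordinate by coordinate.\<close>
lemma A_obj_multifunctor:
  assumes X: "gamma_category X" shows "multifunctor N_Mult Cat_op (A_obj X)"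
proof -
  note a = A_obj_FA[OF X]
  have o: "X \<in> {X. gamma_category X}" using X by simp
  show ?thesis
  proof (intro multifunctor.intro multicategory_N_Mult multicategory_Cat_op multifunctor_axioms.intro)
    show "FO (A_obj X) \<in> MObj N_Mult \<rightarrow>\<^sub>E MObj Cat_op" using gamma_category_values(1)[OF X] by auto
    show "FA (A_obj X) \<in> MMor N_Mult \<rightarrow>\<^sub>E MMor Cat_op" using a(1) by (auto simp: A_obj_def)
    show "FA (A_obj X) (MUnit N_Mult n) = MUnit Cat_op (FO (A_obj X) n)" for n
      using a(1-3)[OF N_Mult_unit(4)[of n]] a(4)[OF N_Mult_unit(4)[of n], of 0] gamma_category_values(1)[OF X, of n] gamma.act_Ident[OF o, of n]
      by (intro Cat_op_coord_eqI) (simp_all add: N_Mult_unit Cat_op_unit Cat_op_unit_closed collapse_to_unit coord_unit)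
    show "FA (A_obj X) (MComp N_Mult g fs) = MComp Cat_op (FA (A_obj X) g) (map (FA (A_obj X)) fs)"
      if g: "g \<in> MMor N_Mult" and "fs \<in> lists (MMor N_Mult)" and "map (Tgt N_Mult) fs = Src N_Mult g" for g fs
    proof -
      have fs: "set fs \<subseteq> MMor N_Mult" "map tgt fs = src g" using that by auto
      have len: "length fs = length (src g)" using arg_cong[OF fs(2), of length] by simp
      note C = N_Mult_comp_closed[OF g fs]
      let ?Fs = "map (FA (A_obj X)) fs"
      have af: "FA (A_obj X) f \<in> MMor Cat_op" "src (FA (A_obj X) f) = map (FO X) (src f)" "tgt (FA (A_obj X) f) = FO X (tgt f)"
        if "f \<in> set fs" for f using a[of f] fs that by auto
      have Fs: "set ?Fs \<subseteq> MMor Cat_op" "map tgt ?Fs = src (FA (A_obj X) g)"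
        using af fs(2)[symmetric] a(2)[OF g] by auto
      have ms: "map src ?Fs = map (map (FO X)) (map src fs)" using af by simp
      show ?thesis
      proof (rule Cat_op_coord_eqI)
        show "FA (A_obj X) (MComp N_Mult g fs) \<in> MMor Cat_op" by (rule a(1)[OF C])
        show "MComp Cat_op (FA (A_obj X) g) ?Fs \<in> MMor Cat_op" by (rule Cat_op_comp_closed(1)[OF a(1)[OF g] Fs])
        show "src (FA (A_obj X) (MComp N_Mult g fs)) = src (MComp Cat_op (FA (A_obj X) g) ?Fs)"
          unfolding Cat_op_comp ms a(2)[OF C] N_Mult_comp_simps by (simp only: map_concat)
        show "tgt (FA (A_obj X) (MComp N_Mult g fs)) = tgt (MComp Cat_op (FA (A_obj X) g) ?Fs)"
          by (simp only: Cat_op_comp a(3)[OF C] a(3)[OF g] N_Mult_comp_simps)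
        fix k assume "k < length (src (FA (A_obj X) (MComp N_Mult g fs)))"
        then have k: "k < length (concat (map src fs))" unfolding a(2)[OF C] N_Mult_comp_simps by simp
        obtain i j where ij: "i < length (map src fs)" "j < length (map src fs ! i)"
          and ke: "k = sum_list (map length (take i (map src fs))) + j"
          using k by (rule obtain_offset)
        have i: "i < length fs" "j < length (src (fs ! i))" using ij by simp_all
        then have fi: "fs ! i \<in> MMor N_Mult" "tgt (fs ! i) = src g ! i" using fs by (auto simp flip: fs(2))
        have o': "sum_list (map length (take i (map src ?Fs))) = sum_list (map length (take i (map src fs)))"
          by (rule same_shape_offset) (simp add: ms del: map_map, simp)
        have "coord (FA (A_obj X) (MComp N_Mult g fs)) k = dat (FA X (collapse_to k (MComp N_Mult g fs)))"
          using k by (intro a(4)[OF C]) (simp add: N_Mult_comp_simps)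
        also have "\<dots> = fcomp (FO X (tgt g)) (dat (FA X (collapse_to j (fs ! i)))) (dat (FA X (collapse_to i g)))"
          unfolding ke collapse_to_comp[OF g fs i]
          using collapse_to_Arr[OF fi(1) i(2)] collapse_to_Arr[OF g, of i] i len fi
          by (subst gamma.act_Comp[OF o]) (simp_all add: collapse_to_simps)
        also have "\<dots> = coord (MComp Cat_op (FA (A_obj X) g) ?Fs) k"
          using Cat_op_comp_closed(2)[OF a(1)[OF g] Fs, of i j] i a(2)[OF fi(1)] a(3)[OF g] a(4)[OF g, of i] a(4)[OF fi(1) i(2)] len
          unfolding o' ke by simp
        finally show "coord (FA (A_obj X) (MComp N_Mult g fs)) k = coord (MComp Cat_op (FA (A_obj X) g) ?Fs) k" .
      qed
    qed
    fix f assume f: "f \<in> MMor N_Mult"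
    show "Src Cat_op (FA (A_obj X) f) = map (FO (A_obj X)) (Src N_Mult f)" "Tgt Cat_op (FA (A_obj X) f) = FO (A_obj X) (Tgt N_Mult f)"
      using a(2,3)[OF f] by simp_all
    fix \<sigma> assume "\<sigma> permutes {..<length (Src N_Mult f)}"
    then have s: "\<sigma> permutes {..<length (src f)}" "\<sigma> permutes {..<length (src (FA (A_obj X) f))}" using a(2)[OF f] by simp_all
    show "FA (A_obj X) (Act N_Mult \<sigma> f) = Act Cat_op \<sigma> (FA (A_obj X) f)"
    proof (rule Cat_op_coord_eqI)
      note A = N_Mult_act_closed[OF f s(1)]
      show "FA (A_obj X) (Act N_Mult \<sigma> f) \<in> MMor Cat_op" by (rule a(1)[OF A])
      show "Act Cat_op \<sigma> (FA (A_obj X) f) \<in> MMor Cat_op" by (rule Cat_op_act_closed(1)[OF a(1)[OF f] s(2)])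
      show "src (FA (A_obj X) (Act N_Mult \<sigma> f)) = src (Act Cat_op \<sigma> (FA (A_obj X) f))"
        unfolding Cat_op_act a(2)[OF A] a(2)[OF f] N_Mult_act_simps by (rule map_permute_list[OF s(1)])
      show "tgt (FA (A_obj X) (Act N_Mult \<sigma> f)) = tgt (Act Cat_op \<sigma> (FA (A_obj X) f))"
        by (simp only: Cat_op_act a(3)[OF A] a(3)[OF f] N_Mult_act_simps)
      fix l assume "l < length (src (FA (A_obj X) (Act N_Mult \<sigma> f)))"
      then have l: "l < length (src f)" unfolding a(2)[OF A] by (simp add: N_Mult_act_simps)
      then show "coord (FA (A_obj X) (Act N_Mult \<sigma> f)) l = coord (Act Cat_op \<sigma> (FA (A_obj X) f)) l"
        using a(4)[OF A, of l] Cat_op_act_closed(2)[OF a(1)[OF f] s(2), of l] a(4)[OF f perm_less[OF s(1) l]] a(2)[OF f]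
          collapse_to_act[OF f s(1) l] by (simp add: N_Mult_act_simps)
    qed
  qed
qed

lemma A_obj_based:
  assumes X: "gamma_category X" shows "A_obj X \<in> N_functors"
proof -
  have z: "FO X 0 = Term_Cat" using X by (simp add: gamma_category_def gamma_category_axioms_def)
  interpret N: based_multicategory N_Mult N_base by (rule based_N_Mult)
  interpret C: based_multicategory Cat_op Cat_op_base by (rule based_Cat_op)
  have n: "FA N_base r \<in> MMor N_Mult" and c: "FA Cat_op_base r \<in> MMor Cat_op" for r
    using N.FA_closed C.FA_closed by (auto simp: Term_Mult_simps)
  have "FA (A_obj X) (FA N_base r) = FA Cat_op_base r" for r
    using A_obj_FA(1-3)[OF X n[of r]] c[of r] z
    by (intro Cat_op_into_points_unique) (auto simp: N_base_def Cat_op_base_def)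
  then show ?thesis
    using A_obj_multifunctor[OF X] based_N_Mult based_Cat_op z
    by (simp add: based_multifunctor_def based_multifunctor_axioms_def N_base_def Cat_op_base_def)
qed

text \<open>This is why \<open>A\<close> does not change families: the action defining \<open>A X\<close> is recovered from \<open>A X\<close>.\<close>
lemma partial_act_A_obj:
  assumes X: "gamma_category X" and h: "h \<in> Arr Gamma_op"
  shows "partial_act (A_obj X) h = dat (FA X h)"
  using A_obj_FA(4)[OF X total_extension_mor[OF h], of 0] collapse_to_total_extension[OF h]
  by (simp add: partial_act_def total_extension_simps)

text \<open>\<open>X\<close> and \<open>A X\<close> have the same values on objects, so the components of a family can be kept.\<close>
definition A_mor :: "(('o, 'a) gcat, 'o, 'a) fmor \<Rightarrow> (('o, 'a) ncat, 'o, 'a) fmor" where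
  "A_mor \<phi> = \<lparr>src = map A_obj (src \<phi>), tgt = A_obj (tgt \<phi>), dat = dat \<phi>\<rparr>"

lemma A_mor_simps [simp]: "src (A_mor \<phi>) = map A_obj (src \<phi>)" "tgt (A_mor \<phi>) = A_obj (tgt \<phi>)" "dat (A_mor \<phi>) = dat \<phi>"
  by (simp_all add: A_mor_def)

lemma map2_FO_A_obj: "map2 (\<lambda>X n. FO X n) (map A_obj Xs) ns = map2 (\<lambda>X n. FO X n) Xs ns"
  by (simp add: zip_map1 comp_def split_def)

lemma prod_at_A_obj: "prod_at (map A_obj Xs) ns = prod_at Xs ns"
  unfolding prod_at_def map2_FO_A_obj ..

lemma A_mor_closed:
  assumes "gamma_multimor \<phi>" shows "linear_transformation (A_mor \<phi>)"
proof -
  have f: "gamma.family \<phi>" "gamma.natural \<phi>" using assms by (simp_all add: gamma_multimor_iff)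
  have X: "gamma_category X" if "X \<in> set (src \<phi>)" for X using f(1) that by (auto simp: gamma.family_def)
  have Y: "gamma_category (tgt \<phi>)" using f(1) by (simp add: gamma.family_def)
  have "mult.family (A_mor \<phi>)"
    using f(1) A_obj_based by (auto simp: mult.family_def gamma.family_def smash_family_def map2_FO_A_obj)
  moreover have "mult.natural (A_mor \<phi>)" unfolding mult.natural_def mult.natural_at_def Let_def
  proof (intro allI impI, elim conjE)
    fix hs assume hs: "length hs = length (src (A_mor \<phi>))" "set hs \<subseteq> Arr Gamma_op"
    have "map2 partial_act (map A_obj (src \<phi>)) hs = map2 (\<lambda>X h. dat (FA X h)) (src \<phi>) hs"
      using hs X by (intro nth_equalityI) (auto intro!: partial_act_A_obj)
    moreover have "partial_act (A_obj (tgt \<phi>)) (smash_gmor hs) = dat (FA (tgt \<phi>) (smash_gmor hs))"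
      by (rule partial_act_A_obj[OF Y smash_gmor_Arr[OF hs(2)]])
    ultimately show "fcomp (prod_at (src (A_mor \<phi>)) (map src hs)) (dat (A_mor \<phi>) (map tgt hs))
          (mk_ftor (prod_at (src (A_mor \<phi>)) (map src hs)) (map2 FO (map2 partial_act (src (A_mor \<phi>)) hs)) (map2 FA (map2 partial_act (src (A_mor \<phi>)) hs)))
        = fcomp (prod_at (src (A_mor \<phi>)) (map src hs)) (partial_act (tgt (A_mor \<phi>)) (smash_gmor hs)) (dat (A_mor \<phi>) (map src hs))"
      using f(2) hs unfolding gamma.natural_def gamma.natural_at_def Let_def A_mor_simps prod_at_A_obj by simp
  qed
  ultimately show ?thesis by (simp add: linear_transformation_iff)
qed

lemma A_mor_unit: "A_mor (fam_unit X) = fam_unit (A_obj X)"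
  by (simp add: A_mor_def fam_unit_def)

lemma A_mor_comp: "A_mor (fam_comp \<gamma> \<phi>s) = fam_comp (A_mor \<gamma>) (map A_mor \<phi>s)"
proof -
  have l: "map (\<lambda>\<phi>. length (src \<phi>)) (map A_mor \<phi>s) = map (\<lambda>\<phi>. length (src \<phi>)) \<phi>s" by simp
  have s: "concat (map src (map A_mor \<phi>s)) = map A_obj (concat (map src \<phi>s))" by (simp add: map_concat comp_def)
  have z: "map2 (\<lambda>\<phi> ms. dat \<phi> ms) (map A_mor \<phi>s) nss = map2 (\<lambda>\<phi> ms. dat \<phi> ms) \<phi>s nss" for nss
    by (simp add: zip_map1 comp_def split_def)
  show ?thesis unfolding fam_comp_def Let_def l s z prod_at_A_obj by (simp add: A_mor_def)
qed

lemma A_mor_act: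
  assumes f: "gamma_multimor \<phi>" and s: "\<sigma> permutes {..<length (src \<phi>)}"
  shows "A_mor (fam_act gamma_push \<sigma> \<phi>) = fam_act mult_push \<sigma> (A_mor \<phi>)"
proof -
  have Y: "gamma_category (tgt \<phi>)" using f by (simp add: gamma_multimor_def)
  have p: "mult_push (A_obj (tgt \<phi>)) \<sigma> (permute_list (inv \<sigma>) ns) = gamma_push (tgt \<phi>) \<sigma> (permute_list (inv \<sigma>) ns)"
    if "length ns = length (src \<phi>)" for ns
  proof -
    have s': "\<sigma> permutes {..<length (permute_list (inv \<sigma>) ns)}" using s that by simp
    show ?thesis
      using mult.push_act[OF A_obj_based[OF Y] s'] gamma.push_act[of "tgt \<phi>", OF _ s'] Y
        partial_act_A_obj[OF Y reorder_gmor_Arr[OF s']] by simp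
  qed
  have m: "permute_list \<sigma> (map A_obj (src \<phi>)) = map A_obj (permute_list \<sigma> (src \<phi>))"
    using map_permute_list[OF s, of A_obj] by simp
  show ?thesis unfolding fam_act_def Let_def A_mor_simps m prod_at_A_obj
    using p by (auto simp: A_mor_def restrict_def fun_eq_iff)
qed

definition A_multifunctor where
  "A_multifunctor = \<lparr>FO = restrict A_obj {X. gamma_category X}, FA = restrict A_mor {\<phi>. gamma_multimor \<phi>}\<rparr>"

lemma multifunctor_A: "multifunctor Gamma_Cat Mult_N_Cat_op A_multifunctor"
proof (intro multifunctor.intro multicategory_Gamma_Cat multicategory_Mult_N_Cat_op)
  interpret G: multicategory Gamma_Cat by (rule multicategory_Gamma_Cat)
  have simps: "MObj Gamma_Cat = {X. gamma_category X}" "MMor Gamma_Cat = {\<phi>. gamma_multimor \<phi>}" "Src Gamma_Cat = src"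
    "Tgt Gamma_Cat = tgt" "MUnit Gamma_Cat = fam_unit" "MComp Gamma_Cat = fam_comp" "Act Gamma_Cat = fam_act gamma_push"
    by (simp_all add: Gamma_Cat_def)
  note c = G.MUnit_closed[unfolded simps] G.MComp_closed[unfolded simps] G.Act_closed[unfolded simps]
  show "multifunctor_axioms Gamma_Cat Mult_N_Cat_op A_multifunctor"
  proof (intro multifunctor_axioms.intro, unfold simps)
    fix \<phi> assume "\<phi> \<in> {\<phi>. gamma_multimor \<phi>}"
    then have f: "gamma_multimor \<phi>" by simp
    then show "Src Mult_N_Cat_op (FA A_multifunctor \<phi>) = map (FO A_multifunctor) (src \<phi>)"
      "Tgt Mult_N_Cat_op (FA A_multifunctor \<phi>) = FO A_multifunctor (tgt \<phi>)"
      by (auto simp: A_multifunctor_def Mult_N_Cat_op_def gamma_multimor_def)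
    show "FA A_multifunctor (fam_act gamma_push \<sigma> \<phi>) = Act Mult_N_Cat_op \<sigma> (FA A_multifunctor \<phi>)"
      if "\<sigma> permutes {..<length (src \<phi>)}" for \<sigma>
      using f c(3)[of \<phi> \<sigma>] that A_mor_act[OF f that] by (simp add: A_multifunctor_def Mult_N_Cat_op_def)
  next
    fix \<gamma> \<phi>s assume "\<gamma> \<in> {\<phi>. gamma_multimor \<phi>}" "\<phi>s \<in> lists {\<phi>. gamma_multimor \<phi>}" "map tgt \<phi>s = src \<gamma>"
    then show "FA A_multifunctor (fam_comp \<gamma> \<phi>s) = MComp Mult_N_Cat_op (FA A_multifunctor \<gamma>) (map (FA A_multifunctor) \<phi>s)"
      using c(2)[of \<gamma> \<phi>s] A_mor_comp[of \<gamma> \<phi>s]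
      by (simp add: A_multifunctor_def Mult_N_Cat_op_def in_lists_conv_set cong: map_cong)
  next
    fix X assume "X \<in> {X. gamma_category X}"
    then show "FA A_multifunctor (fam_unit X) = MUnit Mult_N_Cat_op (FO A_multifunctor X)"
      using c(1)[of X] by (simp add: A_multifunctor_def Mult_N_Cat_op_def A_mor_unit)
  qed (auto simp: A_multifunctor_def Mult_N_Cat_op_def A_obj_based[simplified] A_mor_closed)
qed

lemma A_mor_unary: "A_mor (unary X Y q) = A_nat X Y q"
  using prod_at_A_obj[of "[X]"] by (simp add: A_mor_def A_nat_def unary_def)

text \<open>Naturality of a family in one variable is naturality of \<open>q\<close>, because the smash product of a single
  based map is that map.\<close>
lemma unary_multimor:
  assumes X: "gamma_category X" and Y: "gamma_category Y" and q: "nat_trans Gamma_op Cat_based X Y q"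
  shows "gamma_multimor (unary X Y q)"
proof -
  interpret q: nat_trans Gamma_op Cat_based X Y q by fact
  let ?u = "unary X Y q"
  have u: "src ?u = [X]" "tgt ?u = Y" by (simp_all add: unary_def)
  have qA: "q n \<in> Arr Cat_based" for n using q.q_closed by auto
  have qs: "src (q n) = FO X n" "tgt (q n) = FO Y n" for n
    using q.q_Dom[of n] q.q_Cod[of n] Cat_based_simps(1,2)[OF qA] by simp_all
  then have b: "based_functor (FO X n) (FO Y n) (dat (q n))" for n using qA[of n] by (simp add: Cat_based_mor)
  then have F: "is_functor (FO X n) (FO Y n) (dat (q n))" for n by (simp add: based_functor_iff)
  have d: "dat ?u [n] = fcomp (prod_cat [FO X n]) (dat (q n)) (proj_ftor [FO X n] 0)" for n
    by (simp add: unary_def prod_at_def)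
  have val: "FO (dat ?u [n]) [x] = FO (dat (q n)) x" if "x \<in> Obj (FO X n)" for n x
    using that by (simp add: d proj_ftor_def prod_cat_Obj)
  have valA: "FA (dat ?u [n]) [x] = FA (dat (q n)) x" if "x \<in> Arr (FO X n)" for n x
    using that by (simp add: d proj_ftor_def prod_cat_Arr)
  have bX: "based_category (FO X n)" "based_category (FO Y n)" for n using gamma_category_values(1) X Y by auto
  have P: "is_functor (prod_cat [FO X n]) (FO X n) (proj_ftor [FO X n] 0)" for n
    using functor_proj[of "[FO X n]" 0] bX by (simp add: based_category_iff)
  have I: "FA (dat (q n)) (Ident (FO X n) (Base (FO X n))) = Ident (FO Y n) (Base (FO Y n))" for n
    using is_functor.FA_Ident[OF F, of "Base (FO X n)" n] b[of n] bX(1)[of n] by (simp add: based_functor_iff based_category_iff)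
  have "smash_functor [FO X n] (FO Y n) (dat ?u [n])" for n
    unfolding smash_functor_iff d using functor_fcomp[OF P F] bX I b[of n]
    by (auto simp: proj_ftor_def based_functor_iff less_Suc_eq)
  moreover have "dat ?u \<in> extensional {ns. length ns = 1}" by (simp add: unary_def)
  ultimately have fam: "gamma.family ?u" unfolding gamma.family_def smash_family_def u
    using X Y by (auto simp: length_Suc_conv)
  have nat: "fcomp (FO X (src h)) (dat (q (tgt h))) (dat (FA X h)) = fcomp (FO X (src h)) (dat (FA Y h)) (dat (q (src h)))"
    if h: "h \<in> Arr Gamma_op" for h
    using arg_cong[OF q.q_natural[OF h], of dat] gamma_category_values(2)[OF X h] gamma_category_values(2)[OF Y h] qA qs
    by (simp add: Cat_based_simps Gamma_op_Dom_Cod[OF h])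
  have "gamma.natural ?u"
  proof (rule gamma.naturalI)
    fix hs xs assume hs: "length hs = length (src ?u)" "set hs \<subseteq> Arr Gamma_op" and xs: "xs \<in> tuples_at Obj (src ?u) (map src hs)"
    obtain h where h: "hs = [h]" "h \<in> Arr Gamma_op" using hs by (auto simp: u length_Suc_conv)
    obtain x where x: "xs = [x]" "x \<in> Obj (FO X (src h))" using xs by (cases xs) (auto simp: u h(1) tuples_at_def)
    have "FO (dat (FA X h)) x \<in> Obj (FO X (tgt h))" using gamma.act_closed(1)[of X h] X h x by simp
    then show "FO (dat ?u (map tgt hs)) (map2 FO (map2 (\<lambda>X h. dat (FA X h)) (src ?u) hs) xs)
        = FO (dat (FA (tgt ?u) (smash_gmor hs))) (FO (dat ?u (map src hs)) xs)"
      using arg_cong[OF nat[OF h(2)], of "\<lambda>F. FO F x"] x by (simp add: h u val smash_gmor_single)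
  next
    fix hs xs assume hs: "length hs = length (src ?u)" "set hs \<subseteq> Arr Gamma_op" and xs: "xs \<in> tuples_at Arr (src ?u) (map src hs)"
    obtain h where h: "hs = [h]" "h \<in> Arr Gamma_op" using hs by (auto simp: u length_Suc_conv)
    obtain x where x: "xs = [x]" "x \<in> Arr (FO X (src h))" using xs by (cases xs) (auto simp: u h(1) tuples_at_def)
    have "FA (dat (FA X h)) x \<in> Arr (FO X (tgt h))" using gamma.act_closed(2)[of X h] X h x by simp
    then show "FA (dat ?u (map tgt hs)) (map2 FA (map2 (\<lambda>X h. dat (FA X h)) (src ?u) hs) xs)
        = FA (dat (FA (tgt ?u) (smash_gmor hs))) (FA (dat ?u (map src hs)) xs)"
      using arg_cong[OF nat[OF h(2)], of "\<lambda>F. FA F x"] x by (simp add: h u valA smash_gmor_single)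
  qed
  with fam show ?thesis by (simp add: gamma_multimor_iff)
qed

theorem theorem1:
  shows "multicategory (Gamma_Cat :: (('o, 'a) gcat, (('o, 'a) gcat, 'o, 'a) fmor) multicat) \<and>
    multicategory (Mult_N_Cat_op :: (('o, 'a) ncat, (('o, 'a) ncat, 'o, 'a) fmor) multicat) \<and>
    (\<exists>\<Phi>. multifunctor Gamma_Cat Mult_N_Cat_op \<Phi> \<and>
       (\<forall>X :: ('o, 'a) gcat. gamma_category X \<longrightarrow> FO \<Phi> X = A_obj X) \<and>
       (\<forall>(X :: ('o, 'a) gcat) Y q. gamma_category X \<and> gamma_category Y \<and>
          nat_trans Gamma_op Cat_based X Y q \<longrightarrow> FA \<Phi> (unary X Y q) = A_nat X Y q))"
proof (intro conjI multicategory_Gamma_Cat multicategory_Mult_N_Cat_op exI[of _ A_multifunctor] multifunctor_A allI impI)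
  show "FO A_multifunctor X = A_obj X" if "gamma_category X" for X :: "('o, 'a) gcat"
    using that by (simp add: A_multifunctor_def)
  show "FA A_multifunctor (unary X Y q) = A_nat X Y q"
    if "gamma_category X \<and> gamma_category Y \<and> nat_trans Gamma_op Cat_based X Y q" for X Y :: "('o, 'a) gcat" and q
    using that unary_multimor[of X Y q] by (simp add: A_multifunctor_def A_mor_unary)
qed

end
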